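(* Let $X$ be a smooth closed connected Riemannian manifold of dimension $d\ge 3$ and let $1\le p<d-1$. The topologically transitive elements of $\mathcal{M}^{1,p}_\lambda(X)$ form a generic set in $\mathcal{M}^{1,p}_\lambda(X)$.
   Context: $\lambda$ is the volume measure on $X$ and $d_X$ is the Riemannian distance. $\mathrm{Lip}_\lambda(X)$ is the set of volume preserving Lipschitz homeomorphisms of $X$. Derivatives. $X$ is obtained from the cube $I^d=[0,1]^d$ by boundary identifications: fix a continuous surjection $\varphi:I^d\to X$ whose restriction to the open cube is a homeomorphism onto an open subset of full measure, locally bi-Lipschitz with uniform constants, and which carries Lebesgue measure to a constant multiple of $\lambda$. Maps $f:X\to X$ and their derivatives are read in $I^d$ through $\varphi$; in particular, for a Lipschitz volume preserving homeomorphism $f$, $Df$ is the almost everywhere defined $d\times d$ matrix of partial derivatives $\partial f_i/\partial x_j$ in these coordinates. For a $d\times d$ matrix $A=(a_{ij})$ of functions in $L^p$, $\|A\|_p=\max_{i,j}\|a_{ij}\|_p$ with $\|u\|_p=(\int|u|^p\,d\lambda)^{1/p}$. $\overline{\mathrm{Lip}_\lambda(X)}^{\,p}$ is the closure of $\mathrm{Lip}_\lambda(X)$ in the combined uniform and $(1,p)$-Sobolev topology: its elements are the $f$ represented by pairs $(\pi_1(f),\pi_2(f))$, where $\pi_1(f):X\to X$ is continuous, $\pi_2(f)\in (L^p)^{d^2}$, and there is a sequence $(f_n)$ in $\mathrm{Lip}_\lambda(X)$ with $f_n\to\pi_1(f)$ uniformly and $Df_n\to\pi_2(f)$ in $(L^p)^{d^2}$.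 The topology is the one determined by $\|f-g\|_{1;\infty,p}=\max\{\sup_x d_X(\pi_1(f)(x),\pi_1(g)(x)),\ \|\pi_2(f)-\pi_2(g)\|_p\}$. Since $p\ge1$, $\pi_2(f)$ is the weak derivative of $\pi_1(f)$ and $f$ is identified with the map $\pi_1(f)$. $\mathcal{M}^{1,p}_\lambda(X)$ is the subspace of those $f\in\overline{\mathrm{Lip}_\lambda(X)}^{\,p}$ that are (volume preserving) homeomorphisms of $X$; it is a Baire space. A homeomorphism $f$ of $X$ is topologically transitive if for any nonempty open sets $U,V\subset X$ there is $n\in\mathbb{N}$ with $f^n(U)\cap V\ne\emptyset$. A subset of a topological space is generic if it contains a countable intersection of open and dense subsets. *)

theory Defs
  imports "HOL-Analysis.Analysis"
begin

section \<open>Smooth closed connected Riemannian manifolds\<close>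

text \<open>Meant for open \<open>S\<close>; all directional derivatives of order at most \<open>k\<close> exist and are continuous.\<close>

primrec Ck_on :: "nat \<Rightarrow> 'a::real_normed_vector set \<Rightarrow> ('a \<Rightarrow> 'b::real_normed_vector) \<Rightarrow> bool" where
  "Ck_on 0 S f \<longleftrightarrow> continuous_on S f"
| "Ck_on (Suc k) S f \<longleftrightarrow>
     (\<forall>x\<in>S. f differentiable (at x)) \<and> (\<forall>v. Ck_on k S (\<lambda>x. frechet_derivative f (at x) v))"

definition smooth_on :: "'a::real_normed_vector set \<Rightarrow> ('a \<Rightarrow> 'b::real_normed_vector) \<Rightarrow> bool" where
  "smooth_on S f \<longleftrightarrow> (\<forall>k. Ck_on k S f)"

text \<open>A chart is its domain together with the coordinate map, whose values off the domain are
  irrelevant. The manifold is the whole type \<open>'m\<close>, and its dimension is \<open>CARD('d)\<close>.\<close>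

type_synonym ('m, 'd) chart = "'m set \<times> ('m \<Rightarrow> real^'d)"

definition chart_inv :: "('m, 'd) chart \<Rightarrow> real^'d \<Rightarrow> 'm" where
  "chart_inv c = inv_into (fst c) (snd c)"

definition transition :: "('m, 'd) chart \<Rightarrow> ('m, 'd) chart \<Rightarrow> real^'d \<Rightarrow> real^'d" where
  "transition c c' = snd c' \<circ> chart_inv c"

text \<open>The metric tensor is given by its Gram matrices: \<open>g c x\<close> is the matrix at \<open>x\<close> of the inner
  product of the tangent space with respect to the coordinate basis of the chart \<open>c\<close>.\<close>

type_synonym ('m, 'd) metric_tensor = "('m, 'd) chart \<Rightarrow> 'm \<Rightarrow> real^'d^'d"

locale closed_riemannian_manifold =
  fixes atlas :: "('m::{t2_space, second_countable_topology}, 'd::finite) chart set"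
    and g :: "('m, 'd) metric_tensor"
  assumes compact_space: "compact (UNIV :: 'm set)"
    and connected_space: "connected (UNIV :: 'm set)"
    and charts_cover: "(\<Union>c\<in>atlas. fst c) = UNIV"
    and chart_domain: "c \<in> atlas \<Longrightarrow> open (fst c)"
    and chart_range: "c \<in> atlas \<Longrightarrow> open (snd c ` fst c)"
    and chart_homeo: "c \<in> atlas \<Longrightarrow> homeomorphism (fst c) (snd c ` fst c) (snd c) (chart_inv c)"
    and transition_smooth:
      "\<lbrakk>c \<in> atlas; c' \<in> atlas\<rbrakk> \<Longrightarrow> smooth_on (snd c ` (fst c \<inter> fst c')) (transition c c')"
    and metric_symmetric: "\<lbrakk>c \<in> atlas; x \<in> fst c\<rbrakk> \<Longrightarrow> transpose (g c x) = g c x"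
    and metric_positive: "\<lbrakk>c \<in> atlas; x \<in> fst c; v \<noteq> 0\<rbrakk> \<Longrightarrow> v \<bullet> (g c x *v v) > 0"
    and metric_smooth: "c \<in> atlas \<Longrightarrow> smooth_on (snd c ` fst c) (\<lambda>y. g c (chart_inv c y))"
    and metric_transition:
      "\<lbrakk>c \<in> atlas; c' \<in> atlas; x \<in> fst c; x \<in> fst c'\<rbrakk> \<Longrightarrow>
         g c x = transpose (jacobian (transition c c') (at (snd c x))) ** g c' x
                   ** jacobian (transition c c') (at (snd c x))"

section \<open>Riemannian distance and volume\<close>

definition C1_curve_on :: "('m::topological_space, 'd::finite) chart set \<Rightarrow> real set \<Rightarrow> (real \<Rightarrow> 'm) \<Rightarrow> bool" where
  "C1_curve_on atlas I \<gamma> \<longleftrightarrow> continuous_on I \<gamma> \<and>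
     (\<forall>c\<in>atlas. \<exists>v. continuous_on {t \<in> I. \<gamma> t \<in> fst c} v \<and>
        (\<forall>t\<in>{t \<in> I. \<gamma> t \<in> fst c}. (snd c \<circ> \<gamma> has_vector_derivative v t) (at t within I)))"

definition piecewise_C1_curve :: "('m::topological_space, 'd::finite) chart set \<Rightarrow> (real \<Rightarrow> 'm) \<Rightarrow> bool" where
  "piecewise_C1_curve atlas \<gamma> \<longleftrightarrow>
     (\<exists>n \<tau>. \<tau> 0 = 0 \<and> \<tau> n = 1 \<and>
        (\<forall>i<n. \<tau> i < \<tau> (Suc i) \<and> C1_curve_on atlas {\<tau> i..\<tau> (Suc i)} \<gamma>))"

text \<open>The speed does not depend on the chosen chart. It is meaningful off the finitely many
  break points of the curve, which the length integral does not see.\<close>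

definition curve_speed ::
  "('m, 'd::finite) chart set \<Rightarrow> ('m, 'd) metric_tensor \<Rightarrow> (real \<Rightarrow> 'm) \<Rightarrow> real \<Rightarrow> real" where
  "curve_speed atlas g \<gamma> t =
     (let c = (SOME c. c \<in> atlas \<and> \<gamma> t \<in> fst c);
          v = vector_derivative (snd c \<circ> \<gamma>) (at t)
      in sqrt (v \<bullet> (g c (\<gamma> t) *v v)))"

definition curve_length ::
  "('m, 'd::finite) chart set \<Rightarrow> ('m, 'd) metric_tensor \<Rightarrow> (real \<Rightarrow> 'm) \<Rightarrow> real" where
  "curve_length atlas g \<gamma> = integral {0..1} (curve_speed atlas g \<gamma>)"

definition riemannian_dist ::
  "('m::topological_space, 'd::finite) chart set \<Rightarrow> ('m, 'd) metric_tensor \<Rightarrow> 'm \<Rightarrow> 'm \<Rightarrow> real" where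
  "riemannian_dist atlas g x y =
     Inf {curve_length atlas g \<gamma> | \<gamma>. piecewise_C1_curve atlas \<gamma> \<and> \<gamma> 0 = x \<and> \<gamma> 1 = y}"

text \<open>The Borel measure with density \<open>sqrt (det g)\<close> in every chart; these local formulas
  determine it uniquely.\<close>

definition is_riemannian_volume ::
  "('m::topological_space, 'd::finite) chart set \<Rightarrow> ('m, 'd) metric_tensor \<Rightarrow> 'm measure \<Rightarrow> bool" where
  "is_riemannian_volume atlas g vol \<longleftrightarrow> sets vol = sets borel \<and>
     (\<forall>c\<in>atlas. \<forall>B\<in>sets borel. B \<subseteq> fst c \<longrightarrow>
        emeasure vol B = (\<integral>\<^sup>+y\<in>snd c ` B. ennreal (sqrt (det (g c (chart_inv c y)))) \<partial>lborel))"

section \<open>Reading maps in the cube\<close>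

text \<open>Here \<open>cbox 0 1\<close> is the closed unit cube and \<open>box 0 1\<close> the open one; \<open>d\<close> stands for the
  Riemannian distance.\<close>

definition cube_inv :: "(real^'d \<Rightarrow> 'm) \<Rightarrow> 'm \<Rightarrow> real^'d" where
  "cube_inv \<phi> = inv_into (box 0 1) \<phi>"

definition cube_parametrization ::
  "('m::topological_space \<Rightarrow> 'm \<Rightarrow> real) \<Rightarrow> 'm measure \<Rightarrow> (real^'d::finite \<Rightarrow> 'm) \<Rightarrow> bool" where
  "cube_parametrization d vol \<phi> \<longleftrightarrow>
     continuous_on (cbox 0 1) \<phi> \<and> \<phi> ` cbox 0 1 = UNIV \<and>
     open (\<phi> ` box 0 1) \<and> homeomorphism (box 0 1) (\<phi> ` box 0 1) \<phi> (cube_inv \<phi>) \<and>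
     emeasure vol (- \<phi> ` box 0 1) = 0 \<and>
     (\<exists>L>0. \<forall>x\<in>box 0 1. \<exists>W. open W \<and> x \<in> W \<and> W \<subseteq> box 0 1 \<and>
        (\<forall>y\<in>W. \<forall>z\<in>W. dist y z / L \<le> d (\<phi> y) (\<phi> z) \<and> d (\<phi> y) (\<phi> z) \<le> L * dist y z)) \<and>
     (\<exists>a>0. \<forall>B\<in>sets borel.
        emeasure lborel (\<phi> -` B \<inter> cbox 0 1) = ennreal a * emeasure vol B)"

definition cube_map :: "(real^'d \<Rightarrow> 'm) \<Rightarrow> ('m \<Rightarrow> 'm) \<Rightarrow> real^'d \<Rightarrow> real^'d" where
  "cube_map \<phi> f = cube_inv \<phi> \<circ> f \<circ> \<phi>"

text \<open>The matrix of partial derivatives of the coordinate expression of \<open>f\<close>, as a function on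
  the manifold. For a volume preserving \<open>f\<close> the \<open>else\<close> branch concerns a null set only.\<close>

definition cube_deriv :: "(real^'d::finite \<Rightarrow> 'm) \<Rightarrow> ('m \<Rightarrow> 'm) \<Rightarrow> 'm \<Rightarrow> real^'d^'d" where
  "cube_deriv \<phi> f x =
     (if x \<in> \<phi> ` box 0 1 \<and> f x \<in> \<phi> ` box 0 1
      then (\<chi> i j. deriv (\<lambda>t. cube_map \<phi> f (cube_inv \<phi> x + t *\<^sub>R axis j 1) $ i) 0)
      else 0)"

section \<open>The Sobolev closure of the volume preserving Lipschitz homeomorphisms\<close>

definition Lp_fun :: "'m measure \<Rightarrow> real \<Rightarrow> ('m \<Rightarrow> real) \<Rightarrow> bool" where
  "Lp_fun vol p u \<longleftrightarrow> u \<in> borel_measurable vol \<and> integrable vol (\<lambda>x. \<bar>u x\<bar> powr p)"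

definition Lp_norm :: "'m measure \<Rightarrow> real \<Rightarrow> ('m \<Rightarrow> real) \<Rightarrow> real" where
  "Lp_norm vol p u = (\<integral>x. \<bar>u x\<bar> powr p \<partial>vol) powr (1 / p)"

definition Lp_matrix :: "'m measure \<Rightarrow> real \<Rightarrow> ('m \<Rightarrow> real^'d^'d) \<Rightarrow> bool" where
  "Lp_matrix vol p A \<longleftrightarrow> (\<forall>i j. Lp_fun vol p (\<lambda>x. A x $ i $ j))"

definition Lp_matrix_norm :: "'m measure \<Rightarrow> real \<Rightarrow> ('m \<Rightarrow> real^'d::finite^'d) \<Rightarrow> real" where
  "Lp_matrix_norm vol p A = Max (range (\<lambda>(i, j). Lp_norm vol p (\<lambda>x. A x $ i $ j)))"

definition homeo :: "('m::topological_space \<Rightarrow> 'm) \<Rightarrow> bool" where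
  "homeo f \<longleftrightarrow> (\<exists>h. homeomorphism UNIV UNIV f h)"

definition volume_preserving :: "'m measure \<Rightarrow> ('m \<Rightarrow> 'm) \<Rightarrow> bool" where
  "volume_preserving vol f \<longleftrightarrow> (\<forall>B\<in>sets vol. emeasure vol (f -` B) = emeasure vol B)"

definition Lip_homeos ::
  "('m::topological_space \<Rightarrow> 'm \<Rightarrow> real) \<Rightarrow> 'm measure \<Rightarrow> ('m \<Rightarrow> 'm) set" where
  "Lip_homeos d vol =
     {f. homeo f \<and> volume_preserving vol f \<and> (\<exists>L. \<forall>x y. d (f x) (f y) \<le> L * d x y)}"

definition sobolev_pair ::
  "('m::topological_space \<Rightarrow> 'm \<Rightarrow> real) \<Rightarrow> 'm measure \<Rightarrow> (real^'d::finite \<Rightarrow> 'm) \<Rightarrow> real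
    \<Rightarrow> ('m \<Rightarrow> 'm) \<Rightarrow> ('m \<Rightarrow> real^'d^'d) \<Rightarrow> bool" where
  "sobolev_pair d vol \<phi> p f A \<longleftrightarrow> continuous_on UNIV f \<and> Lp_matrix vol p A \<and>
     (\<exists>F. (\<forall>n. F n \<in> Lip_homeos d vol) \<and>
        (\<forall>\<epsilon>>0. \<forall>\<^sub>F n in sequentially. \<forall>x. d (F n x) (f x) < \<epsilon>) \<and>
        (\<lambda>n. Lp_matrix_norm vol p (\<lambda>x. cube_deriv \<phi> (F n) x - A x)) \<longlonglongrightarrow> 0)"

text \<open>An element of the closure is identified with its first component. The second component is a
  weak derivative of the first, hence unique up to a null set, so the choice made in \<open>weak_deriv\<close>
  does not affect \<open>sobolev_dist\<close>.\<close>

definition sobolev_closure ::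
  "('m::topological_space \<Rightarrow> 'm \<Rightarrow> real) \<Rightarrow> 'm measure \<Rightarrow> (real^'d::finite \<Rightarrow> 'm) \<Rightarrow> real
    \<Rightarrow> ('m \<Rightarrow> 'm) set" where
  "sobolev_closure d vol \<phi> p = {f. \<exists>A. sobolev_pair d vol \<phi> p f A}"

definition weak_deriv ::
  "('m::topological_space \<Rightarrow> 'm \<Rightarrow> real) \<Rightarrow> 'm measure \<Rightarrow> (real^'d::finite \<Rightarrow> 'm) \<Rightarrow> real
    \<Rightarrow> ('m \<Rightarrow> 'm) \<Rightarrow> 'm \<Rightarrow> real^'d^'d" where
  "weak_deriv d vol \<phi> p f = (SOME A. sobolev_pair d vol \<phi> p f A)"

definition sobolev_dist ::
  "('m::topological_space \<Rightarrow> 'm \<Rightarrow> real) \<Rightarrow> 'm measure \<Rightarrow> (real^'d::finite \<Rightarrow> 'm) \<Rightarrow> real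
    \<Rightarrow> ('m \<Rightarrow> 'm) \<Rightarrow> ('m \<Rightarrow> 'm) \<Rightarrow> real" where
  "sobolev_dist d vol \<phi> p f h =
     max (SUP x. d (f x) (h x))
         (Lp_matrix_norm vol p (\<lambda>x. weak_deriv d vol \<phi> p f x - weak_deriv d vol \<phi> p h x))"

definition sobolev_homeos ::
  "('m::topological_space \<Rightarrow> 'm \<Rightarrow> real) \<Rightarrow> 'm measure \<Rightarrow> (real^'d::finite \<Rightarrow> 'm) \<Rightarrow> real
    \<Rightarrow> ('m \<Rightarrow> 'm) set" where
  "sobolev_homeos d vol \<phi> p =
     {f \<in> sobolev_closure d vol \<phi> p. homeo f \<and> volume_preserving vol f}"

definition sobolev_topology ::
  "('m::topological_space \<Rightarrow> 'm \<Rightarrow> real) \<Rightarrow> 'm measure \<Rightarrow> (real^'d::finite \<Rightarrow> 'm) \<Rightarrow> real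
    \<Rightarrow> ('m \<Rightarrow> 'm) topology" where
  "sobolev_topology d vol \<phi> p =
     Metric_space.mtopology (sobolev_homeos d vol \<phi> p) (sobolev_dist d vol \<phi> p)"

section \<open>Transitivity and genericity\<close>

definition topologically_transitive :: "('m::topological_space \<Rightarrow> 'm) \<Rightarrow> bool" where
  "topologically_transitive f \<longleftrightarrow>
     (\<forall>U V. open U \<and> U \<noteq> {} \<and> open V \<and> V \<noteq> {} \<longrightarrow> (\<exists>n. (f ^^ n) ` U \<inter> V \<noteq> {}))"

definition generic_in :: "'a topology \<Rightarrow> 'a set \<Rightarrow> bool" where
  "generic_in T S \<longleftrightarrow> S \<subseteq> topspace T \<and>
     (\<exists>\<U>. countable \<U> \<and> (\<forall>U\<in>\<U>. openin T U \<and> T closure_of U = topspace T) \<and>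
        topspace T \<inter> \<Inter>\<U> \<subseteq> S)"

end

theory Submission
  imports Defs
begin

text \<open>
  For open sets \<open>U\<close> and \<open>V\<close> consider the maps some iterate of which takes a point of \<open>U\<close> into \<open>V\<close>.
  A map is transitive if this holds for all pairs from a countable base, and for fixed \<open>U\<close> and \<open>V\<close> the
  condition is open, even in the uniform topology (\<open>iterate_stays_close\<close>). What has to be proved is that
  it is dense. Every element of the closure is a limit of volume preserving Lipschitz homeomorphisms, so it
  suffices to perturb such a map \<open>F\<close>.

  As \<open>F\<close> preserves a finite volume and the open cube is connected, there are pseudo-orbits from \<open>U\<close> to \<open>V\<close>
  with arbitrarily small jumps from \<open>a i\<close> to \<open>b i\<close> in the cube, where \<open>b i\<close> is then mapped by \<open>F\<close>. A
  shortest one visits no point twice (\<open>injective_pseudo_orbit\<close>). If \<open>H\<close> is a volume preserving map of the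
  cube, close to the identity, that takes each \<open>a i\<close> to \<open>b i\<close>, then the composition of \<open>H\<close> and \<open>F\<close> has a
  true orbit from \<open>U\<close> to \<open>V\<close>.

  The point is to find \<open>H\<close> such that the derivative of the composition differs little from that of \<open>F\<close> in
  the \<open>p\<close>-th mean, although \<open>H\<close> cannot be close to the identity in the Lipschitz sense. For a single pair of
  points, take a long ellipsoid of thickness \<open>r\<close> around the segment joining them and turn its concentric
  shells, the inner ones by half a turn and the boundary not at all (\<open>tube_map\<close>). This preserves the volume
  and exchanges the two points. Its Lipschitz constant is of order \<open>1 / r\<close>, and its support has volume of
  order \<open>r ^ (n - 1)\<close> in dimension \<open>n\<close>, so the \<open>p\<close>-th power of the change of the derivative has an integral
  of order \<open>r powr (n - 1 - p)\<close>. This tends to 0 exactly because \<open>p < n - 1\<close>. For many pairs the tubes have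
  to be disjoint; in dimension at least three the segments are disjoint after a slight displacement of the
  points \<open>a i\<close> (\<open>disjoint_segments\<close>), and the displacement is itself made by twists of short tubes
  (\<open>perturb_to_hit\<close>).

  Two facts connect this with the Sobolev metric. The Riemannian distance is a metric that induces the
  topology of the manifold (\<open>rdist_metric\<close>, \<open>open_iff_rdist\<close>). And for a Lipschitz map the derivative
  attached to it as an element of the closure is almost everywhere the matrix of its partial derivatives
  (\<open>sobolev_pair_unique\<close>): Lipschitz functions have directional derivatives almost everywhere, and these
  are determined by integration against Lipschitz cut-offs, which is compatible with uniform limits.
\<close>

section \<open>Lipschitz functions of one variable are differentiable almost everywhere\<close>

text \<open>By Vitali's covering theorem almost all of \<open>E\<close> is covered by disjoint short intervals
  over which the slope is at most \<open>p\<close>. The map takes each of them to an interval at most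
  \<open>p\<close> times as long, and the remaining null set to a null set.\<close>
lemma emeasure_image_le_of_small_slopes:
  fixes f :: "real \<Rightarrow> real"
  assumes mono: "strict_mono f" and lip: "C-lipschitz_on UNIV f"
    and E: "E \<in> sets borel" and fE: "f ` E \<in> sets borel"
    and p: "0 \<le> p"
    and slope: "\<And>x \<delta>. x \<in> E \<Longrightarrow> \<delta> > 0 \<Longrightarrow>
        \<exists>a b. a < b \<and> x \<in> {a..b} \<and> b - a < \<delta> \<and> f b - f a \<le> p * (b - a)"
  shows "emeasure lborel (f ` E) \<le> ennreal p * emeasure lborel E"
proof -
  have cont: "continuous_on UNIV f" using lip by (rule lipschitz_on_continuous_on)
  have inj: "inj f" using mono by (rule strict_mono_imp_inj_on)
  have img: "f ` {a..b} = {f a..f b}" if ab: "a < b" for a b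
  proof -
    have "mono f" using mono by (rule strict_mono_mono)
    then have "f ` {a..b} \<subseteq> {f a..f b}" by (auto simp: mono_def)
    moreover have "{f a..f b} \<subseteq> f ` {a..b}"
    proof
      fix y assume "y \<in> {f a..f b}"
      then obtain x where "a \<le> x" "x \<le> b" "f x = y"
        using IVT'[of f a y b] ab continuous_on_subset[OF cont subset_UNIV] by auto
      then show "y \<in> f ` {a..b}" by auto
    qed
    ultimately show ?thesis by blast
  qed
  have bound: "emeasure lborel (f ` E) \<le> ennreal p * (emeasure lborel E + ennreal e)" if e: "e > 0" for e
  proof -
    obtain U where U: "open U" "E \<subseteq> U" "emeasure lborel (U - E) < e"
      using outer_regular_lborel[OF E e] by blast
    define K where "K = {(a, b). a < b \<and> {a..b} \<subseteq> U \<and> f b - f a \<le> p * (b - a)}"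
    define cn where "cn = (\<lambda>(a::real, b). (a + b) / 2)"
    define rd where "rd = (\<lambda>(a::real, b). (b - a) / 2)"
    have ball: "cball (cn i) (rd i) = {fst i..snd i}" for i
      by (cases i) (auto simp: cn_def rd_def dist_real_def abs_if field_simps split: if_splits)
    obtain D where D: "countable D" "D \<subseteq> K"
      "pairwise (\<lambda>i j. disjnt (cball (cn i) (rd i)) (cball (cn j) (rd j))) D"
      "negligible (E - (\<Union>i\<in>D. cball (cn i) (rd i)))"
    proof (rule Vitali_covering_theorem_cballs[of K rd E cn])
      show "0 < rd i" if "i \<in> K" for i using that by (auto simp: K_def rd_def)
      fix x d :: real assume x: "x \<in> E" and d: "0 < d"
      obtain r where r: "r > 0" "ball x r \<subseteq> U" using U x open_contains_ball by blast
      obtain a b where ab: "a < b" "x \<in> {a..b}" "b - a < min d r" "f b - f a \<le> p * (b - a)"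
        using slope[OF x, of "min d r"] r d by auto
      have "{a..b} \<subseteq> ball x r" using ab by (auto simp: dist_real_def)
      then have "(a, b) \<in> K" using ab r by (auto simp: K_def)
      moreover have "x \<in> cball (cn (a, b)) (rd (a, b))" using ab by (simp add: ball)
      moreover have "rd (a, b) < d" using ab d by (auto simp: rd_def)
      ultimately show "\<exists>i. i \<in> K \<and> x \<in> cball (cn i) (rd i) \<and> rd i < d" by blast
    qed
    define A where "A = (\<Union>i\<in>D. {fst i..snd i})"
    have A: "A \<in> sets borel" unfolding A_def using D(1) by (intro sets.countable_UN') auto
    have neg: "negligible (E - A)" using D(4) by (simp add: ball A_def)
    have fA: "f ` A = (\<Union>i\<in>D. {f (fst i)..f (snd i)})"
      proof -
      have "f ` {fst i..snd i} = {f (fst i)..f (snd i)}" if "i \<in> D" for i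
        using that D(2) by (intro img) (auto simp: K_def)
      then show ?thesis by (auto simp: A_def image_UN)
    qed
    have fAm: "f ` A \<in> sets borel" unfolding fA using D(1) by (intro sets.countable_UN') auto
    have "negligible (f ` (E - A))"
    proof (rule negligible_locally_Lipschitz_image[OF _ neg])
      show "\<exists>T B. open T \<and> x \<in> T \<and> (\<forall>y\<in>(E - A) \<inter> T. norm (f y - f x) \<le> B * norm (y - x))"
        for x using lip by (intro exI[of _ UNIV] exI[of _ C]) (auto simp: lipschitz_on_def dist_norm)
    qed simp
    moreover have "f ` (E - A) \<in> sets borel"
      using image_set_diff[OF inj, of E A] fE fAm by auto
    ultimately have null: "f ` (E - A) \<in> null_sets lborel"
      by (simp add: negligible_iff_null_sets null_sets_completion_iff)
    have "emeasure lborel (f ` E) \<le> emeasure lborel (f ` A \<union> f ` (E - A))"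
      using fAm null by (intro emeasure_mono) (auto dest: null_setsD2)
    also have "\<dots> = emeasure lborel (f ` A)"
      using fAm null by (intro emeasure_Un_null_set) auto
    also have "\<dots> = (\<integral>\<^sup>+i. emeasure lborel {f (fst i)..f (snd i)} \<partial>count_space D)"
      unfolding fA
    proof (rule emeasure_UN_countable[OF _ D(1)])
      show "disjoint_family_on (\<lambda>i. {f (fst i)..f (snd i)}) D"
        unfolding disjoint_family_on_def
      proof (intro ballI impI)
        fix i j assume ij: "i \<in> D" "j \<in> D" "i \<noteq> j"
        then have "{fst i..snd i} \<inter> {fst j..snd j} = {}"
          using D(3) by (auto simp: pairwise_def disjnt_def ball)
        then have "f ` {fst i..snd i} \<inter> f ` {fst j..snd j} = {}"
          using image_Int[OF inj, of "{fst i..snd i}" "{fst j..snd j}"] by simp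
        moreover have "fst i < snd i" "fst j < snd j" using ij D(2) by (auto simp: K_def)
        ultimately show "{f (fst i)..f (snd i)} \<inter> {f (fst j)..f (snd j)} = {}"
          by (simp add: img)
      qed
    qed auto
    also have "\<dots> \<le> (\<integral>\<^sup>+i. ennreal p * emeasure lborel {fst i..snd i} \<partial>count_space D)"
    proof (rule nn_integral_mono)
      fix i assume "i \<in> space (count_space D)"
      then have "i \<in> K" using D(2) by auto
      then have i: "fst i < snd i" "f (snd i) - f (fst i) \<le> p * (snd i - fst i)"
        by (auto simp: K_def)
      have "f (fst i) < f (snd i)" using i mono by (simp add: strict_mono_def)
      then show "emeasure lborel {f (fst i)..f (snd i)} \<le> ennreal p * emeasure lborel {fst i..snd i}"
        using i p by (simp add: ennreal_mult[symmetric] ennreal_leI)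
    qed
    also have "\<dots> = ennreal p * (\<integral>\<^sup>+i. emeasure lborel {fst i..snd i} \<partial>count_space D)"
      by (rule nn_integral_cmult) auto
    also have "(\<integral>\<^sup>+i. emeasure lborel {fst i..snd i} \<partial>count_space D) = emeasure lborel A"
      unfolding A_def
      by (rule emeasure_UN_countable[OF _ D(1), symmetric])
        (use D(3) in \<open>auto simp: disjoint_family_on_def pairwise_def disjnt_def ball\<close>)
    also have "emeasure lborel A \<le> emeasure lborel U"
    proof (intro emeasure_mono)
      show "A \<subseteq> U" using D(2) unfolding A_def K_def by fastforce
    qed (use U(1) in auto)
    also have "emeasure lborel U = emeasure lborel (E \<union> (U - E))" using U(2) by (auto intro: arg_cong2[where f=emeasure])
    also have "\<dots> \<le> emeasure lborel E + emeasure lborel (U - E)"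
      using E U(1) by (intro emeasure_subadditive) auto
    also have "\<dots> \<le> emeasure lborel E + ennreal e" using U(3) by (intro add_left_mono) simp
    finally show ?thesis by (simp add: mult_left_mono)
  qed
  show ?thesis
  proof (rule ennreal_le_epsilon)
    fix e :: real assume e: "e > 0"
    have "emeasure lborel (f ` E) \<le> ennreal p * (emeasure lborel E + ennreal (e / (p + 1)))"
      using bound[of "e / (p + 1)"] e p by simp
    also have "\<dots> = ennreal p * emeasure lborel E + ennreal (p * (e / (p + 1)))"
      using e p by (subst ennreal_mult) (auto simp: distrib_left)
    also have "\<dots> \<le> ennreal p * emeasure lborel E + ennreal e"
      using e p by (intro add_left_mono ennreal_leI) (auto simp: field_simps)
    finally show "emeasure lborel (f ` E) \<le> ennreal p * emeasure lborel E + ennreal e" .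
  qed
qed

text \<open>The lower derivative at such a point is at most \<open>p\<close>. Asking for \<open>x\<close> in the
  interior of the interval makes this a countable intersection of open sets.\<close>
definition small_slope_points :: "(real \<Rightarrow> real) \<Rightarrow> real \<Rightarrow> real set" where
  "small_slope_points f p =
     {x. \<forall>n. \<exists>a b. a < x \<and> x < b \<and> b - a < inverse (real (Suc n)) \<and> f b - f a < p * (b - a)}"

lemma borel_small_slope_points: "small_slope_points f p \<in> sets borel"
proof -
  have "small_slope_points f p =
      (\<Inter>n. \<Union>(a, b)\<in>{(a, b). b - a < inverse (real (Suc n)) \<and> f b - f a < p * (b - a)}. {a<..<b})"
    unfolding small_slope_points_def by fastforce
  also have "\<dots> \<in> sets borel"
    by (rule sets.countable_INT'') (auto intro!: borel_open open_UN)
  finally show ?thesis .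
qed

text \<open>The inequality is strict and \<open>f\<close> is continuous, so an interval with end point
  \<open>x\<close> can be widened a little.\<close>
lemma small_slope_pointsI:
  fixes f :: "real \<Rightarrow> real"
  assumes cont: "continuous_on UNIV f"
    and ex: "\<And>\<delta>. \<delta> > 0 \<Longrightarrow> \<exists>a b. a \<le> x \<and> x \<le> b \<and> a < b \<and> b - a < \<delta> \<and> f b - f a < p * (b - a)"
  shows "x \<in> small_slope_points f p"
  unfolding small_slope_points_def
proof (intro CollectI allI)
  fix n
  let ?d = "inverse (real (Suc n))"
  obtain a b where ab: "a \<le> x" "x \<le> b" "a < b" "b - a < ?d" "f b - f a < p * (b - a)"
    using ex[of ?d] by auto
  let ?F = "\<lambda>s. p * ((b + s) - (a - s)) - (f (b + s) - f (a - s))"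
  have "continuous_on UNIV ?F"
    by (intro continuous_intros continuous_on_compose2[OF cont]) auto
  then have "isCont ?F 0" by (simp add: continuous_on_eq_continuous_at)
  then have "(?F \<longlongrightarrow> ?F 0) (at_right 0)"
    by (simp add: isCont_def filterlim_at_split)
  moreover have "?F 0 > 0" using ab by simp
  ultimately have "eventually (\<lambda>s. ?F s > 0) (at_right 0)" by (rule order_tendstoD)
  moreover have "eventually (\<lambda>s. s < (?d - (b - a)) / 2) (at_right 0)"
    using ab by (intro eventually_at_rightI[of 0 "(?d - (b - a)) / 2"]) auto
  moreover have "eventually (\<lambda>s::real. s > 0) (at_right 0)" by (rule eventually_at_right_less)
  ultimately have "eventually (\<lambda>s. ?F s > 0 \<and> s < (?d - (b - a)) / 2 \<and> s > 0) (at_right 0)"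
    by eventually_elim auto
  then obtain s where s: "?F s > 0" "s < (?d - (b - a)) / 2" "s > 0"
    using eventually_happens' trivial_limit_at_right_real by blast
  show "\<exists>a b. a < x \<and> x < b \<and> b - a < ?d \<and> f b - f a < p * (b - a)"
    using s ab by (intro exI[of _ "a - s"] exI[of _ "b + s"]) (auto simp: field_simps)
qed

lemma small_slope_points_if_frequently:
  fixes f :: "real \<Rightarrow> real"
  assumes cont: "continuous_on UNIV f"
    and fr: "\<exists>\<^sub>F h in at 0. (f (x + h) - f x) / h < p"
  shows "x \<in> small_slope_points f p"
proof (rule small_slope_pointsI[OF cont])
  fix \<delta> :: real assume d: "\<delta> > 0"
  have "\<forall>\<^sub>F h in at 0. h \<noteq> 0 \<and> \<bar>h\<bar> < \<delta>"
    using d by (auto simp: eventually_at dist_real_def)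
  with fr have "\<exists>\<^sub>F h in at 0. (f (x + h) - f x) / h < p \<and> (h \<noteq> 0 \<and> \<bar>h\<bar> < \<delta>)"
    by (rule frequently_eventually_frequently)
  then obtain h where h: "(f (x + h) - f x) / h < p" "h \<noteq> 0" "\<bar>h\<bar> < \<delta>"
    by (blast dest: frequently_ex)
  show "\<exists>a b. a \<le> x \<and> x \<le> b \<and> a < b \<and> b - a < \<delta> \<and> f b - f a < p * (b - a)"
  proof (cases "h > 0")
    case True
    then show ?thesis using h by (intro exI[of _ x] exI[of _ "x + h"]) (auto simp: field_simps)
  next
    case False
    then show ?thesis using h by (intro exI[of _ "x + h"] exI[of _ x]) (auto simp: field_simps)
  qed
qed

text \<open>On the set \<open>E\<close> of the points of this intersection in a bounded interval, the measure of
  \<open>g ` E\<close> is at most \<open>p\<close> times that of \<open>E\<close>; applied to the inverse of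
  \<open>g\<close>, the same estimate bounds the measure of \<open>E\<close> by \<open>1 / q\<close> times that
  of \<open>g ` E\<close>. Since \<open>p / q < 1\<close> and the measure is finite, it is 0.\<close>
lemma null_slope_gap:
  fixes g :: "real \<Rightarrow> real"
  assumes lower: "\<And>x y. x \<le> y \<Longrightarrow> y - x \<le> g y - g x"
    and upper: "\<And>x y. x \<le> y \<Longrightarrow> g y - g x \<le> M * (y - x)"
    and pq: "p < q"
  shows "small_slope_points g p \<inter> small_slope_points (\<lambda>x. - g x) (- q) \<in> null_sets lborel"
proof -
  let ?A = "small_slope_points g p" and ?B = "small_slope_points (\<lambda>x. - g x) (- q)"
  have smono: "strict_mono g"
  proof (rule strict_monoI)
    fix x y :: real assume "x < y"
    then show "g x < g y" using lower[of x y] by simp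
  qed
  have M: "M \<ge> 1" using lower[of 0 1] upper[of 0 1] by simp
  have lip: "M-lipschitz_on UNIV g"
  proof (rule lipschitz_onI)
    fix x y show "dist (g x) (g y) \<le> M * dist x y"
    proof (cases "x \<le> y")
      case True
      then have "0 \<le> g y - g x" using lower[OF True] by linarith
      then show ?thesis using upper[OF True] True by (simp add: dist_real_def)
    next
      case False
      then have "y \<le> x" by simp
      then have "0 \<le> g x - g y" using lower[of y x] by linarith
      then show ?thesis using upper[OF \<open>y \<le> x\<close>] \<open>y \<le> x\<close> by (simp add: dist_real_def)
    qed
  qed (use M in simp)
  have cont: "continuous_on UNIV g" using lip by (rule lipschitz_on_continuous_on)
  have surj: "surj g"
  proof -
    have "\<exists>x. g x = y" for y
    proof -
      let ?r = "\<bar>y - g 0\<bar>"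
      have "g (- ?r) \<le> y" using lower[of "- ?r" 0] by linarith
      moreover have "y \<le> g ?r" using lower[of 0 ?r] by linarith
      ultimately show ?thesis
        using IVT'[of g "- ?r" y ?r] continuous_on_subset[OF cont subset_UNIV] by auto
    qed
    then show ?thesis by (metis surjI)
  qed
  have bij: "bij g" using surj smono by (simp add: bij_def strict_mono_imp_inj_on)
  define k where "k = inv g"
  have gk: "g (k y) = y" for y unfolding k_def using surj by (simp add: surj_f_inv_f)
  have kg: "k (g x) = x" for x unfolding k_def using bij by (simp add: bij_is_inj)
  have kmono: "strict_mono k"
  proof (rule strict_monoI)
    fix x y :: real assume "x < y"
    then have "g (k x) < g (k y)" by (simp add: gk)
    then show "k x < k y" using strict_mono_less[OF smono] by blast
  qed
  have klip: "1-lipschitz_on UNIV k"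
  proof (rule lipschitz_onI)
    fix x y show "dist (k x) (k y) \<le> 1 * dist x y"
      using lower[of "k x" "k y"] lower[of "k y" "k x"]
      by (simp add: dist_real_def gk) linarith
  qed simp
  have kcont: "continuous_on UNIV k" using klip by (rule lipschitz_on_continuous_on)
  have null: "?A \<inter> ?B \<inter> {- real m..real m} \<in> null_sets lborel" for m
  proof -
    define E where "E = ?A \<inter> ?B \<inter> {- real m..real m}"
    have E: "E \<in> sets borel" unfolding E_def by (intro sets.Int borel_small_slope_points) auto
    have "g ` E = k -` E"
    proof safe
      fix y assume "k y \<in> E" then show "y \<in> g ` E" using gk[of y] by (intro image_eqI[of _ _ "k y"]) auto
    qed (simp add: kg)
    then have gE: "g ` E \<in> sets borel"
      using measurable_sets[OF borel_measurable_continuous_onI[OF kcont] E] by simp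
    have kgE: "k ` (g ` E) = E" by (simp add: image_image kg)
    show ?thesis
    proof (cases "E = {}")
      case True then show ?thesis using E_def by simp
    next
      case False
      have p1: "1 < p"
      proof -
        obtain x where "x \<in> ?A" using False E_def by auto
        then obtain a b where ab: "a < x" "x < b" "g b - g a < p * (b - a)"
          unfolding small_slope_points_def by blast
        have "b - a < p * (b - a)" using ab lower[of a b] by linarith
        moreover have "p * (b - a) \<le> 1 * (b - a)" if "p \<le> 1"
          using that ab by (intro mult_right_mono) auto
        ultimately show ?thesis by fastforce
      qed
      have 1: "emeasure lborel (g ` E) \<le> ennreal p * emeasure lborel E"
      proof (rule emeasure_image_le_of_small_slopes[OF smono lip E gE])
        fix x \<delta> :: real assume x: "x \<in> E" and d: "\<delta> > 0"
        obtain n where n: "inverse (real (Suc n)) < \<delta>" using reals_Archimedean[OF d] by blast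
        from x obtain a b where "a < x" "x < b" "b - a < inverse (real (Suc n))" "g b - g a < p * (b - a)"
          unfolding E_def small_slope_points_def by blast
        then show "\<exists>a b. a < b \<and> x \<in> {a..b} \<and> b - a < \<delta> \<and> g b - g a \<le> p * (b - a)"
          using n by (intro exI[of _ a] exI[of _ b]) auto
      qed (use p1 in auto)
      have 2: "emeasure lborel (k ` (g ` E)) \<le> ennreal (1 / q) * emeasure lborel (g ` E)"
      proof (rule emeasure_image_le_of_small_slopes[OF kmono klip gE])
        show "k ` g ` E \<in> sets borel" using E kgE by simp
        fix y \<delta> :: real assume y: "y \<in> g ` E" and d: "\<delta> > 0"
        obtain x where x: "x \<in> E" "y = g x" using y by blast
        obtain n where n: "inverse (real (Suc n)) < \<delta> / M"
          using reals_Archimedean[of "\<delta> / M"] d M by auto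
        from x obtain a b where ab: "a < x" "x < b" "b - a < inverse (real (Suc n))"
            "(- g b) - (- g a) < (- q) * (b - a)"
          unfolding E_def small_slope_points_def by blast
        have "g b - g a < \<delta>"
        proof -
          have "g b - g a \<le> M * (b - a)" using upper ab by simp
          also have "\<dots> < M * (\<delta> / M)" using ab n M by (intro mult_strict_left_mono) auto
          finally show ?thesis using M by simp
        qed
        moreover have "b - a \<le> 1 / q * (g b - g a)" using ab p1 pq by (simp add: field_simps)
        moreover have "g a < g x" "g x < g b" using ab smono by (auto simp: strict_mono_def)
        ultimately show "\<exists>a b. a < b \<and> y \<in> {a..b} \<and> b - a < \<delta> \<and> k b - k a \<le> 1 / q * (b - a)"
          using x by (intro exI[of _ "g a"] exI[of _ "g b"]) (auto simp: kg)
      qed (use p1 pq in auto)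
      have fin: "emeasure lborel E < \<infinity>"
      proof -
        have "emeasure lborel E \<le> emeasure lborel {- real m..real m}"
          by (rule emeasure_mono) (auto simp: E_def)
        then show ?thesis by (simp add: le_less_trans)
      qed
      then obtain r where r: "emeasure lborel E = ennreal r" "r \<ge> 0"
        by (cases "emeasure lborel E") auto
      have "ennreal r \<le> ennreal (1 / q) * (ennreal p * ennreal r)"
        using order_trans[OF 2 mult_left_mono[OF 1]] r kgE by simp
      also have "\<dots> = ennreal (p / q * r)"
        using p1 pq r by (simp add: ennreal_mult[symmetric])
      finally have "r \<le> p / q * r" using r p1 pq by simp
      then have "r * (q - p) \<le> 0" using p1 pq by (simp add: field_simps)
      then have "r = 0" using pq r by (simp add: mult_le_0_iff)
      then show ?thesis using r E by (auto simp: E_def)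
    qed
  qed
  have "(\<Union>m. {- real m..real m}) = UNIV"
  proof -
    have "\<exists>m. x \<in> {- real m..real m}" for x
    proof -
      obtain m where "\<bar>x\<bar> \<le> real m" using real_arch_simple by blast
      then show ?thesis by (intro exI[of _ m]) (simp add: abs_le_iff)
    qed
    then show ?thesis by blast
  qed
  then have "?A \<inter> ?B = (\<Union>m. ?A \<inter> ?B \<inter> {- real m..real m})"
    by (simp add: Int_UN_distrib[symmetric])
  moreover have "(\<Union>m. ?A \<inter> ?B \<inter> {- real m..real m}) \<in> null_sets lborel"
    by (rule null_sets_UN) (rule null)
  ultimately show ?thesis by simp
qed

text \<open>If the derivative at \<open>x\<close> does not exist, then two rational numbers separate limit
  points of the difference quotients, so that \<open>x\<close> lies in one of the countably many null sets of
  \<open>null_slope_gap\<close>.\<close>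
proposition lipschitz_differentiable_ae:
  fixes f :: "real \<Rightarrow> real"
  assumes lip: "C-lipschitz_on UNIV f"
  shows "\<exists>N\<in>null_sets lborel. \<forall>x. x \<notin> N \<longrightarrow> f differentiable (at x)"
proof -
  \<comment> \<open>the added linear term puts all slopes of \<open>g\<close> between 1 and \<open>2 * C + 1\<close>\<close>
  define g where "g = (\<lambda>x. f x + (C + 1) * x)"
  have C: "C \<ge> 0" using lip by (rule lipschitz_on_nonneg)
  have fb: "\<bar>f y - f x\<bar> \<le> C * (y - x)" if "x \<le> y" for x y
    using lipschitz_onD[OF lip, of y x] that by (simp add: dist_real_def)
  have lower: "y - x \<le> g y - g x" if "x \<le> y" for x y
    using fb[OF that] by (simp add: g_def algebra_simps abs_le_iff)
  have upper: "g y - g x \<le> (2 * C + 1) * (y - x)" if "x \<le> y" for x y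
    using fb[OF that] by (simp add: g_def algebra_simps abs_le_iff)
  have cont: "continuous_on UNIV g" unfolding g_def
    by (intro continuous_intros lipschitz_on_continuous_on[OF lip])
  define N where "N = (\<Union>(p, q)\<in>{(p, q). p \<in> \<rat> \<and> q \<in> \<rat> \<and> p < q}.
      small_slope_points g p \<inter> small_slope_points (\<lambda>x. - g x) (- q))"
  have "countable {(p::real, q). p \<in> \<rat> \<and> q \<in> \<rat> \<and> p < q}"
    by (rule countable_subset[of _ "\<rat> \<times> \<rat>"]) (auto intro: countable_rat)
  then have N: "N \<in> null_sets lborel"
    unfolding N_def by (rule null_sets_UN') (use null_slope_gap[OF lower upper] in auto)
  have "f differentiable (at x)" if x: "x \<notin> N" for x
  proof -
    let ?Q = "\<lambda>h. (g (x + h) - g x) / h"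
    have Qb: "1 \<le> ?Q h \<and> ?Q h \<le> 2 * C + 1" if "h \<noteq> 0" for h
      using that lower[of x "x + h"] upper[of x "x + h"] lower[of "x + h" x] upper[of "x + h" x]
      by (cases "h > 0") (auto simp: field_simps)
    define s where "s = (\<lambda>n. inverse (real (Suc n)))"
    have s0: "s n \<noteq> 0" for n by (simp add: s_def)
    define Q where "Q = ?Q"
    have "(Q \<circ> s) n \<in> {1..2 * C + 1}" for n using Qb[OF s0[of n]] by (simp add: Q_def)
    then obtain l r where l: "strict_mono (r::nat \<Rightarrow> nat)" "((Q \<circ> s) \<circ> r) \<longlonglongrightarrow> l"
      using compact_imp_seq_compact[OF compact_Icc[of 1 "2 * C + 1"]] unfolding seq_compact_def
      by metis
    have h0: "filterlim (s \<circ> r) (at 0) sequentially"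
      unfolding filterlim_at
      using LIMSEQ_subseq_LIMSEQ[OF LIMSEQ_inverse_real_of_nat l(1)] s0 by (auto simp: s_def o_def)
    have freq: "\<exists>\<^sub>F h in at 0. P (?Q h)" if "eventually P (nhds l)" for P
    proof -
      have "\<forall>\<^sub>F n in sequentially. P (Q ((s \<circ> r) n))"
        using l(2) that by (auto simp: filterlim_iff o_def)
      then have "\<exists>\<^sub>F n in sequentially. P (Q ((s \<circ> r) n))"
        by (rule eventually_frequently[rotated]) simp
      then have "\<exists>\<^sub>F h in at 0. P (Q h)" using h0 unfolding filterlim_iff frequently_def by blast
      then show ?thesis by (simp add: Q_def)
    qed
    have neg: "(- g (x + h) - (- g x)) / h = - ?Q h" for h
      by (simp add: diff_divide_distrib)
    have "(?Q \<longlongrightarrow> l) (at 0)"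
    proof (rule order_tendstoI)
      fix a assume a: "a < l"
      show "\<forall>\<^sub>F h in at 0. a < ?Q h"
      proof (rule ccontr)
        assume "\<not> ?thesis"
        then have fr: "\<exists>\<^sub>F h in at 0. ?Q h \<le> a" by (simp add: frequently_def not_le)
        obtain p where p: "p \<in> \<rat>" "a < p" "p < l" using Rats_dense_in_real[OF a] by blast
        obtain q where q: "q \<in> \<rat>" "p < q" "q < l" using Rats_dense_in_real[OF p(3)] by blast
        have "x \<in> small_slope_points g p"
          by (rule small_slope_points_if_frequently[OF cont])
            (rule frequently_elim1[OF fr], use p in auto)
        moreover have "x \<in> small_slope_points (\<lambda>x. - g x) (- q)"
        proof (rule small_slope_points_if_frequently)
          have "\<exists>\<^sub>F h in at 0. q < ?Q h"
            using freq[of "\<lambda>y. q < y"] eventually_nhds_in_open[of "{q<..}" l] q by simp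
          then show "\<exists>\<^sub>F h in at 0. (- g (x + h) - (- g x)) / h < - q"
            unfolding neg by (rule frequently_elim1) simp
        qed (intro continuous_intros cont)
        ultimately show False using x p q by (auto simp: N_def)
      qed
    next
      fix a assume a: "l < a"
      show "\<forall>\<^sub>F h in at 0. ?Q h < a"
      proof (rule ccontr)
        assume "\<not> ?thesis"
        then have fr: "\<exists>\<^sub>F h in at 0. a \<le> ?Q h" by (simp add: frequently_def not_le)
        obtain p where p: "p \<in> \<rat>" "l < p" "p < a" using Rats_dense_in_real[OF a] by blast
        obtain q where q: "q \<in> \<rat>" "p < q" "q < a" using Rats_dense_in_real[OF p(3)] by blast
        have "x \<in> small_slope_points g p"
          by (rule small_slope_points_if_frequently[OF cont])
            (use freq[of "\<lambda>y. y < p"] eventually_nhds_in_open[of "{..<p}" l] p in simp)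
        moreover have "x \<in> small_slope_points (\<lambda>x. - g x) (- q)"
        proof (rule small_slope_points_if_frequently)
          show "\<exists>\<^sub>F h in at 0. (- g (x + h) - (- g x)) / h < - q"
            unfolding neg using fr by (rule frequently_elim1) (use q in auto)
        qed (intro continuous_intros cont)
        ultimately show False using x p q by (auto simp: N_def)
      qed
    qed
    then have "(g has_field_derivative l) (at x)" by (simp add: DERIV_def)
    then have "((\<lambda>x. g x - (C + 1) * x) has_field_derivative (l - (C + 1) * 1)) (at x)"
      by (intro DERIV_diff DERIV_cmult DERIV_ident)
    moreover have "(\<lambda>x. g x - (C + 1) * x) = f" by (simp add: g_def fun_eq_iff)
    ultimately show ?thesis using real_differentiable_def by metis
  qed
  then show ?thesis using N by blast
qed

section \<open>Directional derivatives of Lipschitz functions\<close>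

definition directional_deriv :: "('a::real_normed_vector \<Rightarrow> real) \<Rightarrow> 'a \<Rightarrow> 'a \<Rightarrow> real" where
  "directional_deriv v e y = deriv (\<lambda>t. v (y + t *\<^sub>R e)) 0"

definition directionally_differentiable :: "('a::real_normed_vector \<Rightarrow> real) \<Rightarrow> 'a \<Rightarrow> 'a \<Rightarrow> bool" where
  "directionally_differentiable v e y \<longleftrightarrow> (\<lambda>t. v (y + t *\<^sub>R e)) differentiable (at 0)"

lemma directional_deriv_tendsto:
  assumes "directionally_differentiable v e y"
  shows "((\<lambda>t. (v (y + t *\<^sub>R e) - v y) / t) \<longlongrightarrow> directional_deriv v e y) (at 0)"
proof -
  obtain D where D: "((\<lambda>t. v (y + t *\<^sub>R e)) has_field_derivative D) (at 0)"
    using assms unfolding directionally_differentiable_def real_differentiable_def by blast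
  then have "directional_deriv v e y = D" unfolding directional_deriv_def by (rule DERIV_imp_deriv)
  then show ?thesis using D by (simp add: DERIV_def)
qed

text \<open>The arbitrary value of a derivative that does not exist.\<close>
definition deriv_default :: real where
  "deriv_default = (SOME D. False)"

lemma directional_deriv_default:
  assumes "\<not> directionally_differentiable v e y"
  shows "directional_deriv v e y = deriv_default"
proof -
  have "\<not> ((\<lambda>t. v (y + t *\<^sub>R e)) has_field_derivative D) (at 0)" for D
    using assms unfolding directionally_differentiable_def real_differentiable_def by blast
  then show ?thesis by (simp add: directional_deriv_def deriv_def deriv_default_def)
qed

text \<open>The bound allows for the value of \<open>deriv\<close> at points where there is no
  derivative.\<close>
lemma abs_directional_deriv_le:
  assumes "\<forall>\<^sub>F t in at 0. \<bar>v (y + t *\<^sub>R e) - v y\<bar> \<le> M * \<bar>t\<bar>"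
  shows "\<bar>directional_deriv v e y\<bar> \<le> max M \<bar>deriv_default\<bar>"
proof (cases "directionally_differentiable v e y")
  case True
  have "\<forall>\<^sub>F t in at 0. \<bar>(v (y + t *\<^sub>R e) - v y) / t\<bar> \<le> M"
    using assms eventually_neq_at_within[of 0]
    by eventually_elim (simp add: abs_divide divide_le_eq)
  then have "\<bar>directional_deriv v e y\<bar> \<le> M"
    by (rule tendsto_upperbound[OF tendsto_rabs[OF directional_deriv_tendsto[OF True]]]) simp
  then show ?thesis by simp
qed (simp add: directional_deriv_default)

text \<open>Cauchy's criterion, with bounds from a countable set, describes differentiability by closed
  conditions on \<open>y\<close>; hence it is a Borel condition.\<close>
lemma directionally_differentiable_iff_Cauchy:
  fixes v :: "'a::real_normed_vector \<Rightarrow> real"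
  shows "directionally_differentiable v e y \<longleftrightarrow>
    (\<forall>k::nat. \<exists>n::nat. \<forall>s t. 0 < \<bar>s\<bar> \<and> \<bar>s\<bar> < 1 / Suc n \<and> 0 < \<bar>t\<bar> \<and> \<bar>t\<bar> < 1 / Suc n \<longrightarrow>
       \<bar>(v (y + s *\<^sub>R e) - v y) / s - (v (y + t *\<^sub>R e) - v y) / t\<bar> \<le> 1 / Suc k)"
    (is "_ \<longleftrightarrow> ?C")
proof -
  define Q where "Q = (\<lambda>t. (v (y + t *\<^sub>R e) - v y) / t)"
  have "directionally_differentiable v e y \<longleftrightarrow> (\<exists>l. (Q \<longlongrightarrow> l) (at 0))"
    unfolding directionally_differentiable_def real_differentiable_def DERIV_def Q_def by simp
  also have "\<dots> \<longleftrightarrow> ?C"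
  proof
    assume "\<exists>l. (Q \<longlongrightarrow> l) (at 0)"
    then obtain l where l: "(Q \<longlongrightarrow> l) (at 0)" by blast
    show ?C
    proof
      fix k :: nat
      have "\<forall>\<^sub>F t in at 0. dist (Q t) l < 1 / Suc k / 2" using l by (rule tendstoD) simp
      then obtain d where d: "d > 0" "\<And>t. t \<noteq> 0 \<Longrightarrow> \<bar>t\<bar> < d \<Longrightarrow> dist (Q t) l < 1 / Suc k / 2"
        unfolding eventually_at by auto
      obtain n where n: "1 / Suc n < d" using reals_Archimedean[OF d(1)] by (auto simp: inverse_eq_divide)
      have "\<bar>Q s - Q t\<bar> \<le> 1 / Suc k" if "0 < \<bar>s\<bar>" "\<bar>s\<bar> < 1 / Suc n" "0 < \<bar>t\<bar>" "\<bar>t\<bar> < 1 / Suc n" for s t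
      proof -
        have "dist (Q s) l < 1 / Suc k / 2" "dist (Q t) l < 1 / Suc k / 2"
        proof -
          have st: "s \<noteq> 0" "t \<noteq> 0" "\<bar>s\<bar> < d" "\<bar>t\<bar> < d" using that n by linarith+
          show "dist (Q s) l < 1 / Suc k / 2" using d(2)[OF st(1,3)] .
          show "dist (Q t) l < 1 / Suc k / 2" using d(2)[OF st(2,4)] .
        qed
        from dist_triangle_half_l[OF this] have "dist (Q s) (Q t) \<le> 1 / Suc k" by (rule order_less_imp_le)
        then show ?thesis by (simp only: dist_real_def)
      qed
      then show "\<exists>n::nat. \<forall>s t. 0 < \<bar>s\<bar> \<and> \<bar>s\<bar> < 1 / Suc n \<and> 0 < \<bar>t\<bar> \<and> \<bar>t\<bar> < 1 / Suc n \<longrightarrow>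
       \<bar>(v (y + s *\<^sub>R e) - v y) / s - (v (y + t *\<^sub>R e) - v y) / t\<bar> \<le> 1 / Suc k"
        unfolding Q_def by blast
    qed
  next
    assume C: ?C
    have "cauchy_filter (filtermap Q (at 0))"
      unfolding cauchy_filter_metric_filtermap
    proof (intro allI impI)
      fix \<epsilon> :: real assume "\<epsilon> > 0"
      from reals_Archimedean[OF this] obtain k :: nat where k: "1 / Suc k < \<epsilon>"
        by (auto simp: inverse_eq_divide)
      obtain n :: nat where n: "\<And>s t. 0 < \<bar>s\<bar> \<and> \<bar>s\<bar> < 1 / Suc n \<and> 0 < \<bar>t\<bar> \<and> \<bar>t\<bar> < 1 / Suc n \<Longrightarrow> \<bar>Q s - Q t\<bar> \<le> 1 / Suc k"
        using C unfolding Q_def by blast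
      have "\<forall>\<^sub>F t in at 0. 0 < \<bar>t\<bar> \<and> \<bar>t\<bar> < 1 / Suc n"
        unfolding eventually_at by (intro exI[of _ "1 / Suc n"]) auto
      moreover have "dist (Q s) (Q t) < \<epsilon>" if "0 < \<bar>s\<bar> \<and> \<bar>s\<bar> < 1 / Suc n" "0 < \<bar>t\<bar> \<and> \<bar>t\<bar> < 1 / Suc n" for s t
      proof -
        have "\<bar>Q s - Q t\<bar> \<le> 1 / Suc k" by (rule n) (use that in blast)
        then show ?thesis using k unfolding dist_real_def by linarith
      qed
      ultimately show "\<exists>P. eventually P (at 0) \<and> (\<forall>x y. P x \<and> P y \<longrightarrow> dist (Q x) (Q y) < \<epsilon>)"
        by blast
    qed
    moreover have "complete (UNIV :: real set)" by (rule complete_UNIV)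
    moreover have "filtermap Q (at 0) \<noteq> bot" by (simp add: filtermap_bot_iff)
    ultimately have "\<exists>l. filtermap Q (at 0) \<le> nhds l"
      unfolding complete_uniform by (auto simp del: filtermap_bot_iff)
    then show "\<exists>l. (Q \<longlongrightarrow> l) (at 0)" by (simp add: filterlim_def)
  qed
  finally show ?thesis .
qed

lemma borel_directionally_differentiable:
  fixes v :: "'a::euclidean_space \<Rightarrow> real"
  assumes cont: "continuous_on UNIV v"
  shows "{y. directionally_differentiable v e y} \<in> sets borel"
proof -
  have cl1: "closed {y. \<bar>(v (y + s *\<^sub>R e) - v y) / s - (v (y + t *\<^sub>R e) - v y) / t\<bar> \<le> c}"
    if "s \<noteq> 0" "t \<noteq> 0" for s t c :: real
    using that by (intro closed_Collect_le continuous_intros continuous_on_compose2[OF cont]) auto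
  define B where "B r c = {y. \<forall>s t. 0 < \<bar>s\<bar> \<and> \<bar>s\<bar> < r \<and> 0 < \<bar>t\<bar> \<and> \<bar>t\<bar> < r \<longrightarrow>
       \<bar>(v (y + s *\<^sub>R e) - v y) / s - (v (y + t *\<^sub>R e) - v y) / t\<bar> \<le> c}" for r c
  have cl: "closed (B r c)" for r c
    unfolding B_def
  proof (intro closed_Collect_all)
    fix s t :: real
    show "closed {y. 0 < \<bar>s\<bar> \<and> \<bar>s\<bar> < r \<and> 0 < \<bar>t\<bar> \<and> \<bar>t\<bar> < r \<longrightarrow>
       \<bar>(v (y + s *\<^sub>R e) - v y) / s - (v (y + t *\<^sub>R e) - v y) / t\<bar> \<le> c}"
      using cl1[of s t c] by (cases "0 < \<bar>s\<bar> \<and> \<bar>s\<bar> < r \<and> 0 < \<bar>t\<bar> \<and> \<bar>t\<bar> < r") auto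
  qed
  have "{y. directionally_differentiable v e y} = (\<Inter>k::nat. \<Union>n::nat. B (1 / Suc n) (1 / Suc k))"
    by (simp only: B_def directionally_differentiable_iff_Cauchy Collect_all_eq Collect_ex_eq)
  also have "\<dots> \<in> sets borel"
  proof (rule sets.countable_INT'')
    show "(\<Union>n::nat. B (1 / Suc n) (1 / Suc k)) \<in> sets borel" for k :: nat
      by (rule sets.countable_UN) (auto intro: borel_closed cl)
  qed simp_all
  finally show ?thesis .
qed

lemma borel_measurable_directional_deriv:
  fixes v :: "'a::euclidean_space \<Rightarrow> real"
  assumes cont: "continuous_on UNIV v"
  shows "directional_deriv v e \<in> borel_measurable borel"
proof -
  define q where "q n y = (v (y + (1 / Suc n) *\<^sub>R e) - v y) / (1 / Suc n)" for n y
  have [measurable]: "q n \<in> borel_measurable borel" for n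
    unfolding q_def
    by (intro borel_measurable_continuous_onI continuous_intros continuous_on_compose2[OF cont]) auto
  have [measurable]: "{y. directionally_differentiable v e y} \<in> sets borel"
    by (rule borel_directionally_differentiable[OF cont])
  have "directional_deriv v e y =
      (if y \<in> {y. directionally_differentiable v e y} then lim (\<lambda>n. q n y) else deriv_default)" for y
  proof (cases "directionally_differentiable v e y")
    case True
    have "filterlim (\<lambda>n. 1 / real (Suc n)) (at 0) sequentially"
      unfolding filterlim_at using LIMSEQ_inverse_real_of_nat by (auto simp: inverse_eq_divide)
    from filterlim_compose[OF directional_deriv_tendsto[OF True] this]
    have "(\<lambda>n. q n y) \<longlonglongrightarrow> directional_deriv v e y" by (simp add: q_def)
    from limI[OF this] show ?thesis using True by simp
  qed (simp add: directional_deriv_default)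
  then have eq: "directional_deriv v e =
      (\<lambda>y. if y \<in> {y. directionally_differentiable v e y} then lim (\<lambda>n. q n y) else deriv_default)" by blast
  show ?thesis unfolding eq by measurable
qed

text \<open>Fubini's theorem for the pairs \<open>(y, t)\<close> with \<open>t\<close> in the unit interval and
  \<open>y + t *\<^sub>R e\<close> in \<open>N\<close>: each \<open>y\<close> contributes 0, and each
  \<open>t\<close> contributes the measure of \<open>N\<close>.\<close>
lemma null_if_null_on_lines:
  fixes N :: "'a::euclidean_space set"
  assumes N: "N \<in> sets borel"
    and slice: "\<And>y. {t. y + t *\<^sub>R e \<in> N} \<in> null_sets (lborel :: real measure)"
  shows "N \<in> null_sets lborel"
proof -
  note N[measurable]
  define S where "S = {(y, t::real). t \<in> {0..1} \<and> y + t *\<^sub>R e \<in> N}"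
  have meas: "(\<lambda>(y, t::real). y + t *\<^sub>R e) \<in> borel_measurable (lborel \<Otimes>\<^sub>M lborel)"
    by measurable
  have S: "S \<in> sets (lborel \<Otimes>\<^sub>M lborel)"
  proof -
    have "S = (\<lambda>(y, t::real). y + t *\<^sub>R e) -` N \<inter> space (lborel \<Otimes>\<^sub>M lborel) \<inter> (UNIV \<times> {0..1})"
      by (auto simp: S_def space_pair_measure)
    moreover have "UNIV \<times> {0..1::real} \<in> sets (lborel \<Otimes>\<^sub>M lborel)"
      by (rule pair_measureI) (simp_all add: sets_lborel)
    ultimately show ?thesis using measurable_sets[OF meas N] by (metis sets.Int)
  qed
  have "(\<integral>\<^sup>+t. \<integral>\<^sup>+y. indicator S (y, t) \<partial>lborel \<partial>lborel) = (\<integral>\<^sup>+y. \<integral>\<^sup>+t. indicator S (y, t) \<partial>lborel \<partial>lborel)"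
    by (rule lborel_pair.Fubini') (use S in auto)
  also have "\<dots> = (\<integral>\<^sup>+y. 0 \<partial>(lborel :: 'a measure))"
  proof (rule nn_integral_cong)
    fix y :: 'a
    have "AE t in lborel. t \<notin> {t. y + t *\<^sub>R e \<in> N}" by (rule AE_not_in[OF slice])
    then have "AE t in lborel. indicator S (y, t) = (0::ennreal)" by (auto simp: S_def)
    then have "(\<integral>\<^sup>+t. indicator S (y, t) \<partial>lborel) = (\<integral>\<^sup>+(t::real). 0 \<partial>lborel)" by (rule nn_integral_cong_AE)
    then show "(\<integral>\<^sup>+t. indicator S (y, t) \<partial>lborel) = 0" by simp
  qed
  finally have "(\<integral>\<^sup>+t. \<integral>\<^sup>+y. indicator S (y, t) \<partial>lborel \<partial>lborel) = 0" by simp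
  moreover have "(\<integral>\<^sup>+y. indicator S (y, t) \<partial>lborel) = indicator {0..1} t * emeasure lborel N" for t
  proof -
    have "(\<integral>\<^sup>+y. indicator S (y, t) \<partial>lborel) = (\<integral>\<^sup>+y. indicator {0..1} t * indicator N (t *\<^sub>R e + y) \<partial>lborel)"
      by (intro nn_integral_cong) (auto simp: S_def indicator_def add.commute)
    also have "\<dots> = indicator {0..1} t * (\<integral>\<^sup>+y. indicator N (t *\<^sub>R e + y) \<partial>lborel)"
      using N by (intro nn_integral_cmult) measurable
    also have "(\<integral>\<^sup>+y. indicator N (t *\<^sub>R e + y) \<partial>lborel) = (\<integral>\<^sup>+y. indicator N y \<partial>distr lborel borel ((+) (t *\<^sub>R e)))"
      using N by (subst nn_integral_distr) auto
    also have "\<dots> = emeasure lborel N" using N by (simp add: lborel_distr_plus)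
    finally show ?thesis .
  qed
  ultimately have "(\<integral>\<^sup>+t. indicator {0..1} t * emeasure lborel N \<partial>(lborel :: real measure)) = 0" by simp
  then have "emeasure lborel N = 0" by (subst (asm) nn_integral_multc) auto
  then show ?thesis using N by (simp add: null_sets_def)
qed

text \<open>On each line in direction \<open>e\<close> the one-dimensional result applies.\<close>
lemma lipschitz_directionally_differentiable_ae:
  fixes v :: "'a::euclidean_space \<Rightarrow> real"
  assumes lip: "C-lipschitz_on UNIV v"
  shows "AE y in lborel. directionally_differentiable v e y"
proof -
  let ?N = "{y. \<not> directionally_differentiable v e y}"
  have cont: "continuous_on UNIV v" using lip by (rule lipschitz_on_continuous_on)
  have N: "?N \<in> sets borel"
    using sets.compl_sets[OF borel_directionally_differentiable[OF cont, of e]]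
    by (simp add: Collect_neg_eq Compl_eq_Diff_UNIV)
  have "?N \<in> null_sets lborel"
  proof (rule null_if_null_on_lines[OF N])
    fix y
    have "(C * norm e)-lipschitz_on UNIV (\<lambda>t. v (y + t *\<^sub>R e))"
    proof (rule lipschitz_onI)
      fix s t :: real
      have "dist (v (y + s *\<^sub>R e)) (v (y + t *\<^sub>R e)) \<le> C * dist (y + s *\<^sub>R e) (y + t *\<^sub>R e)"
        by (rule lipschitz_onD[OF lip]) auto
      also have "dist (y + s *\<^sub>R e) (y + t *\<^sub>R e) = norm e * dist s t"
        by (simp add: dist_norm scaleR_diff_left[symmetric])
      finally show "dist (v (y + s *\<^sub>R e)) (v (y + t *\<^sub>R e)) \<le> C * norm e * dist s t" by (simp add: mult.assoc)
    qed (use lipschitz_on_nonneg[OF lip] in simp)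
    from lipschitz_differentiable_ae[OF this] obtain M where M: "M \<in> null_sets lborel"
      "\<And>t. t \<notin> M \<Longrightarrow> (\<lambda>t. v (y + t *\<^sub>R e)) differentiable (at t)" by blast
    have "directionally_differentiable v e (y + t *\<^sub>R e)" if tM: "t \<notin> M" for t
    proof -
      obtain D where "((\<lambda>t. v (y + t *\<^sub>R e)) has_field_derivative D) (at (0 + t))"
        using M(2)[OF tM] by (auto simp: real_differentiable_def)
      then have "((\<lambda>s. v (y + (s + t) *\<^sub>R e)) has_field_derivative D) (at 0)"
        by (subst (asm) DERIV_shift)
      then show ?thesis unfolding directionally_differentiable_def real_differentiable_def
        by (auto simp: algebra_simps)
    qed
    then have sub: "{t. y + t *\<^sub>R e \<in> ?N} \<subseteq> M" by blast
    have "{t. y + t *\<^sub>R e \<in> ?N} \<in> sets lborel"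
    proof -
      have "(\<lambda>t::real. y + t *\<^sub>R e) \<in> borel_measurable borel" by measurable
      from measurable_sets[OF this N] show ?thesis by (simp add: vimage_def)
    qed
    then show "{t. y + t *\<^sub>R e \<in> ?N} \<in> null_sets lborel" using sub by (rule null_sets_subset[OF M(1)])
  qed
  then show ?thesis by (rule AE_I') auto
qed

text \<open>Integration by parts for difference quotients shifts the derivative from \<open>v\<close> to the
  cut-off \<open>\<psi>\<close>. Thus only the size of \<open>v\<close> matters, not its Lipschitz
  constant.\<close>
lemma abs_integral_cutoff_directional_deriv_le:
  fixes v \<psi> :: "'a::euclidean_space \<Rightarrow> real"
  assumes lip: "C-lipschitz_on UNIV v" and small: "\<And>y. \<bar>v y\<bar> \<le> \<epsilon>"
    and \<psi>lip: "M-lipschitz_on UNIV \<psi>" and \<psi>0: "\<And>y. y \<notin> cball z r \<Longrightarrow> \<psi> y = 0" and e: "norm e = 1"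
    and r: "r > 0"
  shows "\<bar>\<integral>y. \<psi> y * directional_deriv v e y \<partial>lborel\<bar> \<le> M * \<epsilon> * measure lborel (cball z (r + 1))"
proof -
  let ?B = "cball z (r + 1)"
  define s where "s n = 1 / real (Suc n)" for n
  have s: "0 < s n" "s n \<le> 1" for n by (simp_all add: s_def)
  have vc: "continuous_on UNIV v" using lip by (rule lipschitz_on_continuous_on)
  have \<psi>c: "continuous_on UNIV \<psi>" using \<psi>lip by (rule lipschitz_on_continuous_on)
  have C: "C \<ge> 0" using lip by (rule lipschitz_on_nonneg)
  have M: "M \<ge> 0" using \<psi>lip by (rule lipschitz_on_nonneg)
  have [measurable]: "v \<in> borel_measurable borel" "\<psi> \<in> borel_measurable borel"
    using vc \<psi>c by (simp_all add: borel_measurable_continuous_onI)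
  have [measurable]: "directional_deriv v e \<in> borel_measurable borel"
    by (rule borel_measurable_directional_deriv[OF vc])
  have "bounded (\<psi> ` cball z r)"
    by (rule compact_imp_bounded, rule compact_continuous_image[OF continuous_on_subset[OF \<psi>c]]) auto
  then obtain P where "\<forall>y\<in>cball z r. \<bar>\<psi> y\<bar> \<le> P" by (auto simp: bounded_iff)
  then have P: "\<bar>\<psi> y\<bar> \<le> P" if "y \<in> cball z r" for y using that by blast
  have P': "\<bar>\<psi> y\<bar> \<le> \<bar>P\<bar> * indicator ?B y" for y
    using P[of y] \<psi>0[of y] by (cases "y \<in> cball z r") (auto simp: indicator_def)
  have intB: "integrable lborel (\<lambda>y. c * indicator ?B y)" for c :: real
    by (intro integrable_mult_right integrable_real_indicator) (simp_all add: emeasure_lborel_cball_finite[unfolded infinity_ennreal_def])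
  define q where "q n y = (v (y + s n *\<^sub>R e) - v y) / s n" for n y
  have qb: "\<bar>q n y\<bar> \<le> C" for n y
  proof -
    have "\<bar>v (y + s n *\<^sub>R e) - v y\<bar> \<le> C * s n"
      using lipschitz_onD[OF lip, of "y + s n *\<^sub>R e" y] e s[of n] by (simp add: dist_norm)
    then show ?thesis using s[of n] by (simp add: q_def abs_divide divide_le_eq)
  qed
  have [measurable]: "q n \<in> borel_measurable borel" for n unfolding q_def by measurable
  have lim: "(\<lambda>n. \<integral>y. \<psi> y * q n y \<partial>lborel) \<longlonglongrightarrow> (\<integral>y. \<psi> y * directional_deriv v e y \<partial>lborel)"
  proof (rule integral_dominated_convergence[where w = "\<lambda>y. (\<bar>P\<bar> * C) * indicator ?B y"])
    show "AE y in lborel. (\<lambda>n. \<psi> y * q n y) \<longlonglongrightarrow> \<psi> y * directional_deriv v e y"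
      using lipschitz_directionally_differentiable_ae[OF lip, of e]
    proof eventually_elim
      case (elim y)
      have "filterlim s (at 0) sequentially"
        unfolding filterlim_at s_def using LIMSEQ_inverse_real_of_nat by (auto simp: inverse_eq_divide)
      from filterlim_compose[OF directional_deriv_tendsto[OF elim] this]
      have "(\<lambda>n. q n y) \<longlonglongrightarrow> directional_deriv v e y" by (simp add: q_def)
      then show ?case by (intro tendsto_intros)
    qed
    show "AE y in lborel. norm (\<psi> y * q n y) \<le> (\<bar>P\<bar> * C) * indicator ?B y" for n
    proof (rule AE_I2)
      fix y
      have "\<bar>\<psi> y\<bar> * \<bar>q n y\<bar> \<le> (\<bar>P\<bar> * indicator ?B y) * C"
        by (rule mult_mono[OF P' qb]) auto
      then show "norm (\<psi> y * q n y) \<le> (\<bar>P\<bar> * C) * indicator ?B y" by (simp add: abs_mult mult_ac)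
    qed
  qed (use intB in \<open>simp_all\<close>)
  have "\<bar>\<integral>y. \<psi> y * q n y \<partial>lborel\<bar> \<le> M * \<epsilon> * measure lborel ?B" for n
  proof -
    have vi: "integrable lborel (\<lambda>y. \<psi> y * v y)"
    proof (rule Bochner_Integration.integrable_bound[OF intB[of "\<bar>P\<bar> * \<epsilon>"]])
      show "AE y in lborel. norm (\<psi> y * v y) \<le> norm ((\<bar>P\<bar> * \<epsilon>) * indicator ?B y :: real)"
      proof (rule AE_I2)
        fix y
        have e0: "\<epsilon> \<ge> 0" using small[of y] by linarith
        have "\<bar>\<psi> y\<bar> * \<bar>v y\<bar> \<le> (\<bar>P\<bar> * indicator ?B y) * \<epsilon>"
          by (rule mult_mono[OF P' small]) auto
        then show "norm (\<psi> y * v y) \<le> norm ((\<bar>P\<bar> * \<epsilon>) * indicator ?B y :: real)"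
          using e0 by (simp add: abs_mult mult_ac)
      qed
    qed simp
    have vi2: "integrable lborel (\<lambda>y. \<psi> y * v (y + s n *\<^sub>R e))"
    proof (rule Bochner_Integration.integrable_bound[OF intB[of "\<bar>P\<bar> * \<epsilon>"]])
      show "AE y in lborel. norm (\<psi> y * v (y + s n *\<^sub>R e)) \<le> norm ((\<bar>P\<bar> * \<epsilon>) * indicator ?B y :: real)"
      proof (rule AE_I2)
        fix y
        have e0: "\<epsilon> \<ge> 0" using small[of y] by linarith
        have "\<bar>\<psi> y\<bar> * \<bar>v (y + s n *\<^sub>R e)\<bar> \<le> (\<bar>P\<bar> * indicator ?B y) * \<epsilon>"
          by (rule mult_mono[OF P' small]) auto
        then show "norm (\<psi> y * v (y + s n *\<^sub>R e)) \<le> norm ((\<bar>P\<bar> * \<epsilon>) * indicator ?B y :: real)"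
          using e0 by (simp add: abs_mult mult_ac)
      qed
    qed measurable
    have shift: "(\<integral>y. \<psi> y * v (y + s n *\<^sub>R e) \<partial>lborel) = (\<integral>y. \<psi> (y - s n *\<^sub>R e) * v y \<partial>lborel)"
    proof -
      have "(\<integral>y. \<psi> (y - s n *\<^sub>R e) * v y \<partial>lborel) =
          (\<integral>y. \<psi> (y - s n *\<^sub>R e) * v y \<partial>distr lborel borel ((+) (s n *\<^sub>R e)))"
        by (simp add: lborel_distr_plus)
      also have "\<dots> = (\<integral>y. \<psi> y * v (y + s n *\<^sub>R e) \<partial>lborel)"
        by (subst integral_distr) (auto simp: add.commute)
      finally show ?thesis by simp
    qed
    have vi3: "integrable lborel (\<lambda>y. \<psi> (y - s n *\<^sub>R e) * v y)"
    proof -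
      have "integrable (distr lborel borel ((+) (s n *\<^sub>R e))) (\<lambda>y. \<psi> (y - s n *\<^sub>R e) * v y)"
        using vi2 by (subst integrable_distr_eq) (auto simp: add.commute)
      then show ?thesis by (simp add: lborel_distr_plus)
    qed
    have "(\<integral>y. \<psi> y * q n y \<partial>lborel) = (\<integral>y. (\<psi> y * v (y + s n *\<^sub>R e) - \<psi> y * v y) / s n \<partial>lborel)"
      by (intro Bochner_Integration.integral_cong) (auto simp: q_def algebra_simps diff_divide_distrib)
    also have "\<dots> = ((\<integral>y. \<psi> y * v (y + s n *\<^sub>R e) \<partial>lborel) - (\<integral>y. \<psi> y * v y \<partial>lborel)) / s n"
      using vi vi2 by (simp add: Bochner_Integration.integral_diff)
    also have "\<dots> = (\<integral>y. (\<psi> (y - s n *\<^sub>R e) - \<psi> y) * v y \<partial>lborel) / s n"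
      unfolding left_diff_distrib shift by (subst Bochner_Integration.integral_diff[OF vi3 vi]) (rule refl)
    finally have eq: "(\<integral>y. \<psi> y * q n y \<partial>lborel) = (\<integral>y. (\<psi> (y - s n *\<^sub>R e) - \<psi> y) * v y \<partial>lborel) / s n" .
    have "norm (\<integral>y. (\<psi> (y - s n *\<^sub>R e) - \<psi> y) * v y \<partial>lborel) \<le> (\<integral>y. (M * s n * \<epsilon>) * indicator ?B y \<partial>lborel)"
    proof (rule Bochner_Integration.integral_norm_bound_integral)
      show "integrable lborel (\<lambda>y. (\<psi> (y - s n *\<^sub>R e) - \<psi> y) * v y)"
        using vi vi3 by (simp add: left_diff_distrib)
      show "integrable lborel (\<lambda>y. (M * s n * \<epsilon>) * indicator ?B y)" by (rule intB)
      fix y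
      show "norm ((\<psi> (y - s n *\<^sub>R e) - \<psi> y) * v y) \<le> (M * s n * \<epsilon>) * indicator ?B y"
      proof (cases "y \<in> ?B")
        case True
        have "\<bar>\<psi> (y - s n *\<^sub>R e) - \<psi> y\<bar> \<le> M * s n"
          using lipschitz_onD[OF \<psi>lip, of "y - s n *\<^sub>R e" y] e s[of n] by (simp add: dist_norm)
        then have "\<bar>\<psi> (y - s n *\<^sub>R e) - \<psi> y\<bar> * \<bar>v y\<bar> \<le> (M * s n) * \<epsilon>"
          by (rule mult_mono[OF _ small]) (use M s[of n] in auto)
        then show ?thesis using True by (simp add: abs_mult)
      next
        case False
        have "norm (y - z) \<le> norm (y - s n *\<^sub>R e - z) + norm (s n *\<^sub>R e)"
          using norm_triangle_ineq[of "y - s n *\<^sub>R e - z" "s n *\<^sub>R e"] by (simp add: algebra_simps)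
        moreover have "norm (s n *\<^sub>R e) \<le> 1" using e s[of n] by simp
        ultimately have "y - s n *\<^sub>R e \<notin> cball z r" "y \<notin> cball z r"
          using False by (auto simp: dist_norm norm_minus_commute)
        then show ?thesis using False by (simp add: \<psi>0)
      qed
    qed
    also have "\<dots> = (M * s n * \<epsilon>) * measure lborel ?B" by simp
    finally have "\<bar>\<integral>y. (\<psi> (y - s n *\<^sub>R e) - \<psi> y) * v y \<partial>lborel\<bar> / s n \<le> (M * s n * \<epsilon>) * measure lborel ?B / s n"
      using s[of n] by (intro divide_right_mono) auto
    then show ?thesis using s[of n] by (simp add: eq abs_divide)
  qed
  then show ?thesis by (intro LIMSEQ_le_const2[OF tendsto_rabs[OF lim]]) auto
qed

text \<open>Lipschitz cut-offs increase to the indicator of any open subset of the ball, and the integrals over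
  open sets determine a function up to a null set.\<close>
lemma AE_zero_if_cutoffs_zero:
  fixes w :: "'a::euclidean_space \<Rightarrow> real"
  assumes int: "integrable lborel (\<lambda>y. indicator (cball z r) y * w y)" and r: "r > 0"
    and zero: "\<And>M \<psi>. M-lipschitz_on UNIV \<psi> \<Longrightarrow> (\<And>y. y \<notin> cball z r \<Longrightarrow> \<psi> y = (0::real)) \<Longrightarrow>
       (\<integral>y. \<psi> y * w y \<partial>lborel) = 0"
  shows "AE y in lborel. y \<in> ball z r \<longrightarrow> w y = 0"
proof -
  define f where "f y = indicator (ball z r) y * w y" for y
  let ?g = "\<lambda>y. indicator (cball z r) y * w y"
  have [measurable]: "?g \<in> borel_measurable borel" using borel_measurable_integrable[OF int] by simp
  have f_eq: "f y = indicator (ball z r) y * ?g y" for y by (simp add: f_def indicator_def)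
  have fint: "integrable lborel f"
    unfolding f_eq[abs_def]
  proof (rule Bochner_Integration.integrable_bound[OF int])
    show "(\<lambda>y. indicator (ball z r) y * ?g y) \<in> borel_measurable lborel"
      by (rule borel_measurable_times[OF borel_measurable_indicator borel_measurable_integrable[OF int]]) simp
  qed (auto simp: indicator_def)
  have open0: "(\<integral>y. indicator U y * f y \<partial>lborel) = 0" if U: "open U" for U
  proof -
    define V where "V = U \<inter> ball z r"
    define \<psi> where "\<psi> n y = min 1 (real n * infdist y (- V))" for n :: nat and y
    have Vne: "- V \<noteq> {}"
    proof
      assume "- V = {}"
      then have "ball z r = UNIV" by (auto simp: V_def)
      then show False using bounded_ball[of z r] not_bounded_UNIV by metis
    qed
    have \<psi>0: "\<psi> n y = 0" if "y \<notin> V" for n y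
      using that by (simp add: \<psi>_def infdist_zero)
    have lipd: "\<bar>infdist x (- V) - infdist y (- V)\<bar> \<le> dist x y" for x y
      using infdist_triangle_abs by (simp add: abs_le_iff infdist_triangle)
    have \<psi>lip: "(real n)-lipschitz_on UNIV (\<psi> n)" for n
    proof (rule lipschitz_onI)
      fix x y
      have "\<bar>\<psi> n x - \<psi> n y\<bar> \<le> \<bar>real n * infdist x (- V) - real n * infdist y (- V)\<bar>"
        unfolding \<psi>_def by linarith
      also have "\<dots> = real n * \<bar>infdist x (- V) - infdist y (- V)\<bar>"
        by (simp add: right_diff_distrib[symmetric] abs_mult)
      also have "\<dots> \<le> real n * dist x y" by (rule mult_left_mono[OF lipd]) simp
      finally show "dist (\<psi> n x) (\<psi> n y) \<le> real n * dist x y" by (simp add: dist_real_def)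
    qed simp
    have "(\<integral>y. \<psi> n y * w y \<partial>lborel) = 0" for n
      by (rule zero[OF \<psi>lip]) (rule \<psi>0, auto simp: V_def)
    moreover have "(\<lambda>n. \<integral>y. \<psi> n y * w y \<partial>lborel) \<longlonglongrightarrow> (\<integral>y. indicator U y * f y \<partial>lborel)"
    proof (rule integral_dominated_convergence[where w = "\<lambda>y. \<bar>?g y\<bar>"])
      show "(\<lambda>y. indicator U y * f y) \<in> borel_measurable lborel"
        using U borel_measurable_integrable[OF fint] by simp
      have [measurable]: "\<psi> n \<in> borel_measurable borel" for n
        by (rule borel_measurable_continuous_onI[OF lipschitz_on_continuous_on[OF \<psi>lip]])
      have "\<psi> n y * w y = \<psi> n y * ?g y" for n y
        using \<psi>0[of y n] by (cases "y \<in> V") (auto simp: V_def indicator_def)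
      then have "(\<lambda>y. \<psi> n y * w y) = (\<lambda>y. \<psi> n y * ?g y)" for n by blast
      then show "(\<lambda>y. \<psi> n y * w y) \<in> borel_measurable lborel" for n by simp
      show "AE y in lborel. norm (\<psi> n y * w y) \<le> \<bar>?g y\<bar>" for n
      proof (rule AE_I2)
        fix y
        have "\<bar>\<psi> n y\<bar> \<le> 1" by (simp add: \<psi>_def infdist_nonneg)
        then have "\<bar>\<psi> n y\<bar> * \<bar>w y\<bar> \<le> 1 * \<bar>w y\<bar>" by (rule mult_right_mono) simp
        then show "norm (\<psi> n y * w y) \<le> \<bar>?g y\<bar>"
          using \<psi>0[of y n] by (cases "y \<in> V") (auto simp: V_def indicator_def abs_mult)
      qed
      show "AE y in lborel. (\<lambda>n. \<psi> n y * w y) \<longlonglongrightarrow> indicator U y * f y"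
      proof (rule AE_I2)
        fix y
        show "(\<lambda>n. \<psi> n y * w y) \<longlonglongrightarrow> indicator U y * f y"
        proof (cases "y \<in> V")
          case True
          have "open V" using U by (simp add: V_def open_Int)
          then have "closed (- V)" by (simp only: closed_Compl)
          then have d: "infdist y (- V) > 0"
            using True Vne in_closed_iff_infdist_zero[of "- V" y] infdist_nonneg[of y "- V"] by auto
          obtain N where N: "1 \<le> real N * infdist y (- V)"
            using reals_Archimedean3[OF d] by (metis less_eq_real_def)
          have "\<forall>\<^sub>F n in sequentially. \<psi> n y * w y = indicator U y * f y"
            using eventually_ge_at_top[of N]
          proof eventually_elim
            case (elim n)
            have "1 \<le> real n * infdist y (- V)"
              using N elim mult_right_mono[of "real N" "real n" "infdist y (- V)"] d by linarith
            then show ?case using True by (simp add: \<psi>_def f_def V_def)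
          qed
          then show ?thesis by (rule tendsto_eventually)
        next
          case False
          then have "indicator U y * f y = 0" by (auto simp: V_def f_def)
          moreover have "(\<lambda>n. \<psi> n y * w y) = (\<lambda>n. 0)" using \<psi>0[OF False] by simp
          ultimately show ?thesis by (simp only: tendsto_const)
        qed
      qed
      show "integrable lborel (\<lambda>y. \<bar>?g y\<bar>)" using int by (rule integrable_abs)
    qed
    ultimately show ?thesis by (simp add: LIMSEQ_const_iff)
  qed
  have "AE y in lborel. f y = 0"
  proof -
    have pos: "emeasure (density lborel (\<lambda>y. ennreal (f y))) A = emeasure (density lborel (\<lambda>y. ennreal (- f y))) A"
      if A: "open A" for A
    proof -
      have i: "integrable lborel (\<lambda>y. indicator A y * f y)"
      proof (rule Bochner_Integration.integrable_bound[OF fint])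
        show "(\<lambda>y. indicator A y * f y) \<in> borel_measurable lborel"
          using A borel_measurable_integrable[OF fint] by simp
      qed (auto simp: indicator_def)
      have "ennreal (f y) * indicator A y = ennreal (indicator A y * f y)" for y
        by (simp add: indicator_def)
      moreover have "ennreal (- f y) * indicator A y = ennreal (- (indicator A y * f y))" for y
        by (simp add: indicator_def)
      moreover have "(\<integral>\<^sup>+y. ennreal (indicator A y * f y) \<partial>lborel) = (\<integral>\<^sup>+y. ennreal (- (indicator A y * f y)) \<partial>lborel)"
      proof -
        let ?a = "\<integral>\<^sup>+y. ennreal (indicator A y * f y) \<partial>lborel" and ?b = "\<integral>\<^sup>+y. ennreal (- (indicator A y * f y)) \<partial>lborel"
        have fin: "?a < \<infinity>" "?b < \<infinity>"
          using i by (auto simp: real_integrable_def less_top[symmetric])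
        have "enn2real ?a - enn2real ?b = 0" using real_lebesgue_integral_def[OF i] open0[OF A] by simp
        then show ?thesis using fin by (metis diff_eq_diff_eq diff_self ennreal_enn2real infinity_ennreal_def)
      qed
      ultimately show ?thesis using A borel_measurable_integrable[OF fint] by (simp add: emeasure_density)
    qed
    have meas_eq: "density lborel (\<lambda>y. ennreal (f y)) = density lborel (\<lambda>y. ennreal (- f y))"
    proof (rule measure_eqI_generator_eq[where E = "{S. open S}" and \<Omega> = UNIV and A = "\<lambda>i. UNIV"])
      show "Int_stable {S::'a set. open S}" by (auto simp: Int_stable_def)
      show "emeasure (density lborel (\<lambda>y. ennreal (f y))) UNIV \<noteq> \<infinity>"
        using fint borel_measurable_integrable[OF fint] by (simp add: emeasure_density real_integrable_def)
    qed (auto simp: pos borel_def)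
    have "AE y in lborel. ennreal (f y) = ennreal (- f y)"
    proof (rule sigma_finite_measure.density_unique[OF sigma_finite_lborel _ _ meas_eq])
    qed (use borel_measurable_integrable[OF fint] in simp_all)
    then show ?thesis
    proof eventually_elim
      case (elim y)
      then show ?case by (cases "f y \<ge> 0") (auto simp: ennreal_neg)
    qed
  qed
  then show ?thesis by eventually_elim (auto simp: f_def indicator_def split: if_splits)
qed

section \<open>Norms of integrable powers\<close>

lemma powr_convex_nonneg:
  fixes x y \<theta> p :: real
  assumes p: "1 \<le> p" and \<theta>: "0 \<le> \<theta>" "\<theta> \<le> 1" and xy: "x \<ge> 0" "y \<ge> 0"
  shows "((1 - \<theta>) * x + \<theta> * y) powr p \<le> (1 - \<theta>) * x powr p + \<theta> * y powr p"
proof -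
  have le: "(t * z) powr p \<le> t * z powr p" if "0 \<le> t" "t \<le> 1" "0 \<le> z" for t z :: real
  proof -
    have "t powr p \<le> t"
    proof (cases "t = 0")
      case False
      then show ?thesis using powr_mono'[of 1 p t] p that by simp
    qed simp
    then have "t powr p * z powr p \<le> t * z powr p" by (rule mult_right_mono) simp
    then show ?thesis using that by (simp add: powr_mult)
  qed
  consider "x = 0" | "y = 0" | "x > 0" "y > 0" using xy by fastforce
  then show ?thesis
  proof cases
    case 1 then show ?thesis using le[of \<theta> y] \<theta> xy by simp
  next
    case 2 then show ?thesis using le[of "1 - \<theta>" x] \<theta> xy by simp
  next
    case 3 then show ?thesis using convex_onD[OF powr_convex[OF p] \<theta>, of x y] by simp
  qed
qed

lemma powr_add_le_convex:
  fixes x y a b p :: real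
  assumes p: "1 \<le> p" and a: "a > 0" and b: "b > 0" and xy: "x \<ge> 0" "y \<ge> 0"
  shows "(x + y) powr p \<le> (a + b) powr p * (a / (a + b) * (x / a) powr p + b / (a + b) * (y / b) powr p)"
proof -
  define \<theta> where "\<theta> = b / (a + b)"
  have \<theta>: "0 \<le> \<theta>" "\<theta> \<le> 1" "1 - \<theta> = a / (a + b)" using a b by (auto simp: \<theta>_def field_simps)
  have "((1 - \<theta>) * (x / a) + \<theta> * (y / b)) powr p \<le> (1 - \<theta>) * (x / a) powr p + \<theta> * (y / b) powr p"
    by (rule powr_convex_nonneg) (use p \<theta> a b xy in auto)
  also have "(1 - \<theta>) * (x / a) + \<theta> * (y / b) = (x + y) / (a + b)"
    unfolding \<theta>(3) using a b by (simp add: \<theta>_def add_divide_distrib)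
  finally have "((x + y) / (a + b)) powr p \<le> a / (a + b) * (x / a) powr p + b / (a + b) * (y / b) powr p"
    unfolding \<theta>(3) by (simp add: \<theta>_def)
  then have "(a + b) powr p * ((x + y) / (a + b)) powr p \<le> (a + b) powr p * (a / (a + b) * (x / a) powr p + b / (a + b) * (y / b) powr p)"
    by (rule mult_left_mono) simp
  moreover have "(a + b) powr p * ((x + y) / (a + b)) powr p = (x + y) powr p"
    using a b xy by (simp add: powr_mult[symmetric])
  ultimately show ?thesis by simp
qed

lemma Lp_norm_nonneg [simp]: "0 \<le> Lp_norm M p u"
  by (simp add: Lp_norm_def)

lemma Lp_norm_powr: "1 \<le> p \<Longrightarrow> Lp_norm M p u powr p = (\<integral>x. \<bar>u x\<bar> powr p \<partial>M)"
  by (simp add: Lp_norm_def powr_powr Bochner_Integration.integral_nonneg)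

lemma Lp_norm_le_iff:
  assumes "1 \<le> p" "0 \<le> c"
  shows "Lp_norm M p u \<le> c \<longleftrightarrow> (\<integral>x. \<bar>u x\<bar> powr p \<partial>M) \<le> c powr p"
proof
  assume "Lp_norm M p u \<le> c"
  then have "Lp_norm M p u powr p \<le> c powr p" using assms by (intro powr_mono2) auto
  then show "(\<integral>x. \<bar>u x\<bar> powr p \<partial>M) \<le> c powr p" by (simp add: Lp_norm_powr[OF assms(1)])
next
  assume le: "(\<integral>x. \<bar>u x\<bar> powr p \<partial>M) \<le> c powr p"
  show "Lp_norm M p u \<le> c"
  proof (rule ccontr)
    assume "\<not> ?thesis"
    then have "c powr p < Lp_norm M p u powr p" using assms by (intro powr_less_mono2) auto
    then show False using le by (simp add: Lp_norm_powr[OF assms(1)])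
  qed
qed

lemma Lp_fun_add:
  assumes p: "1 \<le> p" and u: "Lp_fun M p u" and v: "Lp_fun M p v"
  shows "Lp_fun M p (\<lambda>x. u x + v x)"
proof -
  have [measurable]: "u \<in> borel_measurable M" "v \<in> borel_measurable M" using u v by (auto simp: Lp_fun_def)
  have "integrable M (\<lambda>x. \<bar>u x + v x\<bar> powr p)"
  proof (rule Bochner_Integration.integrable_bound)
    show "integrable M (\<lambda>x. 2 powr p * (1 / 2 * (\<bar>u x\<bar> powr p) + 1 / 2 * (\<bar>v x\<bar> powr p)))"
      using u v by (auto simp: Lp_fun_def)
    show "AE x in M. norm (\<bar>u x + v x\<bar> powr p) \<le> norm (2 powr p * (1 / 2 * (\<bar>u x\<bar> powr p) + 1 / 2 * (\<bar>v x\<bar> powr p)))"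
    proof (rule AE_I2)
      fix x
      have "\<bar>u x + v x\<bar> powr p \<le> (\<bar>u x\<bar> + \<bar>v x\<bar>) powr p" using p by (intro powr_mono2) auto
      also have "\<dots> \<le> 2 powr p * (1 / 2 * (\<bar>u x\<bar> powr p) + 1 / 2 * (\<bar>v x\<bar> powr p))"
        using powr_add_le_convex[OF p, of 1 1 "\<bar>u x\<bar>" "\<bar>v x\<bar>"] by simp
      finally show "norm (\<bar>u x + v x\<bar> powr p) \<le> norm (2 powr p * (1 / 2 * (\<bar>u x\<bar> powr p) + 1 / 2 * (\<bar>v x\<bar> powr p)))"
        by simp
    qed
  qed measurable
  then show ?thesis by (simp add: Lp_fun_def)
qed

lemma Lp_fun_diff:
  assumes p: "1 \<le> p" and u: "Lp_fun M p u" and v: "Lp_fun M p v"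
  shows "Lp_fun M p (\<lambda>x. u x - v x)"
proof -
  have "Lp_fun M p (\<lambda>x. - v x)" using v by (auto simp: Lp_fun_def)
  from Lp_fun_add[OF p u this] show ?thesis by simp
qed

text \<open>Minkowski's inequality. The convexity bound is used with upper bounds \<open>a\<close> and
  \<open>b\<close> slightly above the two norms, since these are positive.\<close>
lemma Lp_norm_add_le:
  assumes p: "1 \<le> p" and u: "Lp_fun M p u" and v: "Lp_fun M p v"
  shows "Lp_norm M p (\<lambda>x. u x + v x) \<le> Lp_norm M p u + Lp_norm M p v"
proof (rule field_le_epsilon)
  fix e :: real assume e: "e > 0"
  define a where "a = Lp_norm M p u + e / 2"
  define b where "b = Lp_norm M p v + e / 2"
  have ab: "a > 0" "b > 0" using e by (auto simp: a_def b_def add_nonneg_pos)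
  have iu: "integrable M (\<lambda>x. \<bar>u x\<bar> powr p)" and iv: "integrable M (\<lambda>x. \<bar>v x\<bar> powr p)"
    using u v by (auto simp: Lp_fun_def)
  have iuv: "integrable M (\<lambda>x. \<bar>u x + v x\<bar> powr p)" using Lp_fun_add[OF p u v] by (simp add: Lp_fun_def)
  have bu: "(\<integral>x. \<bar>u x\<bar> powr p \<partial>M) \<le> a powr p" "(\<integral>x. \<bar>v x\<bar> powr p \<partial>M) \<le> b powr p"
    using Lp_norm_le_iff[OF p, of a M u] Lp_norm_le_iff[OF p, of b M v] ab e by (auto simp: a_def b_def)
  have div: "(\<bar>z\<bar> / c) powr p = \<bar>z\<bar> powr p / c powr p" if "c > 0" for z c :: real
    using that by (simp add: powr_divide)
  let ?g = "\<lambda>x. (a + b) powr p * (a / (a + b) * (\<bar>u x\<bar> powr p / a powr p) + b / (a + b) * (\<bar>v x\<bar> powr p / b powr p))"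
  have "(\<integral>x. \<bar>u x + v x\<bar> powr p \<partial>M) \<le> (\<integral>x. ?g x \<partial>M)"
  proof (rule integral_mono[OF iuv])
    show "integrable M ?g" using iu iv by auto
    fix x
    have "\<bar>u x + v x\<bar> powr p \<le> (\<bar>u x\<bar> + \<bar>v x\<bar>) powr p" using p by (intro powr_mono2) auto
    also have "\<dots> \<le> (a + b) powr p * (a / (a + b) * (\<bar>u x\<bar> / a) powr p + b / (a + b) * (\<bar>v x\<bar> / b) powr p)"
      by (rule powr_add_le_convex[OF p ab]) auto
    finally show "\<bar>u x + v x\<bar> powr p \<le> ?g x" using div ab by simp
  qed
  also have "\<dots> = (a + b) powr p * (a / (a + b) * ((\<integral>x. \<bar>u x\<bar> powr p \<partial>M) / a powr p) + b / (a + b) * ((\<integral>x. \<bar>v x\<bar> powr p \<partial>M) / b powr p))"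
    using iu iv by (simp add: Bochner_Integration.integral_add)
  also have "\<dots> \<le> (a + b) powr p * (a / (a + b) * 1 + b / (a + b) * 1)"
    using bu ab by (intro mult_left_mono add_mono) (auto simp: divide_le_eq)
  also have "a / (a + b) * 1 + b / (a + b) * 1 = 1" using ab by (simp add: add_divide_distrib[symmetric])
  finally have le: "(\<integral>x. \<bar>u x + v x\<bar> powr p \<partial>M) \<le> (a + b) powr p" by simp
  have "0 \<le> a + b" using ab by simp
  from Lp_norm_le_iff[OF p this, THEN iffD2, OF le]
  have "Lp_norm M p (\<lambda>x. u x + v x) \<le> a + b" .
  then show "Lp_norm M p (\<lambda>x. u x + v x) \<le> Lp_norm M p u + Lp_norm M p v + e" by (simp add: a_def b_def)
qed

lemma Lp_norm_cong_AE:
  assumes "AE x in M. u x = v x" "u \<in> borel_measurable M" "v \<in> borel_measurable M"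
  shows "Lp_norm M p u = Lp_norm M p v"
proof -
  have "(\<integral>x. \<bar>u x\<bar> powr p \<partial>M) = (\<integral>x. \<bar>v x\<bar> powr p \<partial>M)"
    using assms by (intro integral_cong_AE) auto
  then show ?thesis by (simp add: Lp_norm_def)
qed

lemma Lp_norm_minus_commute: "Lp_norm M p (\<lambda>x. u x - v x) = Lp_norm M p (\<lambda>x. v x - u x)"
  by (simp add: Lp_norm_def abs_minus_commute)

lemma Lp_matrix_norm_le_iff:
  "Lp_matrix_norm M p A \<le> c \<longleftrightarrow> (\<forall>i j. Lp_norm M p (\<lambda>x. A x $ i $ j) \<le> c)"
  unfolding Lp_matrix_norm_def by (subst Max_le_iff) auto

lemma Lp_norm_le_matrix_norm: "Lp_norm M p (\<lambda>x. A x $ i $ j) \<le> Lp_matrix_norm M p A"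
  using Lp_matrix_norm_le_iff[of M p A "Lp_matrix_norm M p A"] by blast

lemma Lp_matrix_norm_nonneg: "0 \<le> Lp_matrix_norm M p A"
  using Lp_norm_le_matrix_norm Lp_norm_nonneg order_trans by blast

lemma Lp_matrix_norm_triangle:
  assumes p: "1 \<le> p" and A: "Lp_matrix M p A" and B: "Lp_matrix M p B" and C: "Lp_matrix M p C"
  shows "Lp_matrix_norm M p (\<lambda>x. A x - C x) \<le> Lp_matrix_norm M p (\<lambda>x. A x - B x) + Lp_matrix_norm M p (\<lambda>x. B x - C x)"
  unfolding Lp_matrix_norm_le_iff
proof (intro allI)
  fix i j
  have "Lp_norm M p (\<lambda>x. (A x - C x) $ i $ j) = Lp_norm M p (\<lambda>x. (A x $ i $ j - B x $ i $ j) + (B x $ i $ j - C x $ i $ j))"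
    by (simp add: Lp_norm_def)
  also have "\<dots> \<le> Lp_norm M p (\<lambda>x. A x $ i $ j - B x $ i $ j) + Lp_norm M p (\<lambda>x. B x $ i $ j - C x $ i $ j)"
    using A B C by (intro Lp_norm_add_le[OF p] Lp_fun_diff[OF p]) (auto simp: Lp_matrix_def)
  also have "\<dots> \<le> Lp_matrix_norm M p (\<lambda>x. A x - B x) + Lp_matrix_norm M p (\<lambda>x. B x - C x)"
    using Lp_norm_le_matrix_norm[of M p "\<lambda>x. A x - B x" i j] Lp_norm_le_matrix_norm[of M p "\<lambda>x. B x - C x" i j]
    by (intro add_mono) auto
  finally show "Lp_norm M p (\<lambda>x. (A x - C x) $ i $ j) \<le> Lp_matrix_norm M p (\<lambda>x. A x - B x) + Lp_matrix_norm M p (\<lambda>x. B x - C x)" .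
qed

lemma Lp_matrix_norm_commute: "Lp_matrix_norm M p (\<lambda>x. A x - B x) = Lp_matrix_norm M p (\<lambda>x. B x - A x)"
proof -
  have "Lp_norm M p (\<lambda>x. (A x - B x) $ i $ j) = Lp_norm M p (\<lambda>x. (B x - A x) $ i $ j)" for i j
    by (simp, rule Lp_norm_minus_commute)
  then show ?thesis by (simp add: Lp_matrix_norm_def)
qed

lemma Lp_matrix_norm_0: "Lp_matrix_norm M p (\<lambda>x. A x - A x) = 0"
  by (rule antisym) (auto simp: Lp_matrix_norm_le_iff Lp_matrix_norm_nonneg, simp add: Lp_norm_def)

text \<open>A large bound on \<open>u\<close> is harmless if the support is small enough: this is how the large
  derivative of a map supported in a thin tube is controlled.\<close>
lemma Lp_norm_le_on_small_set:
  assumes p: "1 \<le> p" and S: "S \<in> sets M" "emeasure M S < \<infinity>" and u: "u \<in> borel_measurable M" and c: "0 \<le> c"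
    and bound: "\<And>x. \<bar>u x\<bar> \<le> c * indicator S x"
  shows "Lp_norm M p u \<le> (c powr p * measure M S) powr (1 / p)"
proof -
  have i: "integrable M (\<lambda>x. c powr p * indicator S x)" using S by (intro integrable_mult_right integrable_real_indicator) auto
  have le: "\<bar>u x\<bar> powr p \<le> c powr p * indicator S x" for x
    using bound[of x] p by (cases "x \<in> S") (auto intro: powr_mono2)
  have "integrable M (\<lambda>x. \<bar>u x\<bar> powr p)"
    by (rule Bochner_Integration.integrable_bound[OF i]) (use u le in auto)
  then have "(\<integral>x. \<bar>u x\<bar> powr p \<partial>M) \<le> (\<integral>x. c powr p * indicator S x \<partial>M)"
    by (rule integral_mono[OF _ i]) (rule le)
  also have "\<dots> = c powr p * measure M S" using S by simp
  finally show ?thesis unfolding Lp_norm_def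
    using p by (intro powr_mono2) (auto intro: Bochner_Integration.integral_nonneg)
qed

text \<open>For each positive \<open>\<delta>\<close>, \<open>\<bar>u\<bar> \<le> \<delta> + \<delta> powr (1 -
  p) * \<bar>u\<bar> powr p\<close>. The last term tends to 0 in mean, and the constant contributes at most
  \<open>\<delta>\<close> times the finite measure of the space.\<close>
lemma Lp_convergence_imp_L1:
  fixes u :: "nat \<Rightarrow> 'a \<Rightarrow> real"
  assumes fin: "finite_measure M" and p: "1 \<le> p" and u: "\<And>n. Lp_fun M p (u n)"
    and lim: "(\<lambda>n. Lp_norm M p (u n)) \<longlonglongrightarrow> 0"
  shows "(\<lambda>n. \<integral>x. \<bar>u n x\<bar> \<partial>M) \<longlonglongrightarrow> 0" "\<And>n. integrable M (u n)"
proof -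
  interpret finite_measure M by (rule fin)
  have young: "\<bar>z\<bar> \<le> \<delta> + \<delta> powr (1 - p) * \<bar>z\<bar> powr p" if \<delta>: "\<delta> > 0" for z \<delta> :: real
  proof (cases "\<bar>z\<bar> \<le> \<delta>")
    case True
    then show ?thesis by (simp add: add_increasing2)
  next
    case False
    then have z: "\<bar>z\<bar> > 0" using \<delta> by simp
    have "\<bar>z\<bar> = \<bar>z\<bar> powr (1 - p) * \<bar>z\<bar> powr p" using z by (simp add: powr_add[symmetric])
    also have "\<dots> \<le> \<delta> powr (1 - p) * \<bar>z\<bar> powr p"
      using False p \<delta> by (intro mult_right_mono powr_mono2') auto
    finally show ?thesis using \<delta> by simp
  qed
  have um: "u n \<in> borel_measurable M" and ui: "integrable M (\<lambda>x. \<bar>u n x\<bar> powr p)" for n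
    using u by (auto simp: Lp_fun_def)
  show int: "integrable M (u n)" for n
  proof (rule Bochner_Integration.integrable_bound)
    show "integrable M (\<lambda>x. 1 + 1 powr (1 - p) * \<bar>u n x\<bar> powr p)" using ui[of n] by simp
    show "AE x in M. norm (u n x) \<le> norm (1 + 1 powr (1 - p) * \<bar>u n x\<bar> powr p)"
    proof (rule AE_I2)
      fix x
      have "\<bar>u n x\<bar> \<le> 1 + 1 powr (1 - p) * \<bar>u n x\<bar> powr p" by (rule young) simp
      also have "\<dots> \<le> norm (1 + 1 powr (1 - p) * \<bar>u n x\<bar> powr p)" by simp
      finally show "norm (u n x) \<le> norm (1 + 1 powr (1 - p) * \<bar>u n x\<bar> powr p)" by simp
    qed
  qed (rule um)
  let ?m = "measure M (space M)"
  have bound: "(\<integral>x. \<bar>u n x\<bar> \<partial>M) \<le> \<delta> * ?m + \<delta> powr (1 - p) * Lp_norm M p (u n) powr p" if \<delta>: "\<delta> > 0" for n \<delta>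
  proof -
    have "(\<integral>x. \<bar>u n x\<bar> \<partial>M) \<le> (\<integral>x. \<delta> + \<delta> powr (1 - p) * \<bar>u n x\<bar> powr p \<partial>M)"
      by (rule integral_mono) (use int ui young[OF \<delta>] in auto)
    also have "\<dots> = \<delta> * ?m + \<delta> powr (1 - p) * (\<integral>x. \<bar>u n x\<bar> powr p \<partial>M)"
      using ui[of n] by (simp add: Bochner_Integration.integral_add mult.commute)
    finally show ?thesis by (simp add: Lp_norm_powr[OF p])
  qed
  show "(\<lambda>n. \<integral>x. \<bar>u n x\<bar> \<partial>M) \<longlonglongrightarrow> 0"
  proof (rule LIMSEQ_I)
    fix e :: real assume e: "e > 0"
    define \<delta> where "\<delta> = e / (2 * (?m + 1))"
    have m0: "?m \<ge> 0" by simp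
    have \<delta>: "\<delta> > 0" unfolding \<delta>_def using e m0 by (intro divide_pos_pos mult_pos_pos) linarith+
    have \<delta>m: "\<delta> * ?m \<le> e / 2"
    proof -
      have "e / (2 * k) * k = e / 2" if "k \<noteq> 0" for k :: real using that by simp
      from this[of "?m + 1"] have "\<delta> * (?m + 1) = e / 2" using m0 unfolding \<delta>_def by linarith
      moreover have "\<delta> * ?m \<le> \<delta> * (?m + 1)" using \<delta> by (intro mult_left_mono) auto
      ultimately show ?thesis by linarith
    qed
    have "(\<lambda>n. Lp_norm M p (u n) powr p) \<longlonglongrightarrow> 0"
      using tendsto_powr'[OF lim tendsto_const, of p] p by auto
    then have "(\<lambda>n. \<delta> powr (1 - p) * Lp_norm M p (u n) powr p) \<longlonglongrightarrow> 0"
      by (rule tendsto_mult_right_zero)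
    then have "\<forall>\<^sub>F n in sequentially. \<delta> powr (1 - p) * Lp_norm M p (u n) powr p < e / 2"
      using e by (intro order_tendstoD(2)[where y = 0]) auto
    then obtain N where N: "\<And>n. n \<ge> N \<Longrightarrow> \<delta> powr (1 - p) * Lp_norm M p (u n) powr p < e / 2"
      by (auto simp: eventually_sequentially)
    show "\<exists>no. \<forall>n\<ge>no. norm ((\<integral>x. \<bar>u n x\<bar> \<partial>M) - 0) < e"
    proof (intro exI allI impI)
      fix n assume "N \<le> n"
      have "0 \<le> (\<integral>x. \<bar>u n x\<bar> \<partial>M)" by (rule Bochner_Integration.integral_nonneg) simp
      then show "norm ((\<integral>x. \<bar>u n x\<bar> \<partial>M) - 0) < e"
        using bound[OF \<delta>, of n] N[OF \<open>N \<le> n\<close>] \<delta>m by simp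
    qed
  qed
qed

section \<open>Length of curves in a Riemannian manifold\<close>

lemma smooth_on_differentiable:
  assumes "smooth_on S f" "x \<in> S"
  shows "f differentiable (at x)"
proof -
  have "Ck_on (Suc 0) S f" using assms(1) by (simp only: smooth_on_def)
  then show ?thesis using assms(2) by simp
qed

lemma smooth_on_continuous_derivative:
  assumes "smooth_on S f"
  shows "continuous_on S (\<lambda>x. frechet_derivative f (at x) v)"
proof -
  have "Ck_on (Suc 0) S f" using assms by (simp only: smooth_on_def)
  then show ?thesis by simp
qed

lemma smooth_on_continuous: "smooth_on S f \<Longrightarrow> continuous_on S f"
  unfolding smooth_on_def using Ck_on.simps(1) by blast

context closed_riemannian_manifold
begin

lemma chart_inv_left: "c \<in> atlas \<Longrightarrow> x \<in> fst c \<Longrightarrow> chart_inv c (snd c x) = x"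
  using chart_homeo[of c] by (simp add: homeomorphism_def)

lemma chart_inv_right: "c \<in> atlas \<Longrightarrow> y \<in> snd c ` fst c \<Longrightarrow> snd c (chart_inv c y) = y"
  by (auto simp: chart_inv_left)

lemma chart_inv_mem: "c \<in> atlas \<Longrightarrow> y \<in> snd c ` fst c \<Longrightarrow> chart_inv c y \<in> fst c"
  using chart_homeo[of c] by (auto simp: homeomorphism_def)

lemma continuous_on_chart: "c \<in> atlas \<Longrightarrow> continuous_on (fst c) (snd c)"
  using chart_homeo[of c] by (simp add: homeomorphism_def)

lemma continuous_on_chart_inv: "c \<in> atlas \<Longrightarrow> continuous_on (snd c ` fst c) (chart_inv c)"
  using chart_homeo[of c] by (simp add: homeomorphism_def)

lemma chart_at: obtains c where "c \<in> atlas" "x \<in> fst c"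
  using charts_cover by blast

text \<open>The squared Riemannian norm of the tangent vector at \<open>x\<close> with coordinates
  \<open>v\<close> in the chart \<open>c\<close>.\<close>
definition quad :: "('m, 'd) chart \<Rightarrow> 'm \<Rightarrow> real^'d \<Rightarrow> real" where
  "quad c x v = v \<bullet> (g c x *v v)"

lemma transition_differentiable:
  assumes "c \<in> atlas" "c' \<in> atlas" "x \<in> fst c" "x \<in> fst c'"
  shows "transition c c' differentiable (at (snd c x))"
  using assms by (intro smooth_on_differentiable[OF transition_smooth[of c c']]) auto

lemma chart_change_vector_derivative:
  assumes c: "c \<in> atlas" "c' \<in> atlas" and t: "t \<in> I" "\<gamma> t \<in> fst c" "\<gamma> t \<in> fst c'"
    and cont: "continuous_on I \<gamma>"
    and v: "(snd c \<circ> \<gamma> has_vector_derivative v) (at t within I)"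
  shows "(snd c' \<circ> \<gamma> has_vector_derivative
      frechet_derivative (transition c c') (at (snd c (\<gamma> t))) v) (at t within I)"
proof -
  let ?T = "transition c c'"
  have "(?T has_derivative frechet_derivative ?T (at (snd c (\<gamma> t)))) (at (snd c (\<gamma> t)))"
    using transition_differentiable[OF c t(2,3)] by (simp only: frechet_derivative_works)
  then have "(?T has_derivative frechet_derivative ?T (at (snd c (\<gamma> t)))) (at ((snd c \<circ> \<gamma>) t) within (snd c \<circ> \<gamma>) ` I)"
    by (simp add: has_derivative_at_withinI)
  from vector_derivative_diff_chain_within[OF v this]
  have 1: "(?T \<circ> (snd c \<circ> \<gamma>) has_vector_derivative frechet_derivative ?T (at (snd c (\<gamma> t))) v) (at t within I)" .
  obtain U where U: "open U" "\<gamma> -` fst c \<inter> I = U \<inter> I"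
    using cont chart_domain[OF c(1)] by (metis Int_commute continuous_on_open_invariant)
  then have "t \<in> U" using t by auto
  then obtain e where e: "e > 0" "ball t e \<subseteq> U" using U(1) open_contains_ball by blast
  show ?thesis
  proof (rule has_vector_derivative_transform_within[OF 1 e(1) t(1)])
    fix s assume s: "s \<in> I" "dist s t < e"
    then have "s \<in> U" using e by (auto simp: dist_commute)
    then have "\<gamma> s \<in> fst c" using U(2) s(1) by blast
    then show "(?T \<circ> (snd c \<circ> \<gamma>)) s = (snd c' \<circ> \<gamma>) s"
      by (simp add: transition_def chart_inv_left[OF c(1)])
  qed
qed

lemma quad_chart_change:
  assumes c: "c \<in> atlas" "c' \<in> atlas" and x: "x \<in> fst c" "x \<in> fst c'"
  shows "quad c' x (frechet_derivative (transition c c') (at (snd c x)) v) = quad c x v"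
proof -
  let ?J = "jacobian (transition c c') (at (snd c x))"
  let ?D = "frechet_derivative (transition c c') (at (snd c x))"
  have "linear ?D"
    using transition_differentiable[OF c x] unfolding frechet_derivative_works by (rule has_derivative_linear)
  then have D: "?D v = ?J *v v" unfolding jacobian_def by (simp add: matrix_works)
  have "quad c x v = v \<bullet> (transpose ?J *v (g c' x *v (?J *v v)))"
    unfolding quad_def metric_transition[OF c x] by (simp add: matrix_vector_mul_assoc matrix_mul_assoc)
  also have "\<dots> = (?J *v v) \<bullet> (g c' x *v (?J *v v))"
  proof -
    have "v \<bullet> (transpose ?J *v y) = (?J *v v) \<bullet> y" for y
      using dot_lmul_matrix[of y ?J v] by (simp only: transpose_matrix_vector inner_commute[of v] inner_commute[of "?J *v v"])
    then show ?thesis .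
  qed
  finally show ?thesis by (simp add: D quad_def)
qed

lemma quad_pos: "c \<in> atlas \<Longrightarrow> x \<in> fst c \<Longrightarrow> v \<noteq> 0 \<Longrightarrow> quad c x v > 0"
  unfolding quad_def by (rule metric_positive)

lemma quad_nonneg: "c \<in> atlas \<Longrightarrow> x \<in> fst c \<Longrightarrow> quad c x v \<ge> 0"
  using quad_pos[of c x v] by (cases "v = 0") (auto simp: quad_def)

text \<open>The derivative is taken within \<open>I\<close>, so that the speed of a continuously differentiable
  piece is continuous up to its end points.\<close>
definition speed_within :: "real set \<Rightarrow> (real \<Rightarrow> 'm) \<Rightarrow> real \<Rightarrow> real" where
  "speed_within I \<gamma> t = (let c = (SOME c. c \<in> atlas \<and> \<gamma> t \<in> fst c) in
     sqrt (quad c (\<gamma> t) (vector_derivative (snd c \<circ> \<gamma>) (at t within I))))"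

lemma speed_within_eq:
  assumes c: "c \<in> atlas" and t: "t \<in> I" "\<gamma> t \<in> fst c" and cont: "continuous_on I \<gamma>"
    and nt: "at t within I \<noteq> bot"
    and v: "(snd c \<circ> \<gamma> has_vector_derivative v) (at t within I)"
  shows "speed_within I \<gamma> t = sqrt (quad c (\<gamma> t) v)"
proof -
  define c' where "c' = (SOME c. c \<in> atlas \<and> \<gamma> t \<in> fst c)"
  have "c' \<in> atlas \<and> \<gamma> t \<in> fst c'" unfolding c'_def by (rule someI[of _ c]) (use c t in auto)
  then have c': "c' \<in> atlas" "\<gamma> t \<in> fst c'" by auto
  let ?v' = "frechet_derivative (transition c c') (at (snd c (\<gamma> t))) v"
  have "(snd c' \<circ> \<gamma> has_vector_derivative ?v') (at t within I)"
    by (rule chart_change_vector_derivative[OF c c'(1) t c'(2) cont v])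
  then have "vector_derivative (snd c' \<circ> \<gamma>) (at t within I) = ?v'"
    by (rule vector_derivative_within[OF nt])
  then have "speed_within I \<gamma> t = sqrt (quad c' (\<gamma> t) ?v')"
    by (simp add: speed_within_def c'_def[symmetric])
  also have "quad c' (\<gamma> t) ?v' = quad c (\<gamma> t) v" by (rule quad_chart_change[OF c c'(1) t(2) c'(2)])
  finally show ?thesis .
qed

lemma curve_speed_eq_speed_within: "curve_speed atlas g \<gamma> t = speed_within UNIV \<gamma> t"
  by (simp add: curve_speed_def speed_within_def quad_def Let_def)

lemma curve_speed_eq:
  assumes c: "c \<in> atlas" and t: "t \<in> {a<..<b}" "\<gamma> t \<in> fst c" and cont: "continuous_on {a<..<b} \<gamma>"
    and v: "(snd c \<circ> \<gamma> has_vector_derivative v) (at t)"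
  shows "curve_speed atlas g \<gamma> t = sqrt (quad c (\<gamma> t) v)"
proof -
  have eq: "at t within {a<..<b} = at t" by (rule at_within_open[OF t(1) open_greaterThanLessThan])
  have "curve_speed atlas g \<gamma> t = speed_within {a<..<b} \<gamma> t"
    unfolding curve_speed_eq_speed_within speed_within_def eq by simp
  also have "\<dots> = sqrt (quad c (\<gamma> t) v)"
    by (rule speed_within_eq[OF c t cont]) (use v in \<open>simp_all add: eq\<close>)
  finally show ?thesis .
qed

lemma continuous_on_metric:
  assumes "c \<in> atlas"
  shows "continuous_on (fst c) (g c)"
proof -
  have "continuous_on (fst c) (\<lambda>x. g c (chart_inv c (snd c x)))"
    by (rule continuous_on_compose2[OF smooth_on_continuous[OF metric_smooth[OF assms]] continuous_on_chart[OF assms]]) auto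
  then show ?thesis by (rule continuous_on_eq) (simp add: chart_inv_left[OF assms])
qed

lemma continuous_on_quad:
  assumes "continuous_on S G" "continuous_on S v"
  shows "continuous_on S (\<lambda>s. v s \<bullet> ((G s :: real^'d^'d) *v v s))"
  unfolding matrix_vector_mult_def by (intro continuous_intros assms)

lemma C1_curve_speed:
  assumes C1: "C1_curve_on atlas {a..b} \<gamma>" and ab: "a < b"
  shows "continuous_on {a..b} (speed_within {a..b} \<gamma>)"
    "\<And>t. t \<in> {a<..<b} \<Longrightarrow> curve_speed atlas g \<gamma> t = speed_within {a..b} \<gamma> t"
proof -
  let ?I = "{a..b}"
  have cont: "continuous_on ?I \<gamma>" using C1 by (simp add: C1_curve_on_def)
  have nt: "at t within ?I \<noteq> bot" if "t \<in> ?I" for t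
    using that ab by (simp add: trivial_limit_within islimpt_Icc)
  show "continuous_on ?I (speed_within ?I \<gamma>)"
    unfolding continuous_on_eq_continuous_within
  proof
    fix t assume t: "t \<in> ?I"
    obtain c where c: "c \<in> atlas" "\<gamma> t \<in> fst c" by (rule chart_at)
    let ?T = "{t \<in> ?I. \<gamma> t \<in> fst c}"
    obtain v where v: "continuous_on ?T v"
        "\<And>s. s \<in> ?T \<Longrightarrow> (snd c \<circ> \<gamma> has_vector_derivative v s) (at s within ?I)"
      using C1 c(1) unfolding C1_curve_on_def by blast
    have "continuous_on ?T (\<lambda>s. sqrt (quad c (\<gamma> s) (v s)))"
      unfolding quad_def
      by (intro continuous_on_real_sqrt continuous_on_quad v(1) continuous_on_compose2[OF continuous_on_metric[OF c(1)]]
          continuous_on_subset[OF cont]) auto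
    then have "continuous_on ?T (speed_within ?I \<gamma>)"
    proof (rule continuous_on_eq)
      fix s assume "s \<in> ?T"
      then show "sqrt (quad c (\<gamma> s) (v s)) = speed_within ?I \<gamma> s"
        using speed_within_eq[OF c(1) _ _ cont nt v(2), of s] by simp
    qed
    then have ct: "continuous (at t within ?T) (speed_within ?I \<gamma>)"
      using t c(2) by (simp add: continuous_on_eq_continuous_within)
    obtain U where U: "open U" "\<gamma> -` fst c \<inter> ?I = U \<inter> ?I"
      using cont chart_domain[OF c(1)] by (metis Int_commute continuous_on_open_invariant)
    have "t \<in> U" using U(2) t c(2) by blast
    have "?T = ?I \<inter> U" using U(2) by blast
    then have "at t within ?T = at t within ?I"
      using at_within_nhd[OF \<open>t \<in> U\<close> U(1), of ?T ?I] by blast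
    then show "continuous (at t within ?I) (speed_within ?I \<gamma>)" using ct by simp
  qed
  fix t assume t: "t \<in> {a<..<b}"
  then have eq: "at t within {a..b} = at t" by (simp add: at_within_Icc_at)
  show "curve_speed atlas g \<gamma> t = speed_within ?I \<gamma> t"
    by (simp add: curve_speed_eq_speed_within speed_within_def eq)
qed

lemma C1_curve_speed_integrable:
  assumes "C1_curve_on atlas {a..b} \<gamma>" "a < b"
  shows "curve_speed atlas g \<gamma> integrable_on {a..b}"
proof (rule integrable_spike_finite[of "{a, b}"])
  show "speed_within {a..b} \<gamma> integrable_on {a..b}"
    by (rule integrable_continuous_interval[OF C1_curve_speed(1)[OF assms]])
  show "curve_speed atlas g \<gamma> x = speed_within {a..b} \<gamma> x" if "x \<in> {a..b} - {a, b}" for x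
    using that by (intro C1_curve_speed(2)[OF assms]) auto
qed simp

text \<open>The curves of \<open>piecewise_C1_curve\<close> on an arbitrary parameter interval, so that they can
  be joined and reparametrized.\<close>
definition pwC1 :: "(real \<Rightarrow> 'm) \<Rightarrow> real \<Rightarrow> real \<Rightarrow> bool" where
  "pwC1 \<gamma> a b \<longleftrightarrow> (\<exists>n \<tau>. \<tau> 0 = a \<and> \<tau> n = b \<and>
     (\<forall>i<n. \<tau> i < \<tau> (Suc i) \<and> C1_curve_on atlas {\<tau> i..\<tau> (Suc i)} \<gamma>))"

lemma piecewise_C1_curve_iff: "piecewise_C1_curve atlas \<gamma> \<longleftrightarrow> pwC1 \<gamma> 0 1"
  by (simp add: piecewise_C1_curve_def pwC1_def)

lemma pwC1_single: "C1_curve_on atlas {a..b} \<gamma> \<Longrightarrow> a < b \<Longrightarrow> pwC1 \<gamma> a b"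
  unfolding pwC1_def by (intro exI[of _ 1] exI[of _ "\<lambda>i. if i = 0 then a else b"]) auto

lemma pwC1_induct [consumes 1, case_names refl step]:
  assumes "pwC1 \<gamma> a b"
    and "P a" and "\<And>c d. pwC1 \<gamma> a c \<Longrightarrow> a \<le> c \<Longrightarrow> P c \<Longrightarrow> c < d \<Longrightarrow> C1_curve_on atlas {c..d} \<gamma> \<Longrightarrow> P d"
  shows "P b"
proof -
  obtain n \<tau> where \<tau>: "\<tau> 0 = a" "\<tau> n = b"
      "\<And>i. i < n \<Longrightarrow> \<tau> i < \<tau> (Suc i) \<and> C1_curve_on atlas {\<tau> i..\<tau> (Suc i)} \<gamma>"
    using assms(1) unfolding pwC1_def by blast
  have "a \<le> \<tau> i \<and> pwC1 \<gamma> a (\<tau> i) \<and> P (\<tau> i)" if "i \<le> n" for i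
    using that
  proof (induction i)
    case 0
    then show ?case using assms(2) \<tau>(1) unfolding pwC1_def by (auto intro!: exI[of _ 0])
  next
    case (Suc i)
    have i: "i < n" using Suc.prems by simp
    have IH: "a \<le> \<tau> i \<and> pwC1 \<gamma> a (\<tau> i) \<and> P (\<tau> i)" using Suc by simp
    have "pwC1 \<gamma> a (\<tau> (Suc i))"
      unfolding pwC1_def by (rule exI[of _ "Suc i"], rule exI[of _ \<tau>]) (use \<tau> i in auto)
    then show ?case using IH \<tau>(3)[OF i] assms(3)[of "\<tau> i" "\<tau> (Suc i)"] by auto
  qed
  then show ?thesis using \<tau>(2) by blast
qed

lemma pwC1_trans:
  assumes "pwC1 \<gamma> a b" "pwC1 \<gamma> b c"
  shows "pwC1 \<gamma> a c"
proof -
  have extend: "pwC1 \<gamma> a d" if ac: "pwC1 \<gamma> a c" and cd: "c < d" "C1_curve_on atlas {c..d} \<gamma>" for c d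
  proof -
    obtain n \<tau> where \<tau>: "\<tau> 0 = a" "\<tau> n = c"
        "\<And>i. i < n \<Longrightarrow> \<tau> i < \<tau> (Suc i) \<and> C1_curve_on atlas {\<tau> i..\<tau> (Suc i)} \<gamma>"
      using ac unfolding pwC1_def by blast
    show ?thesis unfolding pwC1_def
      by (rule exI[of _ "Suc n"], rule exI[of _ "\<tau>(Suc n := d)"])
        (use \<tau> cd in \<open>auto simp: less_Suc_eq\<close>)
  qed
  show ?thesis
    using assms(2)
  proof (induction rule: pwC1_induct)
    case refl show ?case by (rule assms(1))
  next
    case (step c d)
    show ?case by (rule extend[OF step(5) step(3) step(4)])
  qed
qed

lemma C1_curve_on_cong:
  assumes "C1_curve_on atlas I \<gamma>" "\<And>t. t \<in> I \<Longrightarrow> \<gamma> t = \<delta> t"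
  shows "C1_curve_on atlas I \<delta>"
proof -
  have T: "{t \<in> I. \<gamma> t \<in> fst c} = {t \<in> I. \<delta> t \<in> fst c}" for c using assms(2) by auto
  have d: "(snd c \<circ> \<delta> has_vector_derivative v) (at t within I)"
    if "(snd c \<circ> \<gamma> has_vector_derivative v) (at t within I)" "t \<in> I" for c v t
    by (rule has_vector_derivative_transform[OF that(2) _ that(1)]) (use assms(2) in auto)
  show ?thesis
    unfolding C1_curve_on_def
  proof (intro conjI ballI)
    have "continuous_on I \<gamma>" using assms(1) by (simp add: C1_curve_on_def)
    then show "continuous_on I \<delta>" by (rule continuous_on_eq) (rule assms(2))
    fix c assume "c \<in> atlas"
    then obtain v where v: "continuous_on {t \<in> I. \<gamma> t \<in> fst c} v"
        "\<And>t. t \<in> {t \<in> I. \<gamma> t \<in> fst c} \<Longrightarrow> (snd c \<circ> \<gamma> has_vector_derivative v t) (at t within I)"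
      using assms(1) unfolding C1_curve_on_def by blast
    show "\<exists>v. continuous_on {t \<in> I. \<delta> t \<in> fst c} v \<and>
        (\<forall>t\<in>{t \<in> I. \<delta> t \<in> fst c}. (snd c \<circ> \<delta> has_vector_derivative v t) (at t within I))"
    proof (intro exI[of _ v] conjI ballI)
      show "continuous_on {t \<in> I. \<delta> t \<in> fst c} v" using v(1) by (simp only: T)
      fix t assume t: "t \<in> {t \<in> I. \<delta> t \<in> fst c}"
      then have "t \<in> {t \<in> I. \<gamma> t \<in> fst c}" by (simp only: T)
      from d[OF v(2)[OF this]] t show "(snd c \<circ> \<delta> has_vector_derivative v t) (at t within I)" by blast
    qed
  qed
qed

text \<open>The facts about a piecewise continuously differentiable curve that its length depends on.\<close>
lemma pwC1_facts:
  assumes "pwC1 \<gamma> a b"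
  shows "a \<le> b" "continuous_on {a..b} \<gamma>" "curve_speed atlas g \<gamma> integrable_on {a..b}"
    "\<exists>S. finite S \<and> (\<forall>t\<in>{a<..<b} - S. \<forall>c\<in>atlas. \<gamma> t \<in> fst c \<longrightarrow>
        (\<exists>v. (snd c \<circ> \<gamma> has_vector_derivative v) (at t)))"
proof -
  have "a \<le> b \<and> continuous_on {a..b} \<gamma> \<and> curve_speed atlas g \<gamma> integrable_on {a..b} \<and>
     (\<exists>S. finite S \<and> (\<forall>t\<in>{a<..<b} - S. \<forall>c\<in>atlas. \<gamma> t \<in> fst c \<longrightarrow>
        (\<exists>v. (snd c \<circ> \<gamma> has_vector_derivative v) (at t))))"
    using assms
  proof (induction rule: pwC1_induct)
    case refl
    have "curve_speed atlas g \<gamma> integrable_on cbox a a" by (rule integrable_on_refl)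
    then show ?case by (auto intro!: exI[of _ "{}"])
  next
    case (step c d)
    obtain S where S: "finite S" "\<And>t c'. t \<in> {a<..<c} - S \<Longrightarrow> c' \<in> atlas \<Longrightarrow> \<gamma> t \<in> fst c' \<Longrightarrow>
        \<exists>v. (snd c' \<circ> \<gamma> has_vector_derivative v) (at t)" using step by blast
    have ac: "a \<le> c" "c < d" using step by auto
    have un: "{a..d} = {a..c} \<union> {c..d}" using ac by auto
    have cont: "continuous_on {a..d} \<gamma>"
      unfolding un using step by (intro continuous_on_closed_Un) (auto simp: C1_curve_on_def)
    have int: "curve_speed atlas g \<gamma> integrable_on {a..d}"
      using step C1_curve_speed_integrable[of c d \<gamma>] ac by (intro Henstock_Kurzweil_Integration.integrable_combine[of a c d]) auto
    have *: "\<exists>v. (snd c' \<circ> \<gamma> has_vector_derivative v) (at t)"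
      if t: "t \<in> {a<..<d} - insert c S" and c': "c' \<in> atlas" "\<gamma> t \<in> fst c'" for t c'
    proof (cases "t < c")
      case True then show ?thesis using S(2)[of t c'] t c' by auto
    next
      case False
      then have "t \<in> {c<..<d}" using t by auto
      then have "at t within {c..d} = at t" "t \<in> {c..d}" by (auto simp: at_within_Icc_at)
      then show ?thesis using step(4) c' unfolding C1_curve_on_def by fastforce
    qed
    from * have "\<forall>t\<in>{a<..<d} - insert c S. \<forall>c'\<in>atlas. \<gamma> t \<in> fst c' \<longrightarrow>
        (\<exists>v. (snd c' \<circ> \<gamma> has_vector_derivative v) (at t))" by blast
    moreover have "finite (insert c S)" "a \<le> d" using S(1) ac by auto
    ultimately show ?case using cont int by blast
  qed
  then show "a \<le> b" "continuous_on {a..b} \<gamma>" "curve_speed atlas g \<gamma> integrable_on {a..b}"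
    "\<exists>S. finite S \<and> (\<forall>t\<in>{a<..<b} - S. \<forall>c\<in>atlas. \<gamma> t \<in> fst c \<longrightarrow>
        (\<exists>v. (snd c \<circ> \<gamma> has_vector_derivative v) (at t)))" by blast+
qed

lemma curve_speed_nonneg: "0 \<le> curve_speed atlas g \<gamma> t"
proof -
  define c where "c = (SOME c. c \<in> atlas \<and> \<gamma> t \<in> fst c)"
  obtain c0 where "c0 \<in> atlas" "\<gamma> t \<in> fst c0" by (rule chart_at)
  then have "c \<in> atlas \<and> \<gamma> t \<in> fst c"
    unfolding c_def by (intro someI[of "\<lambda>c. c \<in> atlas \<and> \<gamma> t \<in> fst c" c0]) blast
  then show ?thesis unfolding curve_speed_eq_speed_within speed_within_def c_def[symmetric]
    by (simp add: quad_nonneg)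
qed

lemma curve_length_nonneg: "0 \<le> curve_length atlas g \<gamma>"
proof (cases "curve_speed atlas g \<gamma> integrable_on {0..1}")
  case True
  then show ?thesis unfolding curve_length_def by (intro integral_nonneg curve_speed_nonneg)
next
  case False
  then show ?thesis by (simp add: curve_length_def not_integrable_integral)
qed

lemma C1_curve_on_affine:
  assumes C1: "C1_curve_on atlas {m * a + k..m * b + k} \<gamma>" and m: "m > 0"
  shows "C1_curve_on atlas {a..b} (\<lambda>t. \<gamma> (m * t + k))"
proof -
  let ?J = "{m * a + k..m * b + k}" and ?h = "\<lambda>t. m * t + k"
  have map: "?h t \<in> ?J" if "t \<in> {a..b}" for t using that m by auto
  show ?thesis
    unfolding C1_curve_on_def
  proof (intro conjI ballI)
    have "continuous_on ?J \<gamma>" using C1 by (simp add: C1_curve_on_def)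
    then show "continuous_on {a..b} (\<lambda>t. \<gamma> (?h t))"
      by (rule continuous_on_compose2) (use map in \<open>auto intro!: continuous_intros\<close>)
    fix c assume "c \<in> atlas"
    then obtain v where v: "continuous_on {t \<in> ?J. \<gamma> t \<in> fst c} v"
        "\<And>t. t \<in> {t \<in> ?J. \<gamma> t \<in> fst c} \<Longrightarrow> (snd c \<circ> \<gamma> has_vector_derivative v t) (at t within ?J)"
      using C1 unfolding C1_curve_on_def by blast
    show "\<exists>v. continuous_on {t \<in> {a..b}. \<gamma> (?h t) \<in> fst c} v \<and>
        (\<forall>t\<in>{t \<in> {a..b}. \<gamma> (?h t) \<in> fst c}. (snd c \<circ> (\<lambda>t. \<gamma> (?h t)) has_vector_derivative v t) (at t within {a..b}))"
    proof (rule exI[of _ "\<lambda>t. m *\<^sub>R v (?h t)"], intro conjI ballI)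
      show "continuous_on {t \<in> {a..b}. \<gamma> (?h t) \<in> fst c} (\<lambda>t. m *\<^sub>R v (?h t))"
        by (intro continuous_intros continuous_on_compose2[OF v(1)]) (use map in auto)
      fix t assume t: "t \<in> {t \<in> {a..b}. \<gamma> (?h t) \<in> fst c}"
      have "(snd c \<circ> \<gamma> has_vector_derivative v (?h t)) (at (?h t) within ?h ` {a..b})"
        by (rule has_vector_derivative_within_subset[OF v(2)]) (use t map in auto)
      moreover have "(?h has_vector_derivative m) (at t within {a..b})"
        by (auto intro!: derivative_eq_intros simp: has_real_derivative_iff_has_vector_derivative[symmetric])
      ultimately have "((snd c \<circ> \<gamma>) \<circ> ?h has_vector_derivative m *\<^sub>R v (?h t)) (at t within {a..b})"
        by (intro vector_diff_chain_within)
      then show "(snd c \<circ> (\<lambda>t. \<gamma> (?h t)) has_vector_derivative m *\<^sub>R v (?h t)) (at t within {a..b})"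
        by (simp add: o_def)
    qed
  qed
qed

lemma C1_curve_on_reverse:
  assumes C1: "C1_curve_on atlas {a..b} \<gamma>"
  shows "C1_curve_on atlas {1 - b..1 - a} (\<lambda>t. \<gamma> (1 - t))"
proof -
  let ?J = "{a..b}" and ?I = "{1 - b..1 - a}" and ?h = "\<lambda>t::real. 1 - t"
  have map: "?h t \<in> ?J" if "t \<in> ?I" for t using that by auto
  show ?thesis
    unfolding C1_curve_on_def
  proof (intro conjI ballI)
    have "continuous_on ?J \<gamma>" using C1 by (simp add: C1_curve_on_def)
    then show "continuous_on ?I (\<lambda>t. \<gamma> (?h t))"
      by (rule continuous_on_compose2) (use map in \<open>auto intro!: continuous_intros\<close>)
    fix c assume "c \<in> atlas"
    then obtain v where v: "continuous_on {t \<in> ?J. \<gamma> t \<in> fst c} v"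
        "\<And>t. t \<in> {t \<in> ?J. \<gamma> t \<in> fst c} \<Longrightarrow> (snd c \<circ> \<gamma> has_vector_derivative v t) (at t within ?J)"
      using C1 unfolding C1_curve_on_def by blast
    show "\<exists>v. continuous_on {t \<in> ?I. \<gamma> (?h t) \<in> fst c} v \<and>
        (\<forall>t\<in>{t \<in> ?I. \<gamma> (?h t) \<in> fst c}. (snd c \<circ> (\<lambda>t. \<gamma> (?h t)) has_vector_derivative v t) (at t within ?I))"
    proof (rule exI[of _ "\<lambda>t. (- 1) *\<^sub>R v (?h t)"], intro conjI ballI)
      show "continuous_on {t \<in> ?I. \<gamma> (?h t) \<in> fst c} (\<lambda>t. (- 1) *\<^sub>R v (?h t))"
        by (intro continuous_intros continuous_on_compose2[OF v(1)]) (use map in auto)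
      fix t assume t: "t \<in> {t \<in> ?I. \<gamma> (?h t) \<in> fst c}"
      have "(snd c \<circ> \<gamma> has_vector_derivative v (?h t)) (at (?h t) within ?h ` ?I)"
        by (rule has_vector_derivative_within_subset[OF v(2)]) (use t map in auto)
      moreover have "(?h has_vector_derivative (- 1)) (at t within ?I)"
        by (auto intro!: derivative_eq_intros simp: has_real_derivative_iff_has_vector_derivative[symmetric])
      ultimately have "((snd c \<circ> \<gamma>) \<circ> ?h has_vector_derivative (- 1) *\<^sub>R v (?h t)) (at t within ?I)"
        by (intro vector_diff_chain_within)
      then show "(snd c \<circ> (\<lambda>t. \<gamma> (?h t)) has_vector_derivative (- 1) *\<^sub>R v (?h t)) (at t within ?I)"
        by (simp add: o_def)
    qed
  qed
qed

lemma pwC1_affine: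
  assumes "pwC1 \<gamma> (m * a + k) (m * b + k)" and m: "m > 0"
  shows "pwC1 (\<lambda>t. \<gamma> (m * t + k)) a b"
proof -
  obtain n \<tau> where \<tau>: "\<tau> 0 = m * a + k" "\<tau> n = m * b + k"
      "\<And>i. i < n \<Longrightarrow> \<tau> i < \<tau> (Suc i) \<and> C1_curve_on atlas {\<tau> i..\<tau> (Suc i)} \<gamma>"
    using assms(1) unfolding pwC1_def by blast
  define \<sigma> where "\<sigma> i = (\<tau> i - k) / m" for i
  have s: "m * \<sigma> i + k = \<tau> i" for i using m by (simp add: \<sigma>_def)
  have "\<sigma> i < \<sigma> (Suc i) \<and> C1_curve_on atlas {\<sigma> i..\<sigma> (Suc i)} (\<lambda>t. \<gamma> (m * t + k))" if "i < n" for i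
    using C1_curve_on_affine[of m "\<sigma> i" k "\<sigma> (Suc i)" \<gamma>] \<tau>(3)[OF that] m
    unfolding s by (auto simp: \<sigma>_def divide_strict_right_mono)
  moreover have "\<sigma> 0 = a" "\<sigma> n = b" using \<tau>(1,2) m by (simp_all add: \<sigma>_def)
  ultimately show ?thesis unfolding pwC1_def by blast
qed

lemma pwC1_cong:
  assumes "pwC1 \<gamma> a b" "\<And>t. t \<in> {a..b} \<Longrightarrow> \<gamma> t = \<delta> t"
  shows "pwC1 \<delta> a b"
proof -
  have "a \<le> b" by (rule pwC1_facts(1)[OF assms(1)])
  have "b \<le> b \<longrightarrow> pwC1 \<delta> a b"
    using assms(1)
  proof (induction "b" rule: pwC1_induct[where P = "\<lambda>x. x \<le> b \<longrightarrow> pwC1 \<delta> a x"])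
    case refl
    show ?case unfolding pwC1_def by (auto intro!: exI[of _ 0])
  next
    case (step c d)
    show ?case
    proof
      assume d: "d \<le> b"
      then have "pwC1 \<delta> a c" using step by simp
      moreover have "C1_curve_on atlas {c..d} \<delta>"
        by (rule C1_curve_on_cong[OF \<open>C1_curve_on atlas {c..d} \<gamma>\<close>]) (use assms(2) \<open>a \<le> c\<close> d in auto)
      ultimately show "pwC1 \<delta> a d" using pwC1_trans pwC1_single[OF _ \<open>c < d\<close>] by blast
    qed
  qed
  then show ?thesis by simp
qed

lemma pwC1_reverse:
  assumes "pwC1 \<gamma> 0 1"
  shows "pwC1 (\<lambda>t. \<gamma> (1 - t)) 0 1"
proof -
  obtain n \<tau> where \<tau>: "\<tau> 0 = 0" "\<tau> n = 1"
      "\<And>i. i < n \<Longrightarrow> \<tau> i < \<tau> (Suc i) \<and> C1_curve_on atlas {\<tau> i..\<tau> (Suc i)} \<gamma>"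
    using assms unfolding pwC1_def by blast
  define \<sigma> where "\<sigma> i = 1 - \<tau> (n - i)" for i
  have "\<sigma> i < \<sigma> (Suc i) \<and> C1_curve_on atlas {\<sigma> i..\<sigma> (Suc i)} (\<lambda>t. \<gamma> (1 - t))" if i: "i < n" for i
  proof -
    have "n - i = Suc (n - Suc i)" "n - Suc i < n" using i by auto
    then show ?thesis using \<tau>(3)[of "n - Suc i"] C1_curve_on_reverse by (auto simp: \<sigma>_def)
  qed
  moreover have "\<sigma> 0 = 0" "\<sigma> n = 1" using \<tau>(1,2) by (simp_all add: \<sigma>_def)
  ultimately show ?thesis unfolding pwC1_def by blast
qed

lemma curve_speed_affine:
  assumes cont: "continuous_on {a<..<b} \<gamma>" and s: "m * t + k \<in> {a<..<b}" and m: "m \<noteq> 0"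
    and c: "c \<in> atlas" "\<gamma> (m * t + k) \<in> fst c"
    and v: "(snd c \<circ> \<gamma> has_vector_derivative v) (at (m * t + k))"
  shows "curve_speed atlas g (\<lambda>t. \<gamma> (m * t + k)) t = \<bar>m\<bar> * curve_speed atlas g \<gamma> (m * t + k)"
proof -
  let ?h = "\<lambda>t. m * t + k"
  have "(?h has_vector_derivative m) (at t)"
    by (auto intro!: derivative_eq_intros simp: has_real_derivative_iff_has_vector_derivative[symmetric])
  from vector_diff_chain_at[OF this v]
  have d: "(snd c \<circ> (\<lambda>t. \<gamma> (?h t)) has_vector_derivative m *\<^sub>R v) (at t)" by (simp add: o_def)
  have "open (?h -` {a<..<b})" by (intro open_vimage) (auto intro!: continuous_intros)
  moreover have "t \<in> ?h -` {a<..<b}" using s by simp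
  ultimately obtain e where e: "e > 0" "ball t e \<subseteq> ?h -` {a<..<b}" using open_contains_ball by blast
  have b: "ball t e = {t - e<..<t + e}" by (auto simp: dist_real_def)
  have "continuous_on {t - e<..<t + e} (\<lambda>t. \<gamma> (?h t))"
    by (rule continuous_on_compose2[OF cont]) (use e b in \<open>auto intro!: continuous_intros\<close>)
  then have "curve_speed atlas g (\<lambda>t. \<gamma> (?h t)) t = sqrt (quad c (\<gamma> (?h t)) (m *\<^sub>R v))"
    by (intro curve_speed_eq[of c t "t - e" "t + e"] c d) (use e in auto)
  also have "quad c (\<gamma> (?h t)) (m *\<^sub>R v) = m\<^sup>2 * quad c (\<gamma> (?h t)) v"
    by (simp add: quad_def power2_eq_square matrix_vector_mult_scaleR)
  also have "sqrt (m\<^sup>2 * quad c (\<gamma> (?h t)) v) = \<bar>m\<bar> * curve_speed atlas g \<gamma> (?h t)"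
    using curve_speed_eq[OF c(1) s c(2) cont v] by (simp add: real_sqrt_mult)
  finally show ?thesis .
qed

lemma has_integral_curve_speed_affine:
  assumes \<gamma>: "pwC1 \<gamma> a b" and m: "m \<noteq> 0"
    and I: "{p..q} = (\<lambda>x. (1 / m) * x + - ((1 / m) * k)) ` {a..b}"
  shows "(curve_speed atlas g (\<lambda>t. \<gamma> (m * t + k)) has_integral integral {a..b} (curve_speed atlas g \<gamma>)) {p..q}"
proof -
  let ?f = "curve_speed atlas g \<gamma>"
  obtain S where S: "finite S" "\<And>t c. t \<in> {a<..<b} - S \<Longrightarrow> c \<in> atlas \<Longrightarrow> \<gamma> t \<in> fst c \<Longrightarrow>
      \<exists>v. (snd c \<circ> \<gamma> has_vector_derivative v) (at t)"
    using pwC1_facts(4)[OF \<gamma>] by blast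
  have "(?f has_integral integral {a..b} ?f) (cbox a b)"
    using pwC1_facts(3)[OF \<gamma>] by (simp add: has_integral_integral)
  from has_integral_affinity[OF this m, of k]
  have "((\<lambda>x. ?f (m * x + k)) has_integral (1 / \<bar>m\<bar>) * integral {a..b} ?f) {p..q}"
    using I by simp
  from has_integral_mult_right[OF this, of "\<bar>m\<bar>"]
  have 1: "((\<lambda>x. \<bar>m\<bar> * ?f (m * x + k)) has_integral integral {a..b} ?f) {p..q}" using m by simp
  show ?thesis
  proof (rule has_integral_spike_finite[OF _ _ 1])
    let ?S = "(\<lambda>x. (1 / m) * x + - ((1 / m) * k)) ` (S \<union> {a, b})"
    show "finite ?S" using S(1) by simp
    fix t assume t: "t \<in> {p..q} - ?S"
    define s where "s = m * t + k"
    have ts: "t = (1 / m) * s + - ((1 / m) * k)" using m by (simp add: s_def field_simps)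
    obtain s' where s': "s' \<in> {a..b}" "t = (1 / m) * s' + - ((1 / m) * k)" using t I by auto
    have "s' = s" using s'(2) ts m by simp
    then have "s \<in> {a..b}" using s' by simp
    moreover have "s \<notin> S \<union> {a, b}" using t ts by blast
    ultimately have s: "s \<in> {a<..<b} - S" by auto
    obtain c where c: "c \<in> atlas" "\<gamma> s \<in> fst c" by (rule chart_at)
    obtain v where v: "(snd c \<circ> \<gamma> has_vector_derivative v) (at s)" using S(2)[OF s c] by blast
    have "continuous_on {a<..<b} \<gamma>" by (rule continuous_on_subset[OF pwC1_facts(2)[OF \<gamma>]]) auto
    then show "curve_speed atlas g (\<lambda>t. \<gamma> (m * t + k)) t = \<bar>m\<bar> * ?f (m * t + k)"
      by (rule curve_speed_affine[OF _ _ m c(1)]) (use s c v in \<open>simp_all add: s_def\<close>)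
  qed
qed

lemma curve_speed_cong:
  assumes "open T" "t \<in> T" "\<And>s. s \<in> T \<Longrightarrow> \<gamma> s = \<delta> s"
  shows "curve_speed atlas g \<gamma> t = curve_speed atlas g \<delta> t"
proof -
  have "vector_derivative (snd c \<circ> \<gamma>) (at t) = vector_derivative (snd c \<circ> \<delta>) (at t)" for c :: "('m, 'd) chart"
  proof (rule vector_derivative_cong_eq)
    show "\<forall>\<^sub>F s in nhds t. s \<in> UNIV \<longrightarrow> (snd c \<circ> \<gamma>) s = (snd c \<circ> \<delta>) s"
      using eventually_nhds_in_open[OF assms(1,2)] by eventually_elim (use assms(3) in auto)
  qed auto
  then show ?thesis using assms by (simp add: curve_speed_def)
qed

lemma curve_length_reverse:
  assumes "pwC1 \<gamma> 0 1"
  shows "curve_length atlas g (\<lambda>t. \<gamma> (1 - t)) = curve_length atlas g \<gamma>"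
proof -
  have "(\<lambda>x. (1 / (- 1)) * x + - ((1 / (- 1)) * 1)) ` {0..1} = {0..1::real}"
    by (simp add: image_affinity_atLeastAtMost)
  then have "(curve_speed atlas g (\<lambda>t. \<gamma> ((- 1) * t + 1)) has_integral integral {0..1} (curve_speed atlas g \<gamma>)) {0..1}"
    by (intro has_integral_curve_speed_affine[OF assms]) auto
  then show ?thesis unfolding curve_length_def by (simp add: integral_unique algebra_simps)
qed

lemma join_curves:
  assumes \<gamma>: "pwC1 \<gamma> 0 1" and \<delta>: "pwC1 \<delta> 0 1" and eq: "\<gamma> 1 = \<delta> 0"
  defines "\<beta> \<equiv> \<lambda>t. if t \<le> 1 / 2 then \<gamma> (2 * t) else \<delta> (2 * t - 1)"
  shows "pwC1 \<beta> 0 1" "curve_length atlas g \<beta> = curve_length atlas g \<gamma> + curve_length atlas g \<delta>"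
proof -
  have 1: "pwC1 (\<lambda>t. \<gamma> (2 * t + 0)) 0 (1 / 2)" by (rule pwC1_affine) (use \<gamma> in auto)
  have 2: "pwC1 (\<lambda>t. \<delta> (2 * t + (- 1))) (1 / 2) 1" by (rule pwC1_affine) (use \<delta> in auto)
  have b1: "pwC1 \<beta> 0 (1 / 2)" by (rule pwC1_cong[OF 1]) (auto simp: \<beta>_def)
  have b2: "pwC1 \<beta> (1 / 2) 1"
  proof (rule pwC1_cong[OF 2])
    fix t :: real assume "t \<in> {1 / 2..1}"
    then consider "t = 1 / 2" | "t > 1 / 2" by fastforce
    then show "\<delta> (2 * t + (- 1)) = \<beta> t"
    proof cases
      case 1 show ?thesis unfolding 1 by (simp add: \<beta>_def eq)
    next
      case 2 then show ?thesis by (simp add: \<beta>_def)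
    qed
  qed
  show pw: "pwC1 \<beta> 0 1" by (rule pwC1_trans[OF b1 b2])
  have i1: "(curve_speed atlas g (\<lambda>t. \<gamma> (2 * t + 0)) has_integral curve_length atlas g \<gamma>) {0..1 / 2}"
    unfolding curve_length_def
    by (rule has_integral_curve_speed_affine[OF \<gamma>]) (simp_all add: image_affinity_atLeastAtMost)
  have i2: "(curve_speed atlas g (\<lambda>t. \<delta> (2 * t + (- 1))) has_integral curve_length atlas g \<delta>) {1 / 2..1}"
    unfolding curve_length_def
    by (rule has_integral_curve_speed_affine[OF \<delta>]) (simp, subst image_affinity_atLeastAtMost, simp)
  have j1: "(curve_speed atlas g \<beta> has_integral curve_length atlas g \<gamma>) {0..1 / 2}"
  proof (rule has_integral_spike_finite[OF _ _ i1, of "{1 / 2}"])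
    fix t :: real assume t: "t \<in> {0..1 / 2} - {1 / 2}"
    show "curve_speed atlas g \<beta> t = curve_speed atlas g (\<lambda>t. \<gamma> (2 * t + 0)) t"
      by (rule curve_speed_cong[of "{..<1 / 2}"]) (use t in \<open>auto simp: \<beta>_def\<close>)
  qed simp
  have j2: "(curve_speed atlas g \<beta> has_integral curve_length atlas g \<delta>) {1 / 2..1}"
  proof (rule has_integral_spike_finite[OF _ _ i2, of "{1 / 2}"])
    fix t :: real assume t: "t \<in> {1 / 2..1} - {1 / 2}"
    show "curve_speed atlas g \<beta> t = curve_speed atlas g (\<lambda>t. \<delta> (2 * t + (- 1))) t"
      by (rule curve_speed_cong[of "{1 / 2<..}"]) (use t in \<open>auto simp: \<beta>_def\<close>)
  qed simp
  have "(curve_speed atlas g \<beta> has_integral (curve_length atlas g \<gamma> + curve_length atlas g \<delta>)) {0..1}"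
    by (rule has_integral_combine[OF _ _ j1 j2]) auto
  then show "curve_length atlas g \<beta> = curve_length atlas g \<gamma> + curve_length atlas g \<delta>"
    unfolding curve_length_def[of _ _ \<beta>] by (rule integral_unique)
qed

section \<open>The Riemannian distance is a metric for the topology of the manifold\<close>

abbreviation "rdist \<equiv> riemannian_dist atlas g"

text \<open>The metric tensor is continuous, and on the compact set of unit vectors over \<open>C\<close> its
  values are positive, so they have a positive minimum and a finite maximum.\<close>
lemma quad_bounds:
  assumes c: "c \<in> atlas" and C: "compact C" "C \<subseteq> fst c"
  obtains \<mu> \<Lambda> where "\<mu> > 0" "\<Lambda> > 0"
    "\<And>x v. x \<in> C \<Longrightarrow> \<mu> * norm v \<le> sqrt (quad c x v)" "\<And>x v. x \<in> C \<Longrightarrow> sqrt (quad c x v) \<le> \<Lambda> * norm v"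
proof (cases "C = {}")
  case True
  then show ?thesis using that[of 1 1] by simp
next
  case False
  let ?S = "sphere 0 1 :: (real^'d) set"
  let ?F = "\<lambda>(x, v). quad c x v"
  obtain e :: "real^'d" where "e \<in> ?S" using vector_choose_size[of 1] by auto
  then have ne: "C \<times> ?S \<noteq> {}" using False by auto
  have co: "compact (C \<times> ?S)" using C by (intro compact_Times) auto
  have cont: "continuous_on (C \<times> ?S) ?F"
    unfolding case_prod_beta quad_def
    by (intro continuous_on_quad continuous_on_compose2[OF continuous_on_metric[OF c]] continuous_intros) (use C in auto)
  obtain m where m: "m \<in> C \<times> ?S" "\<And>z. z \<in> C \<times> ?S \<Longrightarrow> ?F m \<le> ?F z"
    using continuous_attains_inf[OF co ne cont] by blast
  obtain M where M: "M \<in> C \<times> ?S" "\<And>z. z \<in> C \<times> ?S \<Longrightarrow> ?F z \<le> ?F M"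
    using continuous_attains_sup[OF co ne cont] by blast
  have pos: "?F m > 0"
  proof -
    have "fst m \<in> fst c" "snd m \<noteq> 0" using m(1) C by auto
    then show ?thesis using quad_pos[OF c] by (simp add: case_prod_beta)
  qed
  then have posM: "?F M > 0" using m(2)[OF M(1)] by simp
  have hom: "sqrt (quad c x v) = norm v * sqrt (quad c x (v /\<^sub>R norm v))" if "v \<noteq> 0" for x v
  proof -
    have "quad c x v = quad c x (norm v *\<^sub>R (v /\<^sub>R norm v))" using that by simp
    also have "\<dots> = (norm v)\<^sup>2 * quad c x (v /\<^sub>R norm v)"
      by (simp only: quad_def power2_eq_square matrix_vector_mult_scaleR inner_scaleR_left inner_scaleR_right mult_ac)
    finally show ?thesis by (simp add: real_sqrt_mult)
  qed
  have unit: "(x, v /\<^sub>R norm v) \<in> C \<times> ?S" if "x \<in> C" "v \<noteq> 0" for x and v :: "real^'d" using that by simp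
  show ?thesis
  proof (rule that[of "sqrt (?F m)" "sqrt (?F M)"])
    show "sqrt (?F m) * norm v \<le> sqrt (quad c x v)" if x: "x \<in> C" for x v
    proof (cases "v = 0")
      case False
      have "sqrt (?F m) \<le> sqrt (quad c x (v /\<^sub>R norm v))" using m(2)[OF unit[OF x False]] by simp
      then have "norm v * sqrt (?F m) \<le> norm v * sqrt (quad c x (v /\<^sub>R norm v))" by (rule mult_left_mono) simp
      then show ?thesis by (simp only: hom[OF False] mult.commute)
    qed (simp add: quad_def)
    show "sqrt (quad c x v) \<le> sqrt (?F M) * norm v" if x: "x \<in> C" for x v
    proof (cases "v = 0")
      case False
      have "sqrt (quad c x (v /\<^sub>R norm v)) \<le> sqrt (?F M)" using M(2)[OF unit[OF x False]] by simp
      then have "norm v * sqrt (quad c x (v /\<^sub>R norm v)) \<le> norm v * sqrt (?F M)" by (rule mult_left_mono) simp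
      then show ?thesis by (simp only: hom[OF False] mult.commute)
    qed (simp add: quad_def)
  qed (use pos posM in auto)
qed

lemma chart_ball:
  obtains c R where "c \<in> atlas" "x \<in> fst c" "R > 0" "cball (snd c x) R \<subseteq> snd c ` fst c"
proof -
  obtain c where c: "c \<in> atlas" "x \<in> fst c" by (rule chart_at)
  then obtain R where "R > 0" "cball (snd c x) R \<subseteq> snd c ` fst c"
    using chart_range[OF c(1)] open_contains_cball by (metis imageI)
  then show ?thesis using that c by blast
qed

lemma open_chart_inv_image:
  assumes c: "c \<in> atlas" and V: "open V" "V \<subseteq> snd c ` fst c"
  shows "open (chart_inv c ` V)"
proof -
  have "chart_inv c ` V = fst c \<inter> snd c -` V"
  proof (intro equalityI subsetI)
    fix x assume "x \<in> chart_inv c ` V"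
    then show "x \<in> fst c \<inter> snd c -` V" using V(2) chart_inv_mem[OF c] chart_inv_right[OF c] by (auto simp: subset_iff)
  next
    fix x assume "x \<in> fst c \<inter> snd c -` V"
    then show "x \<in> chart_inv c ` V" using chart_inv_left[OF c, of x] by (intro image_eqI[of _ _ "snd c x"]) auto
  qed
  also have "open \<dots>"
    by (rule continuous_open_preimage[OF continuous_on_chart[OF c] chart_domain[OF c] V(1)])
  finally show ?thesis .
qed

lemma rdist_le_curve_length: "pwC1 \<gamma> 0 1 \<Longrightarrow> rdist (\<gamma> 0) (\<gamma> 1) \<le> curve_length atlas g \<gamma>"
  unfolding riemannian_dist_def piecewise_C1_curve_iff
  by (rule cInf_lower) (auto intro!: bdd_belowI[of _ 0] curve_length_nonneg)

text \<open>The preimage of a straight segment under the chart; its coordinate velocity is constant.\<close>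
lemma chart_segment:
  assumes c: "c \<in> atlas" and R: "R > 0" "cball (snd c x) R \<subseteq> snd c ` fst c" and x: "x \<in> fst c"
    and z: "z \<in> ball (snd c x) R"
    and \<Lambda>: "\<And>y v. y \<in> chart_inv c ` cball (snd c x) R \<Longrightarrow> sqrt (quad c y v) \<le> \<Lambda> * norm v"
  obtains \<gamma> where "pwC1 \<gamma> 0 1" "\<gamma> 0 = x" "\<gamma> 1 = chart_inv c z"
    "curve_length atlas g \<gamma> \<le> \<Lambda> * norm (z - snd c x)"
proof -
  let ?p = "snd c x" and ?v = "z - snd c x"
  define \<sigma> where "\<sigma> t = ?p + t *\<^sub>R ?v" for t
  define \<gamma> where "\<gamma> t = chart_inv c (\<sigma> t)" for t
  have \<sigma>: "\<sigma> t \<in> ball ?p R" if "t \<in> {0..1}" for t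
  proof -
    have "norm (t *\<^sub>R ?v) \<le> 1 * norm ?v" using that by (simp add: mult_left_le_one_le)
    then show ?thesis using z by (simp add: \<sigma>_def dist_norm norm_minus_commute)
  qed
  have \<sigma>r: "\<sigma> t \<in> snd c ` fst c" if "t \<in> {0..1}" for t using \<sigma>[OF that] R by (meson ball_subset_cball subsetD)
  have \<gamma>m: "\<gamma> t \<in> fst c" "snd c (\<gamma> t) = \<sigma> t" if "t \<in> {0..1}" for t
    using \<sigma>r[OF that] by (simp_all add: \<gamma>_def chart_inv_mem[OF c] chart_inv_right[OF c])
  have \<sigma>d: "(\<sigma> has_vector_derivative ?v) F" if "F = at t within S" for F t S
    unfolding \<sigma>_def[abs_def] that by (auto intro!: derivative_eq_intros)
  have cont: "continuous_on {0..1} \<gamma>"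
    unfolding \<gamma>_def[abs_def]
    by (rule continuous_on_compose2[OF continuous_on_chart_inv[OF c]])
      (use \<sigma>r in \<open>auto simp: \<sigma>_def[abs_def] intro!: continuous_intros\<close>)
  have C1: "C1_curve_on atlas {0..1} \<gamma>"
    unfolding C1_curve_on_def
  proof (intro conjI ballI)
    fix c' assume c': "c' \<in> atlas"
    let ?T = "{t \<in> {0..1}. \<gamma> t \<in> fst c'}"
    let ?w = "\<lambda>t. frechet_derivative (transition c c') (at (\<sigma> t)) ?v"
    show "\<exists>v. continuous_on ?T v \<and>
        (\<forall>t\<in>?T. (snd c' \<circ> \<gamma> has_vector_derivative v t) (at t within {0..1}))"
    proof (intro exI[of _ ?w] conjI ballI)
      show "continuous_on ?T ?w"
      proof (rule continuous_on_compose2[OF smooth_on_continuous_derivative[OF transition_smooth[OF c c']]])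
        show "continuous_on ?T \<sigma>" unfolding \<sigma>_def[abs_def] by (intro continuous_intros)
        show "\<sigma> ` ?T \<subseteq> snd c ` (fst c \<inter> fst c')"
        proof
          fix y assume "y \<in> \<sigma> ` ?T"
          then obtain t where t: "t \<in> {0..1}" "\<gamma> t \<in> fst c'" "y = \<sigma> t" by auto
          then show "y \<in> snd c ` (fst c \<inter> fst c')" using \<gamma>m[OF t(1)] by (intro image_eqI[of _ _ "\<gamma> t"]) auto
        qed
      qed
      fix t assume t: "t \<in> ?T"
      have "(snd c \<circ> \<gamma> has_vector_derivative ?v) (at t within {0..1})"
        by (rule has_vector_derivative_transform[OF _ _ \<sigma>d[OF refl]]) (use t \<gamma>m in auto)
      from chart_change_vector_derivative[OF c c' _ _ _ cont this] t \<gamma>m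
      show "(snd c' \<circ> \<gamma> has_vector_derivative ?w t) (at t within {0..1})" by auto
    qed
  qed (rule cont)
  have pw: "pwC1 \<gamma> 0 1" by (rule pwC1_single[OF C1]) simp
  have "curve_length atlas g \<gamma> \<le> \<Lambda> * norm ?v"
  proof -
    have sp: "curve_speed atlas g \<gamma> t \<le> \<Lambda> * norm ?v" if t: "t \<in> {0<..<1}" for t
    proof -
      have ti: "t \<in> {0..1}" using t by simp
      have "(snd c \<circ> \<gamma> has_vector_derivative ?v) (at t within {0<..<1})"
        by (rule has_vector_derivative_transform[OF t _ \<sigma>d[OF refl]]) (use \<gamma>m in auto)
      then have "(snd c \<circ> \<gamma> has_vector_derivative ?v) (at t)"
        using at_within_open[OF t open_greaterThanLessThan] by simp
      then have "curve_speed atlas g \<gamma> t = sqrt (quad c (\<gamma> t) ?v)"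
        by (intro curve_speed_eq[OF c t \<gamma>m(1)[OF ti] continuous_on_subset[OF cont]]) auto
      also have "\<dots> \<le> \<Lambda> * norm ?v"
        using \<sigma>[OF ti] by (intro \<Lambda>) (auto simp: \<gamma>_def)
      finally show ?thesis .
    qed
    let ?f = "\<lambda>t. if t \<in> {0, 1} then 0 else curve_speed atlas g \<gamma> t"
    have \<Lambda>0: "0 \<le> \<Lambda> * norm ?v" using sp[of "1/2"] curve_speed_nonneg[of \<gamma> "1/2"] by simp
    have "curve_length atlas g \<gamma> = integral {0..1} ?f"
      unfolding curve_length_def by (rule integral_spike[of "{0, 1}"]) auto
    also have "\<dots> \<le> integral {0..1} (\<lambda>t::real. \<Lambda> * norm ?v)"
    proof (rule integral_le)
      show "?f integrable_on {0..1}"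
        by (rule integrable_spike_finite[of "{0, 1}", OF _ _ pwC1_facts(3)[OF pw]]) auto
      show "?f t \<le> \<Lambda> * norm ?v" if "t \<in> {0..1}" for t using sp[of t] \<Lambda>0 that by auto
    qed auto
    finally show ?thesis by simp
  qed
  moreover have "\<gamma> 0 = x" by (simp add: \<gamma>_def \<sigma>_def chart_inv_left[OF c x])
  moreover have "\<gamma> 1 = chart_inv c z" by (simp add: \<gamma>_def \<sigma>_def)
  ultimately show ?thesis using that pw by blast
qed

text \<open>Being joined by a curve is an equivalence relation whose classes are open, because chart segments
  are such curves, and the manifold is connected.\<close>
lemma ex_curve: "\<exists>\<gamma>. pwC1 \<gamma> 0 1 \<and> \<gamma> 0 = x \<and> \<gamma> 1 = y"
proof (rule connected_equivalence_relation_gen[where S = UNIV and P = "\<lambda>_. True" and R = "\<lambda>x y. \<exists>\<gamma>. pwC1 \<gamma> 0 1 \<and> \<gamma> 0 = x \<and> \<gamma> 1 = y"])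
  show "connected (UNIV :: 'm set)" by (rule connected_space)
  fix x y z
  show "\<exists>\<gamma>. pwC1 \<gamma> 0 1 \<and> \<gamma> 0 = x \<and> \<gamma> 1 = z"
    if xy: "\<exists>\<gamma>. pwC1 \<gamma> 0 1 \<and> \<gamma> 0 = x \<and> \<gamma> 1 = y" and yz: "\<exists>\<gamma>. pwC1 \<gamma> 0 1 \<and> \<gamma> 0 = y \<and> \<gamma> 1 = z"
  proof -
    obtain \<gamma> \<delta> where "pwC1 \<gamma> 0 1" "\<gamma> 0 = x" "\<gamma> 1 = y" "pwC1 \<delta> 0 1" "\<delta> 0 = y" "\<delta> 1 = z"
      using xy yz by blast
    then show ?thesis using join_curves(1)[of \<gamma> \<delta>] by (intro exI[of _ "\<lambda>t. if t \<le> 1 / 2 then \<gamma> (2 * t) else \<delta> (2 * t - 1)"]) auto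
  qed
next
  fix T and x :: 'm
  assume T: "openin (top_of_set UNIV) T" "x \<in> T"
  then show "\<exists>z. z \<in> T \<and> True" by blast
next
  fix x :: 'm
  obtain c R where c: "c \<in> atlas" "x \<in> fst c" "R > 0" "cball (snd c x) R \<subseteq> snd c ` fst c" by (rule chart_ball)
  let ?C = "chart_inv c ` cball (snd c x) R"
  have "compact ?C"
    by (rule compact_continuous_image[OF continuous_on_subset[OF continuous_on_chart_inv[OF c(1)] c(4)]]) simp
  moreover have "?C \<subseteq> fst c" using c(4) chart_inv_mem[OF c(1)] by auto
  ultimately obtain \<mu> \<Lambda> where "\<mu> > 0" "\<Lambda> > 0" "\<And>y v. y \<in> ?C \<Longrightarrow> \<mu> * norm v \<le> sqrt (quad c y v)"
      and \<Lambda>: "\<And>y v. y \<in> ?C \<Longrightarrow> sqrt (quad c y v) \<le> \<Lambda> * norm v"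
    using quad_bounds[OF c(1), of ?C] by metis
  let ?N = "chart_inv c ` ball (snd c x) R"
  have N: "open ?N" by (rule open_chart_inv_image[OF c(1)]) (use c(4) ball_subset_cball in auto)
  have xN: "x \<in> ?N" using c chart_inv_left[OF c(1,2)] by (intro image_eqI[of _ _ "snd c x"]) auto
  have from_x: "\<exists>\<gamma>. pwC1 \<gamma> 0 1 \<and> \<gamma> 0 = x \<and> \<gamma> 1 = y" if yN: "y \<in> ?N" for y
  proof -
    obtain z where z: "z \<in> ball (snd c x) R" "y = chart_inv c z" using yN by blast
    show ?thesis using chart_segment[OF c(1,3,4,2) z(1) \<Lambda>] z(2) by metis
  qed
  have to_x: "\<exists>\<gamma>. pwC1 \<gamma> 0 1 \<and> \<gamma> 0 = y \<and> \<gamma> 1 = x" if "y \<in> ?N" for y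
  proof -
    obtain \<gamma> where "pwC1 \<gamma> 0 1" "\<gamma> 0 = x" "\<gamma> 1 = y" using from_x[OF \<open>y \<in> ?N\<close>] by blast
    then show ?thesis using pwC1_reverse[of \<gamma>] by (intro exI[of _ "\<lambda>t. \<gamma> (1 - t)"]) simp
  qed
  show "\<exists>T. openin (top_of_set UNIV) T \<and> x \<in> T \<and> (\<forall>y\<in>T. \<forall>z\<in>T. True \<and> True \<longrightarrow> (\<exists>\<gamma>. pwC1 \<gamma> 0 1 \<and> \<gamma> 0 = y \<and> \<gamma> 1 = z))"
  proof (intro exI[of _ ?N] conjI ballI impI)
    fix y z assume "y \<in> ?N" "z \<in> ?N"
    then obtain \<gamma> \<delta> where "pwC1 \<gamma> 0 1" "\<gamma> 0 = y" "\<gamma> 1 = x" "pwC1 \<delta> 0 1" "\<delta> 0 = x" "\<delta> 1 = z"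
      using to_x from_x by blast
    then show "\<exists>\<gamma>. pwC1 \<gamma> 0 1 \<and> \<gamma> 0 = y \<and> \<gamma> 1 = z"
      using join_curves(1)[of \<gamma> \<delta>] by (intro exI[of _ "\<lambda>t. if t \<le> 1 / 2 then \<gamma> (2 * t) else \<delta> (2 * t - 1)"]) auto
  qed (use N xN in auto)
qed auto

lemma rdist_nonneg: "0 \<le> rdist x y"
  unfolding riemannian_dist_def piecewise_C1_curve_iff
  using ex_curve[of x y] by (intro cInf_greatest) (auto intro: curve_length_nonneg)

lemma rdist_commute_le: "rdist y x \<le> rdist x y"
  unfolding riemannian_dist_def[of _ _ x y] piecewise_C1_curve_iff
proof (rule cInf_greatest)
  show "{curve_length atlas g \<gamma> |\<gamma>. pwC1 \<gamma> 0 1 \<and> \<gamma> 0 = x \<and> \<gamma> 1 = y} \<noteq> {}" using ex_curve by auto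
  fix r assume "r \<in> {curve_length atlas g \<gamma> |\<gamma>. pwC1 \<gamma> 0 1 \<and> \<gamma> 0 = x \<and> \<gamma> 1 = y}"
  then obtain \<gamma> where \<gamma>: "pwC1 \<gamma> 0 1" "\<gamma> 0 = x" "\<gamma> 1 = y" "r = curve_length atlas g \<gamma>" by blast
  have "rdist (\<gamma> (1 - 0)) (\<gamma> (1 - 1)) \<le> curve_length atlas g (\<lambda>t. \<gamma> (1 - t))"
    by (rule rdist_le_curve_length[OF pwC1_reverse[OF \<gamma>(1)]])
  then show "rdist y x \<le> r" using \<gamma> by (simp add: curve_length_reverse)
qed

lemma rdist_commute: "rdist x y = rdist y x"
  using rdist_commute_le by (simp add: antisym)

lemma rdist_triangle: "rdist x z \<le> rdist x y + rdist y z"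
proof (rule field_le_epsilon)
  fix e :: real assume e: "e > 0"
  have ex: "\<exists>\<gamma>. pwC1 \<gamma> 0 1 \<and> \<gamma> 0 = a \<and> \<gamma> 1 = b \<and> curve_length atlas g \<gamma> < rdist a b + e / 2" for a b
  proof -
    let ?L = "{curve_length atlas g \<gamma> |\<gamma>. pwC1 \<gamma> 0 1 \<and> \<gamma> 0 = a \<and> \<gamma> 1 = b}"
    have ne: "?L \<noteq> {}" using ex_curve by auto
    have lt: "Inf ?L < rdist a b + e / 2"
      using e by (simp add: riemannian_dist_def piecewise_C1_curve_iff)
    from cInf_lessD[OF ne lt] obtain r where "r \<in> ?L" "r < rdist a b + e / 2" ..
    then obtain \<gamma> where "pwC1 \<gamma> 0 1" "\<gamma> 0 = a" "\<gamma> 1 = b" "curve_length atlas g \<gamma> < rdist a b + e / 2"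
      by auto
    then show ?thesis by (intro exI[of _ \<gamma>] conjI)
  qed
  obtain \<gamma> where \<gamma>: "pwC1 \<gamma> 0 1" "\<gamma> 0 = x" "\<gamma> 1 = y" "curve_length atlas g \<gamma> < rdist x y + e / 2"
    using ex by blast
  obtain \<delta> where \<delta>: "pwC1 \<delta> 0 1" "\<delta> 0 = y" "\<delta> 1 = z" "curve_length atlas g \<delta> < rdist y z + e / 2"
    using ex by blast
  let ?\<beta> = "\<lambda>t. if t \<le> 1 / 2 then \<gamma> (2 * t) else \<delta> (2 * t - 1)"
  have eq: "\<gamma> 1 = \<delta> 0" using \<gamma> \<delta> by simp
  have "rdist (?\<beta> 0) (?\<beta> 1) \<le> curve_length atlas g ?\<beta>"
    by (rule rdist_le_curve_length[OF join_curves(1)[OF \<gamma>(1) \<delta>(1) eq]])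
  also have "\<dots> = curve_length atlas g \<gamma> + curve_length atlas g \<delta>" by (rule join_curves(2)[OF \<gamma>(1) \<delta>(1) eq])
  finally have "rdist x z \<le> curve_length atlas g \<gamma> + curve_length atlas g \<delta>" using \<gamma>(2) \<delta>(3) by simp
  also have "\<dots> \<le> rdist x y + rdist y z + e" using \<gamma>(4) \<delta>(4) by linarith
  finally show "rdist x z \<le> rdist x y + rdist y z + e" .
qed

text \<open>Up to the first exit from the chart ball the speed is at least \<open>\<mu>\<close> times the
  Euclidean speed in the chart, and at the exit the Euclidean displacement is \<open>\<rho>\<close>.\<close>
lemma curve_length_exit:
  assumes c: "c \<in> atlas" "x \<in> fst c" and \<rho>: "\<rho> > 0" "cball (snd c x) \<rho> \<subseteq> snd c ` fst c"
    and \<mu>: "\<mu> > 0" "\<And>y v. y \<in> chart_inv c ` cball (snd c x) \<rho> \<Longrightarrow> \<mu> * norm v \<le> sqrt (quad c y v)"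
    and \<gamma>: "pwC1 \<gamma> 0 1" "\<gamma> 0 = x" "\<gamma> 1 \<notin> chart_inv c ` ball (snd c x) \<rho>"
  shows "\<mu> * \<rho> \<le> curve_length atlas g \<gamma>"
proof -
  let ?p = "snd c x" let ?N = "chart_inv c ` ball ?p \<rho>" and ?C = "chart_inv c ` cball ?p \<rho>"
  let ?s = "curve_speed atlas g \<gamma>"
  have cont: "continuous_on {0..1} \<gamma>" by (rule pwC1_facts(2)[OF \<gamma>(1)])
  have int: "?s integrable_on {0..1}" by (rule pwC1_facts(3)[OF \<gamma>(1)])
  obtain S where S: "finite S" "\<And>t c. t \<in> {0<..<1} - S \<Longrightarrow> c \<in> atlas \<Longrightarrow> \<gamma> t \<in> fst c \<Longrightarrow>
      \<exists>v. (snd c \<circ> \<gamma> has_vector_derivative v) (at t)"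
    using pwC1_facts(4)[OF \<gamma>(1)] by blast
  have N: "open ?N" by (rule open_chart_inv_image[OF c(1)]) (use \<rho>(2) ball_subset_cball in auto)
  have "compact ?C"
    by (rule compact_continuous_image[OF continuous_on_subset[OF continuous_on_chart_inv[OF c(1)] \<rho>(2)]]) simp
  then have C: "closed ?C" by (rule compact_imp_closed)
  have Cc: "?C \<subseteq> fst c" using \<rho>(2) chart_inv_mem[OF c(1)] by auto
  have NC: "?N \<subseteq> ?C" using ball_subset_cball by blast
  have inC: "y \<in> ?C \<Longrightarrow> norm (snd c y - ?p) \<le> \<rho>" for y
    using \<rho>(2) by (auto simp: chart_inv_right[OF c(1)] dist_norm norm_minus_commute subset_iff)
  have inN: "y \<in> ?N" if "y \<in> ?C" "norm (snd c y - ?p) < \<rho>" for y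
  proof -
    have "chart_inv c (snd c y) = y" using that(1) Cc by (intro chart_inv_left[OF c(1)]) auto
    then show ?thesis using that(2) by (intro image_eqI[of _ _ "snd c y"]) (auto simp: dist_norm norm_minus_commute)
  qed
  define T where "T = {t \<in> {0..1}. \<gamma> t \<in> - ?N}"
  have "closed T"
    unfolding T_def using continuous_closed_preimage[OF cont closed_atLeastAtMost, of "- ?N"] N
    by (simp add: vimage_def Int_def conj_commute closed_Compl)
  moreover have Tne: "T \<noteq> {}" using \<gamma>(3) by (auto simp: T_def)
  moreover have Tb: "bdd_below T" by (auto simp: T_def intro: bdd_belowI[of _ 0])
  ultimately have t1T: "Inf T \<in> T" by (intro closed_contains_Inf)
  define t1 where "t1 = Inf T"
  have t1: "t1 \<in> {0..1}" "\<gamma> t1 \<notin> ?N" using t1T by (auto simp: T_def t1_def)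
  have before: "\<gamma> t \<in> ?N" if "0 \<le> t" "t < t1" for t
  proof (rule ccontr)
    assume "\<not> ?thesis"
    then have "t \<in> T" using that t1 by (auto simp: T_def)
    then have "t1 \<le> t" unfolding t1_def by (rule cInf_lower[OF _ Tb])
    then show False using that by simp
  qed
  have xN: "x \<in> ?N" using c \<rho> chart_inv_left[OF c] by (intro image_eqI[of _ _ ?p]) auto
  have t1pos: "0 < t1" using t1 xN \<gamma>(2) by (cases "t1 = 0") auto
  have t1C: "\<gamma> t1 \<in> ?C"
  proof (rule ccontr)
    assume "\<gamma> t1 \<notin> ?C"
    then have t1C': "t1 \<in> {t \<in> {0..t1}. \<gamma> t \<in> - ?C}" using t1pos by simp
    have ct1: "continuous_on {0..t1} \<gamma>" by (rule continuous_on_subset[OF cont]) (use t1 in auto)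
    have "openin (top_of_set {0..t1}) ({0..t1} \<inter> \<gamma> -` (- ?C))"
      using ct1 C by (simp add: continuous_openin_preimage_gen open_Compl)
    then obtain U where U: "open U" "{0..t1} \<inter> \<gamma> -` (- ?C) = {0..t1} \<inter> U" by (auto simp: openin_open)
    then have "t1 \<in> U" using t1C' by auto
    then obtain e where e: "e > 0" "ball t1 e \<subseteq> U" using U(1) open_contains_ball by blast
    define t where "t = max 0 (t1 - e / 2)"
    have t: "0 \<le> t" "t < t1" "t \<in> U" using t1pos e by (auto simp: t_def dist_real_def subset_iff)
    then have "\<gamma> t \<notin> ?C" using U(2) by auto
    then show False using before[OF t(1,2)] NC by blast
  qed
  have norm_t1: "norm (snd c (\<gamma> t1) - ?p) = \<rho>"
    using inC[OF t1C] inN[OF t1C] t1(2) by fastforce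
  have inCt: "\<gamma> t \<in> ?C" if "t \<in> {0..t1}" for t
    using that before[of t] NC t1C by (cases "t = t1") auto
  define v where "v t = vector_derivative (snd c \<circ> \<gamma>) (at t)" for t
  have vd: "(snd c \<circ> \<gamma> has_vector_derivative v t) (at t)" "?s t = sqrt (quad c (\<gamma> t) (v t))"
    if t: "t \<in> {0<..<t1} - S" for t
  proof -
    have t': "t \<in> {0<..<1}" "\<gamma> t \<in> fst c" using t t1 inCt[of t] Cc by auto
    obtain w where w: "(snd c \<circ> \<gamma> has_vector_derivative w) (at t)" using S(2)[of t c] t t' c(1) by auto
    then have "v t = w" unfolding v_def by (rule vector_derivative_at)
    then show 1: "(snd c \<circ> \<gamma> has_vector_derivative v t) (at t)" using w by simp
    show "?s t = sqrt (quad c (\<gamma> t) (v t))"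
      by (rule curve_speed_eq[OF c(1) t' _ 1]) (rule continuous_on_subset[OF cont], auto)
  qed
  have contc: "continuous_on {0..t1} (snd c \<circ> \<gamma>)"
    by (rule continuous_on_compose[OF continuous_on_subset[OF cont] continuous_on_subset[OF continuous_on_chart[OF c(1)]]])
      (use t1 inCt Cc in auto)
  have vint: "(v has_integral (snd c (\<gamma> t1) - snd c (\<gamma> 0))) {0..t1}"
    using fundamental_theorem_of_calculus_interior_strong[of "S" 0 t1 "snd c \<circ> \<gamma>" v] S(1) t1pos contc vd(1)
    by (auto simp: box_real)
  let ?v' = "\<lambda>t. if t \<in> S \<union> {0, t1} then 0 else v t"
  let ?s' = "\<lambda>t. if t \<in> S \<union> {0, t1} then 0 else ?s t / \<mu>"
  have v'int: "(?v' has_integral (snd c (\<gamma> t1) - snd c (\<gamma> 0))) {0..t1}"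
    by (rule has_integral_spike_finite[of "S \<union> {0, t1}", OF _ _ vint]) (use S(1) in auto)
  have sint: "?s integrable_on {0..t1}"
    using integrable_on_subinterval[OF int, of 0 t1] t1 by auto
  have "((\<lambda>t. ?s t / \<mu>) has_integral (integral {0..t1} ?s / \<mu>)) {0..t1}"
    using has_integral_divide[OF integrable_integral[OF sint], of \<mu>] by simp
  then have s'int: "(?s' has_integral (integral {0..t1} ?s / \<mu>)) {0..t1}"
    by (rule has_integral_spike_finite[of "S \<union> {0, t1}", rotated 2]) (use S(1) in auto)
  have "norm (integral {0..t1} ?v') \<le> integral {0..t1} ?s'"
  proof (rule Henstock_Kurzweil_Integration.integral_norm_bound_integral)
    show "?v' integrable_on {0..t1}" using v'int by blast
    show "?s' integrable_on {0..t1}" using s'int by blast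
    fix t assume t: "t \<in> {0..t1}"
    show "norm (?v' t) \<le> ?s' t"
    proof (cases "t \<in> S \<union> {0, t1}")
      case False
      then have t': "t \<in> {0<..<t1} - S" using t by auto
      have "\<mu> * norm (v t) \<le> ?s t" unfolding vd(2)[OF t'] by (rule \<mu>(2)[OF inCt[OF t]])
      then show ?thesis using False \<mu>(1) by (auto simp: field_simps)
    qed simp
  qed
  then have "\<rho> \<le> integral {0..t1} ?s / \<mu>"
    using integral_unique[OF v'int] integral_unique[OF s'int] norm_t1 \<gamma>(2) by simp
  then have "\<mu> * \<rho> \<le> integral {0..t1} ?s" using \<mu>(1) by (simp add: field_simps)
  also have "\<dots> \<le> integral {0..1} ?s"
    by (rule integral_subset_le[OF _ sint int]) (use t1 curve_speed_nonneg in auto)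
  finally show ?thesis by (simp add: curve_length_def)
qed

text \<open>A curve that leaves a chart ball is long, so a small Riemannian ball lies inside the chart ball. A
  chart segment is short, so a small chart ball lies inside the Riemannian ball.\<close>
lemma open_iff_rdist: "open U \<longleftrightarrow> (\<forall>x\<in>U. \<exists>e>0. \<forall>y. rdist x y < e \<longrightarrow> y \<in> U)"
proof
  have chart_bounds: "\<exists>c R \<mu> \<Lambda>. c \<in> atlas \<and> x \<in> fst c \<and> R > 0 \<and> cball (snd c x) R \<subseteq> snd c ` fst c \<and> \<mu> > 0 \<and> \<Lambda> > 0 \<and>
      (\<forall>y v. y \<in> chart_inv c ` cball (snd c x) R \<longrightarrow> \<mu> * norm v \<le> sqrt (quad c y v) \<and> sqrt (quad c y v) \<le> \<Lambda> * norm v)" for x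
  proof -
    obtain c R where c: "c \<in> atlas" "x \<in> fst c" "R > 0" "cball (snd c x) R \<subseteq> snd c ` fst c" by (rule chart_ball)
    let ?C = "chart_inv c ` cball (snd c x) R"
    have "compact ?C"
      by (rule compact_continuous_image[OF continuous_on_subset[OF continuous_on_chart_inv[OF c(1)] c(4)]]) simp
    moreover have "?C \<subseteq> fst c" using c(4) chart_inv_mem[OF c(1)] by auto
    ultimately obtain \<mu> \<Lambda> where "\<mu> > 0" "\<Lambda> > 0" "\<And>y v. y \<in> ?C \<Longrightarrow> \<mu> * norm v \<le> sqrt (quad c y v)"
        "\<And>y v. y \<in> ?C \<Longrightarrow> sqrt (quad c y v) \<le> \<Lambda> * norm v"
      using quad_bounds[OF c(1), of ?C] by metis
    then show ?thesis using c by blast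
  qed
  {
    assume U: "open U"
    show "\<forall>x\<in>U. \<exists>e>0. \<forall>y. rdist x y < e \<longrightarrow> y \<in> U"
    proof
      fix x assume x: "x \<in> U"
      obtain c R \<mu> \<Lambda> where c: "c \<in> atlas" "x \<in> fst c" "R > 0" "cball (snd c x) R \<subseteq> snd c ` fst c" "\<mu> > 0"
          and \<mu>: "\<And>y v. y \<in> chart_inv c ` cball (snd c x) R \<Longrightarrow> \<mu> * norm v \<le> sqrt (quad c y v)"
        using chart_bounds[of x] by blast
      have "open (snd c ` fst c \<inter> chart_inv c -` U)"
        by (rule continuous_open_preimage[OF continuous_on_chart_inv[OF c(1)] chart_range[OF c(1)] U])
      moreover have "snd c x \<in> snd c ` fst c \<inter> chart_inv c -` U" using c x chart_inv_left[OF c(1,2)] by auto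
      ultimately obtain r where r: "r > 0" "ball (snd c x) r \<subseteq> snd c ` fst c \<inter> chart_inv c -` U"
        using open_contains_ball by blast
      define \<rho> where "\<rho> = min R r"
      have \<rho>: "\<rho> > 0" "\<rho> \<le> R" "\<rho> \<le> r" using c r by (auto simp: \<rho>_def)
      have sub: "cball (snd c x) \<rho> \<subseteq> cball (snd c x) R" using \<rho> by auto
      have "y \<in> U" if y: "rdist x y < \<mu> * \<rho>" for y
      proof (rule ccontr)
        assume "y \<notin> U"
        then have yN: "y \<notin> chart_inv c ` ball (snd c x) \<rho>" using r(2) \<rho>(3) by (auto simp: subset_iff)
        have "\<mu> * \<rho> \<le> rdist x y"
          unfolding riemannian_dist_def piecewise_C1_curve_iff
        proof (rule cInf_greatest)
          show "{curve_length atlas g \<gamma> |\<gamma>. pwC1 \<gamma> 0 1 \<and> \<gamma> 0 = x \<and> \<gamma> 1 = y} \<noteq> {}" using ex_curve by auto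
          fix l assume "l \<in> {curve_length atlas g \<gamma> |\<gamma>. pwC1 \<gamma> 0 1 \<and> \<gamma> 0 = x \<and> \<gamma> 1 = y}"
          then obtain \<gamma> where \<gamma>: "pwC1 \<gamma> 0 1" "\<gamma> 0 = x" "\<gamma> 1 = y" "l = curve_length atlas g \<gamma>" by blast
          show "\<mu> * \<rho> \<le> l"
            unfolding \<gamma>(4)
            by (rule curve_length_exit[OF c(1,2) \<rho>(1) _ c(5) _ \<gamma>(1,2)]) (use sub c(4) \<mu> \<gamma>(3) yN in auto)
        qed
        then show False using y by simp
      qed
      then show "\<exists>e>0. \<forall>y. rdist x y < e \<longrightarrow> y \<in> U" using c(5) \<rho>(1) by (intro exI[of _ "\<mu> * \<rho>"]) auto
    qed
  }
  {
    assume U: "\<forall>x\<in>U. \<exists>e>0. \<forall>y. rdist x y < e \<longrightarrow> y \<in> U"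
    show "open U"
    proof (rule Topological_Spaces.openI)
      fix x assume "x \<in> U"
      then obtain e where e: "e > 0" "\<And>y. rdist x y < e \<Longrightarrow> y \<in> U" using U by blast
      obtain c R \<mu> \<Lambda> where c: "c \<in> atlas" "x \<in> fst c" "R > 0" "cball (snd c x) R \<subseteq> snd c ` fst c" "\<Lambda> > 0"
          and \<Lambda>: "\<And>y v. y \<in> chart_inv c ` cball (snd c x) R \<Longrightarrow> sqrt (quad c y v) \<le> \<Lambda> * norm v"
        using chart_bounds[of x] by blast
      define r where "r = min R (e / \<Lambda>)"
      have r: "r > 0" "r \<le> R" "\<Lambda> * r \<le> e" using c e by (auto simp: r_def min_def field_simps)
      let ?N = "chart_inv c ` ball (snd c x) r"
      have rs: "ball (snd c x) r \<subseteq> snd c ` fst c" using c(4) r(2) by (auto simp: subset_iff)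
      have "?N \<subseteq> U"
      proof
        fix y assume "y \<in> ?N"
        then obtain z where z: "z \<in> ball (snd c x) r" "y = chart_inv c z" by blast
        have zR: "z \<in> ball (snd c x) R" using z(1) r(2) by auto
        obtain \<gamma> where \<gamma>: "pwC1 \<gamma> 0 1" "\<gamma> 0 = x" "\<gamma> 1 = chart_inv c z"
            "curve_length atlas g \<gamma> \<le> \<Lambda> * norm (z - snd c x)"
          using chart_segment[OF c(1,3,4,2) zR \<Lambda>] by blast
        have "rdist x y \<le> \<Lambda> * norm (z - snd c x)" using rdist_le_curve_length[OF \<gamma>(1)] \<gamma> z by simp
        also have "\<dots> < \<Lambda> * r" using z(1) c(5) by (intro mult_strict_left_mono) (auto simp: dist_norm norm_minus_commute)
        finally show "y \<in> U" using e(2) r(3) by simp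
      qed
      moreover have "open ?N" by (rule open_chart_inv_image[OF c(1) _ rs]) simp
      moreover have "x \<in> ?N" using c r chart_inv_left[OF c(1,2)] by (intro image_eqI[of _ _ "snd c x"]) auto
      ultimately show "\<exists>T. open T \<and> x \<in> T \<and> T \<subseteq> U" by blast
    qed
  }
qed

lemma rdist_self: "rdist x x = 0"
proof (rule antisym[OF _ rdist_nonneg])
  obtain c R where c: "c \<in> atlas" "x \<in> fst c" "R > 0" "cball (snd c x) R \<subseteq> snd c ` fst c" by (rule chart_ball)
  let ?C = "chart_inv c ` cball (snd c x) R"
  have "compact ?C"
    by (rule compact_continuous_image[OF continuous_on_subset[OF continuous_on_chart_inv[OF c(1)] c(4)]]) simp
  moreover have "?C \<subseteq> fst c" using c(4) chart_inv_mem[OF c(1)] by auto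
  ultimately obtain \<mu> \<Lambda> where \<Lambda>: "\<And>y v. y \<in> ?C \<Longrightarrow> sqrt (quad c y v) \<le> \<Lambda> * norm v"
    using quad_bounds[OF c(1), of ?C] by metis
  have z: "snd c x \<in> ball (snd c x) R" using c by simp
  obtain \<gamma> where \<gamma>: "pwC1 \<gamma> 0 1" "\<gamma> 0 = x" "\<gamma> 1 = chart_inv c (snd c x)"
      "curve_length atlas g \<gamma> \<le> \<Lambda> * norm (snd c x - snd c x)"
    using chart_segment[OF c(1,3,4,2) z \<Lambda>] by blast
  then show "rdist x x \<le> 0" using rdist_le_curve_length[OF \<gamma>(1)] chart_inv_left[OF c(1,2)] by simp
qed

lemma rdist_metric: "Metric_space UNIV rdist"
proof
  fix x y z
  show "0 \<le> rdist x y" by (rule rdist_nonneg)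
  show "rdist x y = rdist y x" by (rule rdist_commute)
  show "rdist x z \<le> rdist x y + rdist y z" by (rule rdist_triangle)
  show "(rdist x y = 0) = (x = y)"
  proof
    assume 0: "rdist x y = 0"
    show "x = y"
    proof (rule ccontr)
      assume "x \<noteq> y"
      then have "open (- {y})" "x \<in> - {y}" by auto
      then obtain e where "e > 0" "\<And>z. rdist x z < e \<Longrightarrow> z \<in> - {y}" using open_iff_rdist by blast
      then show False using 0 by force
    qed
  qed (simp add: rdist_self)
qed

end

section \<open>Twists of balls\<close>

text \<open>Rotation by the angle \<open>\<theta>\<close> in the plane of \<open>u\<close> and
  \<open>w\<close>.\<close>
definition plane_rotation :: "'a::euclidean_space \<Rightarrow> 'a \<Rightarrow> real \<Rightarrow> 'a \<Rightarrow> 'a" where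
  "plane_rotation u w \<theta> x = x
     + ((cos \<theta> - 1) * (x \<bullet> u) - sin \<theta> * (x \<bullet> w)) *\<^sub>R u
     + (sin \<theta> * (x \<bullet> u) + (cos \<theta> - 1) * (x \<bullet> w)) *\<^sub>R w"

text \<open>The angle is \<open>pi\<close> up to radius \<open>\<rho>\<close> and decreases linearly to 0 at
  radius 1.\<close>
definition twist_angle :: "real \<Rightarrow> real \<Rightarrow> real" where
  "twist_angle \<rho> s = max 0 (min pi (pi * (1 - s) / (1 - \<rho>)))"

locale orthonormal_pair =
  fixes u w :: "'a::euclidean_space"
  assumes uu: "u \<bullet> u = 1" and ww: "w \<bullet> w = 1" and uw: "u \<bullet> w = 0"
begin

lemma wu: "w \<bullet> u = 0" using uw by (simp add: inner_commute)

abbreviation "R \<equiv> plane_rotation u w"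

lemma linear_rotation: "linear (R \<theta>)"
  by (rule linearI) (simp_all add: plane_rotation_def algebra_simps scaleR_add_left)

lemma rotation_inner_u: "R \<theta> x \<bullet> u = cos \<theta> * (x \<bullet> u) - sin \<theta> * (x \<bullet> w)"
  by (simp add: plane_rotation_def inner_add_left uu wu algebra_simps)

lemma rotation_inner_w: "R \<theta> x \<bullet> w = sin \<theta> * (x \<bullet> u) + cos \<theta> * (x \<bullet> w)"
  by (simp add: plane_rotation_def inner_add_left ww uw algebra_simps)

lemma rotation_add: "R \<alpha> (R \<beta> x) = R (\<alpha> + \<beta>) x"
proof -
  define a b where "a = x \<bullet> u" and "b = x \<bullet> w"
  define P Q where "P = (cos \<beta> - 1) * a - sin \<beta> * b" and "Q = sin \<beta> * a + (cos \<beta> - 1) * b"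
  define P' Q' where "P' = (cos \<alpha> - 1) * (cos \<beta> * a - sin \<beta> * b) - sin \<alpha> * (sin \<beta> * a + cos \<beta> * b)"
    and "Q' = sin \<alpha> * (cos \<beta> * a - sin \<beta> * b) + (cos \<alpha> - 1) * (sin \<beta> * a + cos \<beta> * b)"
  have "R \<alpha> (R \<beta> x) = (x + P *\<^sub>R u + Q *\<^sub>R w) + P' *\<^sub>R u + Q' *\<^sub>R w"
    unfolding plane_rotation_def[of u w \<alpha>] rotation_inner_u rotation_inner_w
    unfolding plane_rotation_def[of u w \<beta>]
    by (simp only: P_def Q_def P'_def Q'_def a_def b_def)
  also have "\<dots> = x + (P + P') *\<^sub>R u + (Q + Q') *\<^sub>R w" by (simp add: scaleR_add_left)
  also have "P + P' = (cos (\<alpha> + \<beta>) - 1) * a - sin (\<alpha> + \<beta>) * b"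
    unfolding P_def P'_def cos_add sin_add by (simp add: algebra_simps)
  also have "Q + Q' = sin (\<alpha> + \<beta>) * a + (cos (\<alpha> + \<beta>) - 1) * b"
    unfolding Q_def Q'_def cos_add sin_add by (simp add: algebra_simps)
  finally show ?thesis by (simp add: plane_rotation_def a_def b_def)
qed

lemma rotation_0 [simp]: "R 0 x = x" by (simp add: plane_rotation_def)

lemma rotation_of_0 [simp]: "R \<theta> 0 = 0" by (simp add: plane_rotation_def)

lemma rotation_cancel [simp]: "R \<theta> (R (- \<theta>) x) = x" "R (- \<theta>) (R \<theta> x) = x"
  by (simp_all add: rotation_add)

lemma norm_rotation [simp]: "norm (R \<theta> x) = norm x"
proof -
  define a b where "a = x \<bullet> u" and "b = x \<bullet> w"
  define A B where "A = (cos \<theta> - 1) * a - sin \<theta> * b" and "B = sin \<theta> * a + (cos \<theta> - 1) * b"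
  have "R \<theta> x = x + A *\<^sub>R u + B *\<^sub>R w" by (simp only: plane_rotation_def A_def B_def a_def b_def)
  then have "R \<theta> x \<bullet> R \<theta> x = x \<bullet> x + (2 * A * a + 2 * B * b + A\<^sup>2 + B\<^sup>2)"
    by (simp add: inner_add_left inner_add_right uu ww uw wu power2_eq_square a_def b_def
        inner_commute[of u x] inner_commute[of w x] distrib_left)
  also have "2 * A * a + 2 * B * b + A\<^sup>2 + B\<^sup>2 = (a\<^sup>2 + b\<^sup>2) * ((cos \<theta>)\<^sup>2 + (sin \<theta>)\<^sup>2 - 1)"
    unfolding A_def B_def by (simp only: power2_eq_square) algebra
  finally have "R \<theta> x \<bullet> R \<theta> x = x \<bullet> x" by simp
  then show ?thesis by (simp add: norm_eq_sqrt_inner)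
qed

lemma norm_rotation_diff_le: "norm (R \<alpha> x - R \<beta> x) \<le> 4 * \<bar>\<alpha> - \<beta>\<bar> * norm x"
proof -
  have half: "\<bar>sin ((\<gamma> - \<delta>) / 2)\<bar> \<le> \<bar>\<gamma> - \<delta>\<bar> / 2" for \<gamma> \<delta> :: real
    using abs_sin_x_le_abs_x[of "(\<gamma> - \<delta>) / 2"] by simp
  have s: "\<bar>sin \<alpha> - sin \<beta>\<bar> \<le> \<bar>\<alpha> - \<beta>\<bar>"
  proof -
    have "\<bar>sin \<alpha> - sin \<beta>\<bar> = 2 * (\<bar>sin ((\<alpha> - \<beta>) / 2)\<bar> * \<bar>cos ((\<alpha> + \<beta>) / 2)\<bar>)"
      by (simp add: sin_diff_sin abs_mult)
    also have "\<dots> \<le> 2 * ((\<bar>\<alpha> - \<beta>\<bar> / 2) * 1)"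
      by (intro mult_left_mono mult_mono half) auto
    finally show ?thesis by simp
  qed
  have c: "\<bar>cos \<alpha> - cos \<beta>\<bar> \<le> \<bar>\<alpha> - \<beta>\<bar>"
  proof -
    have "\<bar>cos \<alpha> - cos \<beta>\<bar> = 2 * (\<bar>sin ((\<beta> - \<alpha>) / 2)\<bar> * \<bar>sin ((\<alpha> + \<beta>) / 2)\<bar>)"
      by (simp add: cos_diff_cos abs_mult)
    also have "\<dots> \<le> 2 * ((\<bar>\<beta> - \<alpha>\<bar> / 2) * 1)"
      by (intro mult_left_mono mult_mono half) auto
    finally show ?thesis by (simp add: abs_minus_commute)
  qed
  have nu: "norm u = 1" "norm w = 1" using uu ww by (simp_all add: norm_eq_sqrt_inner)
  have xu: "\<bar>x \<bullet> u\<bar> \<le> norm x" and xw: "\<bar>x \<bullet> w\<bar> \<le> norm x"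
    using Cauchy_Schwarz_ineq2[of x u] Cauchy_Schwarz_ineq2[of x w] nu by auto
  have "R \<alpha> x - R \<beta> x = ((cos \<alpha> - cos \<beta>) * (x \<bullet> u) - (sin \<alpha> - sin \<beta>) * (x \<bullet> w)) *\<^sub>R u
      + ((sin \<alpha> - sin \<beta>) * (x \<bullet> u) + (cos \<alpha> - cos \<beta>) * (x \<bullet> w)) *\<^sub>R w"
    by (simp add: plane_rotation_def algebra_simps)
  also have "norm \<dots> \<le> \<bar>(cos \<alpha> - cos \<beta>) * (x \<bullet> u) - (sin \<alpha> - sin \<beta>) * (x \<bullet> w)\<bar>
      + \<bar>(sin \<alpha> - sin \<beta>) * (x \<bullet> u) + (cos \<alpha> - cos \<beta>) * (x \<bullet> w)\<bar>"
    by (rule norm_triangle_le) (simp add: nu)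
  also have "\<dots> \<le> (\<bar>(cos \<alpha> - cos \<beta>) * (x \<bullet> u)\<bar> + \<bar>(sin \<alpha> - sin \<beta>) * (x \<bullet> w)\<bar>)
      + (\<bar>(sin \<alpha> - sin \<beta>) * (x \<bullet> u)\<bar> + \<bar>(cos \<alpha> - cos \<beta>) * (x \<bullet> w)\<bar>)"
    by (intro add_mono abs_triangle_ineq abs_triangle_ineq4)
  also have "\<dots> \<le> (\<bar>\<alpha> - \<beta>\<bar> * norm x + \<bar>\<alpha> - \<beta>\<bar> * norm x) + (\<bar>\<alpha> - \<beta>\<bar> * norm x + \<bar>\<alpha> - \<beta>\<bar> * norm x)"
    unfolding abs_mult by (intro add_mono mult_mono c s xu xw) auto
  finally show ?thesis by (simp add: mult_ac)
qed

end

lemma abs_twist_angle_diff_le: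
  assumes "\<rho> < 1"
  shows "\<bar>twist_angle \<rho> s - twist_angle \<rho> t\<bar> \<le> pi / (1 - \<rho>) * \<bar>s - t\<bar>"
proof -
  have "\<bar>twist_angle \<rho> s - twist_angle \<rho> t\<bar> \<le> \<bar>pi * (1 - s) / (1 - \<rho>) - pi * (1 - t) / (1 - \<rho>)\<bar>"
    unfolding twist_angle_def by linarith
  also have "pi * (1 - s) / (1 - \<rho>) - pi * (1 - t) / (1 - \<rho>) = pi / (1 - \<rho>) * (t - s)"
    by (simp add: diff_divide_distrib[symmetric] algebra_simps)
  finally show ?thesis using assms by (simp add: abs_mult abs_minus_commute)
qed

lemma twist_angle_outside:
  assumes "\<rho> < 1" "1 \<le> s" shows "twist_angle \<rho> s = 0"
proof -
  have "pi * (1 - s) / (1 - \<rho>) \<le> 0"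
    using assms by (intro divide_nonpos_pos mult_nonneg_nonpos) auto
  then show ?thesis unfolding twist_angle_def by linarith
qed

lemma twist_angle_inside: "\<rho> < 1 \<Longrightarrow> twist_angle \<rho> \<rho> = pi"
  by (simp add: twist_angle_def)

section \<open>Volume preservation\<close>

text \<open>If the angle is replaced by a step function of \<open>q\<close>, then on each piece, a set defined
  by \<open>q\<close>, the map is one of the \<open>M \<alpha>\<close>, which preserves the piece; so the
  measure is preserved. In the limit, Fatou's lemma gives an inequality for open sets, and the same inequality
  for the inverse map, with the angle \<open>- \<theta>\<close>, makes it an equality.\<close>
lemma radial_family_preserves_lborel:
  fixes M :: "real \<Rightarrow> 'a::euclidean_space \<Rightarrow> 'a" and q :: "'a \<Rightarrow> real" and \<theta> :: "real \<Rightarrow> real"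
  assumes pres: "\<And>\<alpha> B. B \<in> sets borel \<Longrightarrow> emeasure lborel (M \<alpha> -` B) = emeasure lborel B"
    and cont: "continuous_on UNIV (\<lambda>(\<alpha>, x). M \<alpha> x)"
    and add: "\<And>\<alpha> \<beta> x. M \<alpha> (M \<beta> x) = M (\<alpha> + \<beta>) x" and M0: "\<And>x. M 0 x = x"
    and inv: "\<And>\<alpha> x. q (M \<alpha> x) = q x" and qcont: "continuous_on UNIV q"
    and thcont: "continuous_on UNIV \<theta>"
    and B: "B \<in> sets borel"
  shows "emeasure lborel ((\<lambda>x. M (\<theta> (q x)) x) -` B) = emeasure lborel B"
proof -
  have cont': "continuous_on UNIV (\<lambda>x. M (\<theta> (q x)) x)" if "continuous_on UNIV \<theta>" for \<theta>
    using continuous_on_compose2[OF cont, of UNIV "\<lambda>x. (\<theta> (q x), x)"]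
    by (simp add: continuous_on_Pair continuous_on_compose2[OF that qcont])
  have contM: "continuous_on UNIV (M \<alpha>)" for \<alpha>
    using continuous_on_compose2[OF cont, of UNIV "\<lambda>x. (\<alpha>, x)"] by (simp add: continuous_on_Pair)
  have [measurable]: "M \<alpha> \<in> borel_measurable borel" for \<alpha>
    by (rule borel_measurable_continuous_onI[OF contM])
  have [measurable]: "q \<in> borel_measurable borel" by (rule borel_measurable_continuous_onI[OF qcont])
  have step: "emeasure lborel ((\<lambda>x. M (\<theta> (q x)) x) -` U) \<le> emeasure lborel U"
    if U: "open U" and th: "continuous_on UNIV \<theta>" for U \<theta>
  proof -
    define P where "P n k = {x. \<lfloor>real (Suc n) * q x\<rfloor> = k}" for n k
    define T where "T n x = M (\<theta> (real_of_int \<lfloor>real (Suc n) * q x\<rfloor> / real (Suc n))) x" for n x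
    have [measurable]: "P n k \<in> sets borel" for n k unfolding P_def by measurable
    have [measurable]: "U \<in> sets borel" using U by simp
    have piece: "T n -` U \<inter> P n k = M (\<theta> (real_of_int k / real (Suc n))) -` (P n k \<inter> U)" for n k
      by (auto simp: T_def P_def inv)
    have Mpre: "M \<alpha> -` S \<in> sets borel" if "S \<in> sets borel" for \<alpha> S
      using measurable_sets[of "M \<alpha>" borel borel S] that by simp
    have un: "T n -` U = (\<Union>k. T n -` U \<inter> P n k)" for n by (auto simp: P_def)
    have pm: "T n -` U \<inter> P n k \<in> sets borel" for n k
      by (simp add: piece Mpre)
    have disj: "disjoint_family (P n)" for n by (auto simp: disjoint_family_on_def P_def)
    have Tm: "T n -` U \<in> sets borel" for n
      by (subst un) (intro sets.countable_UN'', auto intro: pm)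
    have Tpiece: "emeasure lborel (T n -` U \<inter> P n k) = emeasure lborel (P n k \<inter> U)" for n k
      unfolding piece by (rule pres) measurable
    have Tem: "emeasure lborel (T n -` U) = emeasure lborel U" for n
    proof -
      have "emeasure lborel (T n -` U) = (\<integral>\<^sup>+k. emeasure lborel (T n -` U \<inter> P n k) \<partial>count_space UNIV)"
        using disj[of n] pm by (subst un, intro emeasure_UN_countable) (auto simp: disjoint_family_on_def)
      also have "\<dots> = (\<integral>\<^sup>+k. emeasure lborel (P n k \<inter> U) \<partial>count_space UNIV)"
        by (intro nn_integral_cong) (rule Tpiece)
      also have "\<dots> = emeasure lborel (\<Union>k. P n k \<inter> U)"
        using disj[of n] by (intro emeasure_UN_countable[symmetric]) (auto simp: disjoint_family_on_def)
      also have "(\<Union>k. P n k \<inter> U) = U" by (auto simp: P_def)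
      finally show ?thesis .
    qed
    have lim: "(\<lambda>n. T n x) \<longlonglongrightarrow> M (\<theta> (q x)) x" for x
    proof -
      have "(\<lambda>n. real_of_int \<lfloor>real (Suc n) * q x\<rfloor> / real (Suc n)) \<longlonglongrightarrow> q x"
      proof (rule LIMSEQ_I)
        fix r :: real assume "r > 0"
        then obtain N where N: "inverse (real (Suc N)) < r" using reals_Archimedean by blast
        show "\<exists>no. \<forall>n\<ge>no. norm (real_of_int \<lfloor>real (Suc n) * q x\<rfloor> / real (Suc n) - q x) < r"
        proof (intro exI allI impI)
          fix n assume n: "n \<ge> N"
          define z where "z = real (Suc n)"
          have z: "z > 0" "inverse z \<le> inverse (real (Suc N))" using n by (auto simp: z_def intro!: le_imp_inverse_le)
          have "real_of_int \<lfloor>z * q x\<rfloor> / z - q x = (real_of_int \<lfloor>z * q x\<rfloor> - z * q x) / z"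
            using z by (simp add: field_simps)
          moreover have "\<bar>real_of_int \<lfloor>z * q x\<rfloor> - z * q x\<bar> \<le> 1" by linarith
          ultimately have "\<bar>real_of_int \<lfloor>z * q x\<rfloor> / z - q x\<bar> \<le> inverse z"
            using z by (simp add: abs_divide inverse_eq_divide divide_right_mono)
          then show "norm (real_of_int \<lfloor>real (Suc n) * q x\<rfloor> / real (Suc n) - q x) < r"
            using z(2) N unfolding z_def real_norm_def by linarith
        qed
      qed
      moreover have "isCont (\<lambda>s. M (\<theta> s) x) (q x)"
      proof -
        have "continuous_on UNIV (\<lambda>s. M (\<theta> s) x)"
          using continuous_on_compose2[OF cont, of UNIV "\<lambda>s. (\<theta> s, x)"] by (simp add: continuous_on_Pair th)
        then show ?thesis by (simp add: continuous_on_eq_continuous_at)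
      qed
      ultimately show ?thesis unfolding T_def by (rule isCont_tendsto_compose[rotated])
    qed
    have "emeasure lborel ((\<lambda>x. M (\<theta> (q x)) x) -` U) = (\<integral>\<^sup>+x. indicator U (M (\<theta> (q x)) x) \<partial>lborel)"
    proof -
      have "(\<lambda>x. M (\<theta> (q x)) x) -` U \<in> sets borel"
        using measurable_sets[OF borel_measurable_continuous_onI[OF cont'[OF th]], of U] by simp
      then have "(\<integral>\<^sup>+x. indicator ((\<lambda>x. M (\<theta> (q x)) x) -` U) x \<partial>lborel) = emeasure lborel ((\<lambda>x. M (\<theta> (q x)) x) -` U)"
        by (intro nn_integral_indicator) simp
      moreover have "indicator ((\<lambda>x. M (\<theta> (q x)) x) -` U) x = (indicator U (M (\<theta> (q x)) x) :: ennreal)" for x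
        by (simp add: indicator_def)
      ultimately show ?thesis by simp
    qed
    also have "\<dots> \<le> (\<integral>\<^sup>+x. liminf (\<lambda>n. indicator U (T n x)) \<partial>lborel)"
    proof (rule nn_integral_mono)
      fix x
      show "indicator U (M (\<theta> (q x)) x) \<le> liminf (\<lambda>n. indicator U (T n x) :: ennreal)"
      proof (cases "M (\<theta> (q x)) x \<in> U")
        case True
        have "\<forall>\<^sub>F n in sequentially. T n x \<in> U" using lim U True by (rule topological_tendstoD)
        then have "\<forall>\<^sub>F n in sequentially. (1::ennreal) \<le> indicator U (T n x)"
          by eventually_elim simp
        then show ?thesis using True by (simp add: Liminf_bounded)
      qed simp
    qed
    also have "\<dots> \<le> liminf (\<lambda>n. \<integral>\<^sup>+x. indicator U (T n x) \<partial>lborel)"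
    proof (rule nn_integral_liminf)
      fix n
      have "(\<lambda>x. indicator U (T n x) :: ennreal) = indicator (T n -` U)" by (auto simp: indicator_def)
      then show "(\<lambda>x. indicator U (T n x) :: ennreal) \<in> borel_measurable lborel" using Tm by simp
    qed
    also have "(\<lambda>n. \<integral>\<^sup>+x. indicator U (T n x) \<partial>lborel) = (\<lambda>n. emeasure lborel U)"
    proof
      fix n
      have "(\<lambda>x. indicator U (T n x) :: ennreal) = indicator (T n -` U)" by (auto simp: indicator_def)
      then show "(\<integral>\<^sup>+x. indicator U (T n x) \<partial>lborel) = emeasure lborel U" using Tm Tem by simp
    qed
    also have "liminf (\<lambda>n. emeasure lborel U) = emeasure lborel U" by (simp add: Liminf_const)
    finally show ?thesis .
  qed
  define T where "T x = M (\<theta> (q x)) x" for x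
  define S where "S x = M (- \<theta> (q x)) x" for x
  have TS: "T (S x) = x" for x by (simp add: T_def S_def inv add M0)
  have ST: "S (T x) = x" for x by (simp add: T_def S_def inv add M0)
  have Tc: "continuous_on UNIV T" unfolding T_def by (rule cont'[OF thcont])
  have thneg: "continuous_on UNIV (\<lambda>s. - \<theta> s)" by (intro continuous_intros thcont)
  have eq: "emeasure lborel (T -` U) = emeasure lborel U" if U: "open U" for U
  proof (rule antisym)
    show "emeasure lborel (T -` U) \<le> emeasure lborel U"
      using step[OF U thcont] by (simp add: T_def[abs_def])
    have "open (T -` U)" by (rule open_vimage[OF U Tc])
    from step[OF this thneg] have "emeasure lborel (S -` (T -` U)) \<le> emeasure lborel (T -` U)"
      by (simp add: S_def[abs_def])
    moreover have "S -` (T -` U) = U" by (auto simp: TS)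
    ultimately show "emeasure lborel U \<le> emeasure lborel (T -` U)" by simp
  qed
  have Tm: "T \<in> borel_measurable lborel" using borel_measurable_continuous_onI[OF Tc] by simp
  have "lborel = distr lborel borel T"
  proof (rule lborel_eqI)
    fix l u :: 'a assume lu: "\<And>b. b \<in> Basis \<Longrightarrow> l \<bullet> b \<le> u \<bullet> b"
    have "emeasure (distr lborel borel T) (box l u) = emeasure lborel (T -` box l u)"
      using Tm by (subst emeasure_distr) auto
    also have "\<dots> = emeasure lborel (box l u)" by (rule eq) (rule open_box)
    also have "\<dots> = (\<Prod>b\<in>Basis. (u - l) \<bullet> b)" using lu by (rule emeasure_lborel_box)
    finally show "emeasure (distr lborel borel T) (box l u) = (\<Prod>b\<in>Basis. (u - l) \<bullet> b)" .
  qed simp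
  then have "emeasure lborel B = emeasure (distr lborel borel T) B" by simp
  also have "\<dots> = emeasure lborel (T -` B)" using Tm B by (subst emeasure_distr) auto
  finally show ?thesis by (simp add: T_def[abs_def])
qed

lemma emeasure_lborel_translate:
  fixes S :: "'a::euclidean_space set"
  assumes "S \<in> sets borel"
  shows "emeasure lborel {y. y + z \<in> S} = emeasure lborel S"
proof -
  have "emeasure lborel S = emeasure (distr lborel borel ((+) z)) S" by (simp add: lborel_distr_plus)
  also have "\<dots> = emeasure lborel {y. y + z \<in> S}"
    using assms by (subst emeasure_distr) (auto simp: vimage_def add.commute)
  finally show ?thesis by simp
qed

text \<open>Uniqueness of translation invariant measures, in the form needed for linear maps: integrate the
  indicator of the pairs \<open>(x, y)\<close> with \<open>x\<close> in the unit ball and \<open>x + f y\<close>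
  in \<open>C\<close> in both orders.\<close>
lemma emeasure_lborel_vimage_linear:
  fixes f f' :: "'a::euclidean_space \<Rightarrow> 'a"
  assumes f: "linear f" and f': "linear f'" and ff': "\<And>x. f (f' x) = x" "\<And>x. f' (f x) = x"
    and C: "C \<in> sets borel"
  shows "emeasure lborel (ball (0::'a) 1) * emeasure lborel (f -` C)
       = emeasure lborel (f -` ball 0 1) * emeasure lborel C"
proof -
  let ?B = "ball (0::'a) 1"
  have fm[measurable]: "f \<in> borel_measurable borel"
    using linear_continuous_on[of f UNIV] f by (simp add: borel_measurable_continuous_onI linear_linear)
  note C[measurable]
  have pre: "f -` S \<in> sets borel" if "S \<in> sets borel" for S
    using measurable_sets[OF fm that] by simp
  have B[measurable]: "?B \<in> sets borel" by simp
  have m1: "(\<lambda>z. fst z + f (snd z)) \<in> borel_measurable (lborel \<Otimes>\<^sub>M lborel)"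
    and m2: "(\<lambda>z. fst z - f (snd z)) \<in> borel_measurable (lborel \<Otimes>\<^sub>M lborel)" by measurable
  have m3: "fst \<in> borel_measurable (lborel \<Otimes>\<^sub>M (lborel :: 'a measure))" by measurable
  have F1: "(\<lambda>z. indicator ?B (fst z) * indicator C (fst z + f (snd z)) :: ennreal) \<in> borel_measurable (lborel \<Otimes>\<^sub>M lborel)"
    by (intro borel_measurable_times_ennreal measurable_compose[OF m3 borel_measurable_indicator[OF B]]
        measurable_compose[OF m1 borel_measurable_indicator[OF C]])
  have F2: "(\<lambda>z. indicator ?B (fst z - f (snd z)) * indicator C (fst z) :: ennreal) \<in> borel_measurable (lborel \<Otimes>\<^sub>M lborel)"
    by (intro borel_measurable_times_ennreal measurable_compose[OF m3 borel_measurable_indicator[OF C]]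
        measurable_compose[OF m2 borel_measurable_indicator[OF B]])
  define J :: ennreal where "J = (\<integral>\<^sup>+y. \<integral>\<^sup>+x. indicator ?B x * indicator C (x + f y) \<partial>lborel \<partial>lborel)"
  have "J = (\<integral>\<^sup>+x. \<integral>\<^sup>+y. indicator ?B x * indicator C (x + f y) \<partial>lborel \<partial>lborel)"
    unfolding J_def by (rule lborel_pair.Fubini', unfold case_prod_beta, rule F1)
  also have "\<dots> = (\<integral>\<^sup>+x. indicator ?B x * emeasure lborel (f -` C) \<partial>lborel)"
  proof (rule nn_integral_cong)
    fix x
    have eq: "{y. x + f y \<in> C} = {y. y + f' x \<in> f -` C}"
      using f ff' by (auto simp: linear_add add.commute)
    have "(\<integral>\<^sup>+y. indicator ?B x * indicator C (x + f y) \<partial>lborel) = indicator ?B x * (\<integral>\<^sup>+y. indicator C (x + f y) \<partial>lborel)"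
      by (rule nn_integral_cmult) measurable
    also have "(\<integral>\<^sup>+y. indicator C (x + f y) \<partial>lborel) = (\<integral>\<^sup>+y. indicator {y. x + f y \<in> C} y \<partial>lborel)"
      by (intro nn_integral_cong) (simp add: indicator_def)
    also have "\<dots> = emeasure lborel {y. x + f y \<in> C}" by (rule nn_integral_indicator) measurable
    also have "\<dots> = emeasure lborel (f -` C)" unfolding eq by (rule emeasure_lborel_translate[OF pre[OF C]])
    finally show "(\<integral>\<^sup>+y. indicator ?B x * indicator C (x + f y) \<partial>lborel) = indicator ?B x * emeasure lborel (f -` C)" .
  qed
  also have "\<dots> = emeasure lborel ?B * emeasure lborel (f -` C)"
    by (subst nn_integral_multc) (rule borel_measurable_indicator | simp)+
  finally have J1: "J = emeasure lborel ?B * emeasure lborel (f -` C)" .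
  have "J = (\<integral>\<^sup>+y. \<integral>\<^sup>+x. indicator ?B (x - f y) * indicator C x \<partial>lborel \<partial>lborel)"
    unfolding J_def
  proof (rule nn_integral_cong)
    fix y
    have m4: "(\<lambda>x. indicator ?B (x - f y) * indicator C x :: ennreal) \<in> borel_measurable borel"
    proof (intro borel_measurable_times_ennreal borel_measurable_indicator[OF C])
      have "(\<lambda>x. x - f y) \<in> borel_measurable borel" by measurable
      then show "(\<lambda>x. indicator ?B (x - f y) :: ennreal) \<in> borel_measurable borel"
        by (rule measurable_compose[OF _ borel_measurable_indicator[OF B]])
    qed
    have "(\<integral>\<^sup>+x. indicator ?B (x - f y) * indicator C x \<partial>lborel) =
        (\<integral>\<^sup>+x. indicator ?B (x - f y) * indicator C x \<partial>distr lborel borel ((+) (f y)) :: ennreal)"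
      by (simp add: lborel_distr_plus)
    also have "\<dots> = (\<integral>\<^sup>+x. indicator ?B (f y + x - f y) * indicator C (f y + x) \<partial>lborel)"
      using m4 by (subst nn_integral_distr) simp_all
    finally show "(\<integral>\<^sup>+x. indicator ?B x * indicator C (x + f y) \<partial>lborel) =
        (\<integral>\<^sup>+x. indicator ?B (x - f y) * indicator C x \<partial>lborel :: ennreal)"
      by (simp add: add.commute)
  qed
  also have "\<dots> = (\<integral>\<^sup>+x. \<integral>\<^sup>+y. indicator ?B (x - f y) * indicator C x \<partial>lborel \<partial>lborel)"
    by (rule lborel_pair.Fubini', unfold case_prod_beta, rule F2)
  also have "\<dots> = (\<integral>\<^sup>+x. emeasure lborel (f -` ?B) * indicator C x \<partial>lborel)"
  proof (rule nn_integral_cong)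
    fix x
    have eq: "{y. x - f y \<in> ?B} = {y. y + (- f' x) \<in> f -` ?B}"
    proof -
      have "x - f y \<in> ?B \<longleftrightarrow> y + (- f' x) \<in> f -` ?B" for y
        using norm_minus_commute[of x "f y"] by (simp add: linear_diff[OF f] ff')
      then show ?thesis by blast
    qed
    have "(\<integral>\<^sup>+y. indicator ?B (x - f y) * indicator C x \<partial>lborel) = (\<integral>\<^sup>+y. indicator ?B (x - f y) \<partial>lborel) * indicator C x"
      by (rule nn_integral_multc) measurable
    also have "(\<integral>\<^sup>+y. indicator ?B (x - f y) \<partial>lborel) = (\<integral>\<^sup>+y. indicator {y. x - f y \<in> ?B} y \<partial>lborel)"
      by (intro nn_integral_cong) (simp add: indicator_def)
    also have "\<dots> = emeasure lborel {y. x - f y \<in> ?B}" by (rule nn_integral_indicator) measurable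
    also have "\<dots> = emeasure lborel (f -` ?B)" unfolding eq by (rule emeasure_lborel_translate[OF pre]) simp
    finally show "(\<integral>\<^sup>+y. indicator ?B (x - f y) * indicator C x \<partial>lborel) = emeasure lborel (f -` ?B) * indicator C x" .
  qed
  also have "\<dots> = emeasure lborel (f -` ?B) * emeasure lborel C"
    using C by (subst nn_integral_cmult) auto
  finally show ?thesis using J1 by simp
qed

lemma emeasure_lborel_unit_ball: "0 < emeasure lborel (ball (0::'a::euclidean_space) 1)"
    "emeasure lborel (ball (0::'a) 1) < top"
proof -
  show "0 < emeasure lborel (ball (0::'a) 1)"
  proof (rule ccontr)
    assume "\<not> ?thesis"
    then have "ball (0::'a) 1 \<in> null_sets lborel" by (auto simp: null_sets_def zero_less_iff_neq_zero)
    then have "negligible (ball (0::'a) 1)" by (simp add: negligible_iff_null_sets null_sets_completion_iff)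
    then show False using open_not_negligible[of "ball (0::'a) 1"] by simp
  qed
  show "emeasure lborel (ball (0::'a) 1) < top"
    using emeasure_lborel_ball_finite[of "0::'a" 1] by simp
qed

text \<open>The factor in \<open>emeasure_lborel_vimage_linear\<close> is 1, since the unit ball is
  invariant.\<close>
lemma orthogonal_preserves_lborel:
  fixes f f' :: "'a::euclidean_space \<Rightarrow> 'a"
  assumes f: "linear f" and f': "linear f'" and ff': "\<And>x. f (f' x) = x" "\<And>x. f' (f x) = x"
    and norm: "\<And>x. norm (f x) = norm x" and C: "C \<in> sets borel"
  shows "emeasure lborel (f -` C) = emeasure lborel C"
proof -
  have "f -` ball 0 1 = ball 0 1" using norm by (auto simp: dist_norm)
  then show ?thesis
    using emeasure_lborel_vimage_linear[OF f f' ff' C] emeasure_lborel_unit_ball[where 'a = 'a]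
    by (auto simp: ennreal_mult_cancel_left)
qed

text \<open>The factors by which \<open>A\<close> and its inverse change the measure cancel.\<close>
lemma conjugate_preserves_lborel:
  fixes A A' R :: "'a::euclidean_space \<Rightarrow> 'a"
  assumes A: "linear A" and A': "linear A'" and AA': "\<And>x. A (A' x) = x" "\<And>x. A' (A x) = x"
    and R: "\<And>B. B \<in> sets borel \<Longrightarrow> emeasure lborel (R -` B) = emeasure lborel B"
    and Rm: "R \<in> borel_measurable borel" and C: "C \<in> sets borel"
  shows "emeasure lborel ((\<lambda>x. A (R (A' x))) -` C) = emeasure lborel C"
proof -
  let ?b = "emeasure lborel (ball (0::'a) 1)"
  have pre: "A -` S \<in> sets borel" "A' -` S \<in> sets borel" if "S \<in> sets borel" for S
    using measurable_sets[of A borel borel S] measurable_sets[of A' borel borel S] that A A'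
    by (simp_all add: borel_measurable_continuous_onI linear_continuous_on linear_linear)
  have s1: "?b * emeasure lborel (A -` S) = emeasure lborel (A -` ball 0 1) * emeasure lborel S"
    if "S \<in> sets borel" for S by (rule emeasure_lborel_vimage_linear[OF A A' AA' that])
  have s2: "?b * emeasure lborel (A' -` S) = emeasure lborel (A' -` ball 0 1) * emeasure lborel S"
    if "S \<in> sets borel" for S by (rule emeasure_lborel_vimage_linear[OF A' A AA'(2,1) that])
  define U where "U = A -` C"
  have U: "U \<in> sets borel" unfolding U_def by (rule pre(1)[OF C])
  have RU: "R -` U \<in> sets borel" using measurable_sets[OF Rm U] by simp
  have "A' -` U = C" by (auto simp: U_def AA')
  have "?b * emeasure lborel (A' -` (R -` U)) = emeasure lborel (A' -` ball 0 1) * emeasure lborel U"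
    using s2[OF RU] R[OF U] by simp
  also have "\<dots> = ?b * emeasure lborel (A' -` U)" using s2[OF U] by simp
  also have "A' -` U = C" by fact
  finally have "emeasure lborel (A' -` (R -` U)) = emeasure lborel C"
    using emeasure_lborel_unit_ball[where 'a = 'a] by (auto simp: ennreal_mult_cancel_left)
  moreover have "(\<lambda>x. A (R (A' x))) -` C = A' -` (R -` U)" by (auto simp: U_def)
  ultimately show ?thesis by simp
qed

context orthonormal_pair
begin

text \<open>The factor \<open>s\<close> is 1 for the twist and -1 for its inverse.\<close>
definition twist :: "real \<Rightarrow> real \<Rightarrow> 'a \<Rightarrow> 'a" where
  "twist \<rho> s x = R (s * twist_angle \<rho> (norm x)) x"

lemma norm_twist [simp]: "norm (twist \<rho> s x) = norm x"
  by (simp add: twist_def)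

lemma twist_inverse: "twist \<rho> s (twist \<rho> (- s) x) = x"
  by (simp add: twist_def)

lemma twist_outside: "\<rho> < 1 \<Longrightarrow> 1 \<le> norm x \<Longrightarrow> twist \<rho> s x = x"
  by (simp add: twist_def twist_angle_outside)

lemma norm_u: "norm u = 1" using uu by (simp add: norm_eq_sqrt_inner)

lemma twist_antipode: "0 < \<rho> \<Longrightarrow> \<rho> < 1 \<Longrightarrow> twist \<rho> 1 (- \<rho> *\<^sub>R u) = \<rho> *\<^sub>R u"
proof -
  assume \<rho>: "0 < \<rho>" "\<rho> < 1"
  have "norm (- \<rho> *\<^sub>R u) = \<rho>" using \<rho> norm_u by simp
  then have "twist \<rho> 1 (- \<rho> *\<^sub>R u) = R pi (- \<rho> *\<^sub>R u)"
    unfolding twist_def using twist_angle_inside[OF \<rho>(2)] by simp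
  also have "\<dots> = \<rho> *\<^sub>R u"
    by (simp add: plane_rotation_def uu uw scaleR_add_left[symmetric] flip: scaleR_minus_left)
  finally show ?thesis .
qed

lemma twist_lipschitz:
  assumes \<rho>: "\<rho> < 1" and s: "\<bar>s\<bar> \<le> 1"
  shows "norm (twist \<rho> s x - twist \<rho> s y) \<le> (1 + 4 * (pi / (1 - \<rho>))) * norm (x - y)"
proof -
  define \<kappa> where "\<kappa> = pi / (1 - \<rho>)"
  have \<kappa>: "\<kappa> > 0" using \<rho> by (simp add: \<kappa>_def)
  have main: "norm (twist \<rho> s x - twist \<rho> s y) \<le> (1 + 4 * \<kappa>) * norm (x - y)" if y: "norm y \<le> 1" for x y
  proof -
    define \<alpha> \<beta> where "\<alpha> = s * twist_angle \<rho> (norm x)" and "\<beta> = s * twist_angle \<rho> (norm y)"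
    have "twist \<rho> s x - twist \<rho> s y = R \<alpha> (x - y) + (R \<alpha> y - R \<beta> y)"
      by (simp add: twist_def \<alpha>_def \<beta>_def linear_diff[OF linear_rotation])
    then have "norm (twist \<rho> s x - twist \<rho> s y) \<le> norm (x - y) + 4 * \<bar>\<alpha> - \<beta>\<bar> * norm y"
      using norm_triangle_ineq[of "R \<alpha> (x - y)" "R \<alpha> y - R \<beta> y"] norm_rotation_diff_le[of \<alpha> y \<beta>] by simp
    also have "\<dots> \<le> norm (x - y) + 4 * (\<kappa> * norm (x - y)) * 1"
    proof (intro add_left_mono mult_mono)
      have "\<bar>\<alpha> - \<beta>\<bar> = \<bar>s\<bar> * \<bar>twist_angle \<rho> (norm x) - twist_angle \<rho> (norm y)\<bar>"
        by (simp add: \<alpha>_def \<beta>_def abs_mult[symmetric] right_diff_distrib)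
      also have "\<dots> \<le> 1 * (\<kappa> * \<bar>norm x - norm y\<bar>)"
        unfolding \<kappa>_def by (intro mult_mono s abs_twist_angle_diff_le \<rho>) auto
      also have "\<dots> \<le> \<kappa> * norm (x - y)"
        using \<kappa> norm_triangle_ineq3[of x y] by simp
      finally show "\<bar>\<alpha> - \<beta>\<bar> \<le> \<kappa> * norm (x - y)" .
    qed (use y \<kappa> in auto)
    finally show ?thesis by (simp add: algebra_simps)
  qed
  have "norm (twist \<rho> s x - twist \<rho> s y) \<le> (1 + 4 * \<kappa>) * norm (x - y)"
  proof (cases "norm y \<le> 1")
    case True then show ?thesis by (rule main)
  next
    case y: False
    show ?thesis
    proof (cases "norm x \<le> 1")
      case True
      then show ?thesis using main[of x y] by (simp add: norm_minus_commute)
    next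
      case False
      have "1 * norm (x - y) \<le> (1 + 4 * \<kappa>) * norm (x - y)"
        using \<kappa> by (intro mult_right_mono) auto
      then show ?thesis using False y by (simp add: twist_outside[OF \<rho>])
    qed
  qed
  then show ?thesis by (simp add: \<kappa>_def)
qed

lemma continuous_on_twist: "\<rho> < 1 \<Longrightarrow> \<bar>s\<bar> \<le> 1 \<Longrightarrow> continuous_on UNIV (twist \<rho> s)"
  using twist_lipschitz[of \<rho> s]
  by (intro lipschitz_on_continuous_on[of "1 + 4 * (pi / (1 - \<rho>))"] lipschitz_onI) (auto simp: dist_norm)

lemma twist_preserves_lborel:
  assumes \<rho>: "\<rho> < 1" and B: "B \<in> sets borel"
  shows "emeasure lborel (twist \<rho> s -` B) = emeasure lborel B"
proof -
  have "emeasure lborel ((\<lambda>x. R ((\<lambda>t. s * twist_angle \<rho> t) (norm x)) x) -` B) = emeasure lborel B"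
  proof (rule radial_family_preserves_lborel[where M = R and q = norm and \<theta> = "\<lambda>t. s * twist_angle \<rho> t", OF _ _ rotation_add _ _ _ _ B])
    show "emeasure lborel (R \<alpha> -` C) = emeasure lborel C" if "C \<in> sets borel" for \<alpha> C
      by (rule orthogonal_preserves_lborel[of _ "R (- \<alpha>)"]) (use that linear_rotation in auto)
    show "continuous_on UNIV (\<lambda>(\<alpha>, x). R \<alpha> x)"
      unfolding plane_rotation_def case_prod_beta by (intro continuous_intros)
    have "(pi / (1 - \<rho>))-lipschitz_on UNIV (twist_angle \<rho>)"
      using abs_twist_angle_diff_le[OF \<rho>] \<rho> by (intro lipschitz_onI) (auto simp: dist_real_def)
    then show "continuous_on UNIV (\<lambda>t. s * twist_angle \<rho> t)"
      by (intro continuous_intros lipschitz_on_continuous_on)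
  qed (auto intro: continuous_intros)
  then show ?thesis by (simp add: twist_def[abs_def])
qed

section \<open>Twists of thin tubes\<close>

text \<open>Multiplies by \<open>l\<close> in direction \<open>u\<close> and by \<open>r\<close> in the
  orthogonal directions.\<close>
definition stretch :: "real \<Rightarrow> real \<Rightarrow> 'a \<Rightarrow> 'a" where
  "stretch r l x = r *\<^sub>R x + ((l - r) * (x \<bullet> u)) *\<^sub>R u"

lemma linear_stretch: "linear (stretch r l)"
  by (rule linearI) (simp_all add: stretch_def algebra_simps scaleR_add_left)

lemma stretch_inner_u: "stretch r l x \<bullet> u = l * (x \<bullet> u)"
  by (simp add: stretch_def inner_add_left uu algebra_simps)

lemma stretch_inverse:
  assumes "r > 0" "l > 0"
  shows "stretch r l (stretch (1 / r) (1 / l) x) = x" "stretch (1 / r) (1 / l) (stretch r l x) = x"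
proof -
  have "stretch r l (stretch (1 / r) (1 / l) x) =
      x + (r * ((1 / l - 1 / r) * (x \<bullet> u)) + (l - r) * (1 / l * (x \<bullet> u))) *\<^sub>R u"
    unfolding stretch_def[of r] stretch_inner_u unfolding stretch_def using assms
    by (simp add: scaleR_add_right scaleR_add_left)
  also have "r * ((1 / l - 1 / r) * (x \<bullet> u)) + (l - r) * (1 / l * (x \<bullet> u)) = 0"
    using assms by (simp add: field_simps)
  finally show "stretch r l (stretch (1 / r) (1 / l) x) = x" by simp
  have "stretch (1 / r) (1 / l) (stretch r l x) =
      x + (1 / r * ((l - r) * (x \<bullet> u)) + (1 / l - 1 / r) * (l * (x \<bullet> u))) *\<^sub>R u"
    unfolding stretch_def[of "1 / r"] stretch_inner_u unfolding stretch_def using assms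
    by (simp add: scaleR_add_right scaleR_add_left)
  also have "1 / r * ((l - r) * (x \<bullet> u)) + (1 / l - 1 / r) * (l * (x \<bullet> u)) = 0"
    using assms by (simp add: field_simps)
  finally show "stretch (1 / r) (1 / l) (stretch r l x) = x" by simp
qed

lemma norm_stretch_le: "norm (stretch r l x) \<le> (\<bar>r\<bar> + \<bar>l - r\<bar>) * norm x"
proof -
  have "norm (stretch r l x) \<le> \<bar>r\<bar> * norm x + \<bar>l - r\<bar> * \<bar>x \<bullet> u\<bar>"
    unfolding stretch_def by (rule norm_triangle_le) (simp add: norm_u abs_mult)
  also have "\<dots> \<le> \<bar>r\<bar> * norm x + \<bar>l - r\<bar> * norm x"
    using Cauchy_Schwarz_ineq2[of x u] norm_u by (intro add_left_mono mult_left_mono) auto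
  finally show ?thesis by (simp add: algebra_simps)
qed

text \<open>The twist conjugated by the affine map that takes the unit ball to an ellipsoid around
  \<open>m\<close> with half axis \<open>l\<close> in direction \<open>u\<close> and \<open>r\<close> in the
  orthogonal directions.\<close>
definition tube_twist :: "'a \<Rightarrow> real \<Rightarrow> real \<Rightarrow> real \<Rightarrow> real \<Rightarrow> 'a \<Rightarrow> 'a" where
  "tube_twist m r l \<rho> s x = m + stretch r l (twist \<rho> s (stretch (1 / r) (1 / l) (x - m)))"

definition tube :: "'a \<Rightarrow> real \<Rightarrow> real \<Rightarrow> 'a set" where
  "tube m r l = {x. norm (stretch (1 / r) (1 / l) (x - m)) \<le> 1}"

lemma tube_twist_inverse:
  "r > 0 \<Longrightarrow> l > 0 \<Longrightarrow> tube_twist m r l \<rho> s (tube_twist m r l \<rho> (- s) x) = x"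
  by (simp add: tube_twist_def stretch_inverse twist_inverse)

lemma tube_twist_outside:
  "r > 0 \<Longrightarrow> l > 0 \<Longrightarrow> \<rho> < 1 \<Longrightarrow> x \<notin> tube m r l \<Longrightarrow> tube_twist m r l \<rho> s x = x"
  by (simp add: tube_twist_def tube_def twist_outside stretch_inverse)

text \<open>The stretch contributes the factor \<open>l\<close> and its inverse a factor of order \<open>1 /
  r\<close>.\<close>
lemma tube_twist_lipschitz:
  assumes r: "0 < r" "r \<le> l" and \<rho>: "\<rho> < 1" and s: "\<bar>s\<bar> \<le> 1"
  shows "norm (tube_twist m r l \<rho> s x - tube_twist m r l \<rho> s y)
       \<le> (2 * l * (1 + 4 * (pi / (1 - \<rho>))) / r) * norm (x - y)"
proof -
  let ?A = "stretch r l" and ?A' = "stretch (1 / r) (1 / l)" and ?\<kappa> = "1 + 4 * (pi / (1 - \<rho>))"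
  have \<kappa>: "?\<kappa> > 0" using \<rho> by (simp add: add_pos_pos)
  have l: "l > 0" using r by simp
  have d: "tube_twist m r l \<rho> s x - tube_twist m r l \<rho> s y =
      ?A (twist \<rho> s (?A' (x - m)) - twist \<rho> s (?A' (y - m)))"
    by (simp add: tube_twist_def linear_diff[OF linear_stretch])
  have "norm \<dots> \<le> (\<bar>r\<bar> + \<bar>l - r\<bar>) * norm (twist \<rho> s (?A' (x - m)) - twist \<rho> s (?A' (y - m)))"
    by (rule norm_stretch_le)
  also have "\<dots> = l * norm (twist \<rho> s (?A' (x - m)) - twist \<rho> s (?A' (y - m)))" using r by simp
  also have "\<dots> \<le> l * (?\<kappa> * norm (?A' (x - m) - ?A' (y - m)))"
    using l by (intro mult_left_mono twist_lipschitz \<rho> s) auto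
  also have "?A' (x - m) - ?A' (y - m) = ?A' (x - y)"
    by (simp add: linear_diff[OF linear_stretch, symmetric])
  also have "l * (?\<kappa> * norm (?A' (x - y))) \<le> l * (?\<kappa> * ((2 / r) * norm (x - y)))"
  proof (intro mult_left_mono)
    have "1 / l \<le> 1 / r" using r by (simp add: frac_le)
    then have "\<bar>1 / r\<bar> + \<bar>1 / l - 1 / r\<bar> \<le> 2 / r" using l r by simp
    then show "norm (?A' (x - y)) \<le> (2 / r) * norm (x - y)"
      using norm_stretch_le[of "1 / r" "1 / l" "x - y"] mult_right_mono[of _ "2 / r" "norm (x - y)"]
      by (meson norm_ge_zero order_trans)
  qed (use l \<kappa> in auto)
  finally show ?thesis unfolding d by (simp add: field_simps)
qed

lemma tube_twist_preserves_lborel: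
  assumes r: "0 < r" and l: "0 < l" and \<rho>: "\<rho> < 1" and s: "\<bar>s\<bar> \<le> 1" and B: "B \<in> sets borel"
  shows "emeasure lborel (tube_twist m r l \<rho> s -` B) = emeasure lborel B"
proof -
  let ?h = "\<lambda>x. stretch r l (twist \<rho> s (stretch (1 / r) (1 / l) x))"
  have tm: "twist \<rho> s \<in> borel_measurable borel"
    by (rule borel_measurable_continuous_onI[OF continuous_on_twist[OF \<rho> s]])
  have sm: "stretch a b \<in> borel_measurable borel" for a b
    by (intro borel_measurable_continuous_onI linear_continuous_on) (simp add: linear_linear linear_stretch)
  have hm: "?h \<in> borel_measurable borel"
    by (intro measurable_compose[OF measurable_compose[OF sm tm] sm])
  have C: "{x. x + m \<in> B} \<in> sets borel"
    using measurable_sets[of "\<lambda>x. x + m" borel borel B] B by (simp add: vimage_def)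
  have "tube_twist m r l \<rho> s -` B = {x. x + (- m) \<in> ?h -` {x. x + m \<in> B}}"
    by (auto simp: tube_twist_def add.commute)
  then have "emeasure lborel (tube_twist m r l \<rho> s -` B) = emeasure lborel (?h -` {x. x + m \<in> B})"
    using emeasure_lborel_translate[of "?h -` {x. x + m \<in> B}" "- m"] measurable_sets[OF hm C] by simp
  also have "\<dots> = emeasure lborel {x. x + m \<in> B}"
    by (rule conjugate_preserves_lborel[OF linear_stretch linear_stretch stretch_inverse _ tm C])
      (use r l twist_preserves_lborel[OF \<rho>] in auto)
  also have "\<dots> = emeasure lborel B" by (rule emeasure_lborel_translate[OF B])
  finally show ?thesis .
qed

lemma compact_tube:
  assumes r: "0 < r" and l: "0 < l"
  shows "compact (tube m r l)"
proof -
  have "tube m r l = (\<lambda>y. m + stretch r l y) ` cball 0 1"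
  proof (intro equalityI subsetI)
    fix x assume "x \<in> tube m r l"
    then show "x \<in> (\<lambda>y. m + stretch r l y) ` cball 0 1"
      using r l by (intro image_eqI[of _ _ "stretch (1 / r) (1 / l) (x - m)"]) (auto simp: tube_def stretch_inverse)
  qed (use r l in \<open>auto simp: tube_def stretch_inverse\<close>)
  moreover have "continuous_on (cball 0 1) (\<lambda>y. m + stretch r l y)"
    by (intro continuous_intros linear_continuous_on) (simp add: linear_linear linear_stretch)
  ultimately show ?thesis using compact_continuous_image[OF _ compact_cball] by metis
qed

lemma tube_near_segment:
  assumes r: "0 < r" and D: "0 \<le> D" "D \<le> l" "0 < l" and x: "x \<in> tube m r l"
  shows "\<exists>y\<in>closed_segment (m - D *\<^sub>R u) (m + D *\<^sub>R u). dist x y \<le> (l - D) + r"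
proof -
  define z where "z = stretch (1 / r) (1 / l) (x - m)"
  have z: "norm z \<le> 1" using x by (simp add: tube_def z_def)
  have zx: "x - m = stretch r l z" using r D by (simp add: z_def stretch_inverse)
  define \<alpha> where "\<alpha> = l * (z \<bullet> u)"
  have zu: "\<bar>z \<bullet> u\<bar> \<le> 1" using Cauchy_Schwarz_ineq2[of z u] norm_u z by simp
  have \<alpha>: "\<bar>\<alpha>\<bar> \<le> l" using mult_left_mono[OF zu, of l] D by (simp add: \<alpha>_def abs_mult)
  define \<beta> where "\<beta> = max (- D) (min D \<alpha>)"
  have \<beta>: "\<bar>\<beta>\<bar> \<le> D" "\<bar>\<alpha> - \<beta>\<bar> \<le> l - D" using D \<alpha> by (auto simp: \<beta>_def)
  have perp: "norm (z - (z \<bullet> u) *\<^sub>R u) \<le> 1"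
  proof -
    have "(z - (z \<bullet> u) *\<^sub>R u) \<bullet> (z - (z \<bullet> u) *\<^sub>R u) = z \<bullet> z - (z \<bullet> u)\<^sup>2"
      by (simp add: inner_diff_left inner_diff_right uu inner_commute[of u z] power2_eq_square)
    also have "\<dots> \<le> 1"
      using power_le_one[OF norm_ge_zero z, of 2] zero_le_power2[of "z \<bullet> u"]
      unfolding dot_square_norm by linarith
    finally show ?thesis by (simp add: norm_eq_sqrt_inner)
  qed
  have "x - (m + \<beta> *\<^sub>R u) = stretch r l z - \<beta> *\<^sub>R u" using zx by (simp add: algebra_simps)
  also have "\<dots> = r *\<^sub>R (z - (z \<bullet> u) *\<^sub>R u) + (\<alpha> - \<beta>) *\<^sub>R u"
    by (simp add: stretch_def \<alpha>_def algebra_simps)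
  finally have "x - (m + \<beta> *\<^sub>R u) = r *\<^sub>R (z - (z \<bullet> u) *\<^sub>R u) + (\<alpha> - \<beta>) *\<^sub>R u" .
  then have "dist x (m + \<beta> *\<^sub>R u) \<le> r * norm (z - (z \<bullet> u) *\<^sub>R u) + \<bar>\<alpha> - \<beta>\<bar>"
    unfolding dist_norm using norm_triangle_ineq[of "r *\<^sub>R (z - (z \<bullet> u) *\<^sub>R u)" "(\<alpha> - \<beta>) *\<^sub>R u"] r norm_u by simp
  also have "\<dots> \<le> r * 1 + (l - D)" using perp \<beta> r by (intro add_mono mult_left_mono) auto
  finally have "dist x (m + \<beta> *\<^sub>R u) \<le> (l - D) + r" by simp
  moreover have "m + \<beta> *\<^sub>R u \<in> closed_segment (m - D *\<^sub>R u) (m + D *\<^sub>R u)"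
  proof (cases "D = 0")
    case True then show ?thesis using \<beta> by simp
  next
    case False
    then have "m + \<beta> *\<^sub>R u = (1 - (\<beta> + D) / (2 * D)) *\<^sub>R (m - D *\<^sub>R u) + ((\<beta> + D) / (2 * D)) *\<^sub>R (m + D *\<^sub>R u)"
    proof -
      define t where "t = (\<beta> + D) / (2 * D)"
      have "(1 - t) *\<^sub>R (m - D *\<^sub>R u) + t *\<^sub>R (m + D *\<^sub>R u) = m + (2 * t * D - D) *\<^sub>R u"
        by (simp add: algebra_simps scaleR_add_left[symmetric])
      moreover have "2 * t * D - D = \<beta>" using False by (simp add: t_def field_simps)
      ultimately show ?thesis by (simp add: t_def)
    qed
    moreover have "0 \<le> (\<beta> + D) / (2 * D)" "(\<beta> + D) / (2 * D) \<le> 1"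
      using \<beta> False D by (auto simp: field_simps abs_le_iff)
    ultimately show ?thesis by (auto simp: in_segment)
  qed
  ultimately show ?thesis by blast
qed

end

text \<open>In suitable orthonormal coordinates the ellipsoid lies in a box with one side \<open>2 * l\<close>
  and all others \<open>2 * r\<close>.\<close>
lemma emeasure_tube_le:
  fixes u w m :: "real^'n" and f :: "real^'n \<Rightarrow> real^'n" and k :: 'n
  assumes uw: "orthonormal_pair u w" and f: "orthogonal_transformation f" and fu: "f (axis k 1) = u"
    and r: "0 < r" and l: "0 < l"
  shows "emeasure lborel (orthonormal_pair.tube u m r l) \<le> ennreal (2 ^ CARD('n) * l * r ^ (CARD('n) - 1))"
proof -
  interpret orthonormal_pair u w by (rule uw)
  define c :: "real^'n" where "c = (\<chi> i. if i = k then l else r)"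
  have lf: "linear f" using f by (rule orthogonal_transformation_linear)
  define f' where "f' = inv f"
  have of': "orthogonal_transformation f'" unfolding f'_def by (rule orthogonal_transformation_inv[OF f])
  have ff': "f (f' x) = x" "f' (f x) = x" for x
    using orthogonal_transformation_bij[OF f] by (simp_all add: f'_def surj_f_inv_f bij_is_surj bij_is_inj)
  have lf': "linear f'" using of' by (rule orthogonal_transformation_linear)
  have sub: "tube m r l \<subseteq> {x. x + (- m) \<in> f' -` cbox (- c) c}"
  proof
    fix x assume x: "x \<in> tube m r l"
    define z where "z = stretch (1 / r) (1 / l) (x - m)"
    have z: "norm z \<le> 1" using x by (simp add: tube_def z_def)
    have zx: "x - m = stretch r l z" using r l by (simp add: z_def stretch_inverse)
    have "\<bar>f' (x - m) $ i\<bar> \<le> c $ i" for i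
    proof -
      let ?v = "f (axis i 1)"
      have nv: "norm ?v = 1" using f by (simp add: orthogonal_transformation norm_axis_1)
      have zv: "\<bar>z \<bullet> ?v\<bar> \<le> 1" using Cauchy_Schwarz_ineq2[of z ?v] nv z by simp
      have "f' (x - m) $ i = f' (x - m) \<bullet> axis i 1" by (simp add: inner_axis)
      also have "\<dots> = f (f' (x - m)) \<bullet> ?v" using f by (simp add: orthogonal_transformation_def)
      also have "\<dots> = r * (z \<bullet> ?v) + (l - r) * (z \<bullet> u) * (u \<bullet> ?v)"
        unfolding ff' zx by (simp add: stretch_def inner_add_left)
      finally have eq: "f' (x - m) $ i = r * (z \<bullet> ?v) + (l - r) * (z \<bullet> u) * (u \<bullet> ?v)" .
      show ?thesis
      proof (cases "i = k")
        case True
        then have "f' (x - m) $ i = l * (z \<bullet> ?v)"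
          using eq by (simp add: fu uu algebra_simps)
        then show ?thesis using True mult_left_mono[OF zv, of l] l by (simp add: c_def abs_mult)
      next
        case False
        have "u \<bullet> ?v = axis k 1 \<bullet> (axis i 1 :: real^'n)"
          unfolding fu[symmetric] using f by (simp add: orthogonal_transformation_def)
        also have "\<dots> = 0" using False by (simp add: inner_axis_axis)
        finally have "f' (x - m) $ i = r * (z \<bullet> ?v)" using eq by simp
        then show ?thesis using False mult_left_mono[OF zv, of r] r by (simp add: c_def abs_mult)
      qed
    qed
    then show "x \<in> {x. x + (- m) \<in> f' -` cbox (- c) c}"
      by (auto simp: mem_box_cart abs_le_iff minus_le_iff)
  qed
  have box: "f' -` cbox (- c) c \<in> sets borel"
    using measurable_sets[of f' borel borel "cbox (- c) c"] lf'
    by (simp add: borel_measurable_continuous_onI linear_continuous_on linear_linear)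
  have "emeasure lborel (tube m r l) \<le> emeasure lborel {x. x + (- m) \<in> f' -` cbox (- c) c}"
  proof (rule emeasure_mono[OF sub])
    show "{x. x + (- m) \<in> f' -` cbox (- c) c} \<in> sets lborel"
      using measurable_sets[of "\<lambda>x. x + (- m)" borel borel, OF _ box] by (simp add: vimage_def)
  qed
  also have "\<dots> = emeasure lborel (f' -` cbox (- c) c)" by (rule emeasure_lborel_translate[OF box])
  also have "\<dots> = emeasure lborel (cbox (- c) c)"
    by (rule orthogonal_preserves_lborel[OF lf' lf ff'(2,1)]) (use of' in \<open>auto simp: orthogonal_transformation\<close>)
  also have "\<dots> = ennreal (measure lborel (cbox (- c) c))"
    using emeasure_lborel_cbox_finite[of "- c" c]
    by (intro emeasure_eq_ennreal_measure) (simp only: infinity_ennreal_def less_top)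
  also have "measure lborel (cbox (- c) c) = (\<Prod>i\<in>UNIV. c $ i - (- c) $ i)"
    using r l by (intro content_cbox_cart) (simp add: interval_ne_empty_cart c_def)
  also have "\<dots> = (\<Prod>i\<in>UNIV. 2 * (if i = k then l else r))"
    by (intro prod.cong) (auto simp: c_def)
  also have "\<dots> = 2 ^ CARD('n) * (l * r ^ (CARD('n) - 1))"
  proof -
    have "(\<Prod>i\<in>UNIV. (if i = k then l else r)) = l * (\<Prod>i\<in>UNIV - {k}. r)"
      by (subst prod.remove[of _ k]) (auto intro!: prod.cong)
    then show ?thesis by (simp add: prod.distrib card_Diff_singleton)
  qed
  finally show ?thesis by (simp add: mult.assoc)
qed

text \<open>A long and thin ellipsoid around the segment, twisted by half a turn, exchanges the two end points.
  If the thickness \<open>r\<close> tends to 0, then the Lipschitz constant \<open>K\<close> grows like \<open>1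
  / r\<close> and the measure of the ellipsoid shrinks like \<open>r ^ (CARD('n) - 1)\<close>. So the product in
  the last claim is of the order \<open>r powr (CARD('n) - 1 - p)\<close>, which tends to 0 because \<open>p <
  CARD('n) - 1\<close>.\<close>
proposition tube_map:
  fixes a b :: "real^'n"
  assumes n: "2 \<le> CARD('n)" and p: "0 \<le> p" "p < real CARD('n) - 1" and \<epsilon>: "0 < \<epsilon>" and \<eta>: "0 < \<eta>"
  obtains h h' :: "real^'n \<Rightarrow> real^'n" and K S where
    "1 \<le> K" "K-lipschitz_on UNIV h" "K-lipschitz_on UNIV h'" "\<And>x. h (h' x) = x" "\<And>x. h' (h x) = x"
    "\<And>B. B \<in> sets borel \<Longrightarrow> emeasure lborel (h -` B) = emeasure lborel B"
    "compact S" "\<And>x. x \<notin> S \<Longrightarrow> h x = x" "\<And>x. x \<in> S \<Longrightarrow> \<exists>y\<in>closed_segment a b. dist x y \<le> \<epsilon>"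
    "h a = b" "measure lborel S * K powr p \<le> \<eta>"
proof (cases "a = b")
  case True
  show ?thesis
    by (rule that[of 1 "\<lambda>x. x" "\<lambda>x. x" "{}"]) (use True \<eta> in \<open>auto intro: lipschitz_on_id\<close>)
next
  case False
  define D where "D = norm (b - a) / 2"
  define m where "m = (1/2) *\<^sub>R (a + b)"
  define u where "u = (1 / (2 * D)) *\<^sub>R (b - a)"
  have D: "D > 0" using False by (simp add: D_def)
  have nu: "norm u = 1" using D by (simp add: u_def D_def)
  have Du: "D *\<^sub>R u = (1/2) *\<^sub>R (b - a)" using D by (simp add: u_def)
  have ma: "m - D *\<^sub>R u = a" and mb: "m + D *\<^sub>R u = b"
    unfolding Du m_def by (simp_all add: vec_eq_iff field_simps)
  obtain k j :: 'n where kj: "k \<noteq> j"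
  proof -
    have "\<not> card (UNIV :: 'n set) \<le> Suc 0" using n by simp
    then show ?thesis using that card_le_Suc0_iff_eq[of "UNIV :: 'n set"] by auto
  qed
  have "norm (axis k 1 :: real^'n) = norm u" by (simp add: nu norm_axis_1)
  then obtain f :: "real^'n \<Rightarrow> real^'n" where f: "orthogonal_transformation f" "f (axis k 1) = u"
    using orthogonal_transformation_exists by blast
  define w where "w = f (axis j 1)"
  have ouw: "orthonormal_pair u w"
  proof
    show "u \<bullet> u = 1" using nu by (simp add: norm_eq_sqrt_inner)
    have "norm w = 1" unfolding w_def using f(1) by (simp add: orthogonal_transformation norm_axis_1)
    then show "w \<bullet> w = 1" by (simp add: norm_eq_sqrt_inner)
    show "u \<bullet> w = 0"
      unfolding w_def f(2)[symmetric] using f(1) kj by (simp add: orthogonal_transformation_def inner_axis_axis)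
  qed
  interpret orthonormal_pair u w by (rule ouw)
  \<comment> \<open>the ellipsoid reaches beyond the end points of the segment, which correspond to points of norm \<open>\<rho> < 1\<close> in the unit ball\<close>
  define l where "l = D + \<epsilon> / 2"
  define \<rho> where "\<rho> = D / l"
  have l: "l > 0" "D \<le> l" using D \<epsilon> by (auto simp: l_def)
  have \<rho>: "0 < \<rho>" "\<rho> < 1" using D \<epsilon> l by (auto simp: \<rho>_def l_def)
  define \<kappa> where "\<kappa> = 1 + 4 * (pi / (1 - \<rho>))"
  have \<kappa>: "\<kappa> \<ge> 1" using \<rho> by (simp add: \<kappa>_def)
  define e where "e = real CARD('n) - 1 - p"
  have e: "e > 0" using p by (simp add: e_def)
  define c where "c = 2 ^ CARD('n) * l * (2 * l * \<kappa>) powr p"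
  have c: "c > 0" using l \<kappa> by (simp add: c_def)
  \<comment> \<open>the last term makes \<open>c * r powr e\<close>, the bound on \<open>measure lborel S * K powr p\<close>, at most \<open>\<eta>\<close>\<close>
  define r where "r = min (min l (\<epsilon> / 2)) ((\<eta> / c) powr (1 / e))"
  have r: "0 < r" "r \<le> l" "r \<le> \<epsilon> / 2" "r \<le> (\<eta> / c) powr (1 / e)"
    using l \<epsilon> \<eta> c by (auto simp: r_def)
  have re: "r powr e \<le> \<eta> / c"
  proof -
    have "r powr e \<le> ((\<eta> / c) powr (1 / e)) powr e"
      using r e by (intro powr_mono2) auto
    also have "\<dots> = \<eta> / c" using e \<eta> c by (simp add: powr_powr)
    finally show ?thesis .
  qed
  define K where "K = 2 * l * \<kappa> / r"
  have K: "K \<ge> 1"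
  proof -
    have "1 * 1 \<le> (l / r) * (2 * \<kappa>)" using r \<kappa> by (intro mult_mono) auto
    then show ?thesis by (simp add: K_def field_simps)
  qed
  show ?thesis
  proof (rule that[of K "tube_twist m r l \<rho> 1" "tube_twist m r l \<rho> (- 1)" "tube m r l"])
    show "K-lipschitz_on UNIV (tube_twist m r l \<rho> 1)" "K-lipschitz_on UNIV (tube_twist m r l \<rho> (- 1))"
      using tube_twist_lipschitz[OF r(1,2) \<rho>(2), of 1 m] tube_twist_lipschitz[OF r(1,2) \<rho>(2), of "- 1" m] K
      by (auto intro!: lipschitz_onI simp: dist_norm K_def \<kappa>_def)
    show "tube_twist m r l \<rho> 1 (tube_twist m r l \<rho> (- 1) x) = x" for x
      by (rule tube_twist_inverse[OF r(1) l(1)])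
    show "tube_twist m r l \<rho> (- 1) (tube_twist m r l \<rho> 1 x) = x" for x
      using tube_twist_inverse[OF r(1) l(1), of m \<rho> "- 1" x] by simp
    show "emeasure lborel (tube_twist m r l \<rho> 1 -` B) = emeasure lborel B" if "B \<in> sets borel" for B
      by (rule tube_twist_preserves_lborel) (use r l \<rho> that in auto)
    show "compact (tube m r l)" by (rule compact_tube[OF r(1) l(1)])
    show "tube_twist m r l \<rho> 1 x = x" if "x \<notin> tube m r l" for x
      by (rule tube_twist_outside[OF r(1) l(1) \<rho>(2) that])
    show "\<exists>y\<in>closed_segment a b. dist x y \<le> \<epsilon>" if xt: "x \<in> tube m r l" for x
    proof -
      obtain y where "y \<in> closed_segment a b" "dist x y \<le> l - D + r"
        using tube_near_segment[OF r(1) less_imp_le[OF D] l(2,1) xt] unfolding ma mb by blast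
      then show ?thesis using r(3) by (intro bexI[of _ y]) (auto simp: l_def)
    qed
    have "stretch (1 / r) (1 / l) (a - m) = - \<rho> *\<^sub>R u"
    proof -
      have "a - m = - (D *\<^sub>R u)" using ma by (simp add: algebra_simps)
      then have "stretch (1 / r) (1 / l) (a - m) = - ((D * (1 / r) + (1 / l - 1 / r) * D) *\<^sub>R u)"
        by (simp add: stretch_def uu scaleR_add_left mult.commute)
      also have "D * (1 / r) + (1 / l - 1 / r) * D = \<rho>" by (simp add: \<rho>_def algebra_simps)
      finally show ?thesis by simp
    qed
    then have "tube_twist m r l \<rho> 1 a = m + stretch r l (\<rho> *\<^sub>R u)"
      using twist_antipode[OF \<rho>] by (simp add: tube_twist_def)
    also have "stretch r l (\<rho> *\<^sub>R u) = (\<rho> * l) *\<^sub>R u"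
    proof -
      have "stretch r l (\<rho> *\<^sub>R u) = (r * \<rho> + (l - r) * \<rho>) *\<^sub>R u"
        by (simp add: stretch_def uu scaleR_add_left)
      then show ?thesis by (simp add: algebra_simps)
    qed
    also have "\<rho> * l = D" using l by (simp add: \<rho>_def)
    finally show "tube_twist m r l \<rho> 1 a = b" using mb by simp
    have "measure lborel (tube m r l) \<le> 2 ^ CARD('n) * l * r ^ (CARD('n) - 1)"
      unfolding measure_def using emeasure_tube_le[OF ouw f r(1) l(1), of m] l r
      by (intro enn2real_leI) auto
    then have "measure lborel (tube m r l) * K powr p \<le> (2 ^ CARD('n) * l * r ^ (CARD('n) - 1)) * K powr p"
      by (rule mult_right_mono) simp
    also have "\<dots> = c * r powr e"
    proof -
      have 1: "K powr p = (2 * l * \<kappa>) powr p / r powr p"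
        unfolding K_def using l \<kappa> r by (simp add: powr_divide)
      have 2: "r ^ (CARD('n) - 1) = r powr (real CARD('n) - 1)"
        using r n by (simp add: powr_realpow[symmetric] of_nat_diff)
      show ?thesis unfolding 1 2 using powr_diff[of r "real CARD('n) - 1" p] by (simp add: c_def e_def)
    qed
    also have "\<dots> \<le> c * (\<eta> / c)" using re c by (intro mult_left_mono) auto
    also have "\<dots> = \<eta>" using c by simp
    finally show "measure lborel (tube m r l) * K powr p \<le> \<eta>" .
  qed (rule K)
qed

section \<open>Segments in general position\<close>

lemma segment_meets_imp_in_span:
  fixes a c x y :: "'a::real_vector"
  assumes meet: "closed_segment a c \<inter> closed_segment x y \<noteq> {}" and c: "c \<notin> closed_segment x y"
  shows "a \<in> (+) c ` span {x - c, y - c}"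
proof -
  obtain z where z: "z \<in> closed_segment a c" "z \<in> closed_segment x y" using meet by blast
  obtain s where s: "z = (1 - s) *\<^sub>R x + s *\<^sub>R y" using z(2) by (auto simp: in_segment)
  obtain t where t: "z = (1 - t) *\<^sub>R a + t *\<^sub>R c" using z(1) by (auto simp: in_segment)
  have t1: "t \<noteq> 1" using t z(2) c by auto
  have "z - c = (1 - s) *\<^sub>R (x - c) + s *\<^sub>R (y - c)" by (simp add: s algebra_simps)
  also have "\<dots> \<in> span {x - c, y - c}"
    by (intro span_add span_scale span_base) auto
  finally have zc: "z - c \<in> span {x - c, y - c}" .
  have "z - c = (1 - t) *\<^sub>R (a - c)" by (simp add: t algebra_simps)
  then have "a - c = (1 / (1 - t)) *\<^sub>R (z - c)" using t1 by simp
  then have "a - c \<in> span {x - c, y - c}" using span_scale[OF zc] by simp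
  then show ?thesis by (intro image_eqI[of _ _ "a - c"]) auto
qed

lemma negligible_translated_plane:
  fixes c x y :: "'a::euclidean_space"
  assumes "3 \<le> DIM('a)"
  shows "negligible ((+) c ` span {x, y})"
proof (rule negligible_translation, rule negligible_lowdim)
  have "dim {x, y} \<le> card {x, y}" by (rule dim_le_card') simp
  also have "\<dots> \<le> 2" by (simp add: card_insert_if)
  finally show "dim (span {x, y}) < DIM('a)" using assms by (simp add: dim_span)
qed

text \<open>A segment ending at \<open>c\<close> that meets a given segment not containing \<open>c\<close>
  starts in a plane through \<open>c\<close>, which is a null set in dimension three or more. So the starting
  points can be chosen one after the other in general position, provided that each new segment also avoids the
  end points of the later ones.\<close>
lemma disjoint_segments:
  fixes b :: "nat \<Rightarrow> 'a::euclidean_space"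
  assumes dim: "3 \<le> DIM('a)" and inj: "inj_on b {..<N}"
    and U: "\<And>i. i < N \<Longrightarrow> open (U i)" "\<And>i. i < N \<Longrightarrow> U i \<noteq> {}"
  obtains a where "\<And>i. i < N \<Longrightarrow> a i \<in> U i"
    "\<And>i j. i < N \<Longrightarrow> j < N \<Longrightarrow> i \<noteq> j \<Longrightarrow> closed_segment (a i) (b i) \<inter> closed_segment (a j) (b j) = {}"
proof -
  have "\<exists>a. (\<forall>i<n. a i \<in> U i) \<and>
      (\<forall>i<n. \<forall>j<n. i \<noteq> j \<longrightarrow> closed_segment (a i) (b i) \<inter> closed_segment (a j) (b j) = {}) \<and>
      (\<forall>i<n. \<forall>m<N. m \<noteq> i \<longrightarrow> b m \<notin> closed_segment (a i) (b i))" if "n \<le> N" for n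
    using that
  proof (induction n)
    case 0
    show ?case by simp
  next
    case (Suc n)
    have "n \<le> N" using Suc.prems by simp
    from Suc.IH[OF this] obtain a where a': "\<forall>i<n. a i \<in> U i"
      "\<forall>i<n. \<forall>j<n. i \<noteq> j \<longrightarrow> closed_segment (a i) (b i) \<inter> closed_segment (a j) (b j) = {}"
      "\<forall>i<n. \<forall>m<N. m \<noteq> i \<longrightarrow> b m \<notin> closed_segment (a i) (b i)"
      by (elim exE conjE) (rule that)
    note a = a'[rule_format]
    have nN: "n < N" using Suc.prems by simp
    \<comment> \<open>a null set containing the starting points whose segment meets an earlier segment or another end point\<close>
    define Z where "Z = (\<Union>i<n. (+) (b n) ` span {a i - b n, b i - b n}) \<union>
        (\<Union>m<N. (+) (b n) ` span {b m - b n, b m - b n})"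
    have point: "negligible ((+) c ` span {y})" for c y :: 'a
      using negligible_translated_plane[OF dim, of c y y] by simp
    have "negligible Z"
      unfolding Z_def by (intro negligible_Un negligible_Union) (auto intro: negligible_translated_plane[OF dim] point)
    moreover have "\<not> negligible (U n)" using open_not_negligible U nN by blast
    ultimately obtain x where x: "x \<in> U n" "x \<notin> Z" using negligible_subset by blast
    have x1: "closed_segment x (b n) \<inter> closed_segment (a i) (b i) = {}" if "i < n" for i
    proof (rule ccontr)
      assume "\<not> ?thesis"
      then have "x \<in> (+) (b n) ` span {a i - b n, b i - b n}"
        using a(3)[of i n] that nN by (intro segment_meets_imp_in_span) auto
      then show False using x(2) that unfolding Z_def by blast
    qed
    have x2: "b m \<notin> closed_segment x (b n)" if "m < N" "m \<noteq> n" for m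
    proof
      assume "b m \<in> closed_segment x (b n)"
      then have "closed_segment x (b n) \<inter> closed_segment (b m) (b m) \<noteq> {}" by simp
      moreover have "b n \<notin> closed_segment (b m) (b m)" using inj that nN by (auto simp: inj_on_def)
      ultimately have "x \<in> (+) (b n) ` span {b m - b n, b m - b n}"
        by (rule segment_meets_imp_in_span)
      then show False using x(2) that unfolding Z_def by blast
    qed
    show ?case
    proof (intro exI[of _ "a(n := x)"] conjI allI impI)
      fix i assume "i < Suc n"
      then show "(a(n := x)) i \<in> U i" using a(1) x by (cases "i = n") auto
    next
      fix i j assume "i < Suc n" "j < Suc n" "i \<noteq> j"
      then show "closed_segment ((a(n := x)) i) (b i) \<inter> closed_segment ((a(n := x)) j) (b j) = {}"
        using a(2)[of i j] x1[of i] x1[of j] by (cases "i = n"; cases "j = n") (auto simp: Int_commute)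
    next
      fix i m assume "i < Suc n" "m < N" "m \<noteq> i"
      then show "b m \<notin> closed_segment ((a(n := x)) i) (b i)"
        using a(3)[of i m] x2[of m] by (cases "i = n") auto
    qed
  qed
  from this[OF order_refl] show ?thesis
  proof (elim exE conjE)
    fix a
    assume "\<forall>i<N. a i \<in> U i"
      "\<forall>i<N. \<forall>j<N. i \<noteq> j \<longrightarrow> closed_segment (a i) (b i) \<inter> closed_segment (a j) (b j) = {}"
    then show thesis by (intro that[of a]) simp_all
  qed
qed

section \<open>Spaces parametrized by the cube\<close>

text \<open>The properties of the Riemannian distance, the volume and the parametrization on which the
  perturbation argument rests.\<close>
locale cube_space =
  fixes d :: "'m::{t2_space, second_countable_topology} \<Rightarrow> 'm \<Rightarrow> real"
    and vol :: "'m measure" and \<phi> :: "real^'d::finite \<Rightarrow> 'm"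
  assumes compact_UNIV: "compact (UNIV :: 'm set)"
    and metric: "Metric_space UNIV d"
    and open_iff: "\<And>U. open U \<longleftrightarrow> (\<forall>x\<in>U. \<exists>e>0. \<forall>y. d x y < e \<longrightarrow> y \<in> U)"
    and cube: "cube_parametrization d vol \<phi>"
    and sets_vol: "sets vol = sets borel"
begin

lemma d_nonneg: "0 \<le> d x y"
  and d_commute: "d x y = d y x"
  and d_zero: "d x y = 0 \<longleftrightarrow> x = y"
  and d_triangle: "d x z \<le> d x y + d y z"
  using metric by (simp_all add: Metric_space_def)

lemma d_self [simp]: "d x x = 0" by (simp add: d_zero)

lemma open_d_ball: "open {y. d x y < e}"
  unfolding open_iff
proof
  fix y assume y: "y \<in> {y. d x y < e}"
  have "z \<in> {y. d x y < e}" if "d y z < e - d x y" for z using d_triangle[of x z y] that by simp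
  then show "\<exists>r>0. \<forall>z. d y z < r \<longrightarrow> z \<in> {y. d x y < e}" using y by (intro exI[of _ "e - d x y"]) auto
qed

lemma tendsto_d:
  assumes "(f \<longlongrightarrow> a) F" "(h \<longlongrightarrow> b) F"
  shows "((\<lambda>x. d (f x) (h x)) \<longlongrightarrow> d a b) F"
proof (rule tendstoI)
  fix e :: real assume e: "e > 0"
  have "\<forall>\<^sub>F x in F. f x \<in> {y. d a y < e / 2}" "\<forall>\<^sub>F x in F. h x \<in> {y. d b y < e / 2}"
    using topological_tendstoD[OF assms(1) open_d_ball[of a "e / 2"]]
      topological_tendstoD[OF assms(2) open_d_ball[of b "e / 2"]] e by simp_all
  then show "\<forall>\<^sub>F x in F. dist (d (f x) (h x)) (d a b) < e"
  proof eventually_elim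
    case (elim x)
    have "d (f x) (h x) \<le> d (f x) a + (d a b + d b (h x))"
      using d_triangle[of "f x" "h x" a] d_triangle[of a "h x" b] by simp
    moreover have "d a b \<le> d a (f x) + (d (f x) (h x) + d (h x) b)"
      using d_triangle[of a b "f x"] d_triangle[of "f x" b "h x"] by simp
    ultimately show ?case using elim by (simp add: dist_real_def d_commute abs_less_iff)
  qed
qed

lemma continuous_on_d:
  "continuous_on S f \<Longrightarrow> continuous_on S h \<Longrightarrow> continuous_on S (\<lambda>x. d (f x) (h x))"
  unfolding continuous_on_def by (blast intro: tendsto_d)

lemma d_bounded: "\<exists>D>0. \<forall>x y. d x y \<le> D"
proof -
  have co: "compact (UNIV \<times> UNIV :: ('m \<times> 'm) set)" by (intro compact_Times compact_UNIV)
  have c: "continuous_on (UNIV \<times> UNIV) (\<lambda>z. d (fst z) (snd z))"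
    by (intro continuous_on_d continuous_intros)
  obtain z where z: "\<forall>w\<in>UNIV \<times> UNIV. d (fst w) (snd w) \<le> d (fst z) (snd z)"
    using continuous_attains_sup[OF co _ c] by blast
  have "d x y \<le> \<bar>d (fst z) (snd z)\<bar> + 1" for x y
    using z[rule_format, of "(x, y)"] by simp
  then show ?thesis by (intro exI[of _ "\<bar>d (fst z) (snd z)\<bar> + 1"]) auto
qed

text \<open>Compactness leaves finitely many of the neighbourhoods. For pairs of points outside all of them the
  distance is bounded below, while the distances of the images are bounded above.\<close>
lemma locally_lipschitz_imp_lipschitz:
  assumes loc: "\<And>x. \<exists>N C. open N \<and> x \<in> N \<and> (\<forall>y\<in>N. \<forall>z\<in>N. d (H y) (H z) \<le> C * d y z)"
  shows "\<exists>C. \<forall>x y. d (H x) (H y) \<le> C * d x y"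
proof -
  obtain N C where N: "\<And>x. open (N x)" "\<And>x. x \<in> N x"
      "\<And>x y z. y \<in> N x \<Longrightarrow> z \<in> N x \<Longrightarrow> d (H y) (H z) \<le> C x * d y z"
    using loc by metis
  obtain X where X: "finite X" "UNIV \<subseteq> (\<Union>x\<in>X. N x)"
    using compactE_image[OF compact_UNIV, of UNIV N] N by (metis UNIV_I UN_I subsetI)
  define K where "K = (UNIV \<times> UNIV) - (\<Union>x\<in>X. N x \<times> N x)"
  have "open (\<Union>x\<in>X. N x \<times> N x)" by (intro open_UN ballI open_Times N)
  then have K: "compact K"
    unfolding K_def by (intro compact_diff compact_Times compact_UNIV)
  obtain D where "D > 0" "\<forall>x y. d x y \<le> D" using d_bounded by blast
  then have D: "D > 0" "d x y \<le> D" for x y by auto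
  define C0 where "C0 = Max (insert 0 (C ` X))"
  have C0: "0 \<le> C0" "\<And>x. x \<in> X \<Longrightarrow> C x \<le> C0" using X(1) by (auto simp: C0_def)
  obtain m where m: "m > 0" "\<And>z. z \<in> K \<Longrightarrow> m \<le> d (fst z) (snd z)"
  proof (cases "K = {}")
    case True then show ?thesis using that[of 1] by simp
  next
    case False
    have "continuous_on K (\<lambda>z. d (fst z) (snd z))" by (intro continuous_on_d continuous_intros)
    from continuous_attains_inf[OF K False this] obtain z where z: "z \<in> K" "\<And>w. w \<in> K \<Longrightarrow> d (fst z) (snd z) \<le> d (fst w) (snd w)"
      by blast
    have "fst z \<noteq> snd z"
    proof
      assume eq: "fst z = snd z"
      obtain x where "x \<in> X" "fst z \<in> N x" using X(2) by blast
      then have "z \<in> (\<Union>x\<in>X. N x \<times> N x)" using eq by (auto simp: mem_Times_iff)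
      then show False using z(1) by (simp add: K_def)
    qed
    then have "d (fst z) (snd z) > 0" using d_zero d_nonneg by (metis less_eq_real_def)
    then show ?thesis using z(2) that by blast
  qed
  have "d (H y) (H z) \<le> max C0 (D / m) * d y z" for y z
  proof (cases "(y, z) \<in> K")
    case True
    then have "D \<le> D / m * d y z" using m(2)[OF True] m(1) D(1) by (simp add: field_simps)
    also have "\<dots> \<le> max C0 (D / m) * d y z" by (rule mult_right_mono) (auto simp: d_nonneg)
    finally show ?thesis using D(2)[of "H y" "H z"] by linarith
  next
    case False
    then obtain x where x: "x \<in> X" "y \<in> N x" "z \<in> N x" by (auto simp: K_def)
    have "d (H y) (H z) \<le> C x * d y z" by (rule N(3)[OF x(2,3)])
    also have "\<dots> \<le> max C0 (D / m) * d y z" using C0(2)[OF x(1)] by (intro mult_right_mono) (auto simp: d_nonneg)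
    finally show ?thesis .
  qed
  then show ?thesis by blast
qed

abbreviation "Q \<equiv> box 0 1 :: (real^'d) set"
abbreviation "P \<equiv> \<phi> ` box 0 1"
abbreviation "\<psi> \<equiv> cube_inv \<phi>"

lemma continuous_on_phi: "continuous_on (cbox 0 1) \<phi>"
  and phi_surj: "\<phi> ` cbox 0 1 = UNIV"
  and open_P: "open P"
  and homeo_phi: "homeomorphism Q P \<phi> \<psi>"
  and null_compl_P: "emeasure vol (- P) = 0"
  using cube unfolding cube_parametrization_def by blast+

lemma psi_phi [simp]: "y \<in> Q \<Longrightarrow> \<psi> (\<phi> y) = y"
  and phi_psi [simp]: "x \<in> P \<Longrightarrow> \<phi> (\<psi> x) = x"
  and continuous_on_psi: "continuous_on P \<psi>"
  and continuous_on_phi_Q: "continuous_on Q \<phi>"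
  using homeo_phi by (auto simp: homeomorphism_def)

lemma psi_mem: "x \<in> P \<Longrightarrow> \<psi> x \<in> Q"
  using homeo_phi by (auto simp: homeomorphism_def)

text \<open>A local bi-Lipschitz constant of the parametrization, valid near every point of the open
  cube.\<close>
definition L where "L = (SOME L. L > 0 \<and> (\<forall>x\<in>box 0 1. \<exists>W. open W \<and> x \<in> W \<and> W \<subseteq> box 0 1 \<and>
        (\<forall>y\<in>W. \<forall>z\<in>W. dist y z / L \<le> d (\<phi> y) (\<phi> z) \<and> d (\<phi> y) (\<phi> z) \<le> L * dist y z)))"

lemma L_ex: "\<exists>L. L > 0 \<and> (\<forall>x\<in>box 0 1. \<exists>W. open W \<and> x \<in> W \<and> W \<subseteq> box 0 1 \<and>
        (\<forall>y\<in>W. \<forall>z\<in>W. dist y z / L \<le> d (\<phi> y) (\<phi> z) \<and> d (\<phi> y) (\<phi> z) \<le> L * dist y z))"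
  using cube unfolding cube_parametrization_def by blast

lemma L_spec: "L > 0 \<and> (\<forall>x\<in>box 0 1. \<exists>W. open W \<and> x \<in> W \<and> W \<subseteq> box 0 1 \<and>
        (\<forall>y\<in>W. \<forall>z\<in>W. dist y z / L \<le> d (\<phi> y) (\<phi> z) \<and> d (\<phi> y) (\<phi> z) \<le> L * dist y z))"
  unfolding L_def by (rule someI_ex[OF L_ex])

lemma L_pos: "L > 0" by (rule L_spec[THEN conjunct1])

lemma bilipschitz_nhd:
  assumes "y \<in> Q"
  obtains W where "open W" "y \<in> W" "W \<subseteq> Q"
    "\<And>u v. u \<in> W \<Longrightarrow> v \<in> W \<Longrightarrow> dist u v \<le> L * d (\<phi> u) (\<phi> v)"
    "\<And>u v. u \<in> W \<Longrightarrow> v \<in> W \<Longrightarrow> d (\<phi> u) (\<phi> v) \<le> L * dist u v"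
proof -
  from bspec[OF L_spec[THEN conjunct2] assms] obtain W where W: "open W" "y \<in> W" "W \<subseteq> Q"
      "\<forall>u\<in>W. \<forall>v\<in>W. dist u v / L \<le> d (\<phi> u) (\<phi> v) \<and> d (\<phi> u) (\<phi> v) \<le> L * dist u v"
    by (elim exE conjE) (rule that)
  have "dist u v \<le> L * d (\<phi> u) (\<phi> v)" if "u \<in> W" "v \<in> W" for u v
    using W(4) that L_pos by (auto simp: divide_le_eq mult.commute)
  then show ?thesis by (intro that[of W]) (use W in auto)
qed

lemma open_phi_image:
  assumes "open W" "W \<subseteq> Q"
  shows "open (\<phi> ` W)"
proof -
  have "\<phi> ` W = P \<inter> \<psi> -` W"
  proof (intro equalityI subsetI)
    fix x assume "x \<in> P \<inter> \<psi> -` W"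
    then show "x \<in> \<phi> ` W" by (intro image_eqI[of _ _ "\<psi> x"]) auto
  next
    fix x assume "x \<in> \<phi> ` W"
    then obtain y where "y \<in> W" "x = \<phi> y" by blast
    then show "x \<in> P \<inter> \<psi> -` W" using assms(2) by (auto simp: subset_iff)
  qed
  also have "open \<dots>" by (rule continuous_open_preimage[OF continuous_on_psi open_P assms(1)])
  finally show ?thesis .
qed

lemma open_phi_preimage:
  assumes "open U" shows "open {y \<in> Q. \<phi> y \<in> U}"
  using continuous_open_preimage[OF continuous_on_phi_Q open_box assms] by (simp add: vimage_def Int_def)

lemma phi_uniform:
  assumes "\<epsilon> > 0"
  obtains \<delta> where "\<delta> > 0" "\<And>y z. y \<in> Q \<Longrightarrow> z \<in> Q \<Longrightarrow> dist y z < \<delta> \<Longrightarrow> d (\<phi> y) (\<phi> z) < \<epsilon>"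
proof -
  let ?I = "cbox 0 1 :: (real^'d) set" let ?F = "\<lambda>w. d (\<phi> (fst w)) (\<phi> (snd w))"
  have "continuous_on (?I \<times> ?I) ?F"
    by (intro continuous_on_d continuous_on_compose2[OF continuous_on_phi] continuous_intros) auto
  then have "uniformly_continuous_on (?I \<times> ?I) ?F"
    by (rule compact_uniformly_continuous) (intro compact_Times compact_cbox)
  then obtain \<delta> where \<delta>: "\<delta> > 0" "\<And>w w'. w \<in> ?I \<times> ?I \<Longrightarrow> w' \<in> ?I \<times> ?I \<Longrightarrow> dist w' w < \<delta> \<Longrightarrow> dist (?F w') (?F w) < \<epsilon>"
    using assms unfolding uniformly_continuous_on_def by metis
  show ?thesis
  proof (rule that[OF \<delta>(1)])
    fix y z assume yz: "y \<in> Q" "z \<in> Q" "dist y z < \<delta>"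
    have "dist (?F (y, z)) (?F (y, y)) < \<epsilon>"
      by (rule \<delta>(2)) (use yz box_subset_cbox in \<open>auto simp: dist_Pair_Pair dist_commute subset_iff\<close>)
    then show "d (\<phi> y) (\<phi> z) < \<epsilon>" by simp
  qed
qed

text \<open>The ratio between Lebesgue measure in the cube and the volume.\<close>
definition a where "a = (SOME a. a > 0 \<and> (\<forall>B\<in>sets borel. emeasure lborel (\<phi> -` B \<inter> cbox 0 1) = ennreal a * emeasure vol B))"

lemma a_pos: "a > 0" and emeasure_cbox: "B \<in> sets borel \<Longrightarrow> emeasure lborel (\<phi> -` B \<inter> cbox 0 1) = ennreal a * emeasure vol B"
proof -
  have "\<exists>a. a > 0 \<and> (\<forall>B\<in>sets borel. emeasure lborel (\<phi> -` B \<inter> cbox 0 1) = ennreal a * emeasure vol B)"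
    using cube unfolding cube_parametrization_def by blast
  from someI_ex[OF this, folded a_def]
  show "a > 0" "B \<in> sets borel \<Longrightarrow> emeasure lborel (\<phi> -` B \<inter> cbox 0 1) = ennreal a * emeasure vol B"
    by blast+
qed

lemma measurable_continuous_on_preimage:
  fixes f :: "'x::topological_space \<Rightarrow> 'y::topological_space"
  assumes "continuous_on A f" "A \<in> sets borel" "B \<in> sets borel"
  shows "{x \<in> A. f x \<in> B} \<in> sets borel"
proof -
  have "f \<in> borel_measurable (restrict_space borel A)" by (rule borel_measurable_continuous_on_restrict[OF assms(1)])
  from measurable_sets[OF this assms(3)] have "f -` B \<inter> A \<in> sets (restrict_space borel A)"
    by (simp add: space_restrict_space)
  then have "f -` B \<inter> A \<in> sets borel" using assms(2) by (auto simp: sets_restrict_space_iff sets_restrict_space)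
  moreover have "f -` B \<inter> A = {x \<in> A. f x \<in> B}" by auto
  ultimately show ?thesis by simp
qed

lemma borel_Q_preimage: "B \<in> sets borel \<Longrightarrow> {y \<in> Q. \<phi> y \<in> B} \<in> sets borel"
  by (rule measurable_continuous_on_preimage[OF continuous_on_phi_Q]) auto

lemma borel_P_preimage: "B \<in> sets borel \<Longrightarrow> {x \<in> P. \<psi> x \<in> B} \<in> sets borel"
  by (rule measurable_continuous_on_preimage[OF continuous_on_psi]) (auto intro: borel_open open_P)

lemma emeasure_Q:
  assumes B: "B \<in> sets borel"
  shows "emeasure lborel {y \<in> Q. \<phi> y \<in> B} = ennreal a * emeasure vol B"
proof -
  have "{y \<in> cbox 0 1. \<phi> y \<in> B} \<in> sets borel"
    by (rule measurable_continuous_on_preimage[OF continuous_on_phi _ B]) auto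
  moreover have "{y \<in> cbox 0 1. \<phi> y \<in> B} = \<phi> -` B \<inter> cbox 0 1" by auto
  ultimately have c: "\<phi> -` B \<inter> cbox 0 1 \<in> sets lborel" by simp
  have "AE y in lborel. y \<notin> cbox 0 1 - Q" by (rule AE_not_in[OF null_sets_cbox_Diff_box])
  then have "emeasure lborel {y \<in> Q. \<phi> y \<in> B} = emeasure lborel (\<phi> -` B \<inter> cbox 0 1)"
    using borel_Q_preimage[OF B] c box_subset_cbox[of "0 :: real^'d" 1]
    by (intro emeasure_eq_AE) (auto simp: subset_iff elim!: eventually_mono)
  then show ?thesis using emeasure_cbox[OF B] by simp
qed

lemma emeasure_vol_finite: "emeasure vol B < \<infinity>"
proof -
  have "emeasure lborel {y \<in> Q. \<phi> y \<in> UNIV} = ennreal a * emeasure vol UNIV" by (rule emeasure_Q) simp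
  then have "ennreal a * emeasure vol UNIV < \<infinity>" using emeasure_lborel_box_finite[of "0 :: real^'d" 1] by simp
  then have "emeasure vol UNIV < \<infinity>" using a_pos by (auto simp: ennreal_mult_less_top less_top)
  moreover have "emeasure vol B \<le> emeasure vol UNIV"
    by (rule emeasure_mono) (auto simp: sets_vol)
  ultimately show ?thesis by (rule le_less_trans[rotated])
qed

lemma finite_measure_vol: "finite_measure vol"
  by (rule finite_measureI) (use emeasure_vol_finite in \<open>simp add: less_top\<close>)

lemma open_meets_P:
  assumes "open U" "U \<noteq> {}"
  shows "{y \<in> Q. \<phi> y \<in> U} \<noteq> {}"
proof -
  obtain x where "x \<in> U" using assms by blast
  then obtain y where y: "y \<in> cbox 0 1" "\<phi> y \<in> U" using phi_surj by (metis UNIV_I imageE)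
  obtain V where V: "open V" "cbox 0 1 \<inter> \<phi> -` U = cbox 0 1 \<inter> V"
    using continuous_openin_preimage_gen[OF continuous_on_phi assms(1)] by (auto simp: openin_open)
  have ne: "box 0 1 \<noteq> ({} :: (real^'d) set)" by (auto simp: interval_ne_empty_cart)
  have "y \<in> V" using V(2) y by blast
  moreover have "y \<in> closure Q" using y closure_box[OF ne] by simp
  ultimately have "V \<inter> Q \<noteq> {}" using V(1) open_Int_closure_eq_empty by blast
  then show ?thesis using V(2) box_subset_cbox[of "0 :: real^'d" 1] by blast
qed

lemma emeasure_vol_pos:
  assumes "open U" "U \<noteq> {}"
  shows "emeasure vol U > 0"
proof (rule ccontr)
  assume "\<not> ?thesis"
  then have "emeasure lborel {y \<in> Q. \<phi> y \<in> U} = 0" using emeasure_Q[of U] assms(1) by (simp add: not_gr_zero)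
  then have "{y \<in> Q. \<phi> y \<in> U} \<in> null_sets lborel"
    using borel_Q_preimage[of U] assms(1) by (auto simp: null_sets_def)
  then have "negligible {y \<in> Q. \<phi> y \<in> U}" using borel_Q_preimage[of U] assms(1)
    by (simp add: negligible_iff_null_sets null_sets_completion_iff)
  then show False using open_not_negligible[OF open_phi_preimage[OF assms(1)] open_meets_P[OF assms]] by blast
qed

definition d_lipschitz :: "real \<Rightarrow> ('m \<Rightarrow> 'm) \<Rightarrow> bool" where
  "d_lipschitz C f \<longleftrightarrow> 0 \<le> C \<and> (\<forall>x y. d (f x) (f y) \<le> C * d x y)"

lemma Lip_homeosD:
  assumes "f \<in> Lip_homeos d vol"
  shows "homeo f" "volume_preserving vol f" "\<exists>C. d_lipschitz C f" "continuous_on UNIV f" "bij f"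
proof -
  show h: "homeo f" "volume_preserving vol f" using assms by (auto simp: Lip_homeos_def)
  obtain C where C: "\<forall>x y. d (f x) (f y) \<le> C * d x y" using assms by (auto simp: Lip_homeos_def)
  have "d (f x) (f y) \<le> \<bar>C\<bar> * d x y" for x y
    using C[rule_format, of x y] mult_right_mono[OF abs_ge_self[of C] d_nonneg[of x y]] by linarith
  then show "\<exists>C. d_lipschitz C f" by (auto simp: d_lipschitz_def intro!: exI[of _ "\<bar>C\<bar>"])
  show "continuous_on UNIV f" using h(1) by (auto simp: homeo_def homeomorphism_def)
  obtain k where "homeomorphism UNIV UNIV f k" using h(1) by (auto simp: homeo_def)
  then show "bij f" by (intro o_bij[of k f]) (auto simp: homeomorphism_def fun_eq_iff)
qed

text \<open>The parametrization and its inverse contribute a factor \<open>L\<close> each, whatever the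
  point.\<close>
lemma cube_map_local_lipschitz:
  assumes f: "d_lipschitz C f" "continuous_on UNIV f" and y: "y \<in> Q" "f (\<phi> y) \<in> P"
  obtains N where "open N" "y \<in> N" "N \<subseteq> Q" "\<And>z. z \<in> N \<Longrightarrow> f (\<phi> z) \<in> P"
    "\<And>u v. u \<in> N \<Longrightarrow> v \<in> N \<Longrightarrow> dist (cube_map \<phi> f u) (cube_map \<phi> f v) \<le> L * C * L * dist u v"
proof -
  obtain W where W: "open W" "y \<in> W" "W \<subseteq> Q"
    "\<And>u v. u \<in> W \<Longrightarrow> v \<in> W \<Longrightarrow> dist u v \<le> L * d (\<phi> u) (\<phi> v)"
    "\<And>u v. u \<in> W \<Longrightarrow> v \<in> W \<Longrightarrow> d (\<phi> u) (\<phi> v) \<le> L * dist u v"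
    by (rule bilipschitz_nhd[OF y(1)]) (rule that, assumption+)
  obtain W' where W': "open W'" "\<psi> (f (\<phi> y)) \<in> W'" "W' \<subseteq> Q"
    "\<And>u v. u \<in> W' \<Longrightarrow> v \<in> W' \<Longrightarrow> dist u v \<le> L * d (\<phi> u) (\<phi> v)"
    "\<And>u v. u \<in> W' \<Longrightarrow> v \<in> W' \<Longrightarrow> d (\<phi> u) (\<phi> v) \<le> L * dist u v"
    by (rule bilipschitz_nhd[OF psi_mem[OF y(2)]]) (rule that, assumption+)
  have oV: "open (f -` (\<phi> ` W'))" by (rule open_vimage[OF open_phi_image[OF W'(1,3)] f(2)])
  define N where "N = W \<inter> {z \<in> Q. \<phi> z \<in> f -` (\<phi> ` W')}"
  have N: "open N" unfolding N_def by (intro open_Int W open_phi_preimage oV)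
  have fN: "f (\<phi> z) \<in> P" "\<psi> (f (\<phi> z)) \<in> W'" if zN: "z \<in> N" for z
  proof -
    obtain w where "w \<in> W'" "f (\<phi> z) = \<phi> w" using zN by (auto simp: N_def)
    then show "f (\<phi> z) \<in> P" "\<psi> (f (\<phi> z)) \<in> W'" using W'(3) by (auto simp: subset_iff)
  qed
  show ?thesis
  proof (rule that[OF N])
    show "y \<in> N" using y W(2) W'(2) by (auto simp: N_def intro!: image_eqI[of _ _ "\<psi> (f (\<phi> y))"])
    show "N \<subseteq> Q" by (auto simp: N_def)
    show "f (\<phi> z) \<in> P" if "z \<in> N" for z by (rule fN(1)[OF that])
    fix u v assume uv: "u \<in> N" "v \<in> N"
    have "dist (cube_map \<phi> f u) (cube_map \<phi> f v) \<le> L * d (f (\<phi> u)) (f (\<phi> v))"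
      using W'(4)[OF fN(2)[OF uv(1)] fN(2)[OF uv(2)]] fN(1) uv by (simp add: cube_map_def)
    also have "\<dots> \<le> L * (C * d (\<phi> u) (\<phi> v))" using f(1) L_pos by (intro mult_left_mono) (auto simp: d_lipschitz_def)
    also have "\<dots> \<le> L * (C * (L * dist u v))"
      using W(5) uv L_pos f(1) by (intro mult_left_mono) (auto simp: N_def d_lipschitz_def)
    finally show "dist (cube_map \<phi> f u) (cube_map \<phi> f v) \<le> L * C * L * dist u v" by (simp add: mult.assoc)
  qed
qed

lemma cube_deriv_eq:
  assumes "y \<in> Q" "f (\<phi> y) \<in> P"
  shows "cube_deriv \<phi> f (\<phi> y) $ i $ j = directional_deriv (\<lambda>z. cube_map \<phi> f z $ i) (axis j 1) y"
  using assms by (simp add: cube_deriv_def directional_deriv_def)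

lemma cube_deriv_zero: "\<not> (x \<in> P \<and> f x \<in> P) \<Longrightarrow> cube_deriv \<phi> f x = 0"
  unfolding cube_deriv_def by (rule if_not_P)

lemma eventually_line:
  fixes e :: "'x::real_normed_vector"
  assumes "open N" "y \<in> N"
  shows "\<forall>\<^sub>F t::real in at 0. y + t *\<^sub>R e \<in> N"
proof -
  have "((\<lambda>t::real. y + t *\<^sub>R e) \<longlongrightarrow> y + 0 *\<^sub>R e) (at 0)" by (intro tendsto_intros)
  then show ?thesis using assms by (intro topological_tendstoD) auto
qed

lemma abs_directional_deriv_le_lipschitz:
  fixes V :: "real^'d \<Rightarrow> real^'d"
  assumes N: "open N" "y \<in> N" and lip: "\<And>u. u \<in> N \<Longrightarrow> dist (V u) (V y) \<le> C * dist u y"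
  shows "\<bar>directional_deriv (\<lambda>z. V z $ i) (axis j 1) y\<bar> \<le> max C \<bar>deriv_default\<bar>"
proof (rule abs_directional_deriv_le)
  show "\<forall>\<^sub>F t in at 0. \<bar>V (y + t *\<^sub>R axis j 1) $ i - V y $ i\<bar> \<le> C * \<bar>t\<bar>"
    using eventually_line[OF N, of "axis j 1"]
  proof eventually_elim
    case (elim t)
    have "\<bar>V (y + t *\<^sub>R axis j 1) $ i - V y $ i\<bar> \<le> dist (V (y + t *\<^sub>R axis j 1)) (V y)"
      using component_le_norm_cart[of "V (y + t *\<^sub>R axis j 1) - V y" i] by (simp add: dist_norm)
    also have "\<dots> \<le> C * dist (y + t *\<^sub>R axis j 1) y" by (rule lip[OF elim])
    also have "dist (y + t *\<^sub>R axis j 1) y = \<bar>t\<bar>" by (simp add: dist_norm norm_axis_1)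
    finally show ?case .
  qed
qed

lemma abs_cube_deriv_le:
  assumes f: "d_lipschitz C f" "continuous_on UNIV f"
  shows "\<bar>cube_deriv \<phi> f x $ i $ j\<bar> \<le> max (L * C * L) \<bar>deriv_default\<bar>"
proof (cases "x \<in> P \<and> f x \<in> P")
  case True
  then obtain y where y: "y \<in> Q" "x = \<phi> y" "f (\<phi> y) \<in> P" by blast
  obtain N where N: "open N" "y \<in> N" "N \<subseteq> Q" "\<And>z. z \<in> N \<Longrightarrow> f (\<phi> z) \<in> P"
    "\<And>u v. u \<in> N \<Longrightarrow> v \<in> N \<Longrightarrow> dist (cube_map \<phi> f u) (cube_map \<phi> f v) \<le> L * C * L * dist u v"
    by (rule cube_map_local_lipschitz[OF f y(1,3)]) (rule that, assumption+)
  show ?thesis unfolding y(2) cube_deriv_eq[of y f, OF y(1,3)]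
    by (rule abs_directional_deriv_le_lipschitz[OF N(1,2)]) (use N in auto)
next
  case False
  then show ?thesis by (simp add: cube_deriv_zero)
qed

end

lemma directional_deriv_cong:
  assumes "open N" "y \<in> N" "\<And>z. z \<in> N \<Longrightarrow> u z = v z"
  shows "directional_deriv u e y = directional_deriv v e y"
    "directionally_differentiable u e y \<longleftrightarrow> directionally_differentiable v e y"
proof -
  let ?u = "\<lambda>t. u (y + t *\<^sub>R e)" and ?v = "\<lambda>t. v (y + t *\<^sub>R e)"
  have "((\<lambda>t::real. y + t *\<^sub>R e) \<longlongrightarrow> y + 0 *\<^sub>R e) (nhds 0)"
    by (intro tendsto_intros filterlim_ident)
  then have "\<forall>\<^sub>F t in nhds 0. y + t *\<^sub>R e \<in> N" using assms(1,2) by (intro topological_tendstoD) auto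
  then have ev: "\<forall>\<^sub>F t in nhds 0. ?u t = ?v t" by eventually_elim (use assms(3) in auto)
  show "directional_deriv u e y = directional_deriv v e y"
    unfolding directional_deriv_def by (rule deriv_cong_ev[OF ev refl])
  have "(?u has_field_derivative D) (at 0) \<longleftrightarrow> (?v has_field_derivative D) (at 0)" for D
    by (rule DERIV_cong_ev[OF refl ev refl])
  then show "directionally_differentiable u e y \<longleftrightarrow> directionally_differentiable v e y"
    unfolding directionally_differentiable_def real_differentiable_def by simp
qed

context cube_space
begin

section \<open>Lipschitz maps read in the cube\<close>

text \<open>A local Lipschitz bound with the same constant at all points propagates along the segments of the
  ball.\<close>
lemma cube_map_lipschitz_on_cball:
  assumes f: "d_lipschitz C f" "continuous_on UNIV f" and B: "cball y r \<subseteq> Q" "\<And>z. z \<in> cball y r \<Longrightarrow> f (\<phi> z) \<in> P"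
    and uv: "u \<in> cball y r" "v \<in> cball y r"
  shows "dist (cube_map \<phi> f u) (cube_map \<phi> f v) \<le> L * C * L * dist u v"
proof -
  have C: "C \<ge> 0" using f(1) by (simp add: d_lipschitz_def)
  let ?F = "\<lambda>t. cube_map \<phi> f (u + t *\<^sub>R (v - u))"
  let ?M = "L * C * L * dist u v"
  have seg: "u + t *\<^sub>R (v - u) \<in> cball y r" if "t \<in> {0..1}" for t
  proof -
    have "(1 - t) *\<^sub>R u + t *\<^sub>R v \<in> cball y r"
      using convexD[OF convex_cball uv, of "1 - t" t] that by simp
    then show ?thesis by (simp add: algebra_simps)
  qed
  have cm: "continuous_on (cball y r) (cube_map \<phi> f)"
    unfolding cube_map_def
    by (intro continuous_on_compose continuous_on_subset[OF continuous_on_phi_Q B(1)] continuous_on_subset[OF f(2)]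
        continuous_on_subset[OF continuous_on_psi]) (use B(2) in auto)
  have "?M-lipschitz_on {0..1} ?F"
  proof (rule Lipschitz.locally_lipschitz_imp_lipschitz)
    show "continuous_on {0..1} ?F"
      by (rule continuous_on_compose2[OF cm]) (use seg in \<open>auto intro!: continuous_intros\<close>)
    fix s t :: real assume s: "s \<in> {0..<1}" "s < t"
    let ?w = "u + s *\<^sub>R (v - u)"
    have w: "?w \<in> cball y r" using seg s by auto
    obtain N where N: "open N" "?w \<in> N" "N \<subseteq> Q" "\<And>z. z \<in> N \<Longrightarrow> f (\<phi> z) \<in> P"
      "\<And>u v. u \<in> N \<Longrightarrow> v \<in> N \<Longrightarrow> dist (cube_map \<phi> f u) (cube_map \<phi> f v) \<le> L * C * L * dist u v"
    proof (rule cube_map_local_lipschitz[OF f, of ?w])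
      show "?w \<in> Q" "f (\<phi> ?w) \<in> P" using w B by auto
    qed (rule that, assumption+)
    have "\<forall>\<^sub>F z in at_right s. u + z *\<^sub>R (v - u) \<in> N"
    proof -
      have "((\<lambda>z. u + z *\<^sub>R (v - u)) \<longlongrightarrow> ?w) (at_right s)" by (intro tendsto_intros)
      then show ?thesis using N(1,2) by (rule topological_tendstoD)
    qed
    moreover have "\<forall>\<^sub>F z in at_right s. z \<in> {s<..<t}" by (rule eventually_at_right_real[OF s(2)])
    ultimately have "\<forall>\<^sub>F z in at_right s. u + z *\<^sub>R (v - u) \<in> N \<and> z \<in> {s<..<t}" by (rule eventually_conj)
    then obtain z where z: "u + z *\<^sub>R (v - u) \<in> N" "z \<in> {s<..<t}"
      using eventually_happens' trivial_limit_at_right_real by blast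
    have "dist (?F z) (?F s) \<le> L * C * L * dist (u + z *\<^sub>R (v - u)) ?w" by (rule N(5)[OF z(1) N(2)])
    also have "dist (u + z *\<^sub>R (v - u)) ?w = (z - s) * dist u v"
    proof -
      have "u + z *\<^sub>R (v - u) - ?w = (z - s) *\<^sub>R (v - u)" by (simp add: algebra_simps)
      then show ?thesis using z(2) by (simp add: dist_norm norm_minus_commute)
    qed
    finally show "\<exists>z\<in>{s<..t}. dist (?F z) (?F s) \<le> ?M * (z - s)"
      using z(2) by (intro bexI[of _ z]) (auto simp: mult_ac)
  qed (use L_pos C in simp)
  from lipschitz_onD[OF this, of 0 1] show ?thesis by simp
qed

text \<open>Composing with the nearest point projection to a ball extends a coordinate of \<open>f\<close> to
  the whole space, where the results on Lipschitz functions apply.\<close>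
definition clamp :: "('m \<Rightarrow> 'm) \<Rightarrow> real^'d \<Rightarrow> real \<Rightarrow> 'd \<Rightarrow> real^'d \<Rightarrow> real" where
  "clamp f y r i z = cube_map \<phi> f (closest_point (cball y r) z) $ i"

lemma clamp_lipschitz:
  assumes f: "d_lipschitz C f" "continuous_on UNIV f" and B: "cball y r \<subseteq> Q" "\<And>z. z \<in> cball y r \<Longrightarrow> f (\<phi> z) \<in> P"
    and r: "r > 0"
  shows "(L * C * L)-lipschitz_on UNIV (clamp f y r i)"
proof (rule lipschitz_onI)
  fix u v :: "real^'d"
  let ?c = "closest_point (cball y r)"
  have in_ball: "?c z \<in> cball y r" for z using r by (intro closest_point_in_set) auto
  have "dist (clamp f y r i u) (clamp f y r i v) \<le> dist (cube_map \<phi> f (?c u)) (cube_map \<phi> f (?c v))"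
    using component_le_norm_cart[of "cube_map \<phi> f (?c u) - cube_map \<phi> f (?c v)" i]
    by (simp add: clamp_def dist_norm)
  also have "\<dots> \<le> L * C * L * dist (?c u) (?c v)"
    by (rule cube_map_lipschitz_on_cball[OF f B in_ball in_ball])
  also have "\<dots> \<le> L * C * L * dist u v"
    using r L_pos f(1) by (intro mult_left_mono closest_point_lipschitz) (auto simp: d_lipschitz_def)
  finally show "dist (clamp f y r i u) (clamp f y r i v) \<le> L * C * L * dist u v" .
qed (use L_pos f(1) in \<open>simp add: d_lipschitz_def\<close>)

lemma cube_deriv_clamp:
  assumes B: "cball y r \<subseteq> Q" "\<And>z. z \<in> cball y r \<Longrightarrow> f (\<phi> z) \<in> P" and z: "z \<in> ball y r"
  shows "cube_deriv \<phi> f (\<phi> z) $ i $ j = directional_deriv (clamp f y r i) (axis j 1) z"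
proof -
  have zc: "z \<in> cball y r" using z by simp
  have "cube_deriv \<phi> f (\<phi> z) $ i $ j = directional_deriv (\<lambda>z. cube_map \<phi> f z $ i) (axis j 1) z"
    by (rule cube_deriv_eq) (use B zc in auto)
  also have "\<dots> = directional_deriv (clamp f y r i) (axis j 1) z"
    by (rule directional_deriv_cong(1)[of "ball y r"]) (use z in \<open>auto simp: clamp_def closest_point_self\<close>)
  finally show ?thesis .
qed

lemma good_ball:
  assumes f: "continuous_on UNIV f" and y: "y \<in> Q" "f (\<phi> y) \<in> P"
  obtains r where "r > 0" "cball y r \<subseteq> Q" "\<And>z. z \<in> cball y r \<Longrightarrow> f (\<phi> z) \<in> P"
proof -
  have "open {z \<in> Q. \<phi> z \<in> f -` P}" by (intro open_phi_preimage open_vimage[OF open_P f])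
  moreover have "y \<in> {z \<in> Q. \<phi> z \<in> f -` P}" using y by auto
  ultimately obtain r where "r > 0" "cball y r \<subseteq> {z \<in> Q. \<phi> z \<in> f -` P}" using open_contains_cball by blast
  then show ?thesis using that by (auto simp: subset_iff)
qed

text \<open>By Lindelof's theorem, statements up to null sets about the points of the cube at which
  \<open>f\<close> is read in the cube can be proved ball by ball.\<close>
lemma countable_good_balls:
  assumes f: "continuous_on UNIV f" and R: "\<And>y. y \<in> Q \<Longrightarrow> f (\<phi> y) \<in> P \<Longrightarrow> R y > 0"
  obtains Y where "countable Y" "Y \<subseteq> {y \<in> Q. f (\<phi> y) \<in> P}" "{y \<in> Q. f (\<phi> y) \<in> P} \<subseteq> (\<Union>y\<in>Y. ball y (R y))"
proof -
  let ?\<Omega> = "{y \<in> Q. f (\<phi> y) \<in> P}"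
  obtain F where F: "F \<subseteq> (\<lambda>y. ball y (R y)) ` ?\<Omega>" "countable F" "\<Union>F = \<Union>((\<lambda>y. ball y (R y)) ` ?\<Omega>)"
    using Lindelof[of "(\<lambda>y. ball y (R y)) ` ?\<Omega>"] by auto
  obtain Y where Y: "Y \<subseteq> ?\<Omega>" "countable Y" "F = (\<lambda>y. ball y (R y)) ` Y"
    using countable_subset_image[of F "\<lambda>y. ball y (R y)" ?\<Omega>] F by auto
  have "?\<Omega> \<subseteq> \<Union>F" unfolding F(3) using R by (auto intro!: bexI)
  then show ?thesis using that[of Y] Y by auto
qed

text \<open>On each of countably many balls the entry is a directional derivative of a Lipschitz function on the
  whole space.\<close>
lemma measurable_cube_deriv:
  assumes f: "d_lipschitz C f" "continuous_on UNIV f"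
  shows "(\<lambda>x. cube_deriv \<phi> f x $ i $ j) \<in> borel_measurable vol"
proof -
  let ?\<Omega> = "{y \<in> Q. f (\<phi> y) \<in> P}"
  define R where "R y = (SOME r. r > 0 \<and> cball y r \<subseteq> Q \<and> (\<forall>z\<in>cball y r. f (\<phi> z) \<in> P))" for y
  have R: "R y > 0" "cball y (R y) \<subseteq> Q" "\<And>z. z \<in> cball y (R y) \<Longrightarrow> f (\<phi> z) \<in> P" if y: "y \<in> Q" "f (\<phi> y) \<in> P" for y
  proof -
    have "\<exists>r. r > 0 \<and> cball y r \<subseteq> Q \<and> (\<forall>z\<in>cball y r. f (\<phi> z) \<in> P)"
      using good_ball[OF f(2) y] by metis
    then have "R y > 0 \<and> cball y (R y) \<subseteq> Q \<and> (\<forall>z\<in>cball y (R y). f (\<phi> z) \<in> P)"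
      unfolding R_def by (rule someI_ex)
    then show "R y > 0" "cball y (R y) \<subseteq> Q" "\<And>z. z \<in> cball y (R y) \<Longrightarrow> f (\<phi> z) \<in> P" by auto
  qed
  obtain Y where Y: "countable Y" "Y \<subseteq> ?\<Omega>" "?\<Omega> \<subseteq> (\<Union>y\<in>Y. ball y (R y))"
    by (rule countable_good_balls[where f = f and R = R]) (rule f(2) R(1) that | assumption)+
  have "(\<lambda>x. cube_deriv \<phi> f x $ i $ j) \<in> borel_measurable borel"
  proof (rule borel_measurableI)
    fix B :: "real set" assume "open B"
    then have B: "B \<in> sets borel" by simp
    define Z where "Z = (\<Union>y\<in>Y. ball y (R y) \<inter> directional_deriv (clamp f y (R y) i) (axis j 1) -` B)"
    have Z: "Z \<in> sets borel"
      unfolding Z_def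
    proof (rule sets.countable_UN''[OF Y(1)])
      fix y assume "y \<in> Y"
      then have y: "y \<in> Q" "f (\<phi> y) \<in> P" using Y(2) by auto
      have "continuous_on UNIV (clamp f y (R y) i)"
        by (rule lipschitz_on_continuous_on[OF clamp_lipschitz[OF f R(2,3,1)[OF y]]])
      from measurable_sets[OF borel_measurable_directional_deriv[OF this] B]
      show "ball y (R y) \<inter> directional_deriv (clamp f y (R y) i) (axis j 1) -` B \<in> sets borel" by simp
    qed
    have ZQ: "(y \<in> Z) = (cube_deriv \<phi> f (\<phi> y) $ i $ j \<in> B)" if y: "y \<in> Q" "f (\<phi> y) \<in> P" for y
    proof -
      have *: "directional_deriv (clamp f y (R y) i) (axis j 1) z = cube_deriv \<phi> f (\<phi> z) $ i $ j"
        if "y \<in> Y" "z \<in> ball y (R y)" for y z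
      proof (rule cube_deriv_clamp[symmetric])
        have y: "y \<in> Q" "f (\<phi> y) \<in> P" using that Y(2) by auto
        show "cball y (R y) \<subseteq> Q" by (rule R(2)[OF y])
        show "f (\<phi> z) \<in> P" if "z \<in> cball y (R y)" for z by (rule R(3)[OF y that])
      qed (rule that(2))
      obtain y' where "y' \<in> Y" "y \<in> ball y' (R y')" using Y(3) y by auto
      then show ?thesis using * unfolding Z_def by (auto simp del: mem_ball)
    qed
    have fP: "f -` P \<in> sets borel" by (intro borel_open open_vimage[OF open_P f(2)])
    have "(\<lambda>x. cube_deriv \<phi> f x $ i $ j) -` B \<inter> space borel =
        ({x \<in> P. \<psi> x \<in> Z} \<inter> f -` P) \<union> (if 0 \<in> B then - (P \<inter> f -` P) else {})"
    proof -
      have iff: "cube_deriv \<phi> f x $ i $ j \<in> B \<longleftrightarrow>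
          x \<in> ({x \<in> P. \<psi> x \<in> Z} \<inter> f -` P) \<union> (if 0 \<in> B then - (P \<inter> f -` P) else {})" for x
      proof (cases "x \<in> P \<and> f x \<in> P")
        case True
        then have "(\<psi> x \<in> Z) = (cube_deriv \<phi> f x $ i $ j \<in> B)" using ZQ[of "\<psi> x"] by (simp add: psi_mem)
        then show ?thesis using True by simp
      next
        case False
        then have "cube_deriv \<phi> f x = 0" by (rule cube_deriv_zero)
        then show ?thesis using False by auto
      qed
      show ?thesis
      proof (rule set_eqI)
        fix x
        show "(x \<in> (\<lambda>x. cube_deriv \<phi> f x $ i $ j) -` B \<inter> space borel) =
            (x \<in> ({x \<in> P. \<psi> x \<in> Z} \<inter> f -` P) \<union> (if 0 \<in> B then - (P \<inter> f -` P) else {}))"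
          using iff[of x] by (simp only: Int_iff vimage_eq space_borel UNIV_I simp_thms)
      qed
    qed
    also have "\<dots> \<in> sets borel"
    proof -
      have "- (P \<inter> f -` P) \<in> sets borel" using borel_open[OF open_P] fP by (intro borel_comp sets.Int)
      then show ?thesis using borel_P_preimage[OF Z] fP by auto
    qed
    finally show "(\<lambda>x. cube_deriv \<phi> f x $ i $ j) -` B \<inter> space borel \<in> sets borel" .
  qed
  then show ?thesis by (simp add: measurable_cong_sets[OF sets_vol refl])
qed

lemma Lp_matrix_cube_deriv:
  assumes f: "f \<in> Lip_homeos d vol" and p: "1 \<le> p"
  shows "Lp_matrix vol p (cube_deriv \<phi> f)"
proof -
  interpret finite_measure vol by (rule finite_measure_vol)
  obtain C where C: "d_lipschitz C f" using Lip_homeosD(3)[OF f] by blast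
  note fc = Lip_homeosD(4)[OF f]
  let ?M = "max (L * C * L) \<bar>deriv_default\<bar>"
  have "integrable vol (\<lambda>x. \<bar>cube_deriv \<phi> f x $ i $ j\<bar> powr p)" for i j
  proof (rule integrable_const_bound[where B = "?M powr p"])
    show "AE x in vol. norm (\<bar>cube_deriv \<phi> f x $ i $ j\<bar> powr p) \<le> ?M powr p"
      using p abs_cube_deriv_le[OF C fc] by (auto intro!: AE_I2 powr_mono2)
  qed (use measurable_cube_deriv[OF C fc] in simp)
  then show ?thesis using measurable_cube_deriv[OF C fc] by (simp add: Lp_matrix_def Lp_fun_def)
qed

lemma sobolev_pair_cube_deriv:
  assumes f: "f \<in> Lip_homeos d vol" and p: "1 \<le> p"
  shows "sobolev_pair d vol \<phi> p f (cube_deriv \<phi> f)"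
  unfolding sobolev_pair_def
proof (intro conjI exI[of _ "\<lambda>_. f"])
  show "Lp_matrix vol p (cube_deriv \<phi> f)" by (rule Lp_matrix_cube_deriv[OF f p])
  show "continuous_on UNIV f" by (rule Lip_homeosD(4)[OF f])
  show "(\<lambda>n. Lp_matrix_norm vol p (\<lambda>x. cube_deriv \<phi> f x - cube_deriv \<phi> f x)) \<longlonglongrightarrow> 0"
    unfolding Lp_matrix_norm_0 by (rule tendsto_const)
qed (use f in auto)

section \<open>Transplanting maps of the cube to the manifold\<close>

text \<open>The maps with which the dynamics is perturbed. The inverse \<open>h'\<close> is kept because its
  Lipschitz constant and continuity are needed too, and the support \<open>S\<close> because it bounds the
  region where derivatives change.\<close>
definition inner_homeo :: "real \<Rightarrow> (real^'d \<Rightarrow> real^'d) \<Rightarrow> (real^'d \<Rightarrow> real^'d) \<Rightarrow> (real^'d) set \<Rightarrow> bool" where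
  "inner_homeo K h h' S \<longleftrightarrow> 1 \<le> K \<and> K-lipschitz_on UNIV h \<and> K-lipschitz_on UNIV h' \<and>
     (\<forall>x. h (h' x) = x) \<and> (\<forall>x. h' (h x) = x) \<and>
     (\<forall>B\<in>sets borel. emeasure lborel (h -` B) = emeasure lborel B) \<and>
     compact S \<and> S \<subseteq> Q \<and> (\<forall>x. x \<notin> S \<longrightarrow> h x = x)"

text \<open>The map of the manifold that reads \<open>h\<close> in the cube, continued by the identity.\<close>
definition ext :: "(real^'d \<Rightarrow> real^'d) \<Rightarrow> 'm \<Rightarrow> 'm" where
  "ext h x = (if x \<in> P then \<phi> (h (\<psi> x)) else x)"

lemma inner_homeo_sym:
  assumes "inner_homeo K h h' S"
  shows "inner_homeo K h' h S"
proof -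
  have hh: "h (h' x) = x" "h' (h x) = x" for x using assms by (auto simp: inner_homeo_def)
  have "h' -` B \<in> sets borel" if "B \<in> sets borel" for B
  proof -
    have "continuous_on UNIV h'" using assms by (auto simp: inner_homeo_def intro: lipschitz_on_continuous_on)
    from measurable_sets[OF borel_measurable_continuous_onI[OF this] that] show ?thesis by simp
  qed
  then have "emeasure lborel (h' -` B) = emeasure lborel (h -` (h' -` B))" if "B \<in> sets borel" for B
    using assms that by (auto simp: inner_homeo_def)
  moreover have "h -` (h' -` B) = B" for B by (auto simp: hh)
  moreover have "h' x = x" if "x \<notin> S" for x
    using assms that hh[of x] unfolding inner_homeo_def by metis
  ultimately show ?thesis using assms unfolding inner_homeo_def by auto
qed

lemma inner_homeo_maps_S:
  assumes h: "inner_homeo K h h' S" and x: "x \<in> S"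
  shows "h x \<in> S"
proof (rule ccontr)
  assume "h x \<notin> S"
  then have "h (h x) = h x" using h by (auto simp: inner_homeo_def)
  then have "h' (h (h x)) = h' (h x)" by simp
  then have "h x = x" using h by (auto simp: inner_homeo_def)
  then show False using \<open>h x \<notin> S\<close> x by simp
qed

lemma inner_homeo_maps_Q:
  assumes h: "inner_homeo K h h' S" and x: "x \<in> Q"
  shows "h x \<in> Q"
proof (cases "x \<in> S")
  case True
  then show ?thesis using inner_homeo_maps_S[OF h True] h by (auto simp: inner_homeo_def)
next
  case False
  then show ?thesis using h x by (auto simp: inner_homeo_def)
qed

lemma inner_homeo_mem_Q_iff: "inner_homeo K h h' S \<Longrightarrow> h x \<in> Q \<longleftrightarrow> x \<in> Q"
  using inner_homeo_maps_Q[of K h h' S x] inner_homeo_maps_Q[OF inner_homeo_sym, of K h h' S "h x"]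
  by (auto simp: inner_homeo_def)

lemma ext_phi: "y \<in> Q \<Longrightarrow> ext h (\<phi> y) = \<phi> (h y)"
  by (simp add: ext_def)

lemma ext_outside: "x \<notin> P \<Longrightarrow> ext h x = x"
  by (simp add: ext_def)

lemma ext_comp:
  assumes "\<And>y. y \<in> Q \<Longrightarrow> k y \<in> Q"
  shows "ext (h \<circ> k) x = ext h (ext k x)"
  using assms[OF psi_mem, of x] by (cases "x \<in> P") (auto simp: ext_def)

lemma ext_off_support: "inner_homeo K h h' S \<Longrightarrow> x \<notin> \<phi> ` S \<Longrightarrow> ext h x = x"
  by (cases "x \<in> P") (auto simp: ext_def inner_homeo_def image_iff dest: spec[of _ "\<psi> x"])

lemma ext_inverse: "inner_homeo K h h' S \<Longrightarrow> ext h (ext h' x) = x"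
  using ext_comp[of h' h x] inner_homeo_maps_Q[OF inner_homeo_sym, of K h h' S]
  by (cases "x \<in> P") (auto simp: ext_def inner_homeo_def)

lemma closed_phi_image:
  assumes "compact S" "S \<subseteq> Q"
  shows "closed (\<phi> ` S)"
  by (intro compact_imp_closed compact_continuous_image assms continuous_on_subset[OF continuous_on_phi_Q])

text \<open>The complement of the compact support is open, and there the map is the identity.\<close>
lemma continuous_on_ext:
  assumes h: "inner_homeo K h h' S"
  shows "continuous_on UNIV (ext h)"
proof -
  have S: "compact S" "S \<subseteq> Q" using h by (auto simp: inner_homeo_def)
  have un: "UNIV = P \<union> - \<phi> ` S" using S by auto
  have "continuous_on P (\<phi> \<circ> (h \<circ> \<psi>))"
  proof (intro continuous_on_compose continuous_on_psi)
    show "continuous_on (\<psi> ` P) h"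
      using h by (auto simp: inner_homeo_def intro: continuous_on_subset[OF lipschitz_on_continuous_on])
    show "continuous_on ((h \<circ> \<psi>) ` P) \<phi>"
      by (rule continuous_on_subset[OF continuous_on_phi_Q]) (use psi_mem inner_homeo_maps_Q[OF h] in auto)
  qed
  then have "continuous_on P (ext h)" by (rule continuous_on_eq) (simp add: ext_def)
  moreover have "continuous_on (- \<phi> ` S) (ext h)"
    by (rule continuous_on_eq[OF continuous_on_id]) (use ext_off_support[OF h] in auto)
  ultimately show ?thesis
    unfolding un by (intro continuous_on_open_Un open_P open_Compl closed_phi_image S)
qed

lemma volume_preserving_ext:
  assumes h: "inner_homeo K h h' S"
  shows "volume_preserving vol (ext h)"
  unfolding volume_preserving_def sets_vol
proof
  fix B :: "'m set" assume B: "B \<in> sets borel"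
  have E: "ext h -` B \<in> sets borel"
    using measurable_sets[OF borel_measurable_continuous_onI[OF continuous_on_ext[OF h]] B] by simp
  have "{y \<in> Q. \<phi> y \<in> ext h -` B} = h -` {y \<in> Q. \<phi> y \<in> B}"
    using inner_homeo_mem_Q_iff[OF h] by (auto simp: ext_phi)
  then have "ennreal a * emeasure vol (ext h -` B) = emeasure lborel (h -` {y \<in> Q. \<phi> y \<in> B})"
    using emeasure_Q[OF E] by simp
  also have "\<dots> = emeasure lborel {y \<in> Q. \<phi> y \<in> B}"
    using h borel_Q_preimage[OF B] by (auto simp: inner_homeo_def)
  also have "\<dots> = ennreal a * emeasure vol B" by (rule emeasure_Q[OF B])
  finally show "emeasure vol (ext h -` B) = emeasure vol B"
    using a_pos by (auto simp: ennreal_mult_cancel_left)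
qed

text \<open>Locally the map is either the identity or, in bi-Lipschitz coordinates, the map
  \<open>h\<close>.\<close>
lemma ext_lipschitz:
  assumes h: "inner_homeo K h h' S"
  shows "\<exists>C. \<forall>x y. d (ext h x) (ext h y) \<le> C * d x y"
proof (rule locally_lipschitz_imp_lipschitz)
  fix x
  have S: "compact S" "S \<subseteq> Q" and K: "1 \<le> K" "K-lipschitz_on UNIV h" using h by (auto simp: inner_homeo_def)
  have hc: "continuous_on UNIV h" using K(2) by (rule lipschitz_on_continuous_on)
  show "\<exists>N C. open N \<and> x \<in> N \<and> (\<forall>y\<in>N. \<forall>z\<in>N. d (ext h y) (ext h z) \<le> C * d y z)"
  proof (cases "x \<in> P")
    case True
    then obtain y where y: "y \<in> Q" "x = \<phi> y" by blast
    obtain W where W: "open W" "y \<in> W" "W \<subseteq> Q"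
      "\<And>u v. u \<in> W \<Longrightarrow> v \<in> W \<Longrightarrow> dist u v \<le> L * d (\<phi> u) (\<phi> v)"
      "\<And>u v. u \<in> W \<Longrightarrow> v \<in> W \<Longrightarrow> d (\<phi> u) (\<phi> v) \<le> L * dist u v"
      by (rule bilipschitz_nhd[OF y(1)]) (rule that, assumption+)
    obtain W' where W': "open W'" "h y \<in> W'" "W' \<subseteq> Q"
      "\<And>u v. u \<in> W' \<Longrightarrow> v \<in> W' \<Longrightarrow> dist u v \<le> L * d (\<phi> u) (\<phi> v)"
      "\<And>u v. u \<in> W' \<Longrightarrow> v \<in> W' \<Longrightarrow> d (\<phi> u) (\<phi> v) \<le> L * dist u v"
      by (rule bilipschitz_nhd[OF inner_homeo_maps_Q[OF h y(1)]]) (rule that, assumption+)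
    let ?V = "W \<inter> h -` W'"
    have V: "open ?V" by (intro open_Int W open_vimage W' hc)
    have "d (ext h (\<phi> u)) (ext h (\<phi> v)) \<le> (L * K * L) * d (\<phi> u) (\<phi> v)" if uv: "u \<in> ?V" "v \<in> ?V" for u v
    proof -
      have "u \<in> Q" "v \<in> Q" using uv W(3) by auto
      then have "d (ext h (\<phi> u)) (ext h (\<phi> v)) = d (\<phi> (h u)) (\<phi> (h v))" by (simp add: ext_phi)
      also have "\<dots> \<le> L * dist (h u) (h v)" using uv by (intro W'(5)) auto
      also have "\<dots> \<le> L * (K * dist u v)"
        using lipschitz_onD[OF K(2)] L_pos by (intro mult_left_mono) auto
      also have "\<dots> \<le> L * (K * (L * d (\<phi> u) (\<phi> v)))"
        using W(4) uv L_pos K(1) by (intro mult_left_mono) auto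
      finally show ?thesis by (simp add: mult.assoc)
    qed
    then show ?thesis using open_phi_image[OF V] W y W'
      by (intro exI[of _ "\<phi> ` ?V"] exI[of _ "L * K * L"]) auto
  next
    case False
    then show ?thesis
      using closed_phi_image[OF S] ext_off_support[OF h] S
      by (intro exI[of _ "- \<phi> ` S"] exI[of _ 1]) auto
  qed
qed

lemma ext_in_Lip_homeos:
  assumes h: "inner_homeo K h h' S"
  shows "ext h \<in> Lip_homeos d vol"
proof -
  have "homeomorphism UNIV UNIV (ext h) (ext h')"
    using continuous_on_ext[OF h] continuous_on_ext[OF inner_homeo_sym[OF h]]
      ext_inverse[OF h] ext_inverse[OF inner_homeo_sym[OF h]]
    by (auto simp: homeomorphism_def intro!: surjI)
  then show ?thesis
    using volume_preserving_ext[OF h] ext_lipschitz[OF h] by (auto simp: Lip_homeos_def homeo_def)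
qed

lemma Lip_homeos_comp:
  assumes f: "f \<in> Lip_homeos d vol" and k: "k \<in> Lip_homeos d vol"
  shows "f \<circ> k \<in> Lip_homeos d vol"
proof -
  obtain f' k' where "homeomorphism UNIV UNIV f f'" "homeomorphism UNIV UNIV k k'"
    using f k by (auto simp: Lip_homeos_def homeo_def)
  then have "homeomorphism UNIV UNIV (f \<circ> k) (k' \<circ> f')" by (rule homeomorphism_compose[rotated])
  then have 1: "homeo (f \<circ> k)" by (auto simp: homeo_def)
  have 2: "volume_preserving vol (f \<circ> k)"
    unfolding volume_preserving_def
  proof
    fix B assume B: "B \<in> sets vol"
    have "f -` B \<in> sets vol"
      using measurable_sets[OF borel_measurable_continuous_onI[OF Lip_homeosD(4)[OF f]], of B] B
      by (simp add: sets_vol)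
    then show "emeasure vol ((f \<circ> k) -` B) = emeasure vol B"
      using Lip_homeosD(2)[OF f] Lip_homeosD(2)[OF k] B by (simp add: volume_preserving_def vimage_comp[symmetric])
  qed
  obtain C D where C: "d_lipschitz C f" and D: "d_lipschitz D k" using Lip_homeosD(3) f k by metis
  have "d (f (k x)) (f (k y)) \<le> (C * D) * d x y" for x y
  proof -
    have "d (f (k x)) (f (k y)) \<le> C * d (k x) (k y)" using C by (simp add: d_lipschitz_def)
    also have "\<dots> \<le> C * (D * d x y)" using C D by (intro mult_left_mono) (auto simp: d_lipschitz_def)
    finally show ?thesis by (simp add: mult.assoc)
  qed
  then have 3: "\<exists>L. \<forall>x y. d ((f \<circ> k) x) ((f \<circ> k) y) \<le> L * d x y" by auto
  show ?thesis using 1 2 3 by (simp add: Lip_homeos_def)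
qed

lemma cube_map_ext: "y \<in> Q \<Longrightarrow> cube_map \<phi> (f \<circ> ext h) y = cube_map \<phi> f (h y)" if "inner_homeo K h h' S"
  using inner_homeo_maps_Q[OF that, of y] by (simp add: cube_map_def ext_phi)

text \<open>Outside \<open>S\<close> the maps agree locally, and on \<open>S\<close> both derivatives are
  bounded in terms of the Lipschitz constants alone.\<close>
lemma cube_deriv_ext_diff:
  assumes h: "inner_homeo K h h' S" and f: "d_lipschitz C f" "continuous_on UNIV f"
  shows "\<bar>cube_deriv \<phi> (f \<circ> ext h) x $ i $ j - cube_deriv \<phi> f x $ i $ j\<bar>
       \<le> (2 * max (L * C * L) \<bar>deriv_default\<bar> * K) * indicator (\<phi> ` S) x"
proof -
  let ?M = "max (L * C * L) \<bar>deriv_default\<bar>"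
  have S: "compact S" "S \<subseteq> Q" and K: "1 \<le> K" "K-lipschitz_on UNIV h" using h by (auto simp: inner_homeo_def)
  have M: "?M \<ge> 0" by simp
  have C: "0 \<le> L * C * L" using f(1) L_pos by (simp add: d_lipschitz_def)
  show ?thesis
  proof (cases "x \<in> \<phi> ` S")
    case True
    then obtain y where y: "y \<in> S" "x = \<phi> y" by blast
    then have yQ: "y \<in> Q" using S by auto
    have "\<bar>cube_deriv \<phi> (f \<circ> ext h) x $ i $ j\<bar> \<le> ?M * K"
    proof (cases "f (\<phi> (h y)) \<in> P")
      case T: True
      obtain N where N: "open N" "h y \<in> N" "N \<subseteq> Q" "\<And>z. z \<in> N \<Longrightarrow> f (\<phi> z) \<in> P"
        "\<And>u v. u \<in> N \<Longrightarrow> v \<in> N \<Longrightarrow> dist (cube_map \<phi> f u) (cube_map \<phi> f v) \<le> L * C * L * dist u v"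
        by (rule cube_map_local_lipschitz[OF f inner_homeo_maps_Q[OF h yQ] T]) (rule that, assumption+)
      have hN: "open (Q \<inter> h -` N)"
        by (intro open_Int open_box open_vimage N lipschitz_on_continuous_on[OF K(2)])
      have "\<bar>directional_deriv (\<lambda>z. cube_map \<phi> (f \<circ> ext h) z $ i) (axis j 1) y\<bar> \<le> max (L * C * L * K) \<bar>deriv_default\<bar>"
      proof (rule abs_directional_deriv_le_lipschitz[OF hN])
        show "y \<in> Q \<inter> h -` N" using yQ N by auto
        fix u assume u: "u \<in> Q \<inter> h -` N"
        have "dist (cube_map \<phi> (f \<circ> ext h) u) (cube_map \<phi> (f \<circ> ext h) y) = dist (cube_map \<phi> f (h u)) (cube_map \<phi> f (h y))"
          using u yQ by (simp add: cube_map_ext[OF h])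
        also have "\<dots> \<le> L * C * L * dist (h u) (h y)" using u N by (intro N(5)) auto
        also have "\<dots> \<le> L * C * L * (K * dist u y)"
          using lipschitz_onD[OF K(2)] C by (intro mult_left_mono) auto
        finally show "dist (cube_map \<phi> (f \<circ> ext h) u) (cube_map \<phi> (f \<circ> ext h) y) \<le> L * C * L * K * dist u y"
          by (simp add: mult.assoc)
      qed
      moreover have "cube_deriv \<phi> (f \<circ> ext h) x $ i $ j = directional_deriv (\<lambda>z. cube_map \<phi> (f \<circ> ext h) z $ i) (axis j 1) y"
        unfolding y(2) by (rule cube_deriv_eq) (use yQ T in \<open>auto simp: ext_phi\<close>)
      moreover have "max (L * C * L * K) \<bar>deriv_default\<bar> \<le> ?M * K"
      proof (rule max.boundedI)
        show "L * C * L * K \<le> ?M * K" using K(1) by (intro mult_right_mono) auto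
        have "\<bar>deriv_default\<bar> * 1 \<le> ?M * K" using K(1) by (intro mult_mono) auto
        then show "\<bar>deriv_default\<bar> \<le> ?M * K" by simp
      qed
      ultimately show ?thesis by linarith
    next
      case F: False
      then have "cube_deriv \<phi> (f \<circ> ext h) x = 0"
        using yQ y by (intro cube_deriv_zero) (simp add: ext_phi)
      then show ?thesis using M K(1) by simp
    qed
    moreover have "\<bar>cube_deriv \<phi> f x $ i $ j\<bar> \<le> ?M * K"
      using abs_cube_deriv_le[OF f, of x i j] mult_left_mono[OF K(1) M] by linarith
    ultimately have "\<bar>cube_deriv \<phi> (f \<circ> ext h) x $ i $ j - cube_deriv \<phi> f x $ i $ j\<bar> \<le> 2 * ?M * K"
      by linarith
    then show ?thesis using True by simp
  next
    case False
    have e: "ext h x = x" by (rule ext_off_support[OF h False])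
    have "cube_deriv \<phi> (f \<circ> ext h) x $ i $ j = cube_deriv \<phi> f x $ i $ j"
    proof (cases "x \<in> P \<and> f x \<in> P")
      case True
      then obtain y where y: "y \<in> Q" "x = \<phi> y" "f (\<phi> y) \<in> P" by blast
      have yS: "y \<notin> S" using False y(2) by auto
      have "cube_deriv \<phi> (f \<circ> ext h) x $ i $ j = directional_deriv (\<lambda>z. cube_map \<phi> (f \<circ> ext h) z $ i) (axis j 1) y"
        unfolding y(2) by (rule cube_deriv_eq) (use y e in auto)
      also have "\<dots> = directional_deriv (\<lambda>z. cube_map \<phi> f z $ i) (axis j 1) y"
      proof (rule directional_deriv_cong(1)[of "Q - S"])
        show "open (Q - S)" using S by (intro open_Diff compact_imp_closed) auto
        show "y \<in> Q - S" using y yS by simp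
        show "cube_map \<phi> (f \<circ> ext h) z $ i = cube_map \<phi> f z $ i" if "z \<in> Q - S" for z
          using that h by (simp add: cube_map_ext[OF h] inner_homeo_def)
      qed
      also have "\<dots> = cube_deriv \<phi> f x $ i $ j" unfolding y(2) by (rule cube_deriv_eq[symmetric]) (use y in auto)
      finally show ?thesis .
    next
      case F: False
      then show ?thesis using e by (simp add: cube_deriv_zero)
    qed
    then show ?thesis using False by simp
  qed
qed

section \<open>Perturbation along segments with small change of the derivative\<close>

text \<open>The map of \<open>tube_map\<close> is transplanted to the manifold. The Lipschitz constant of
  \<open>f\<close> is known before the tube is chosen, so the tube can be so thin that the change of the
  derivative is small.\<close>
lemma perturb_along_segment:
  assumes f: "f \<in> Lip_homeos d vol" and n: "2 \<le> CARD('d)" and p: "1 \<le> p" "p < real CARD('d) - 1"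
    and seg: "closed_segment x y \<subseteq> Q" and \<epsilon>: "\<epsilon> > 0" and \<eta>: "\<eta> > 0"
  shows "\<exists>h h' K S. inner_homeo K h h' S \<and> (\<forall>z\<in>S. \<exists>w\<in>closed_segment x y. dist z w \<le> \<epsilon>) \<and> h x = y \<and>
      Lp_matrix_norm vol p (\<lambda>z. cube_deriv \<phi> (f \<circ> ext h) z - cube_deriv \<phi> f z) \<le> \<eta>"
proof -
  obtain C where C: "d_lipschitz C f" using Lip_homeosD(3)[OF f] by blast
  note fc = Lip_homeosD(4)[OF f]
  obtain e0 where e0: "e0 > 0" "(\<Union>w\<in>closed_segment x y. ball w e0) \<subseteq> Q"
    using compact_subset_open_imp_ball_epsilon_subset[OF compact_segment(1) open_box seg] by blast
  define \<epsilon>' where "\<epsilon>' = min \<epsilon> (e0 / 2)"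
  have \<epsilon>': "\<epsilon>' > 0" "\<epsilon>' \<le> \<epsilon>" "\<epsilon>' < e0" using \<epsilon> e0 by (auto simp: \<epsilon>'_def)
  define c1 where "c1 = 2 * max (L * C * L) \<bar>deriv_default\<bar> + 1"
  have c1: "c1 > 0" "2 * max (L * C * L) \<bar>deriv_default\<bar> \<le> c1" unfolding c1_def by linarith+
  define \<eta>0 where "\<eta>0 = \<eta> powr p * a / c1 powr p"
  have \<eta>0: "\<eta>0 > 0" using \<eta> a_pos c1 by (simp add: \<eta>0_def)
  have p0: "0 \<le> p" using p by simp
  obtain h h' K S where h: "1 \<le> K" "K-lipschitz_on UNIV h" "K-lipschitz_on UNIV h'"
    "\<forall>x. h (h' x) = x" "\<forall>x. h' (h x) = x"
    "\<forall>B\<in>sets borel. emeasure lborel (h -` B) = emeasure lborel B"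
    "compact S" "\<forall>x. x \<notin> S \<longrightarrow> h x = x" "\<forall>z\<in>S. \<exists>w\<in>closed_segment x y. dist z w \<le> \<epsilon>'"
    "h x = y" "measure lborel S * K powr p \<le> \<eta>0"
  proof (rule tube_map[OF n p0 p(2) \<epsilon>'(1) \<eta>0, of x y])
    fix h h' :: "real^'d \<Rightarrow> real^'d" and K S
    assume *: "1 \<le> K" "K-lipschitz_on UNIV h" "K-lipschitz_on UNIV h'" "\<And>x. h (h' x) = x" "\<And>x. h' (h x) = x"
      "\<And>B. B \<in> sets borel \<Longrightarrow> emeasure lborel (h -` B) = emeasure lborel B"
      "compact S" "\<And>x. x \<notin> S \<Longrightarrow> h x = x" "\<And>z. z \<in> S \<Longrightarrow> \<exists>w\<in>closed_segment x y. dist z w \<le> \<epsilon>'"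
      "h x = y" "measure lborel S * K powr p \<le> \<eta>0"
    show thesis
      by (rule that[of K h h' S]) (use * in simp_all)
  qed
  have SQ: "S \<subseteq> Q"
  proof
    fix z assume "z \<in> S"
    then obtain w where w: "w \<in> closed_segment x y" "dist z w \<le> \<epsilon>'" using h(9) by blast
    then have "z \<in> ball w e0" using \<epsilon>'(3) by (simp add: dist_commute)
    then show "z \<in> Q" using e0(2) w(1) by blast
  qed
  have ih: "inner_homeo K h h' S" using h SQ unfolding inner_homeo_def by simp
  have fe: "f \<circ> ext h \<in> Lip_homeos d vol" by (rule Lip_homeos_comp[OF f ext_in_Lip_homeos[OF ih]])
  have Scl: "closed (\<phi> ` S)" by (rule closed_phi_image[OF h(7) SQ])
  then have Sb: "\<phi> ` S \<in> sets borel" by simp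
  have "{y \<in> Q. \<phi> y \<in> \<phi> ` S} = S"
  proof (intro equalityI subsetI)
    fix y assume "y \<in> {y \<in> Q. \<phi> y \<in> \<phi> ` S}"
    then obtain s where "y \<in> Q" "s \<in> S" "\<phi> y = \<phi> s" by auto
    then show "y \<in> S" using psi_phi[of y] psi_phi[of s] SQ by auto
  qed (use SQ in auto)
  then have "emeasure lborel S = ennreal a * emeasure vol (\<phi> ` S)" using emeasure_Q[OF Sb] by simp
  then have vS: "measure lborel S = a * measure vol (\<phi> ` S)"
    using a_pos by (simp add: measure_def enn2real_mult)
  have norm: "Lp_norm vol p (\<lambda>z. (cube_deriv \<phi> (f \<circ> ext h) z - cube_deriv \<phi> f z) $ i $ j) \<le> \<eta>" for i j
  proof -
    have "Lp_norm vol p (\<lambda>z. cube_deriv \<phi> (f \<circ> ext h) z $ i $ j - cube_deriv \<phi> f z $ i $ j)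
        \<le> ((c1 * K) powr p * measure vol (\<phi> ` S)) powr (1 / p)"
    proof (rule Lp_norm_le_on_small_set[OF p(1)])
      show "\<phi> ` S \<in> sets vol" using Sb by (simp add: sets_vol)
      show "emeasure vol (\<phi> ` S) < \<infinity>" by (rule emeasure_vol_finite)
      obtain C' where C': "d_lipschitz C' (f \<circ> ext h)" using Lip_homeosD(3)[OF fe] by blast
      show "(\<lambda>z. cube_deriv \<phi> (f \<circ> ext h) z $ i $ j - cube_deriv \<phi> f z $ i $ j) \<in> borel_measurable vol"
        by (intro borel_measurable_diff measurable_cube_deriv[OF C fc] measurable_cube_deriv[OF C' Lip_homeosD(4)[OF fe]])
      show "0 \<le> c1 * K" using c1 h(1) by simp
      fix z
      have "\<bar>cube_deriv \<phi> (f \<circ> ext h) z $ i $ j - cube_deriv \<phi> f z $ i $ j\<bar>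
          \<le> (2 * max (L * C * L) \<bar>deriv_default\<bar> * K) * indicator (\<phi> ` S) z"
        by (rule cube_deriv_ext_diff[OF ih C fc])
      also have "\<dots> \<le> (c1 * K) * indicator (\<phi> ` S) z"
        using c1(2) h(1) by (intro mult_right_mono) auto
      finally show "\<bar>cube_deriv \<phi> (f \<circ> ext h) z $ i $ j - cube_deriv \<phi> f z $ i $ j\<bar> \<le> c1 * K * indicator (\<phi> ` S) z" .
    qed
    also have "\<dots> \<le> (\<eta> powr p) powr (1 / p)"
    proof (rule powr_mono2)
      have "(c1 * K) powr p * measure vol (\<phi> ` S) = c1 powr p / a * (measure lborel S * K powr p)"
        using c1 h(1) a_pos by (simp add: powr_mult vS)
      also have "\<dots> \<le> c1 powr p / a * \<eta>0"
        using h(11) a_pos by (intro mult_left_mono) auto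
      also have "\<dots> = \<eta> powr p" using c1 a_pos by (simp add: \<eta>0_def)
      finally show "(c1 * K) powr p * measure vol (\<phi> ` S) \<le> \<eta> powr p" .
    qed (use p in auto)
    also have "\<dots> = \<eta>" using p \<eta> by (simp add: powr_powr)
    finally show ?thesis by simp
  qed
  have "\<forall>z\<in>S. \<exists>w\<in>closed_segment x y. dist z w \<le> \<epsilon>" using h(9) \<epsilon>'(2) by (meson order_trans)
  then show ?thesis
    using ih h(10) norm by (intro exI[of _ h] exI[of _ h'] exI[of _ K] exI[of _ S]) (simp add: Lp_matrix_norm_le_iff)
qed

definition segment_nhd :: "real \<Rightarrow> real^'d \<Rightarrow> real^'d \<Rightarrow> (real^'d) set" where
  "segment_nhd \<epsilon> x y = {z. \<exists>w\<in>closed_segment x y. dist z w \<le> \<epsilon>}"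

lemma segment_nhd_dist:
  assumes z: "z \<in> segment_nhd \<epsilon> x y" "z' \<in> segment_nhd \<epsilon> x y"
  shows "dist z z' \<le> dist x y + 2 * \<epsilon>"
proof -
  obtain w w' where w: "w \<in> closed_segment x y" "dist z w \<le> \<epsilon>" "w' \<in> closed_segment x y" "dist z' w' \<le> \<epsilon>"
    using z by (auto simp: segment_nhd_def)
  obtain s where s: "0 \<le> s" "s \<le> 1" "w = (1 - s) *\<^sub>R x + s *\<^sub>R y" using w(1) by (auto simp: in_segment)
  obtain t where t: "0 \<le> t" "t \<le> 1" "w' = (1 - t) *\<^sub>R x + t *\<^sub>R y" using w(3) by (auto simp: in_segment)
  have "w - w' = (t - s) *\<^sub>R (x - y)" by (simp add: s t algebra_simps)
  then have "dist w w' = \<bar>t - s\<bar> * dist x y" by (simp add: dist_norm)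
  also have "\<dots> \<le> 1 * dist x y" using s t by (intro mult_right_mono) auto
  finally have "dist w w' \<le> dist x y" by simp
  moreover have "dist z z' \<le> dist z w + dist w w' + dist z' w'"
    using dist_triangle[of z z' w] dist_triangle[of w z' w'] by (simp add: dist_commute)
  ultimately show ?thesis using w by linarith
qed

text \<open>Disjoint segments can be served one after the other; the error in the derivative is made small at
  each stage, after the Lipschitz constant of the previous stage is known.\<close>
lemma perturb_along_segments:
  fixes N :: nat
  assumes f: "f \<in> Lip_homeos d vol" and n: "2 \<le> CARD('d)" and p: "1 \<le> p" "p < real CARD('d) - 1"
    and seg: "\<And>i. i < N \<Longrightarrow> closed_segment (x i) (y i) \<subseteq> Q" and \<epsilon>: "\<epsilon> > 0"
    and disj: "\<And>i j. i < N \<Longrightarrow> j < N \<Longrightarrow> i \<noteq> j \<Longrightarrow> segment_nhd \<epsilon> (x i) (y i) \<inter> segment_nhd \<epsilon> (x j) (y j) = {}"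
    and \<eta>: "\<eta> > 0"
  shows "\<exists>H. (\<forall>z\<in>Q. H z \<in> Q) \<and> f \<circ> ext H \<in> Lip_homeos d vol \<and>
      Lp_matrix_norm vol p (\<lambda>z. cube_deriv \<phi> (f \<circ> ext H) z - cube_deriv \<phi> f z) \<le> \<eta> \<and>
      (\<forall>i<N. H (x i) = y i) \<and> (\<forall>z. H z \<noteq> z \<longrightarrow> (\<exists>i<N. z \<in> segment_nhd \<epsilon> (x i) (y i) \<and> H z \<in> segment_nhd \<epsilon> (x i) (y i)))"
proof -
  let ?T = "\<lambda>i. segment_nhd \<epsilon> (x i) (y i)"
  have "\<forall>\<eta>>0. \<exists>H. (\<forall>z\<in>Q. H z \<in> Q) \<and> f \<circ> ext H \<in> Lip_homeos d vol \<and>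
      Lp_matrix_norm vol p (\<lambda>z. cube_deriv \<phi> (f \<circ> ext H) z - cube_deriv \<phi> f z) \<le> \<eta> \<and>
      (\<forall>i<n. H (x i) = y i) \<and> (\<forall>z. H z \<noteq> z \<longrightarrow> (\<exists>i<n. z \<in> ?T i \<and> H z \<in> ?T i))" if "n \<le> N" for n :: nat
    using that
  proof (induct n)
    case 0
    have e: "ext (\<lambda>z. z) = (\<lambda>x. x)" by (auto simp: ext_def fun_eq_iff)
    show ?case
      by (intro allI impI exI[of _ "\<lambda>z. z"]) (use f in \<open>simp add: e o_def Lp_matrix_norm_0[of vol p "\<lambda>_. 0", simplified]\<close>)
  next
    case (Suc n)
    show ?case
    proof (intro allI impI)
      fix \<eta> :: real assume \<eta>: "\<eta> > 0"
      have nN: "n < N" "n \<le> N" using Suc.prems by auto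
      have "\<eta> / 2 > 0" using \<eta> by simp
      then obtain H where H: "\<forall>z\<in>Q. H z \<in> Q" "f \<circ> ext H \<in> Lip_homeos d vol"
          "Lp_matrix_norm vol p (\<lambda>z. cube_deriv \<phi> (f \<circ> ext H) z - cube_deriv \<phi> f z) \<le> \<eta> / 2"
          "\<forall>i<n. H (x i) = y i" "\<forall>z. H z \<noteq> z \<longrightarrow> (\<exists>i<n. z \<in> ?T i \<and> H z \<in> ?T i)"
        using Suc.hyps[OF nN(2)] by blast
      obtain h h' K S where h: "inner_homeo K h h' S" "\<forall>z\<in>S. \<exists>w\<in>closed_segment (x n) (y n). dist z w \<le> \<epsilon>"
          "h (x n) = y n"
          "Lp_matrix_norm vol p (\<lambda>z. cube_deriv \<phi> ((f \<circ> ext H) \<circ> ext h) z - cube_deriv \<phi> (f \<circ> ext H) z) \<le> \<eta> / 2"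
        using perturb_along_segment[OF H(2) \<open>2 \<le> CARD('d)\<close> p seg[OF nN(1)] \<epsilon> \<open>\<eta> / 2 > 0\<close>] by blast
      have ST: "S \<subseteq> ?T n" using h(2) by (auto simp: segment_nhd_def)
      have off: "h z = z" if "z \<notin> S" for z using h(1) that by (auto simp: inner_homeo_def)
      have HT: "H z = z" if "z \<in> ?T n" for z
      proof (rule ccontr)
        assume "H z \<noteq> z"
        then obtain i where "i < n" "z \<in> ?T i" using H(5) by blast
        then show False using disj[of i n] nN that by auto
      qed
      have end_points: "x i \<in> ?T i" "y i \<in> ?T i" for i
        unfolding segment_nhd_def using \<epsilon> ends_in_segment[of "x i" "y i"]
        by (intro CollectI, force)+
      have e: "ext (H \<circ> h) = ext H \<circ> ext h"
        using ext_comp[of h H] inner_homeo_maps_Q[OF h(1)] by (auto simp: fun_eq_iff)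
      have G: "f \<circ> ext (H \<circ> h) = (f \<circ> ext H) \<circ> ext h" unfolding e by (simp add: o_assoc)
      have GL: "f \<circ> ext (H \<circ> h) \<in> Lip_homeos d vol"
        unfolding G by (rule Lip_homeos_comp[OF H(2) ext_in_Lip_homeos[OF h(1)]])
      show "\<exists>H. (\<forall>z\<in>Q. H z \<in> Q) \<and> f \<circ> ext H \<in> Lip_homeos d vol \<and>
        Lp_matrix_norm vol p (\<lambda>z. cube_deriv \<phi> (f \<circ> ext H) z - cube_deriv \<phi> f z) \<le> \<eta> \<and>
        (\<forall>i<Suc n. H (x i) = y i) \<and> (\<forall>z. H z \<noteq> z \<longrightarrow> (\<exists>i<Suc n. z \<in> ?T i \<and> H z \<in> ?T i))"
      proof (intro exI[of _ "H \<circ> h"] conjI)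
        show "\<forall>z\<in>Q. (H \<circ> h) z \<in> Q" using H(1) inner_homeo_maps_Q[OF h(1)] by auto
        show "f \<circ> ext (H \<circ> h) \<in> Lip_homeos d vol" by (rule GL)
        have "Lp_matrix_norm vol p (\<lambda>z. cube_deriv \<phi> (f \<circ> ext (H \<circ> h)) z - cube_deriv \<phi> f z)
            \<le> Lp_matrix_norm vol p (\<lambda>z. cube_deriv \<phi> (f \<circ> ext (H \<circ> h)) z - cube_deriv \<phi> (f \<circ> ext H) z)
              + Lp_matrix_norm vol p (\<lambda>z. cube_deriv \<phi> (f \<circ> ext H) z - cube_deriv \<phi> f z)"
          by (intro Lp_matrix_norm_triangle p Lp_matrix_cube_deriv GL H(2) f)
        also have "\<dots> \<le> \<eta> / 2 + \<eta> / 2" using h(4) H(3) unfolding G by (intro add_mono)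
        finally show "Lp_matrix_norm vol p (\<lambda>z. cube_deriv \<phi> (f \<circ> ext (H \<circ> h)) z - cube_deriv \<phi> f z) \<le> \<eta>" by simp
        show "\<forall>i<Suc n. (H \<circ> h) (x i) = y i"
        proof (intro allI impI)
          fix i assume i: "i < Suc n"
          show "(H \<circ> h) (x i) = y i"
          proof (cases "i = n")
            case True
            then show ?thesis using h(3) HT[OF end_points(2)] by simp
          next
            case False
            then have "x i \<notin> S" using i nN ST end_points(1)[of i] disj[of i n] by auto
            then show ?thesis using False i H(4) by (simp add: off)
          qed
        qed
        show "\<forall>z. (H \<circ> h) z \<noteq> z \<longrightarrow> (\<exists>i<Suc n. z \<in> ?T i \<and> (H \<circ> h) z \<in> ?T i)"
        proof (intro allI impI)
          fix z assume z: "(H \<circ> h) z \<noteq> z"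
          show "\<exists>i<Suc n. z \<in> ?T i \<and> (H \<circ> h) z \<in> ?T i"
          proof (cases "z \<in> S")
            case True
            then have "h z \<in> S" by (rule inner_homeo_maps_S[OF h(1)])
            then have "z \<in> ?T n" "h z \<in> ?T n" using True ST by auto
            then show ?thesis using HT by (intro exI[of _ n]) auto
          next
            case False
            then have "H z \<noteq> z" using z by (simp add: off)
            then obtain i where "i < n" "z \<in> ?T i" "H z \<in> ?T i" using H(5) by blast
            then show ?thesis using False by (intro exI[of _ i]) (auto simp: off)
          qed
        qed
      qed
    qed
  qed
  from this[OF order_refl] \<eta> show ?thesis by blast
qed

text \<open>Disjoint compact sets have a positive distance, and there are finitely many of them.\<close>
lemma disjoint_segment_nhds:
  fixes N :: nat
  assumes disj: "\<And>i j. i < N \<Longrightarrow> j < N \<Longrightarrow> i \<noteq> j \<Longrightarrow> closed_segment (x i) (y i) \<inter> closed_segment (x j) (y j) = {}"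
    and \<epsilon>0: "\<epsilon>0 > 0"
  shows "\<exists>\<epsilon>>0. \<epsilon> \<le> \<epsilon>0 \<and> (\<forall>i<N. \<forall>j<N. i \<noteq> j \<longrightarrow> segment_nhd \<epsilon> (x i) (y i) \<inter> segment_nhd \<epsilon> (x j) (y j) = {})"
proof -
  have "\<exists>r>0. i < N \<and> j < N \<and> i \<noteq> j \<longrightarrow>
      (\<forall>u\<in>closed_segment (x i) (y i). \<forall>v\<in>closed_segment (x j) (y j). r \<le> dist u v)" for i j
  proof (cases "i < N \<and> j < N \<and> i \<noteq> j")
    case True
    then have "closed_segment (x i) (y i) \<inter> closed_segment (x j) (y j) = {}" using disj by blast
    then show ?thesis
      using separate_compact_closed[OF compact_segment(1) closed_segment, of "x i" "y i" "x j" "y j"] by blast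
  next
    case False
    then show ?thesis by (intro exI[of _ 1]) auto
  qed
  then obtain r where r: "\<And>i j. r i j > 0"
      "\<And>i j u v. i < N \<Longrightarrow> j < N \<Longrightarrow> i \<noteq> j \<Longrightarrow> u \<in> closed_segment (x i) (y i) \<Longrightarrow> v \<in> closed_segment (x j) (y j) \<Longrightarrow> r i j \<le> dist u v"
    by metis
  define A where "A = insert \<epsilon>0 ((\<lambda>(i, j). r i j / 3) ` ({..<N} \<times> {..<N}))"
  have A: "finite A" "A \<noteq> {}" "\<And>t. t \<in> A \<Longrightarrow> t > 0" using \<epsilon>0 r(1) by (auto simp: A_def)
  define \<epsilon> where "\<epsilon> = Min A"
  have \<epsilon>: "\<epsilon> > 0" "\<epsilon> \<le> \<epsilon>0" using A by (auto simp: \<epsilon>_def A_def)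
  have \<epsilon>r: "\<epsilon> \<le> r i j / 3" if "i < N" "j < N" for i j
    unfolding \<epsilon>_def using that by (intro Min_le A) (auto simp: A_def)
  have "segment_nhd \<epsilon> (x i) (y i) \<inter> segment_nhd \<epsilon> (x j) (y j) = {}" if ij: "i < N" "j < N" "i \<noteq> j" for i j
  proof (rule ccontr)
    assume "\<not> ?thesis"
    then obtain z u v where z: "u \<in> closed_segment (x i) (y i)" "dist z u \<le> \<epsilon>" "v \<in> closed_segment (x j) (y j)" "dist z v \<le> \<epsilon>"
      by (auto simp: segment_nhd_def)
    have "r i j \<le> dist u v" by (rule r(2)[OF ij z(1,3)])
    also have "\<dots> \<le> dist z u + dist z v" by (rule dist_triangle3)
    finally show False using z \<epsilon>r[OF ij(1,2)] r(1)[of i j] by linarith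
  qed
  then show ?thesis using \<epsilon> by blast
qed

end

section \<open>Uniqueness of the weak derivative of Lipschitz maps\<close>

lemma directional_deriv_diff:
  assumes "directionally_differentiable u e y" "directionally_differentiable v e y"
  shows "directional_deriv (\<lambda>z. u z - v z) e y = directional_deriv u e y - directional_deriv v e y"
proof -
  have "((\<lambda>t. u (y + t *\<^sub>R e)) has_field_derivative directional_deriv u e y) (at 0)"
    "((\<lambda>t. v (y + t *\<^sub>R e)) has_field_derivative directional_deriv v e y) (at 0)"
    using assms directional_deriv_tendsto[of u e y] directional_deriv_tendsto[of v e y] by (simp_all add: DERIV_def)
  from DERIV_diff[OF this] show ?thesis
    unfolding directional_deriv_def[of "\<lambda>z. u z - v z"] by (rule DERIV_imp_deriv)
qed

text \<open>Integrated against a Lipschitz cut-off, the derivative of a uniformly small function is small,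
  however large its Lipschitz constant. So the derivatives of \<open>vn n\<close> converge weakly to that of
  \<open>v\<close>; they also converge to \<open>w\<close> in mean, and cut-offs separate functions.\<close>
lemma directional_deriv_of_uniform_limit:
  fixes v :: "'a::euclidean_space \<Rightarrow> real" and vn :: "nat \<Rightarrow> 'a \<Rightarrow> real" and Cn :: "nat \<Rightarrow> real"
  assumes v: "C-lipschitz_on UNIV v" and vn: "\<And>n. (Cn n)-lipschitz_on UNIV (vn n)"
    and unif: "\<And>\<epsilon>. \<epsilon> > 0 \<Longrightarrow> \<forall>\<^sub>F n in sequentially. \<forall>y. \<bar>vn n y - v y\<bar> \<le> \<epsilon>"
    and e: "norm e = 1" and r: "r > 0"
    and int: "\<forall>\<^sub>F n in sequentially. integrable lborel (\<lambda>y. indicator (cball z r) y * (directional_deriv (vn n) e y - w y))"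
    and lim: "(\<lambda>n. \<integral>y. \<bar>indicator (cball z r) y * (directional_deriv (vn n) e y - w y)\<bar> \<partial>lborel) \<longlonglongrightarrow> 0"
  shows "AE y in lborel. y \<in> ball z r \<longrightarrow> directional_deriv v e y = w y"
proof -
  let ?I = "\<lambda>y. indicator (cball z r) y :: real"
  have dm: "directional_deriv v e \<in> borel_measurable borel" "directional_deriv (vn n) e \<in> borel_measurable borel" for n
    by (intro borel_measurable_directional_deriv lipschitz_on_continuous_on[OF v] lipschitz_on_continuous_on[OF vn])+
  have Ii: "integrable lborel (\<lambda>y. c * ?I y)" for c :: real
    by (intro integrable_mult_right integrable_real_indicator) (simp_all add: emeasure_lborel_cball_finite[unfolded infinity_ennreal_def])
  have dint: "integrable lborel (\<lambda>y. ?I y * directional_deriv u e y)" if u: "D-lipschitz_on UNIV u" for u :: "'a \<Rightarrow> real" and D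
  proof (rule Bochner_Integration.integrable_bound[OF Ii[of "max D \<bar>deriv_default\<bar>"]])
    have "directional_deriv u e \<in> borel_measurable borel"
      by (rule borel_measurable_directional_deriv[OF lipschitz_on_continuous_on[OF u]])
    then show "(\<lambda>y. ?I y * directional_deriv u e y) \<in> borel_measurable lborel"
      by (intro borel_measurable_times borel_measurable_indicator) simp_all
    have "\<bar>directional_deriv u e y\<bar> \<le> max D \<bar>deriv_default\<bar>" for y
    proof (rule abs_directional_deriv_le, rule always_eventually, rule allI)
      fix t show "\<bar>u (y + t *\<^sub>R e) - u y\<bar> \<le> D * \<bar>t\<bar>"
        using lipschitz_onD[OF u, of "y + t *\<^sub>R e" y] e by (simp add: dist_norm)
    qed
    then show "AE y in lborel. norm (?I y * directional_deriv u e y) \<le> norm (max D \<bar>deriv_default\<bar> * ?I y)"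
      by (intro AE_I2) (auto simp: indicator_def intro: order_trans[OF _ abs_ge_self])
  qed
  obtain n0 where n0: "integrable lborel (\<lambda>y. ?I y * (directional_deriv (vn n0) e y - w y))"
    using int by (auto simp: eventually_sequentially)
  have wi: "integrable lborel (\<lambda>y. ?I y * w y)"
    using Bochner_Integration.integrable_diff[OF dint[OF vn[of n0]] n0] by (simp add: right_diff_distrib)
  have Iw: "integrable lborel (\<lambda>y. ?I y * (directional_deriv v e y - w y))"
    using Bochner_Integration.integrable_diff[OF dint[OF v] wi] by (simp add: right_diff_distrib)
  have "AE y in lborel. y \<in> ball z r \<longrightarrow> directional_deriv v e y - w y = 0"
  proof (rule AE_zero_if_cutoffs_zero[OF Iw r])
    fix M and \<psi> :: "'a \<Rightarrow> real"
    assume \<psi>: "M-lipschitz_on UNIV \<psi>" "\<And>y. y \<notin> cball z r \<Longrightarrow> \<psi> y = 0"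
    have \<psi>c: "continuous_on UNIV \<psi>" using \<psi>(1) by (rule lipschitz_on_continuous_on)
    have \<psi>m: "\<psi> \<in> borel_measurable lborel" using borel_measurable_continuous_onI[OF \<psi>c] by simp
    have "bounded (\<psi> ` cball z r)"
      by (rule compact_imp_bounded, rule compact_continuous_image[OF continuous_on_subset[OF \<psi>c]]) auto
    then obtain B where "\<forall>y\<in>cball z r. \<bar>\<psi> y\<bar> \<le> B" by (auto simp: bounded_iff)
    then have B: "\<bar>\<psi> y\<bar> \<le> \<bar>B\<bar>" for y using \<psi>(2)[of y] by (cases "y \<in> cball z r") force+
    have \<psi>I: "\<psi> y * u y = \<psi> y * (?I y * u y)" for u :: "'a \<Rightarrow> real" and y
      using \<psi>(2)[of y] by (cases "y \<in> cball z r") auto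
    have \<psi>int: "integrable lborel (\<lambda>y. \<psi> y * u y)" if ui: "integrable lborel (\<lambda>y. ?I y * u y)" for u :: "'a \<Rightarrow> real"
      unfolding \<psi>I[of _ u]
    proof (rule Bochner_Integration.integrable_bound[OF integrable_mult_right[OF ui, of "\<bar>B\<bar>"]])
      show "(\<lambda>y. \<psi> y * (?I y * u y)) \<in> borel_measurable lborel"
        using \<psi>m borel_measurable_integrable[OF ui] by (rule borel_measurable_times)
      show "AE y in lborel. norm (\<psi> y * (?I y * u y)) \<le> norm (\<bar>B\<bar> * (?I y * u y))"
      proof (rule AE_I2)
        fix y
        show "norm (\<psi> y * (?I y * u y)) \<le> norm (\<bar>B\<bar> * (?I y * u y))"
          using mult_right_mono[OF B[of y] abs_ge_zero, of "?I y * u y"]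
          by (simp only: real_norm_def abs_mult abs_idempotent)
      qed
    qed
    let ?J = "\<integral>y. \<psi> y * (directional_deriv v e y - w y) \<partial>lborel"
    let ?m = "measure lborel (cball z (r + 1))"
    have bound: "\<bar>?J\<bar> \<le> M * \<epsilon> * ?m + \<bar>B\<bar> * (\<integral>y. \<bar>?I y * (directional_deriv (vn n) e y - w y)\<bar> \<partial>lborel)"
      if close: "\<forall>y. \<bar>vn n y - v y\<bar> \<le> \<epsilon>" and i: "integrable lborel (\<lambda>y. ?I y * (directional_deriv (vn n) e y - w y))" for n \<epsilon>
    proof -
      let ?d = "\<lambda>y. directional_deriv (\<lambda>z. vn n z - v z) e y"
      have dl: "(Cn n + C)-lipschitz_on UNIV (\<lambda>z. vn n z - v z)" by (rule lipschitz_on_diff[OF vn v])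
      have 1: "\<bar>\<integral>y. \<psi> y * ?d y \<partial>lborel\<bar> \<le> M * \<epsilon> * ?m"
        by (rule abs_integral_cutoff_directional_deriv_le[OF dl _ \<psi> e r]) (use close in auto)
      have 2: "\<bar>\<integral>y. \<psi> y * (directional_deriv (vn n) e y - w y) \<partial>lborel\<bar>
          \<le> \<bar>B\<bar> * (\<integral>y. \<bar>?I y * (directional_deriv (vn n) e y - w y)\<bar> \<partial>lborel)"
      proof -
        let ?g = "\<lambda>y. directional_deriv (vn n) e y - w y"
        have "norm (\<integral>y. \<psi> y * ?g y \<partial>lborel) \<le> (\<integral>y. \<bar>B\<bar> * \<bar>?I y * ?g y\<bar> \<partial>lborel)"
        proof (rule Bochner_Integration.integral_norm_bound_integral[OF \<psi>int[OF i]])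
          show "integrable lborel (\<lambda>y. \<bar>B\<bar> * \<bar>?I y * ?g y\<bar>)" using integrable_abs[OF i] by simp
          fix y
          have "\<psi> y * ?g y = \<psi> y * (?I y * ?g y)" by (rule \<psi>I)
          then show "norm (\<psi> y * ?g y) \<le> \<bar>B\<bar> * \<bar>?I y * ?g y\<bar>"
            using mult_right_mono[OF B[of y] abs_ge_zero, of "?I y * ?g y"]
            by (simp only: real_norm_def abs_mult[of "\<psi> y"])
        qed
        then show ?thesis by simp
      qed
      have ae: "AE y in lborel. \<psi> y * (directional_deriv v e y - w y) =
          \<psi> y * (directional_deriv (vn n) e y - w y) - \<psi> y * ?d y"
        using lipschitz_directionally_differentiable_ae[OF v, of e] lipschitz_directionally_differentiable_ae[OF vn[of n], of e]
      proof eventually_elim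
        case (elim y)
        show ?case unfolding directional_deriv_diff[OF elim(2,1)] by (simp add: algebra_simps)
      qed
      have "?J = (\<integral>y. \<psi> y * (directional_deriv (vn n) e y - w y) - \<psi> y * ?d y \<partial>lborel)"
      proof (rule integral_cong_AE[OF _ _ ae])
        show "(\<lambda>y. \<psi> y * (directional_deriv v e y - w y)) \<in> borel_measurable lborel"
          by (rule borel_measurable_integrable[OF \<psi>int[OF Iw]])
        show "(\<lambda>y. \<psi> y * (directional_deriv (vn n) e y - w y) - \<psi> y * ?d y) \<in> borel_measurable lborel"
          by (intro borel_measurable_diff borel_measurable_integrable[OF \<psi>int[OF i]] borel_measurable_integrable[OF \<psi>int[OF dint[OF dl]]])
      qed
      also have "\<dots> = (\<integral>y. \<psi> y * (directional_deriv (vn n) e y - w y) \<partial>lborel) - (\<integral>y. \<psi> y * ?d y \<partial>lborel)"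
        by (rule Bochner_Integration.integral_diff[OF \<psi>int[OF i] \<psi>int[OF dint[OF dl]]])
      finally show ?thesis using 1 2 by linarith
    qed
    have "\<bar>?J\<bar> \<le> 0 + \<epsilon>" if \<epsilon>: "\<epsilon> > 0" for \<epsilon>
    proof -
      have M0: "M \<ge> 0" using \<psi>(1) by (rule lipschitz_on_nonneg)
      define \<epsilon>1 where "\<epsilon>1 = \<epsilon> / (2 * (M * ?m + 1))"
      have Mm: "M * ?m \<ge> 0" using M0 by simp
      have \<epsilon>1: "\<epsilon>1 > 0" unfolding \<epsilon>1_def using Mm \<epsilon> by (intro divide_pos_pos mult_pos_pos) linarith+
      have half: "M * \<epsilon>1 * ?m \<le> \<epsilon> / 2"
      proof -
        have "\<epsilon> / (2 * k) * k = \<epsilon> / 2" if "k \<noteq> 0" for k :: real using that by simp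
        from this[of "M * ?m + 1"] have "\<epsilon>1 * (M * ?m + 1) = \<epsilon> / 2" using Mm unfolding \<epsilon>1_def by linarith
        then show ?thesis using \<epsilon>1 by (simp add: algebra_simps)
      qed
      have "(\<lambda>n. \<bar>B\<bar> * (\<integral>y. \<bar>?I y * (directional_deriv (vn n) e y - w y)\<bar> \<partial>lborel)) \<longlonglongrightarrow> 0"
        by (rule tendsto_mult_right_zero[OF lim])
      then have "\<forall>\<^sub>F n in sequentially. \<bar>B\<bar> * (\<integral>y. \<bar>?I y * (directional_deriv (vn n) e y - w y)\<bar> \<partial>lborel) < \<epsilon> / 2"
        by (rule order_tendstoD(2)) (use \<epsilon> in simp)
      then have "\<forall>\<^sub>F n in sequentially. \<bar>?J\<bar> \<le> \<epsilon>"
        using unif[OF \<epsilon>1] int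
      proof eventually_elim
        case (elim n)
        show ?case using bound[OF elim(2,3)] elim(1) half by linarith
      qed
      then have "\<exists>n::nat. \<bar>?J\<bar> \<le> \<epsilon>" by (rule eventually_happens'[OF sequentially_bot])
      then show ?thesis by simp
    qed
    then have "\<bar>?J\<bar> \<le> 0" by (rule field_le_epsilon)
    then show "?J = 0" by simp
  qed
  then show ?thesis by eventually_elim auto
qed

context cube_space
begin

lemma nn_integral_Q:
  assumes u: "u \<in> borel_measurable borel"
  shows "(\<integral>\<^sup>+y. indicator Q y * u (\<phi> y) \<partial>lborel) = ennreal a * (\<integral>\<^sup>+x. u x \<partial>vol)"
proof -
  let ?M = "restrict_space lborel Q"
  have m: "\<phi> \<in> measurable ?M borel"
    using borel_measurable_continuous_on_restrict[OF continuous_on_phi_Q]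
    by (simp add: measurable_cong_sets[OF sets_restrict_space_cong[OF sets_lborel] refl])
  have "distr ?M borel \<phi> = scale_measure (ennreal a) vol"
  proof (rule measure_eqI)
    show "sets (distr ?M borel \<phi>) = sets (scale_measure (ennreal a) vol)" by (simp add: sets_vol)
    fix B assume "B \<in> sets (distr ?M borel \<phi>)"
    then have B: "B \<in> sets borel" by simp
    have "\<phi> -` B \<inter> space ?M = {y \<in> Q. \<phi> y \<in> B}" by (auto simp: space_restrict_space)
    then have "emeasure (distr ?M borel \<phi>) B = emeasure lborel {y \<in> Q. \<phi> y \<in> B}"
      using B by (subst emeasure_distr[OF m]) (auto simp: emeasure_restrict_space)
    then show "emeasure (distr ?M borel \<phi>) B = emeasure (scale_measure (ennreal a) vol) B"
      using emeasure_Q[OF B] by simp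
  qed
  have "(\<integral>\<^sup>+y. indicator Q y * u (\<phi> y) \<partial>lborel) = (\<integral>\<^sup>+y. u (\<phi> y) \<partial>?M)"
    by (subst nn_integral_restrict_space) (auto simp: mult.commute)
  also have "\<dots> = (\<integral>\<^sup>+x. u x \<partial>distr ?M borel \<phi>)" by (rule nn_integral_distr[OF m, symmetric]) (use u in simp)
  also have "\<dots> = (\<integral>\<^sup>+x. u x \<partial>scale_measure (ennreal a) vol)" by (simp only: \<open>distr ?M borel \<phi> = scale_measure (ennreal a) vol\<close>)
  also have "\<dots> = ennreal a * (\<integral>\<^sup>+x. u x \<partial>vol)"
    by (rule nn_integral_scale_measure) (use u in \<open>simp add: measurable_cong_sets[OF sets_vol refl]\<close>)
  finally show ?thesis .
qed

text \<open>Near a point at which \<open>G\<close> is read in the cube, the coordinates of the approximating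
  maps are Lipschitz functions that converge uniformly to those of \<open>G\<close>, while their derivatives
  converge in mean to the entries of \<open>A\<close>. As \<open>G\<close> preserves the volume, the remaining
  points form a null set.\<close>
lemma sobolev_pair_unique:
  assumes G: "G \<in> Lip_homeos d vol" and pair: "sobolev_pair d vol \<phi> p G A" and p: "1 \<le> p"
  shows "AE x in vol. cube_deriv \<phi> G x $ i $ j = A x $ i $ j"
proof -
  obtain C where C: "d_lipschitz C G" using Lip_homeosD(3)[OF G] by blast
  note Gc = Lip_homeosD(4)[OF G]
  obtain F where F: "\<And>n. F n \<in> Lip_homeos d vol" "\<And>\<epsilon>. \<epsilon> > 0 \<Longrightarrow> \<forall>\<^sub>F n in sequentially. \<forall>x. d (F n x) (G x) < \<epsilon>"
      "(\<lambda>n. Lp_matrix_norm vol p (\<lambda>x. cube_deriv \<phi> (F n) x - A x)) \<longlonglongrightarrow> 0"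
    and A: "Lp_matrix vol p A"
    using pair unfolding sobolev_pair_def by blast
  obtain CF where CF: "\<And>n. d_lipschitz (CF n) (F n)" using Lip_homeosD(3)[OF F(1)] by metis
  note Fc = Lip_homeosD(4)[OF F(1)]
  define u where "u n x = cube_deriv \<phi> (F n) x $ i $ j - A x $ i $ j" for n x
  have uLp: "Lp_fun vol p (u n)" for n
    using Lp_matrix_cube_deriv[OF F(1) p, of n] A unfolding u_def Lp_matrix_def by (intro Lp_fun_diff[OF p]) auto
  have "(\<lambda>n. Lp_norm vol p (u n)) \<longlonglongrightarrow> 0"
  proof (rule tendsto_sandwich[OF _ _ tendsto_const F(3)])
    show "\<forall>\<^sub>F n in sequentially. Lp_norm vol p (u n) \<le> Lp_matrix_norm vol p (\<lambda>x. cube_deriv \<phi> (F n) x - A x)"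
      using Lp_norm_le_matrix_norm[of vol p "\<lambda>x. cube_deriv \<phi> (F _) x - A x" i j] by (simp add: u_def[abs_def])
  qed simp
  note L1 = Lp_convergence_imp_L1[OF finite_measure_vol p uLp this]
  have Am: "(\<lambda>x. A x $ i $ j) \<in> borel_measurable borel"
    using A by (simp add: Lp_matrix_def Lp_fun_def measurable_cong_sets[OF sets_vol refl])
  have um: "u n \<in> borel_measurable borel" for n
    using uLp[of n] by (simp add: Lp_fun_def measurable_cong_sets[OF sets_vol refl])
  let ?\<Omega> = "{y \<in> Q. G (\<phi> y) \<in> P}"
  have local_eq: "\<exists>r>0. AE y in lborel. y \<in> ball y0 r \<longrightarrow> y \<in> Q \<and> cube_deriv \<phi> G (\<phi> y) $ i $ j = A (\<phi> y) $ i $ j"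
    if y0: "y0 \<in> Q" "G (\<phi> y0) \<in> P" for y0
  proof -
    obtain W where W: "open W" "\<psi> (G (\<phi> y0)) \<in> W" "W \<subseteq> Q"
      "\<And>u v. u \<in> W \<Longrightarrow> v \<in> W \<Longrightarrow> dist u v \<le> L * d (\<phi> u) (\<phi> v)"
      "\<And>u v. u \<in> W \<Longrightarrow> v \<in> W \<Longrightarrow> d (\<phi> u) (\<phi> v) \<le> L * dist u v"
      by (rule bilipschitz_nhd[OF psi_mem[OF y0(2)]]) (rule that, assumption+)
    have oW: "open (\<phi> ` W)" by (rule open_phi_image[OF W(1,3)])
    have "G (\<phi> y0) \<in> \<phi> ` W" using W(2) y0 by (intro image_eqI[of _ _ "\<psi> (G (\<phi> y0))"]) auto
    then obtain \<eta> where \<eta>: "\<eta> > 0" "\<And>x. d (G (\<phi> y0)) x < \<eta> \<Longrightarrow> x \<in> \<phi> ` W"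
      using oW unfolding open_iff by blast
    let ?V = "{y \<in> Q. \<phi> y \<in> G -` {x. d (G (\<phi> y0)) x < \<eta> / 2}}"
    have "open ?V" by (intro open_phi_preimage open_vimage[OF open_d_ball Gc])
    moreover have "y0 \<in> ?V" using y0 \<eta> by simp
    ultimately obtain r where r: "r > 0" "cball y0 r \<subseteq> ?V" using open_contains_cball by blast
    have rQ: "cball y0 r \<subseteq> Q" using r(2) by blast
    have inW: "\<psi> x \<in> W" "x \<in> P" if xW: "x \<in> \<phi> ` W" for x
    proof -
      obtain w where "w \<in> W" "x = \<phi> w" using xW by blast
      then show "\<psi> x \<in> W" "x \<in> P" using W(3) by auto
    qed
    have GW: "G (\<phi> y) \<in> \<phi> ` W" if "y \<in> cball y0 r" for y using r(2) that \<eta> by (intro \<eta>(2)) auto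
    have FW: "F n (\<phi> y) \<in> \<phi> ` W" if "\<forall>x. d (F n x) (G x) < \<eta> / 2" "y \<in> cball y0 r" for n y
    proof (rule \<eta>(2))
      have "d (G (\<phi> y0)) (G (\<phi> y)) < \<eta> / 2" using r(2) that(2) by auto
      then show "d (G (\<phi> y0)) (F n (\<phi> y)) < \<eta>"
        using d_triangle[of "G (\<phi> y0)" "F n (\<phi> y)" "G (\<phi> y)"] that(1)[rule_format, of "\<phi> y"] by (simp add: d_commute)
    qed
    have "\<forall>\<^sub>F n in sequentially. \<forall>x. d (F n x) (G x) < \<eta> / 2" using \<eta>(1) by (intro F(2)) simp
    then obtain n1 where n1: "\<And>n. n \<ge> n1 \<Longrightarrow> \<forall>x. d (F n x) (G x) < \<eta> / 2" by (auto simp: eventually_sequentially)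
    define Fn where "Fn n = F (n + n1)" for n
    have Fnd: "\<forall>x. d (Fn n x) (G x) < \<eta> / 2" for n unfolding Fn_def by (rule n1) simp
    have FnP: "Fn n (\<phi> y) \<in> P" if "y \<in> cball y0 r" for n y
      using inW(2) FW[OF Fnd[of n, unfolded Fn_def] that] by (simp add: Fn_def)
    have GP: "G (\<phi> y) \<in> P" if "y \<in> cball y0 r" for y using inW(2)[OF GW[OF that]] .
    have clF: "(L * CF (n + n1) * L)-lipschitz_on UNIV (clamp (Fn n) y0 r i)" for n
    proof (rule clamp_lipschitz[where f = "Fn n", OF _ _ rQ FnP r(1)])
      show "d_lipschitz (CF (n + n1)) (Fn n)" unfolding Fn_def by (rule CF)
      show "continuous_on UNIV (Fn n)" unfolding Fn_def by (rule Fc)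
    qed
    let ?e = "axis j 1 :: real^'d"
    have "AE y in lborel. y \<in> ball y0 r \<longrightarrow> directional_deriv (clamp G y0 r i) ?e y = A (\<phi> y) $ i $ j"
    proof (rule directional_deriv_of_uniform_limit)
      show "(L * C * L)-lipschitz_on UNIV (clamp G y0 r i)" by (rule clamp_lipschitz[OF C Gc rQ GP r(1)])
      show "(L * CF (n + n1) * L)-lipschitz_on UNIV (clamp (Fn n) y0 r i)" for n
        by (rule clF)
      show "norm ?e = 1" by (simp add: norm_axis_1)
      show "r > 0" by (rule r(1))
      show "\<forall>\<^sub>F n in sequentially. \<forall>y. \<bar>clamp (Fn n) y0 r i y - clamp G y0 r i y\<bar> \<le> \<epsilon>" if \<epsilon>: "\<epsilon> > 0" for \<epsilon>
      proof -
        have "\<forall>\<^sub>F n in sequentially. \<forall>x. d (F n x) (G x) < \<epsilon> / L" using \<epsilon> L_pos by (intro F(2)) simp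
        then have "\<forall>\<^sub>F n in sequentially. \<forall>x. d (Fn n x) (G x) < \<epsilon> / L"
          unfolding Fn_def by (rule sequentially_offset)
        then show ?thesis
        proof eventually_elim
          case (elim n)
          show ?case
          proof
            fix y
            let ?y = "closest_point (cball y0 r) y"
            have yb: "?y \<in> cball y0 r" using r(1) by (intro closest_point_in_set) auto
            have w: "Fn n (\<phi> ?y) \<in> \<phi> ` W" "G (\<phi> ?y) \<in> \<phi> ` W"
              using FW[OF Fnd[of n, unfolded Fn_def] yb] GW[OF yb] by (simp_all add: Fn_def)
            have "\<bar>clamp (Fn n) y0 r i y - clamp G y0 r i y\<bar> \<le> dist (cube_map \<phi> (Fn n) ?y) (cube_map \<phi> G ?y)"
              using component_le_norm_cart[of "cube_map \<phi> (Fn n) ?y - cube_map \<phi> G ?y" i] by (simp add: clamp_def dist_norm)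
            also have "\<dots> \<le> L * d (Fn n (\<phi> ?y)) (G (\<phi> ?y))"
              using W(4)[OF inW(1)[OF w(1)] inW(1)[OF w(2)]] inW(2)[OF w(1)] inW(2)[OF w(2)] by (simp add: cube_map_def)
            also have "\<dots> \<le> L * (\<epsilon> / L)" using elim L_pos by (intro mult_left_mono) (auto intro: less_imp_le)
            finally show "\<bar>clamp (Fn n) y0 r i y - clamp G y0 r i y\<bar> \<le> \<epsilon>" using L_pos by simp
          qed
        qed
      qed
      have ae: "AE y in lborel. indicator (cball y0 r) y * (directional_deriv (clamp (Fn n) y0 r i) ?e y - A (\<phi> y) $ i $ j)
          = indicator (ball y0 r) y * u (n + n1) (\<phi> y)" for n
      proof -
        have "negligible (sphere y0 r)" by (rule negligible_sphere)
        then have "sphere y0 r \<in> null_sets lborel"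
          by (simp add: negligible_iff_null_sets null_sets_completion_iff)
        then have "AE y in lborel. y \<notin> sphere y0 r" by (rule AE_not_in)
        then show ?thesis
        proof eventually_elim
          case (elim y)
          show ?case
          proof (cases "y \<in> ball y0 r")
            case True
            then show ?thesis
              using cube_deriv_clamp[where f = "Fn n", OF rQ FnP True, of i j] by (simp add: u_def Fn_def)
          next
            case False
            then show ?thesis using elim by (auto simp: indicator_def)
          qed
        qed
      qed
      have bm: "(\<lambda>y. indicator (ball y0 r) y * u n (\<phi> y)) \<in> borel_measurable lborel" for n
      proof -
        have "(\<lambda>y. indicator Q y *\<^sub>R u n (\<phi> y)) \<in> borel_measurable borel"
        proof (subst borel_measurable_restrict_space_iff[symmetric])
          have "\<phi> \<in> borel_measurable (restrict_space borel Q)"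
            by (rule borel_measurable_continuous_on_restrict[OF continuous_on_phi_Q])
          then show "(\<lambda>y. u n (\<phi> y)) \<in> borel_measurable (restrict_space borel Q)"
            using um by (rule measurable_compose)
        qed simp
        then have "(\<lambda>y. indicator (ball y0 r) y * (indicator Q y *\<^sub>R u n (\<phi> y))) \<in> borel_measurable borel"
          by (intro borel_measurable_times borel_measurable_indicator) auto
        moreover have "(\<lambda>y. indicator (ball y0 r) y * (indicator Q y *\<^sub>R u n (\<phi> y))) = (\<lambda>y. indicator (ball y0 r) y * u n (\<phi> y))"
          using rQ by (auto simp: indicator_def fun_eq_iff subset_iff)
        ultimately show ?thesis by simp
      qed
      have nb: "(\<integral>\<^sup>+y. ennreal \<bar>indicator (ball y0 r) y * u n (\<phi> y)\<bar> \<partial>lborel) \<le> ennreal a * ennreal (\<integral>x. \<bar>u n x\<bar> \<partial>vol)" for n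
      proof -
        have "(\<integral>\<^sup>+y. ennreal \<bar>indicator (ball y0 r) y * u n (\<phi> y)\<bar> \<partial>lborel) \<le> (\<integral>\<^sup>+y. indicator Q y * ennreal \<bar>u n (\<phi> y)\<bar> \<partial>lborel)"
          using rQ by (intro nn_integral_mono) (auto simp: indicator_def subset_iff)
        also have "\<dots> = ennreal a * (\<integral>\<^sup>+x. ennreal \<bar>u n x\<bar> \<partial>vol)" by (rule nn_integral_Q) (use um in simp)
        also have "(\<integral>\<^sup>+x. ennreal \<bar>u n x\<bar> \<partial>vol) = ennreal (\<integral>x. \<bar>u n x\<bar> \<partial>vol)"
          by (rule nn_integral_eq_integral) (use L1(2)[of n] in auto)
        finally show ?thesis .
      qed
      have ib: "integrable lborel (\<lambda>y. indicator (ball y0 r) y * u n (\<phi> y))" for n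
      proof (rule integrableI_bounded[OF bm])
        show "(\<integral>\<^sup>+y. ennreal (norm (indicator (ball y0 r) y * u n (\<phi> y))) \<partial>lborel) < \<infinity>"
          unfolding real_norm_def
        proof (rule le_less_trans[OF nb[of n]])
          show "ennreal a * ennreal (\<integral>x. \<bar>u n x\<bar> \<partial>vol) < \<infinity>" by (simp add: ennreal_mult_less_top)
        qed
      qed
      have cm: "(\<lambda>y. indicator (cball y0 r) y * (directional_deriv (clamp (Fn n) y0 r i) ?e y - A (\<phi> y) $ i $ j)) \<in> borel_measurable lborel" for n
      proof -
        have 1: "directional_deriv (clamp (Fn n) y0 r i) ?e \<in> borel_measurable borel"
          by (rule borel_measurable_directional_deriv[OF lipschitz_on_continuous_on[OF clF]])
        have 2: "(\<lambda>y. indicator Q y *\<^sub>R (A (\<phi> y) $ i $ j)) \<in> borel_measurable borel"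
        proof (subst borel_measurable_restrict_space_iff[symmetric])
          have "\<phi> \<in> borel_measurable (restrict_space borel Q)"
            by (rule borel_measurable_continuous_on_restrict[OF continuous_on_phi_Q])
          then show "(\<lambda>y. A (\<phi> y) $ i $ j) \<in> borel_measurable (restrict_space borel Q)"
            using Am by (rule measurable_compose)
        qed simp
        have "(\<lambda>y. indicator (cball y0 r) y * (directional_deriv (clamp (Fn n) y0 r i) ?e y - indicator Q y *\<^sub>R (A (\<phi> y) $ i $ j))) \<in> borel_measurable borel"
          using 1 2 by (intro borel_measurable_times borel_measurable_indicator borel_measurable_diff) auto
        moreover have "(\<lambda>y. indicator (cball y0 r) y * (directional_deriv (clamp (Fn n) y0 r i) ?e y - indicator Q y *\<^sub>R (A (\<phi> y) $ i $ j)))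
          = (\<lambda>y. indicator (cball y0 r) y * (directional_deriv (clamp (Fn n) y0 r i) ?e y - A (\<phi> y) $ i $ j))"
          using rQ by (auto simp: indicator_def fun_eq_iff subset_iff)
        ultimately show ?thesis by simp
      qed
      show "\<forall>\<^sub>F n in sequentially. integrable lborel (\<lambda>y. indicator (cball y0 r) y * (directional_deriv (clamp (Fn n) y0 r i) ?e y - A (\<phi> y) $ i $ j))"
        using integrable_cong_AE[OF cm bm ae] ib by (intro always_eventually allI) blast
      have eq: "(\<integral>y. \<bar>indicator (cball y0 r) y * (directional_deriv (clamp (Fn n) y0 r i) ?e y - A (\<phi> y) $ i $ j)\<bar> \<partial>lborel)
          = (\<integral>y. \<bar>indicator (ball y0 r) y * u (n + n1) (\<phi> y)\<bar> \<partial>lborel)" for n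
      proof (rule integral_cong_AE)
        show "AE y in lborel. \<bar>indicator (cball y0 r) y * (directional_deriv (clamp (Fn n) y0 r i) ?e y - A (\<phi> y) $ i $ j)\<bar>
            = \<bar>indicator (ball y0 r) y * u (n + n1) (\<phi> y)\<bar>"
          using ae[of n] by eventually_elim (simp only:)
      qed (intro borel_measurable_abs cm bm)+
      have le: "(\<integral>y. \<bar>indicator (ball y0 r) y * u n (\<phi> y)\<bar> \<partial>lborel) \<le> a * (\<integral>x. \<bar>u n x\<bar> \<partial>vol)" for n
      proof -
        have "ennreal (\<integral>y. \<bar>indicator (ball y0 r) y * u n (\<phi> y)\<bar> \<partial>lborel) = (\<integral>\<^sup>+y. ennreal \<bar>indicator (ball y0 r) y * u n (\<phi> y)\<bar> \<partial>lborel)"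
          by (rule nn_integral_eq_integral[symmetric]) (use integrable_abs[OF ib] in auto)
        also have "\<dots> \<le> ennreal (a * (\<integral>x. \<bar>u n x\<bar> \<partial>vol))"
          using nb[of n] a_pos by (simp add: ennreal_mult Bochner_Integration.integral_nonneg)
        finally show ?thesis
          using a_pos by (subst (asm) ennreal_le_iff) (auto intro!: mult_nonneg_nonneg Bochner_Integration.integral_nonneg)
      qed
      have lim0: "(\<lambda>n. a * (\<integral>x. \<bar>u (n + n1) x\<bar> \<partial>vol)) \<longlonglongrightarrow> 0"
        by (rule tendsto_mult_right_zero[OF LIMSEQ_ignore_initial_segment[OF L1(1)]])
      show "(\<lambda>n. \<integral>y. \<bar>indicator (cball y0 r) y * (directional_deriv (clamp (Fn n) y0 r i) ?e y - A (\<phi> y) $ i $ j)\<bar> \<partial>lborel) \<longlonglongrightarrow> 0"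
        unfolding eq
        by (rule tendsto_sandwich[OF _ _ tendsto_const lim0]) (use le in \<open>auto intro!: always_eventually Bochner_Integration.integral_nonneg\<close>)
    qed
    then have "AE y in lborel. y \<in> ball y0 r \<longrightarrow> y \<in> Q \<and> cube_deriv \<phi> G (\<phi> y) $ i $ j = A (\<phi> y) $ i $ j"
    proof eventually_elim
      case (elim y)
      then show ?case using cube_deriv_clamp[where f = G, OF rQ GP, of y i j] rQ by (auto simp: subset_iff)
    qed
    then show ?thesis using r(1) by blast
  qed
  define R where "R y = (SOME r. r > 0 \<and> (AE z in lborel. z \<in> ball y r \<longrightarrow> z \<in> Q \<and> cube_deriv \<phi> G (\<phi> z) $ i $ j = A (\<phi> z) $ i $ j))" for y
  have R: "R y > 0" "AE z in lborel. z \<in> ball y (R y) \<longrightarrow> z \<in> Q \<and> cube_deriv \<phi> G (\<phi> z) $ i $ j = A (\<phi> z) $ i $ j"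
    if y: "y \<in> Q" "G (\<phi> y) \<in> P" for y
  proof -
    from local_eq[OF y] have "R y > 0 \<and> (AE z in lborel. z \<in> ball y (R y) \<longrightarrow> z \<in> Q \<and> cube_deriv \<phi> G (\<phi> z) $ i $ j = A (\<phi> z) $ i $ j)"
      unfolding R_def by (rule someI_ex)
    then show "R y > 0" "AE z in lborel. z \<in> ball y (R y) \<longrightarrow> z \<in> Q \<and> cube_deriv \<phi> G (\<phi> z) $ i $ j = A (\<phi> z) $ i $ j" by auto
  qed
  obtain Y where Y: "countable Y" "Y \<subseteq> ?\<Omega>" "?\<Omega> \<subseteq> (\<Union>y\<in>Y. ball y (R y))"
    by (rule countable_good_balls[where f = G and R = R]) (rule Gc R(1) that | assumption)+
  have "AE z in lborel. \<forall>y\<in>Y. z \<in> ball y (R y) \<longrightarrow> z \<in> Q \<and> cube_deriv \<phi> G (\<phi> z) $ i $ j = A (\<phi> z) $ i $ j"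
    using R(2) Y(2) by (intro AE_ball_countable'[OF _ Y(1)]) auto
  then have ae: "AE z in lborel. z \<in> ?\<Omega> \<longrightarrow> cube_deriv \<phi> G (\<phi> z) $ i $ j = A (\<phi> z) $ i $ j"
    by eventually_elim (use Y(3) in blast)
  let ?X = "{x. cube_deriv \<phi> G x $ i $ j \<noteq> A x $ i $ j}"
  have dG: "(\<lambda>x. cube_deriv \<phi> G x $ i $ j) \<in> borel_measurable borel"
    using measurable_cube_deriv[OF C Gc] by (simp add: measurable_cong_sets[OF sets_vol refl])
  have X: "?X \<in> sets borel"
  proof -
    have "?X = (\<lambda>x. cube_deriv \<phi> G x $ i $ j - A x $ i $ j) -` (- {0})" by auto
    moreover have "(\<lambda>x. cube_deriv \<phi> G x $ i $ j - A x $ i $ j) \<in> borel_measurable borel"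
      using dG Am by (rule borel_measurable_diff)
    moreover have "- {0 :: real} \<in> sets borel" by (intro borel_open open_Compl closed_singleton)
    ultimately show ?thesis using measurable_sets[of "\<lambda>x. cube_deriv \<phi> G x $ i $ j - A x $ i $ j" borel borel "- {0}"]
      by (simp only: space_borel Int_UNIV_right)
  qed
  let ?Z = "?X \<inter> G -` P"
  have GP: "G -` P \<in> sets borel" by (intro borel_open open_vimage[OF open_P Gc])
  have Z: "?Z \<in> sets borel" using X GP by (rule sets.Int)
  have "AE y in lborel. y \<notin> {y \<in> Q. \<phi> y \<in> ?Z}" using ae by eventually_elim auto
  then have "{y \<in> Q. \<phi> y \<in> ?Z} \<in> null_sets lborel"
    using borel_Q_preimage[OF Z] AE_iff_null_sets[of "{y \<in> Q. \<phi> y \<in> ?Z}" lborel] by simp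
  then have "ennreal a * emeasure vol ?Z = 0" using emeasure_Q[OF Z] by (simp add: null_sets_def)
  then have Z0: "?Z \<in> null_sets vol" using a_pos Z by (auto simp: null_sets_def sets_vol)
  have "emeasure vol (G -` (- P)) = emeasure vol (- P)"
    using Lip_homeosD(2)[OF G] open_P by (simp add: volume_preserving_def sets_vol)
  then have "G -` (- P) \<in> null_sets vol" using null_compl_P GP by (auto simp: null_sets_def sets_vol vimage_Compl)
  then have "?Z \<union> G -` (- P) \<in> null_sets vol" using Z0 by blast
  then show ?thesis by (rule AE_I') auto
qed

section \<open>Pseudo-orbits\<close>

text \<open>A pseudo-orbit alternates small jumps with \<open>f\<close>. Jumps take place inside the cube, where
  a perturbation of \<open>f\<close> can realize them.\<close>
definition pseudo_step :: "('m \<Rightarrow> 'm) \<Rightarrow> real \<Rightarrow> ('m \<times> 'm) set" where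
  "pseudo_step f \<delta> = {(x, y). x \<in> P \<and> (\<exists>b\<in>Q. y = f (\<phi> b) \<and> dist (\<psi> x) b < \<delta>)}"

text \<open>Volume preservation makes pseudo-orbits go from anywhere to anywhere: the
  \<open>\<delta>\<close>-neighbourhood of the set of reachable points is mapped by \<open>f\<close> into that
  set, hence, having the same volume, the set is dense in its own \<open>\<delta>\<close>-neighbourhood. In the
  connected cube such a set is dense.\<close>
lemma pseudo_orbit_exists:
  assumes f: "f \<in> Lip_homeos d vol" and U: "open U" "U \<noteq> {}" and V: "open V" "V \<noteq> {}" and \<delta>: "\<delta> > 0"
  shows "\<exists>u\<in>U. \<exists>v\<in>V. (u, v) \<in> (pseudo_step f \<delta>)\<^sup>*"
proof -
  note fc = Lip_homeosD(4)[OF f] and fbij = Lip_homeosD(5)[OF f]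
  obtain f' where f': "homeomorphism UNIV UNIV f f'" using Lip_homeosD(1)[OF f] by (auto simp: homeo_def)
  define R where "R = {y. \<exists>u\<in>U. (u, y) \<in> (pseudo_step f \<delta>)\<^sup>*}"
  define R0 where "R0 = {y \<in> Q. \<phi> y \<in> R}"
  define R' where "R' = Q \<inter> (\<Union>z\<in>R0. ball z \<delta>)"
  have oR': "open R'" unfolding R'_def by (intro open_Int open_box open_UN ballI open_ball)
  have R'Q: "R' \<subseteq> Q" by (auto simp: R'_def)
  have R0R': "R0 \<subseteq> R'" using \<delta> by (auto simp: R0_def R'_def)
  have UR: "U \<subseteq> R" by (auto simp: R_def)
  have ne: "R' \<noteq> {}" using open_meets_P[OF U] UR R0R' by (auto simp: R0_def)
  have fR': "f (\<phi> y) \<in> R" if yR: "y \<in> R'" for y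
  proof -
    obtain z where z: "z \<in> Q" "\<phi> z \<in> R" "dist z y < \<delta>" "y \<in> Q" using yR by (auto simp: R'_def R0_def)
    then have "(\<phi> z, f (\<phi> y)) \<in> pseudo_step f \<delta>" by (auto simp: pseudo_step_def)
    then show ?thesis using z(2) by (auto simp: R_def intro: rtrancl_into_rtrancl)
  qed
  define B where "B = \<phi> ` R'"
  have B: "open B" unfolding B_def by (rule open_phi_image[OF oR' R'Q])
  have fB: "open (f ` B)" using homeomorphism_imp_open_map[OF f', of B] B by simp
  have Bm: "B \<in> sets vol" "f ` B \<in> sets vol" "P \<in> sets vol" using B fB open_P by (auto simp: sets_vol)
  have "emeasure vol (f -` (f ` B)) = emeasure vol (f ` B)"
    using Lip_homeosD(2)[OF f] Bm(2) by (simp add: volume_preserving_def)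
  then have eq: "emeasure vol (f ` B) = emeasure vol B"
    using fbij by (simp add: inj_vimage_image_eq bij_is_inj)
  have sub: "f ` B \<inter> P \<subseteq> B"
  proof
    fix x assume x: "x \<in> f ` B \<inter> P"
    then have "x \<in> R" using fR' by (auto simp: B_def)
    then have "\<psi> x \<in> R0" using x psi_mem by (simp add: R0_def)
    then show "x \<in> B" using R0R' x by (auto simp: B_def intro!: image_eqI[of _ _ "\<psi> x"])
  qed
  have "emeasure vol (f ` B \<inter> P) = emeasure vol (f ` B)"
  proof -
    have "- P \<in> null_sets vol" using null_compl_P Bm(3) by (auto simp: null_sets_def sets_vol)
    then have "AE x in vol. x \<notin> - P" by (rule AE_not_in)
    then show ?thesis using Bm by (intro emeasure_eq_AE) auto
  qed
  then have "emeasure vol (B - (f ` B \<inter> P)) = emeasure vol B - emeasure vol B"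
    using Bm eq sub emeasure_vol_finite by (subst emeasure_Diff) (auto simp: less_top)
  then have null: "emeasure vol (B - (f ` B \<inter> P)) = 0" using emeasure_vol_finite[of B] by (simp add: less_top)
  have dense: "\<exists>y\<in>G. y \<in> R0" if G: "open G" "G \<noteq> {}" "G \<subseteq> R'" for G
  proof (rule ccontr)
    assume none: "\<not> ?thesis"
    have "\<phi> ` G \<subseteq> B - (f ` B \<inter> P)"
    proof
      fix x assume "x \<in> \<phi> ` G"
      then obtain y where y: "y \<in> G" "x = \<phi> y" by blast
      have "\<phi> y \<notin> f ` B"
      proof
        assume "\<phi> y \<in> f ` B"
        then have "\<phi> y \<in> R" using fR' by (auto simp: B_def)
        then show False using none y(1) G(3) R'Q by (auto simp: R0_def)
      qed
      then show "x \<in> B - (f ` B \<inter> P)" using y G(3) by (auto simp: B_def)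
    qed
    then have "emeasure vol (\<phi> ` G) \<le> 0"
      using emeasure_mono[of "\<phi> ` G" "B - (f ` B \<inter> P)" vol] Bm null by auto
    moreover have "emeasure vol (\<phi> ` G) > 0"
      using G R'Q by (intro emeasure_vol_pos open_phi_image) auto
    ultimately show False by simp
  qed
  have "R' = Q"
  proof -
    have "closedin (top_of_set Q) R'"
      unfolding closedin_closed
    proof (intro exI[of _ "closure R'"] conjI closed_closure equalityI subsetI)
      fix y assume y: "y \<in> Q \<inter> closure R'"
      then obtain y' where y': "y' \<in> R'" "dist y' y < \<delta> / 2"
      proof -
        have "\<forall>e>0. \<exists>y'\<in>R'. dist y' y < e" using closure_approachable[of y R'] y by blast
        from this[rule_format, of "\<delta> / 2"] \<delta> show ?thesis using that by (meson half_gt_zero)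
      qed
      have "open (R' \<inter> ball y' (\<delta> / 2))" "R' \<inter> ball y' (\<delta> / 2) \<noteq> {}" using oR' y' \<delta> by auto
      then obtain z where z: "z \<in> R' \<inter> ball y' (\<delta> / 2)" "z \<in> R0" using dense[of "R' \<inter> ball y' (\<delta> / 2)"] by blast
      have "dist z y < \<delta>" using z(1) y'(2) dist_triangle[of z y y'] dist_commute[of y' z] by auto
      then show "y \<in> R'" using y z(2) by (auto simp: R'_def)
    qed (use R'Q closure_subset in auto)
    moreover have "openin (top_of_set Q) R'" using oR' R'Q by (rule open_subset[rotated])
    moreover have "connected Q" by (rule convex_connected[OF convex_box(2)])
    ultimately show ?thesis using ne by (metis connected_clopen)
  qed
  then obtain y where "y \<in> Q" "\<phi> y \<in> V" "y \<in> R0"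
    using dense[OF open_phi_preimage[OF V(1)] open_meets_P[OF V]] by auto
  then show ?thesis by (auto simp: R0_def R_def)
qed

text \<open>A shortest pseudo-orbit visits no point twice. Distinct points are needed because a single map has
  to close all the gaps.\<close>
lemma injective_pseudo_orbit:
  assumes f: "f \<in> Lip_homeos d vol" and U: "open U" "U \<noteq> {}" and V: "open V" "V \<noteq> {}" and \<delta>: "\<delta> > 0"
  shows "\<exists>N w. w 0 \<in> U \<and> w N \<in> V \<and> inj_on w {..N} \<and> (\<forall>i<N. (w i, w (Suc i)) \<in> pseudo_step f \<delta>)"
proof -
  let ?r = "pseudo_step f \<delta>"
  let ?A = "\<lambda>N. \<exists>u\<in>U. \<exists>v\<in>V. (u, v) \<in> ?r ^^ N"
  have "\<exists>N. ?A N"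
    using pseudo_orbit_exists[OF assms] by (meson rtrancl_imp_relpow)
  define N where "N = (LEAST N. ?A N)"
  have "?A N" unfolding N_def by (rule LeastI_ex) fact
  then obtain u v where uv: "u \<in> U" "v \<in> V" "(u, v) \<in> ?r ^^ N" by blast
  obtain w where w: "w 0 = u" "w N = v" "\<And>i. i < N \<Longrightarrow> (w i, w (Suc i)) \<in> ?r"
    using uv(3) by (auto simp: relpow_fun_conv)
  have sub: "(w i, w (i + k)) \<in> ?r ^^ k" if "i + k \<le> N" for i k
    using w(3) that by (auto simp: relpow_fun_conv intro!: exI[of _ "\<lambda>l. w (i + l)"])
  have "w i \<noteq> w j" if ij: "i < j" "j \<le> N" for i j
  proof
    assume eq: "w i = w j"
    have "(w 0, w i) \<in> ?r ^^ i" using sub[of 0 i] ij by simp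
    moreover have "(w j, w N) \<in> ?r ^^ (N - j)" using sub[of j "N - j"] ij by simp
    ultimately have "(u, v) \<in> ?r ^^ (i + (N - j))" using w eq by (auto simp: relpow_add)
    then have "N \<le> i + (N - j)" unfolding N_def using uv by (intro Least_le) auto
    then show False using ij by simp
  qed
  then have "inj_on w {..N}" by (intro linorder_inj_onI) auto
  then show ?thesis using w uv by blast
qed

section \<open>Closing pseudo-orbits\<close>

text \<open>The last step is \<open>g\<close> instead of \<open>f\<close>, at the cost of \<open>e / 2\<close>;
  the earlier ones have to reach the preimage under \<open>f\<close> of a ball, which is open.\<close>
lemma iterate_stays_close:
  fixes f :: "'m \<Rightarrow> 'm"
  assumes f: "continuous_on UNIV f" and V: "open V" "(f ^^ n) x \<in> V"
  shows "\<exists>\<delta>>0. \<forall>g. (\<forall>y. d (f y) (g y) < \<delta>) \<longrightarrow> (g ^^ n) x \<in> V"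
  using V
proof (induct n arbitrary: V)
  case 0
  then show ?case by (intro exI[of _ 1]) auto
next
  case (Suc n)
  let ?z = "(f ^^ Suc n) x"
  obtain e where e: "e > 0" "\<And>y. d ?z y < e \<Longrightarrow> y \<in> V"
    using Suc.prems open_iff[of V] by blast
  have "open (f -` {y. d ?z y < e / 2})" by (rule open_vimage[OF open_d_ball f])
  moreover have "(f ^^ n) x \<in> f -` {y. d ?z y < e / 2}" using e by simp
  ultimately obtain \<delta> where \<delta>: "\<delta> > 0"
      "\<forall>g. (\<forall>y. d (f y) (g y) < \<delta>) \<longrightarrow> (g ^^ n) x \<in> f -` {y. d ?z y < e / 2}"
    using Suc.hyps by blast
  show ?case
  proof (intro exI[of _ "min \<delta> (e / 2)"] conjI allI impI)
    show "min \<delta> (e / 2) > 0" using \<delta> e by simp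
    fix g assume g: "\<forall>y. d (f y) (g y) < min \<delta> (e / 2)"
    then have "(g ^^ n) x \<in> f -` {y. d ?z y < e / 2}" using \<delta>(2) by simp
    then have "d ?z (f ((g ^^ n) x)) < e / 2" by simp
    moreover have "d (f ((g ^^ n) x)) (g ((g ^^ n) x)) < e / 2" using g by simp
    ultimately have "d ?z (g ((g ^^ n) x)) < e"
      using d_triangle[of ?z "g ((g ^^ n) x)" "f ((g ^^ n) x)"] by linarith
    then show "(g ^^ Suc n) x \<in> V" using e(2) by simp
  qed
qed

text \<open>Two rounds of pushes along segments close the gaps of a pseudo-orbit. The first moves each \<open>a
  i\<close> a negligible distance to a point \<open>a' i\<close> in general position; the second carries
  \<open>a' i\<close> to \<open>b i\<close>, along segments that in dimension at least three can be chosen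
  disjoint.\<close>
lemma perturb_to_hit:
  assumes F: "F \<in> Lip_homeos d vol" and n: "3 \<le> CARD('d)" and p: "1 \<le> p" "p < real CARD('d) - 1"
    and U: "open U" "U \<noteq> {}" and V: "open V" "V \<noteq> {}" and \<eta>: "\<eta> > 0"
  shows "\<exists>G\<in>Lip_homeos d vol. (\<exists>n. (G ^^ n) ` U \<inter> V \<noteq> {}) \<and> (\<forall>x. d (F x) (G x) \<le> \<eta>) \<and>
      Lp_matrix_norm vol p (\<lambda>z. cube_deriv \<phi> F z - cube_deriv \<phi> G z) \<le> \<eta>"
proof -
  have n2: "2 \<le> CARD('d)" using n by simp
  obtain C0 where C0: "d_lipschitz C0 F" using Lip_homeosD(3)[OF F] by blast
  define C where "C = max C0 0"
  have C: "C \<ge> 0" "\<And>x y. d (F x) (F y) \<le> C * d x y"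
  proof -
    show "C \<ge> 0" by (simp add: C_def)
    fix x y
    have "d (F x) (F y) \<le> C0 * d x y" using C0 by (simp add: d_lipschitz_def)
    also have "\<dots> \<le> C * d x y" using d_nonneg by (intro mult_right_mono) (auto simp: C_def)
    finally show "d (F x) (F y) \<le> C * d x y" .
  qed
  have "\<eta> / (C + 1) > 0" using \<eta> C(1) by simp
  then obtain \<delta>0 where \<delta>0: "\<delta>0 > 0"
      "\<And>y z. y \<in> Q \<Longrightarrow> z \<in> Q \<Longrightarrow> dist y z < \<delta>0 \<Longrightarrow> d (\<phi> y) (\<phi> z) < \<eta> / (C + 1)"
    by (rule phi_uniform) blast
  \<comment> \<open>the first round displaces points by at most \<open>3 * \<delta>\<close>, the second by at most \<open>4 * \<delta>\<close>\<close>
  define \<delta> where "\<delta> = \<delta>0 / 8"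
  have \<delta>: "\<delta> > 0" "7 * \<delta> < \<delta>0" using \<delta>0(1) by (auto simp: \<delta>_def)
  obtain N w where w: "w 0 \<in> U" "w N \<in> V" "inj_on w {..N}" "\<forall>i<N. (w i, w (Suc i)) \<in> pseudo_step F \<delta>"
    using injective_pseudo_orbit[OF F U V \<delta>(1)] by blast
  have "\<forall>i<N. \<exists>b. w i \<in> P \<and> b \<in> Q \<and> dist (\<psi> (w i)) b < \<delta> \<and> w (Suc i) = F (\<phi> b)"
    using w(4) by (auto simp: pseudo_step_def)
  then obtain b where b: "\<And>i. i < N \<Longrightarrow> w i \<in> P" "\<And>i. i < N \<Longrightarrow> b i \<in> Q"
      "\<And>i. i < N \<Longrightarrow> dist (\<psi> (w i)) (b i) < \<delta>" "\<And>i. i < N \<Longrightarrow> w (Suc i) = F (\<phi> (b i))"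
    by metis
  define a where "a i = \<psi> (w i)" for i
  have aQ: "a i \<in> Q" "\<phi> (a i) = w i" if "i < N" for i
    using b(1)[OF that] psi_mem by (auto simp: a_def)
  have a_ne: "a i \<noteq> a j" if "i < N" "j < N" "i \<noteq> j" for i j
    using that inj_onD[OF w(3), of i j] aQ(2)[of i] aQ(2)[of j] by auto
  have injb: "inj_on b {..<N}"
  proof (rule inj_onI)
    fix i j assume "i \<in> {..<N}" "j \<in> {..<N}" "b i = b j"
    then show "i = j" using inj_onD[OF w(3), of "Suc i" "Suc j"] b(4)[of i] b(4)[of j] by auto
  qed
  define A where "A = insert (2 * \<delta>) ((\<lambda>(i, j). dist (a i) (a j)) ` {(i, j). i < N \<and> j < N \<and> i \<noteq> j})"
  have "finite {(i, j). i < N \<and> j < N \<and> i \<noteq> j}"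
    by (rule finite_subset[of _ "{..<N} \<times> {..<N}"]) auto
  then have A: "finite A" "A \<noteq> {}" "\<And>t. t \<in> A \<Longrightarrow> t > 0" using \<delta>(1) a_ne by (auto simp: A_def)
  \<comment> \<open>half the least distance between the \<open>a i\<close>, so that the balls are disjoint; \<open>2 * \<delta>\<close> in \<open>A\<close> gives \<open>s \<le> \<delta>\<close>\<close>
  define s where "s = Min A / 2"
  have s: "s > 0" "s \<le> \<delta>"
  proof -
    show "s > 0" using A(3)[OF Min_in[OF A(1,2)]] by (simp add: s_def)
    have "Min A \<le> 2 * \<delta>" by (rule Min_le[OF A(1)]) (simp add: A_def)
    then show "s \<le> \<delta>" by (simp add: s_def)
  qed
  have balls: "ball (a i) s \<inter> ball (a j) s = {}" if "i < N" "j < N" "i \<noteq> j" for i j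
  proof -
    have "Min A \<le> dist (a i) (a j)" by (rule Min_le[OF A(1)]) (use that in \<open>auto simp: A_def\<close>)
    then show ?thesis by (intro disjoint_ballI) (simp add: s_def)
  qed
  obtain a' where a': "\<And>i. i < N \<Longrightarrow> a' i \<in> ball (a i) s \<inter> Q"
      "\<And>i j. i < N \<Longrightarrow> j < N \<Longrightarrow> i \<noteq> j \<Longrightarrow> closed_segment (a' i) (b i) \<inter> closed_segment (a' j) (b j) = {}"
  proof (rule disjoint_segments[OF _ injb, of "\<lambda>i. ball (a i) s \<inter> Q"])
    show "3 \<le> DIM(real^'d)" using n by simp
    show "open (ball (a i) s \<inter> Q)" "ball (a i) s \<inter> Q \<noteq> {}" if "i < N" for i
    proof -
      show "open (ball (a i) s \<inter> Q)" by (intro open_Int open_ball open_box)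
      have "a i \<in> ball (a i) s \<inter> Q" using s(1) aQ(1)[OF that] by simp
      then show "ball (a i) s \<inter> Q \<noteq> {}" by blast
    qed
    fix a'
    assume "\<And>i. i < N \<Longrightarrow> a' i \<in> ball (a i) s \<inter> Q"
      "\<And>i j. i < N \<Longrightarrow> j < N \<Longrightarrow> i \<noteq> j \<Longrightarrow> closed_segment (a' i) (b i) \<inter> closed_segment (a' j) (b j) = {}"
    then show thesis by (rule that)
  qed
  have seg2: "closed_segment (a' i) (b i) \<subseteq> Q" if "i < N" for i
    using a'(1)[OF that] b(2)[OF that] by (intro closed_segment_subset convex_box) auto
  have seg1b: "closed_segment (a i) (a' i) \<subseteq> ball (a i) s" if "i < N" for i
    using a'(1)[OF that] s(1) by (intro closed_segment_subset convex_ball) auto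
  have seg1: "closed_segment (a i) (a' i) \<subseteq> Q" if "i < N" for i
    using a'(1)[OF that] aQ(1)[OF that] by (intro closed_segment_subset convex_box) auto
  have seg1d: "closed_segment (a i) (a' i) \<inter> closed_segment (a j) (a' j) = {}" if "i < N" "j < N" "i \<noteq> j" for i j
    using seg1b[OF that(1)] seg1b[OF that(2)] balls[OF that] by blast
  obtain \<epsilon>2 where \<epsilon>2: "\<epsilon>2 > 0" "\<epsilon>2 \<le> \<delta>"
      "\<forall>i<N. \<forall>j<N. i \<noteq> j \<longrightarrow> segment_nhd \<epsilon>2 (a' i) (b i) \<inter> segment_nhd \<epsilon>2 (a' j) (b j) = {}"
    using disjoint_segment_nhds[where N = N and x = a' and y = b, OF a'(2) \<delta>(1)] by blast
  obtain \<epsilon>1 where \<epsilon>1: "\<epsilon>1 > 0" "\<epsilon>1 \<le> \<delta>"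
      "\<forall>i<N. \<forall>j<N. i \<noteq> j \<longrightarrow> segment_nhd \<epsilon>1 (a i) (a' i) \<inter> segment_nhd \<epsilon>1 (a j) (a' j) = {}"
    using disjoint_segment_nhds[where N = N and x = a and y = a', OF seg1d \<delta>(1)] by blast
  have \<eta>2: "\<eta> / 2 > 0" using \<eta> by simp
  have "\<exists>H. (\<forall>z\<in>Q. H z \<in> Q) \<and> F \<circ> ext H \<in> Lip_homeos d vol \<and>
      Lp_matrix_norm vol p (\<lambda>z. cube_deriv \<phi> (F \<circ> ext H) z - cube_deriv \<phi> F z) \<le> \<eta> / 2 \<and>
      (\<forall>i<N. H (a' i) = b i) \<and> (\<forall>z. H z \<noteq> z \<longrightarrow> (\<exists>i<N. z \<in> segment_nhd \<epsilon>2 (a' i) (b i) \<and> H z \<in> segment_nhd \<epsilon>2 (a' i) (b i)))"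
    by (rule perturb_along_segments[OF F n2 p seg2 \<epsilon>2(1) _ \<eta>2]) (use \<epsilon>2(3) in auto)
  then obtain H2 where H2: "\<forall>z\<in>Q. H2 z \<in> Q" "F \<circ> ext H2 \<in> Lip_homeos d vol"
      "Lp_matrix_norm vol p (\<lambda>z. cube_deriv \<phi> (F \<circ> ext H2) z - cube_deriv \<phi> F z) \<le> \<eta> / 2"
      "\<forall>i<N. H2 (a' i) = b i"
      "\<forall>z. H2 z \<noteq> z \<longrightarrow> (\<exists>i<N. z \<in> segment_nhd \<epsilon>2 (a' i) (b i) \<and> H2 z \<in> segment_nhd \<epsilon>2 (a' i) (b i))"
    by blast
  have "\<exists>H. (\<forall>z\<in>Q. H z \<in> Q) \<and> (F \<circ> ext H2) \<circ> ext H \<in> Lip_homeos d vol \<and>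
      Lp_matrix_norm vol p (\<lambda>z. cube_deriv \<phi> ((F \<circ> ext H2) \<circ> ext H) z - cube_deriv \<phi> (F \<circ> ext H2) z) \<le> \<eta> / 2 \<and>
      (\<forall>i<N. H (a i) = a' i) \<and> (\<forall>z. H z \<noteq> z \<longrightarrow> (\<exists>i<N. z \<in> segment_nhd \<epsilon>1 (a i) (a' i) \<and> H z \<in> segment_nhd \<epsilon>1 (a i) (a' i)))"
    by (rule perturb_along_segments[OF H2(2) n2 p seg1 \<epsilon>1(1) _ \<eta>2]) (use \<epsilon>1(3) in auto)
  then obtain H1 where H1: "\<forall>z\<in>Q. H1 z \<in> Q" "(F \<circ> ext H2) \<circ> ext H1 \<in> Lip_homeos d vol"
      "Lp_matrix_norm vol p (\<lambda>z. cube_deriv \<phi> ((F \<circ> ext H2) \<circ> ext H1) z - cube_deriv \<phi> (F \<circ> ext H2) z) \<le> \<eta> / 2"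
      "\<forall>i<N. H1 (a i) = a' i"
      "\<forall>z. H1 z \<noteq> z \<longrightarrow> (\<exists>i<N. z \<in> segment_nhd \<epsilon>1 (a i) (a' i) \<and> H1 z \<in> segment_nhd \<epsilon>1 (a i) (a' i))"
    by blast
  let ?G = "(F \<circ> ext H2) \<circ> ext H1"
  have disp1: "dist z (H1 z) \<le> 3 * \<delta>" for z
  proof (cases "H1 z = z")
    case False
    then obtain i where i: "i < N" "z \<in> segment_nhd \<epsilon>1 (a i) (a' i)" "H1 z \<in> segment_nhd \<epsilon>1 (a i) (a' i)"
      using H1(5) by blast
    have "dist (a i) (a' i) < s" using a'(1)[OF i(1)] by simp
    then show ?thesis using segment_nhd_dist[OF i(2,3)] \<epsilon>1(2) s(2) by linarith
  qed (use \<delta>(1) in simp)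
  have disp2: "dist z (H2 z) \<le> 4 * \<delta>" for z
  proof (cases "H2 z = z")
    case False
    then obtain i where i: "i < N" "z \<in> segment_nhd \<epsilon>2 (a' i) (b i)" "H2 z \<in> segment_nhd \<epsilon>2 (a' i) (b i)"
      using H2(5) by blast
    have "dist (a i) (a' i) < s" using a'(1)[OF i(1)] by simp
    moreover have "dist (a i) (b i) < \<delta>" using b(3)[OF i(1)] by (simp add: a_def)
    ultimately have "dist (a' i) (b i) \<le> 2 * \<delta>"
      using dist_triangle[of "a' i" "b i" "a i"] s(2) dist_commute[of "a i" "a' i"] by linarith
    then show ?thesis using segment_nhd_dist[OF i(2,3)] \<epsilon>2(2) by linarith
  qed (use \<delta>(1) in simp)
  show ?thesis
  proof (intro bexI[of _ ?G] conjI)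
    show "?G \<in> Lip_homeos d vol" by (rule H1(2))
    have step: "?G (w i) = w (Suc i)" if "i < N" for i
    proof -
      have "ext H1 (w i) = \<phi> (a' i)"
        using ext_phi[OF aQ(1)[OF that], of H1] aQ(2)[OF that] H1(4) that by simp
      moreover have "ext H2 (\<phi> (a' i)) = \<phi> (b i)"
        using ext_phi[of "a' i" H2] a'(1)[OF that] H2(4) that by simp
      ultimately show ?thesis using b(4)[OF that] by simp
    qed
    have "(?G ^^ i) (w 0) = w i" if "i \<le> N" for i
      using that by (induct i) (use step in auto)
    then have "(?G ^^ N) (w 0) = w N" by simp
    then have "w N \<in> (?G ^^ N) ` U" using w(1) by (metis imageI)
    then show "\<exists>n. (?G ^^ n) ` U \<inter> V \<noteq> {}" using w(2) by blast
    show "\<forall>x. d (F x) (?G x) \<le> \<eta>"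
    proof
      fix x
      show "d (F x) (?G x) \<le> \<eta>"
      proof (cases "x \<in> P")
        case True
        define y where "y = \<psi> x"
        have y: "y \<in> Q" "x = \<phi> y" using True psi_mem by (auto simp: y_def)
        have y1: "H1 y \<in> Q" "H2 (H1 y) \<in> Q" using H1(1) H2(1) y by auto
        have "dist y (H2 (H1 y)) < \<delta>0"
          using dist_triangle[of y "H2 (H1 y)" "H1 y"] disp1[of y] disp2[of "H1 y"] \<delta>(2) by linarith
        then have "d (\<phi> y) (\<phi> (H2 (H1 y))) \<le> \<eta> / (C + 1)" using \<delta>0(2)[OF y(1) y1(2)] by simp
        then have "C * d (\<phi> y) (\<phi> (H2 (H1 y))) \<le> C * (\<eta> / (C + 1))" by (intro mult_left_mono C(1))
        also have "\<dots> \<le> \<eta>" using C(1) \<eta> by (simp add: field_simps)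
        finally have "C * d (\<phi> y) (\<phi> (H2 (H1 y))) \<le> \<eta>" .
        moreover have "?G x = F (\<phi> (H2 (H1 y)))"
          using y y1 ext_phi[OF y(1), of H1] ext_phi[OF y1(1), of H2] by simp
        ultimately show ?thesis using C(2)[of "\<phi> y" "\<phi> (H2 (H1 y))"] y(2) by simp
      next
        case False
        then show ?thesis using \<eta> by (simp add: ext_outside)
      qed
    qed
    have "Lp_matrix_norm vol p (\<lambda>z. cube_deriv \<phi> F z - cube_deriv \<phi> ?G z)
        \<le> Lp_matrix_norm vol p (\<lambda>z. cube_deriv \<phi> F z - cube_deriv \<phi> (F \<circ> ext H2) z)
          + Lp_matrix_norm vol p (\<lambda>z. cube_deriv \<phi> (F \<circ> ext H2) z - cube_deriv \<phi> ?G z)"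
      by (intro Lp_matrix_norm_triangle p(1) Lp_matrix_cube_deriv F H2(2) H1(2))
    also have "\<dots> \<le> \<eta> / 2 + \<eta> / 2"
      using H2(3) H1(3) Lp_matrix_norm_commute[of vol p "cube_deriv \<phi> F" "cube_deriv \<phi> (F \<circ> ext H2)"]
        Lp_matrix_norm_commute[of vol p "cube_deriv \<phi> (F \<circ> ext H2)" "cube_deriv \<phi> ?G"]
      by linarith
    finally show "Lp_matrix_norm vol p (\<lambda>z. cube_deriv \<phi> F z - cube_deriv \<phi> ?G z) \<le> \<eta>" by simp
  qed
qed

section \<open>The metric space of Sobolev homeomorphisms\<close>

abbreviation "M p \<equiv> sobolev_homeos d vol \<phi> p"
abbreviation "D p \<equiv> sobolev_dist d vol \<phi> p"
abbreviation "W p \<equiv> weak_deriv d vol \<phi> p"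

lemma sobolev_pair_weak_deriv: "f \<in> M p \<Longrightarrow> sobolev_pair d vol \<phi> p f (W p f)"
  unfolding weak_deriv_def sobolev_homeos_def sobolev_closure_def by (auto intro: someI[of "sobolev_pair d vol \<phi> p f"])

lemma Lp_matrix_weak_deriv: "f \<in> M p \<Longrightarrow> Lp_matrix vol p (W p f)"
  and continuous_on_sobolev_homeo: "f \<in> M p \<Longrightarrow> continuous_on UNIV f"
  using sobolev_pair_weak_deriv[of f p] by (auto simp: sobolev_pair_def)

lemma bdd_above_d: "bdd_above (range (\<lambda>x. d (f x) (h x)))"
proof -
  obtain D where "\<forall>x y. d x y \<le> D" using d_bounded by blast
  then show ?thesis by (intro bdd_aboveI[of _ D]) auto
qed

lemma d_le_sobolev_dist: "d (f x) (h x) \<le> D p f h"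
  unfolding sobolev_dist_def using cSUP_upper[OF UNIV_I bdd_above_d[of f h], of x] by simp

lemma sobolev_dist_le_iff:
  "D p f h \<le> c \<longleftrightarrow> (\<forall>x. d (f x) (h x) \<le> c) \<and> Lp_matrix_norm vol p (\<lambda>x. W p f x - W p h x) \<le> c"
  unfolding sobolev_dist_def by (auto simp: cSUP_le_iff[OF _ bdd_above_d])

lemma Metric_space_sobolev:
  assumes p: "1 \<le> p"
  shows "Metric_space (M p) (D p)"
proof
  fix f h k
  show "0 \<le> D p f h" using d_le_sobolev_dist[of f undefined h p] d_nonneg order_trans by blast
  show "D p f h = D p h f"
    unfolding sobolev_dist_def by (simp add: d_commute Lp_matrix_norm_commute[of vol p "W p f"])
  assume f: "f \<in> M p" and h: "h \<in> M p"
  show "D p f h = 0 \<longleftrightarrow> f = h"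
  proof
    assume 0: "D p f h = 0"
    have "d (f x) (h x) = 0" for x using d_le_sobolev_dist[of f x h p] d_nonneg[of "f x" "h x"] 0 by simp
    then show "f = h" by (auto simp: d_zero)
  next
    assume "f = h"
    then show "D p f h = 0" by (simp add: sobolev_dist_def Lp_matrix_norm_0[of vol p "\<lambda>_. 0", simplified])
  qed
  assume k: "k \<in> M p"
  have "Lp_matrix_norm vol p (\<lambda>x. W p f x - W p k x)
      \<le> Lp_matrix_norm vol p (\<lambda>x. W p f x - W p h x) + Lp_matrix_norm vol p (\<lambda>x. W p h x - W p k x)"
    by (intro Lp_matrix_norm_triangle p Lp_matrix_weak_deriv f h k)
  also have "\<dots> \<le> D p f h + D p h k" by (intro add_mono) (auto simp: sobolev_dist_def)
  finally show "D p f k \<le> D p f h + D p h k"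
    unfolding sobolev_dist_le_iff
    using d_triangle add_mono[OF d_le_sobolev_dist d_le_sobolev_dist] by (blast intro: order_trans)
qed

lemma Lip_homeos_subset: "1 \<le> p \<Longrightarrow> Lip_homeos d vol \<subseteq> M p"
  using sobolev_pair_cube_deriv by (auto simp: sobolev_homeos_def sobolev_closure_def dest: Lip_homeosD(1,2))

text \<open>The derivative selected by \<open>weak_deriv\<close> is almost everywhere the one computed in
  coordinates, so Sobolev distances to Lipschitz maps can be estimated by \<open>cube_deriv\<close>.\<close>
lemma Lp_matrix_norm_weak_deriv_Lip:
  assumes G: "G \<in> Lip_homeos d vol" and p: "1 \<le> p" and A: "Lp_matrix vol p A"
  shows "Lp_matrix_norm vol p (\<lambda>x. A x - W p G x) \<le> Lp_matrix_norm vol p (\<lambda>x. A x - cube_deriv \<phi> G x)"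
proof -
  have GM: "G \<in> M p" using Lip_homeos_subset[OF p] G by blast
  have "Lp_norm vol p (\<lambda>x. cube_deriv \<phi> G x $ i $ j - W p G x $ i $ j) = 0" for i j
  proof -
    have "Lp_fun vol p (\<lambda>x. cube_deriv \<phi> G x $ i $ j - W p G x $ i $ j)"
      using Lp_matrix_cube_deriv[OF G p] Lp_matrix_weak_deriv[OF GM]
      by (intro Lp_fun_diff p) (auto simp: Lp_matrix_def)
    then have "(\<lambda>x. cube_deriv \<phi> G x $ i $ j - W p G x $ i $ j) \<in> borel_measurable vol" by (simp add: Lp_fun_def)
    moreover have "AE x in vol. cube_deriv \<phi> G x $ i $ j - W p G x $ i $ j = 0"
      using sobolev_pair_unique[OF G sobolev_pair_weak_deriv[OF GM] p, of i j] by eventually_elim simp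
    ultimately have "Lp_norm vol p (\<lambda>x. cube_deriv \<phi> G x $ i $ j - W p G x $ i $ j) = Lp_norm vol p (\<lambda>_. 0)"
      by (intro Lp_norm_cong_AE) auto
    then show ?thesis by (simp add: Lp_norm_def)
  qed
  then have "Lp_matrix_norm vol p (\<lambda>x. cube_deriv \<phi> G x - W p G x) \<le> 0" by (simp add: Lp_matrix_norm_le_iff)
  then show ?thesis
    using Lp_matrix_norm_triangle[OF p A Lp_matrix_cube_deriv[OF G p] Lp_matrix_weak_deriv[OF GM]] by linarith
qed

section \<open>Genericity of transitivity\<close>

text \<open>By definition of the closure, \<open>f\<close> is close to a Lipschitz map, which
  \<open>perturb_to_hit\<close> changes as little as desired.\<close>
lemma hitting_maps_dense:
  assumes f: "f \<in> M p" and n: "3 \<le> CARD('d)" and p: "1 \<le> p" "p < real CARD('d) - 1"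
    and U: "open U" "U \<noteq> {}" and V: "open V" "V \<noteq> {}" and r: "r > 0"
  shows "\<exists>G\<in>M p. (\<exists>n. (G ^^ n) ` U \<inter> V \<noteq> {}) \<and> D p f G < r"
proof -
  define \<eta> where "\<eta> = r / 3"
  have \<eta>: "\<eta> > 0" "2 * \<eta> < r" using r by (auto simp: \<eta>_def)
  obtain F where F: "\<And>n. F n \<in> Lip_homeos d vol" "\<And>\<epsilon>. \<epsilon> > 0 \<Longrightarrow> \<forall>\<^sub>F n in sequentially. \<forall>x. d (F n x) (f x) < \<epsilon>"
      "(\<lambda>n. Lp_matrix_norm vol p (\<lambda>x. cube_deriv \<phi> (F n) x - W p f x)) \<longlonglongrightarrow> 0"
    using sobolev_pair_weak_deriv[OF f] unfolding sobolev_pair_def by blast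
  have "\<forall>\<^sub>F n in sequentially. (\<forall>x. d (F n x) (f x) < \<eta>) \<and> Lp_matrix_norm vol p (\<lambda>x. cube_deriv \<phi> (F n) x - W p f x) < \<eta>"
    using F(2)[OF \<eta>(1)] order_tendstoD(2)[OF F(3) \<eta>(1)] by (rule eventually_conj)
  then obtain m where m: "\<forall>x. d (F m x) (f x) < \<eta>" "Lp_matrix_norm vol p (\<lambda>x. cube_deriv \<phi> (F m) x - W p f x) < \<eta>"
    by (auto simp: eventually_sequentially)
  obtain G where G: "G \<in> Lip_homeos d vol" "\<exists>n. (G ^^ n) ` U \<inter> V \<noteq> {}" "\<forall>x. d (F m x) (G x) \<le> \<eta>"
      "Lp_matrix_norm vol p (\<lambda>z. cube_deriv \<phi> (F m) z - cube_deriv \<phi> G z) \<le> \<eta>"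
    using perturb_to_hit[OF F(1) n p U V \<eta>(1)] by blast
  have "d (f x) (G x) \<le> 2 * \<eta>" for x
  proof -
    have "d (f x) (G x) \<le> d (F m x) (f x) + d (F m x) (G x)"
      using d_triangle[of "f x" "G x" "F m x"] d_commute[of "f x" "F m x"] by simp
    moreover have "d (F m x) (f x) < \<eta>" "d (F m x) (G x) \<le> \<eta>" using m(1) G(3) by auto
    ultimately show ?thesis by linarith
  qed
  moreover have "Lp_matrix_norm vol p (\<lambda>x. W p f x - W p G x) \<le> 2 * \<eta>"
  proof -
    have "Lp_matrix_norm vol p (\<lambda>x. W p f x - W p G x) \<le> Lp_matrix_norm vol p (\<lambda>x. W p f x - cube_deriv \<phi> G x)"
      by (rule Lp_matrix_norm_weak_deriv_Lip[OF G(1) p(1) Lp_matrix_weak_deriv[OF f]])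
    also have "\<dots> \<le> Lp_matrix_norm vol p (\<lambda>x. W p f x - cube_deriv \<phi> (F m) x)
        + Lp_matrix_norm vol p (\<lambda>x. cube_deriv \<phi> (F m) x - cube_deriv \<phi> G x)"
      by (intro Lp_matrix_norm_triangle p(1) Lp_matrix_weak_deriv[OF f] Lp_matrix_cube_deriv F(1) G(1))
    also have "Lp_matrix_norm vol p (\<lambda>x. W p f x - cube_deriv \<phi> (F m) x) < \<eta>"
      using m(2) Lp_matrix_norm_commute[of vol p "W p f" "cube_deriv \<phi> (F m)"] by simp
    finally show ?thesis using G(4) by linarith
  qed
  ultimately have "D p f G \<le> 2 * \<eta>" by (simp add: sobolev_dist_le_iff)
  then show ?thesis using G(1,2) Lip_homeos_subset[OF p(1)] \<eta>(2) by (intro bexI[of _ G]) auto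
qed

text \<open>Transitivity can be tested on pairs from a countable base, and each pair imposes an open and dense
  condition.\<close>
theorem generic_transitive:
  assumes n: "3 \<le> CARD('d)" and p: "1 \<le> p" "p < real CARD('d) - 1"
  shows "generic_in (sobolev_topology d vol \<phi> p) {f \<in> M p. topologically_transitive f}"
proof -
  interpret MS: Metric_space "M p" "D p" by (rule Metric_space_sobolev[OF p(1)])
  define H where "H U V = {f \<in> M p. \<exists>n. (f ^^ n) ` U \<inter> V \<noteq> {}}" for U V :: "'m set"
  obtain \<B> :: "'m set set" where \<B>: "countable \<B>" "topological_basis \<B>"
    using ex_countable_basis by blast
  let ?B = "{U \<in> \<B>. U \<noteq> {}}"
  have Bo: "open U" if "U \<in> ?B" for U using topological_basis_open[OF \<B>(2)] that by blast
  have op: "openin MS.mtopology (H U V)" if V: "open V" for U V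
    unfolding MS.openin_mtopology
  proof (intro conjI allI impI)
    show "H U V \<subseteq> M p" by (auto simp: H_def)
    fix f assume f: "f \<in> H U V"
    then obtain n x where x: "x \<in> U" "(f ^^ n) x \<in> V" by (auto simp: H_def)
    have fc: "continuous_on UNIV f" using f continuous_on_sobolev_homeo by (auto simp: H_def)
    obtain \<delta> where \<delta>: "\<delta> > 0" "\<forall>g. (\<forall>y. d (f y) (g y) < \<delta>) \<longrightarrow> (g ^^ n) x \<in> V"
      using iterate_stays_close[OF fc V x(2)] by blast
    show "\<exists>r>0. MS.mball f r \<subseteq> H U V"
    proof (intro exI[of _ \<delta>] conjI subsetI)
      fix g assume g: "g \<in> MS.mball f \<delta>"
      have "d (f y) (g y) < \<delta>" for y
        using g d_le_sobolev_dist[of f y g p] by (simp add: MS.in_mball)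
      then have "(g ^^ n) x \<in> V" using \<delta>(2) by blast
      then show "g \<in> H U V" using g x(1) by (auto simp: H_def)
    qed (rule \<delta>(1))
  qed
  have dense: "MS.mtopology closure_of (H U V) = topspace MS.mtopology" if U: "U \<in> ?B" and V: "V \<in> ?B" for U V
    unfolding MS.metric_closure_of MS.topspace_mtopology
  proof (intro equalityI subsetI CollectI conjI allI impI)
    fix f and r :: real assume f: "f \<in> M p" and r: "r > 0"
    have ne: "U \<noteq> {}" "V \<noteq> {}" using U V by auto
    obtain G where G: "G \<in> M p" "\<exists>n. (G ^^ n) ` U \<inter> V \<noteq> {}" "D p f G < r"
      using hitting_maps_dense[OF f n p Bo[OF U] ne(1) Bo[OF V] ne(2) r] by blast
    then show "\<exists>y\<in>H U V. y \<in> MS.mball f r" using f by (intro bexI[of _ G]) (auto simp: H_def)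
  qed auto
  have trans: "topologically_transitive f" if f: "f \<in> M p" and all: "\<And>U V. U \<in> ?B \<Longrightarrow> V \<in> ?B \<Longrightarrow> f \<in> H U V" for f
    unfolding topologically_transitive_def
  proof (intro allI impI, elim conjE)
    fix U V :: "'m set" assume U: "open U" "U \<noteq> {}" and V: "open V" "V \<noteq> {}"
    obtain u v where uv: "u \<in> U" "v \<in> V" using U V by blast
    obtain U' where U': "U' \<in> \<B>" "u \<in> U'" "U' \<subseteq> U" by (rule topological_basisE[OF \<B>(2) U(1) uv(1)])
    obtain V' where V': "V' \<in> \<B>" "v \<in> V'" "V' \<subseteq> V" by (rule topological_basisE[OF \<B>(2) V(1) uv(2)])
    have "U' \<in> ?B" "V' \<in> ?B" using U' V' by auto
    from all[OF this] obtain n where "(f ^^ n) ` U' \<inter> V' \<noteq> {}" by (auto simp: H_def)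
    then show "\<exists>n. (f ^^ n) ` U \<inter> V \<noteq> {}" using U'(3) V'(3) by blast
  qed
  show ?thesis
    unfolding generic_in_def sobolev_topology_def
  proof (intro conjI exI[of _ "(\<lambda>(U, V). H U V) ` (?B \<times> ?B)"])
    show "{f \<in> M p. topologically_transitive f} \<subseteq> topspace MS.mtopology" by auto
    show "countable ((\<lambda>(U, V). H U V) ` (?B \<times> ?B))" using \<B>(1) by (intro countable_image countable_SIGMA) auto
    show "\<forall>Z\<in>(\<lambda>(U, V). H U V) ` (?B \<times> ?B). openin MS.mtopology Z \<and> MS.mtopology closure_of Z = topspace MS.mtopology"
      using op dense Bo by (auto simp: split_beta)
    show "topspace MS.mtopology \<inter> \<Inter> ((\<lambda>(U, V). H U V) ` (?B \<times> ?B)) \<subseteq> {f \<in> M p. topologically_transitive f}"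
      using trans by auto
  qed
qed

end

theorem theorem3:
  fixes atlas :: "('m::{t2_space, second_countable_topology}, 'd::finite) chart set"
    and g :: "('m, 'd) metric_tensor"
    and vol :: "'m measure"
    and \<phi> :: "real^'d \<Rightarrow> 'm"
    and p :: real
  defines "d \<equiv> riemannian_dist atlas g"
  assumes "closed_riemannian_manifold atlas g"
    and "is_riemannian_volume atlas g vol"
    and "cube_parametrization d vol \<phi>"
    and "CARD('d) \<ge> 3"
    and "1 \<le> p" and "p < real CARD('d) - 1"
  shows "generic_in (sobolev_topology d vol \<phi> p)
           {f \<in> sobolev_homeos d vol \<phi> p. topologically_transitive f}"
proof -
  interpret mf: closed_riemannian_manifold atlas g by fact
  interpret cs: cube_space d vol \<phi>
  proof (rule cube_space.intro)
    show "compact (UNIV :: 'm set)" by (rule mf.compact_space)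
    show "sets vol = sets borel" using assms(3) by (simp add: is_riemannian_volume_def)
    show "cube_parametrization d vol \<phi>" by fact
    show "Metric_space UNIV d" unfolding d_def by (rule mf.rdist_metric)
    show "open U \<longleftrightarrow> (\<forall>x\<in>U. \<exists>e>0. \<forall>y. d x y < e \<longrightarrow> y \<in> U)" for U
      unfolding d_def by (rule mf.open_iff_rdist)
  qed
  show ?thesis using assms(5,6,7) by (rule cs.generic_transitive)
qed

end
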